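(* Let $H$ be a connected, simply connected, nilpotent Lie group of dimension $k\ge1$, and let $(Y,y,d,\mathfrak m)$ be a pointed $\mathrm{RCD}(0,N)$ space with $N>k+1$ such that $H$ is a closed subgroup of $\mathrm{Isom}(Y)$ acting by measure-preserving isometries, $(Y/H,\bar y)$ is isometric to $([0,\infty),0)$, and $H$ contains a closed subgroup $L\cong\mathbb R$ whose orbit $Ly$ has Hausdorff dimension $>1$. Let $Y_+=(0,\infty)\times H$, $g=dr^2+g_r$, $\mathfrak m=\rho(r)\,dr\wedge\Omega$ be the weighted Riemannian description of the regular part of $Y$ with respect to a fixed left-invariant frame $\{X_1,\dots,X_k\}$ of $H$, let $G(r)=[g_r(X_i,X_j)]$, and let $0<\lambda_1(r)\le\dots\le\lambda_k(r)$ be the ordered eigenvalues of $G(r)$. Then the following inequality holds in the sense of distributions: $$\mathrm{Ric}_{\mathfrak m,\infty}(\partial_r,\partial_r)\le -\frac14\sum_{j=1}^k\left(\frac{\lambda_j'}{\lambda_j}\right)^2-\left(\frac{\rho'}{\rho}\right)'.$$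
   Context: A metric measure space is a complete separable metric space with a nonnegative $\sigma$-finite Borel measure of full support; $\mathrm{RCD}(0,N)$ means $\mathrm{CD}(0,N)$ in the Lott--Sturm--Villani sense with $W^{1,2}$ Hilbert. Weighted Riemannian description (known to exist under these hypotheses): $(Y,H)$ is equivariantly homeomorphic to $[0,\infty)\times H$ with $H$ acting by left multiplication on the second factor; $\{\theta^1,\dots,\theta^k\}$ is the coframe dual to $\{X_1,\dots,X_k\}$ and $\Omega=\theta^1\wedge\dots\wedge\theta^k$ the corresponding Haar measure; $\mathfrak m=\rho(r)\,dr\wedge\Omega$ with $\rho:[0,\infty)\to[0,\infty)$ such that $\rho^{1/(N-1)}$ is concave; $\{g_r\}_{r>0}$ is a family of left-invariant Riemannian metrics on $H$ such that the entries of $G(r)$ lie in $C^0\cap W^{1,2}_{loc}((0,\infty))$; and $(Y,d)$ is the metric completion of $(Y_+,d_g)$, $g=dr^2+g_r$. The functions $\lambda_j$ lie in $C^0\cap W^{1,2}_{loc}((0,\infty))$. One has $\mathfrak m=e^{-V}\mathrm{dvol}_g$ on $Y_+$ with $V(r)=\ln\sqrt{\det G(r)}-\ln\rho(r)$. $\mathrm{Ric}_{\mathfrak m,\infty}=\mathrm{Ric}+\mathrm{Hess}\,V$ is understood in the distributional sense: for smooth vector fields, $\nabla_XY$ is the $L^2_{loc}$ vector field given by the Koszul formula with distributional derivatives; $\langle\nabla_X\theta,Z\rangle=X\langle\theta,Z\rangle-\langle\theta,\nabla_XZ\rangle$; $\langle \mathrm{Rm}(X,Y)Z,\theta\rangle=X\langle\nabla_YZ,\theta\rangle-Y\langle\nabla_XZ,\theta\rangle-\langle\nabla_YZ,\nabla_X\theta\rangle+\langle\nabla_XZ,\nabla_Y\theta\rangle-\langle\nabla_{[X,Y]}Z,\theta\rangle$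 for smooth $1$-forms $\theta$; $\mathrm{Ric}(Y,Z)$ is the trace $g^{ij}g(\mathrm{Rm}(E_i,Y)Z,E_j)$ over a local frame $E_i$, $g_{ij}=g(E_i,E_j)$; $\mathrm{Hess}\,V(X,Y)=X(Y(V))-(\nabla_XY)(V)$. *)

theory Defs
  imports "HOL-Analysis.Analysis" "HOL-Algebra.Generated_Groups"
begin

section \<open>Smooth maps, manifolds and Lie groups\<close>

text \<open>Only used for open \<open>S\<close>.\<close>

fun Ck_on :: "nat \<Rightarrow> 'a::real_normed_vector set \<Rightarrow> ('a \<Rightarrow> 'b::real_normed_vector) \<Rightarrow> bool" where
  "Ck_on 0 S f \<longleftrightarrow> continuous_on S f"
| "Ck_on (Suc n) S f \<longleftrightarrow>
     f differentiable_on S \<and> (\<forall>v. Ck_on n S (\<lambda>x. frechet_derivative f (at x) v))"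

definition smooth_on :: "'a::real_normed_vector set \<Rightarrow> ('a \<Rightarrow> 'b::real_normed_vector) \<Rightarrow> bool" where
  "smooth_on S f \<longleftrightarrow> (\<forall>n. Ck_on n S f)"

text \<open>A chart is a pair of its domain and its coordinate map.\<close>

type_synonym ('h, 'k) chart = "'h set \<times> ('h \<Rightarrow> real ^ 'k)"

definition chart_img :: "('h, 'k::finite) chart \<Rightarrow> (real ^ 'k) set" where
  "chart_img \<kappa> = snd \<kappa> ` fst \<kappa>"

definition chart_inv :: "('h, 'k::finite) chart \<Rightarrow> real ^ 'k \<Rightarrow> 'h" where
  "chart_inv \<kappa> = inv_into (fst \<kappa>) (snd \<kappa>)"

definition smooth_atlas :: "('h::{t2_space, second_countable_topology}, 'k::finite) chart set \<Rightarrow> bool" where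
  "smooth_atlas A \<longleftrightarrow>
     (\<Union>\<kappa>\<in>A. fst \<kappa>) = UNIV \<and>
     (\<forall>\<kappa>\<in>A. open (fst \<kappa>) \<and> open (chart_img \<kappa>) \<and>
        homeomorphism (fst \<kappa>) (chart_img \<kappa>) (snd \<kappa>) (chart_inv \<kappa>)) \<and>
     (\<forall>\<kappa>\<in>A. \<forall>\<kappa>'\<in>A. smooth_on (snd \<kappa> ` (fst \<kappa> \<inter> fst \<kappa>')) (snd \<kappa>' \<circ> chart_inv \<kappa>))"

definition chart_at :: "('h, 'k::finite) chart set \<Rightarrow> 'h \<Rightarrow> ('h, 'k) chart" where
  "chart_at A h = (SOME \<kappa>. \<kappa> \<in> A \<and> h \<in> fst \<kappa>)"

definition lie_group ::
  "'h::{t2_space, second_countable_topology} monoid \<Rightarrow> ('h, 'k::finite) chart set \<Rightarrow> bool" where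
  "lie_group G A \<longleftrightarrow>
     group G \<and> carrier G = UNIV \<and> smooth_atlas A \<and>
     continuous_on UNIV (\<lambda>p. fst p \<otimes>\<^bsub>G\<^esub> snd p) \<and>
     continuous_on UNIV (\<lambda>a. inv\<^bsub>G\<^esub> a) \<and>
     (\<forall>\<kappa>1\<in>A. \<forall>\<kappa>2\<in>A. \<forall>\<kappa>3\<in>A. smooth_on
        {p \<in> chart_img \<kappa>1 \<times> chart_img \<kappa>2.
           chart_inv \<kappa>1 (fst p) \<otimes>\<^bsub>G\<^esub> chart_inv \<kappa>2 (snd p) \<in> fst \<kappa>3}
        (\<lambda>p. snd \<kappa>3 (chart_inv \<kappa>1 (fst p) \<otimes>\<^bsub>G\<^esub> chart_inv \<kappa>2 (snd p)))) \<and>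
     (\<forall>\<kappa>1\<in>A. \<forall>\<kappa>2\<in>A. smooth_on
        {x \<in> chart_img \<kappa>1. inv\<^bsub>G\<^esub> (chart_inv \<kappa>1 x) \<in> fst \<kappa>2}
        (\<lambda>x. snd \<kappa>2 (inv\<^bsub>G\<^esub> (chart_inv \<kappa>1 x))))"

fun lower_central :: "('h, 'b) monoid_scheme \<Rightarrow> nat \<Rightarrow> 'h set" where
  "lower_central G 0 = carrier G"
| "lower_central G (Suc n) =
     generate G {a \<otimes>\<^bsub>G\<^esub> b \<otimes>\<^bsub>G\<^esub> inv\<^bsub>G\<^esub> a \<otimes>\<^bsub>G\<^esub> inv\<^bsub>G\<^esub> b | a b.
       a \<in> carrier G \<and> b \<in> lower_central G n}"

definition nilpotent_group :: "('h, 'b) monoid_scheme \<Rightarrow> bool" where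
  "nilpotent_group G \<longleftrightarrow> (\<exists>n. lower_central G n = {\<one>\<^bsub>G\<^esub>})"

text \<open>Tangent vectors at \<open>h\<close> are given by their components in each chart around \<open>h\<close>; components in
  different charts are related by the derivative of the coordinate change.\<close>

type_synonym ('h, 'k) vfield = "('h, 'k) chart \<Rightarrow> 'h \<Rightarrow> real ^ 'k"

type_synonym ('h, 'k) metric_tensor = "('h, 'k) chart \<Rightarrow> 'h \<Rightarrow> real ^ 'k \<Rightarrow> real ^ 'k \<Rightarrow> real"

definition tangent_map ::
  "('h, 'k::finite) chart \<Rightarrow> ('h, 'k) chart \<Rightarrow> ('h \<Rightarrow> 'h) \<Rightarrow> 'h \<Rightarrow> real ^ 'k \<Rightarrow> real ^ 'k" where
  "tangent_map \<kappa> \<kappa>' f h = frechet_derivative (snd \<kappa>' \<circ> f \<circ> chart_inv \<kappa>) (at (snd \<kappa> h))"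

definition smooth_vector_field :: "('h, 'k::finite) chart set \<Rightarrow> ('h, 'k) vfield \<Rightarrow> bool" where
  "smooth_vector_field A X \<longleftrightarrow>
     (\<forall>\<kappa>\<in>A. smooth_on (chart_img \<kappa>) (X \<kappa> \<circ> chart_inv \<kappa>)) \<and>
     (\<forall>\<kappa>\<in>A. \<forall>\<kappa>'\<in>A. \<forall>h\<in>fst \<kappa> \<inter> fst \<kappa>'. X \<kappa>' h = tangent_map \<kappa> \<kappa>' (\<lambda>a. a) h (X \<kappa> h))"

definition left_invariant_vf ::
  "'h monoid \<Rightarrow> ('h, 'k::finite) chart set \<Rightarrow> ('h, 'k) vfield \<Rightarrow> bool" where
  "left_invariant_vf G A X \<longleftrightarrow>
     (\<forall>a. \<forall>\<kappa>\<in>A. \<forall>\<kappa>'\<in>A. \<forall>h\<in>fst \<kappa>. a \<otimes>\<^bsub>G\<^esub> h \<in> fst \<kappa>' \<longrightarrow>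
        X \<kappa>' (a \<otimes>\<^bsub>G\<^esub> h) = tangent_map \<kappa> \<kappa>' (\<lambda>b. a \<otimes>\<^bsub>G\<^esub> b) h (X \<kappa> h))"

definition frame_matrix ::
  "('k \<Rightarrow> ('h, 'k::finite) vfield) \<Rightarrow> ('h, 'k) chart \<Rightarrow> 'h \<Rightarrow> real ^ 'k ^ 'k" where
  "frame_matrix X \<kappa> h = (\<chi> i j. X j \<kappa> h $ i)"

definition left_invariant_frame ::
  "'h monoid \<Rightarrow> ('h, 'k::finite) chart set \<Rightarrow> ('k \<Rightarrow> ('h, 'k) vfield) \<Rightarrow> bool" where
  "left_invariant_frame G A X \<longleftrightarrow>
     (\<forall>i. smooth_vector_field A (X i) \<and> left_invariant_vf G A (X i)) \<and>
     (\<forall>\<kappa>\<in>A. \<forall>h\<in>fst \<kappa>. invertible (frame_matrix X \<kappa> h))"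

text \<open>Row \<open>i\<close> holds the components in the chart of the dual one-form \<open>\<theta>\<^sup>i\<close>.\<close>

definition coframe_matrix ::
  "('k \<Rightarrow> ('h, 'k::finite) vfield) \<Rightarrow> ('h, 'k) chart \<Rightarrow> 'h \<Rightarrow> real ^ 'k ^ 'k" where
  "coframe_matrix X \<kappa> h = matrix_inv (frame_matrix X \<kappa> h)"

text \<open>The measure given by the density of \<open>\<theta>\<^sup>1 \<and> \<dots> \<and> \<theta>\<^sup>k\<close>.\<close>

definition coframe_volume ::
  "('h::topological_space, 'k::finite) chart set \<Rightarrow> ('k \<Rightarrow> ('h, 'k) vfield) \<Rightarrow> 'h measure \<Rightarrow> bool" where
  "coframe_volume A X \<Omega> \<longleftrightarrow>
     sets \<Omega> = sets borel \<and>
     (\<forall>\<kappa>\<in>A. \<forall>B\<in>sets borel. B \<subseteq> fst \<kappa> \<longrightarrow>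
        emeasure \<Omega> B = (\<integral>\<^sup>+ x. ennreal \<bar>det (coframe_matrix X \<kappa> (chart_inv \<kappa> x))\<bar> *
           indicator (snd \<kappa> ` B) x \<partial>lborel))"

definition riemannian_metric :: "('h, 'k::finite) chart set \<Rightarrow> ('h, 'k) metric_tensor \<Rightarrow> bool" where
  "riemannian_metric A g \<longleftrightarrow>
     (\<forall>\<kappa>\<in>A. \<forall>h\<in>fst \<kappa>.
        bilinear (g \<kappa> h) \<and> (\<forall>u v. g \<kappa> h u v = g \<kappa> h v u) \<and> (\<forall>u. u \<noteq> 0 \<longrightarrow> g \<kappa> h u u > 0)) \<and>
     (\<forall>\<kappa>\<in>A. \<forall>u v. smooth_on (chart_img \<kappa>) (\<lambda>x. g \<kappa> (chart_inv \<kappa> x) u v)) \<and>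
     (\<forall>\<kappa>\<in>A. \<forall>\<kappa>'\<in>A. \<forall>h\<in>fst \<kappa> \<inter> fst \<kappa>'. \<forall>u v.
        g \<kappa>' h (tangent_map \<kappa> \<kappa>' (\<lambda>a. a) h u) (tangent_map \<kappa> \<kappa>' (\<lambda>a. a) h v) = g \<kappa> h u v)"

definition left_invariant_metric ::
  "'h monoid \<Rightarrow> ('h, 'k::finite) chart set \<Rightarrow> ('h, 'k) metric_tensor \<Rightarrow> bool" where
  "left_invariant_metric G A g \<longleftrightarrow>
     riemannian_metric A g \<and>
     (\<forall>a. \<forall>\<kappa>\<in>A. \<forall>\<kappa>'\<in>A. \<forall>h\<in>fst \<kappa>. a \<otimes>\<^bsub>G\<^esub> h \<in> fst \<kappa>' \<longrightarrow> (\<forall>u v.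
        g \<kappa>' (a \<otimes>\<^bsub>G\<^esub> h) (tangent_map \<kappa> \<kappa>' (\<lambda>b. a \<otimes>\<^bsub>G\<^esub> b) h u)
          (tangent_map \<kappa> \<kappa>' (\<lambda>b. a \<otimes>\<^bsub>G\<^esub> b) h v) = g \<kappa> h u v))"

text \<open>For a left-invariant metric and left-invariant fields, \<open>g(X\<^sub>i, X\<^sub>j)\<close> is constant on the group;
  it is evaluated at the identity.\<close>

definition gram_matrix ::
  "'h monoid \<Rightarrow> ('h, 'k::finite) chart set \<Rightarrow> ('k \<Rightarrow> ('h, 'k) vfield) \<Rightarrow> ('h, 'k) metric_tensor \<Rightarrow>
    real ^ 'k ^ 'k" where
  "gram_matrix G A X g =
     (let \<kappa> = chart_at A \<one>\<^bsub>G\<^esub> in \<chi> i j. g \<kappa> \<one>\<^bsub>G\<^esub> (X i \<kappa> \<one>\<^bsub>G\<^esub>) (X j \<kappa> \<one>\<^bsub>G\<^esub>))"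

text \<open>Eigenvalues \<open>l 1 \<le> \<dots> \<le> l k\<close> listed with multiplicity.\<close>

definition ordered_eigenvalues :: "real ^ 'k::finite ^ 'k \<Rightarrow> (nat \<Rightarrow> real) \<Rightarrow> bool" where
  "ordered_eigenvalues M l \<longleftrightarrow>
     (\<forall>i j. 1 \<le> i \<and> i \<le> j \<and> j \<le> CARD('k) \<longrightarrow> l i \<le> l j) \<and>
     (\<forall>x. det (mat x - M) = (\<Prod>j=1..CARD('k). (x - l j)))"


section \<open>Metric measure spaces and the RCD condition\<close>

text \<open>The ambient complete separable metric space is a type of class \<^class>\<open>polish_space\<close>.\<close>

definition metric_measure_space :: "'y::polish_space measure \<Rightarrow> bool" where
  "metric_measure_space m \<longleftrightarrow>
     sets m = sets borel \<and> sigma_finite_measure m \<and> (\<forall>U. open U \<and> U \<noteq> {} \<longrightarrow> emeasure m U > 0)"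

definition couplings :: "'y::polish_space measure \<Rightarrow> 'y measure \<Rightarrow> ('y \<times> 'y) measure set" where
  "couplings \<mu> \<nu> = {q. sets q = sets borel \<and> distr q borel fst = \<mu> \<and> distr q borel snd = \<nu>}"

text \<open>Only used between probability measures of finite second moment, where the infimum is finite.\<close>

definition W2 :: "'y::polish_space measure \<Rightarrow> 'y measure \<Rightarrow> real" where
  "W2 \<mu> \<nu> = sqrt (enn2real (INF q\<in>couplings \<mu> \<nu>. \<integral>\<^sup>+ p. ennreal ((dist (fst p) (snd p))\<^sup>2) \<partial>q))"

definition P2_ac :: "'y::polish_space measure \<Rightarrow> 'y measure set" where
  "P2_ac m = {\<mu>. sets \<mu> = sets borel \<and> emeasure \<mu> UNIV = 1 \<and>
     (\<forall>x0. (\<integral>\<^sup>+ x. ennreal ((dist x0 x)\<^sup>2) \<partial>\<mu>) < \<infinity>) \<and> absolutely_continuous m \<mu>}"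

text \<open>The negative of the Renyi entropy, \<open>- S\<^sub>N(\<mu>|m) = \<integral> \<rho>\<^bsup>1 - 1/N\<^esup> dm\<close> for \<open>\<mu> = \<rho> m\<close>.\<close>

definition neg_renyi_entropy :: "real \<Rightarrow> 'y::polish_space measure \<Rightarrow> 'y measure \<Rightarrow> ennreal" where
  "neg_renyi_entropy N m \<mu> = (\<integral>\<^sup>+ x. ennreal (enn2real (RN_deriv m \<mu> x) powr (1 - 1 / N)) \<partial>m)"

text \<open>Sturm's condition \<open>CD(K, N)\<close> at \<open>K = 0\<close>: the distortion coefficients reduce to \<open>t\<close> and \<open>1 - t\<close>, so
  that no optimal coupling has to be mentioned.\<close>

definition CD0 :: "'y::polish_space measure \<Rightarrow> real \<Rightarrow> bool" where
  "CD0 m N \<longleftrightarrow>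
     (\<forall>\<mu>0\<in>P2_ac m. \<forall>\<mu>1\<in>P2_ac m. \<exists>\<Gamma>. \<Gamma> (0::real) = \<mu>0 \<and> \<Gamma> 1 = \<mu>1 \<and>
        (\<forall>t\<in>{0..1}. \<Gamma> t \<in> P2_ac m) \<and>
        (\<forall>s\<in>{0..1}. \<forall>t\<in>{0..1}. W2 (\<Gamma> s) (\<Gamma> t) = \<bar>s - t\<bar> * W2 \<mu>0 \<mu>1) \<and>
        (\<forall>t\<in>{0..1}. \<forall>N'\<ge>N. neg_renyi_entropy N' m (\<Gamma> t) \<ge>
           ennreal (1 - t) * neg_renyi_entropy N' m \<mu>0 + ennreal t * neg_renyi_entropy N' m \<mu>1))"

definition L2_fun :: "'y::polish_space measure \<Rightarrow> ('y \<Rightarrow> real) \<Rightarrow> bool" where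
  "L2_fun m f \<longleftrightarrow> f \<in> borel_measurable m \<and> integrable m (\<lambda>x. (f x)\<^sup>2)"

text \<open>This is \<open>0\<close> at isolated points.\<close>

definition local_lip :: "('y::metric_space \<Rightarrow> real) \<Rightarrow> 'y \<Rightarrow> ennreal" where
  "local_lip f x = Limsup (at x) (\<lambda>z. ennreal (\<bar>f z - f x\<bar> / dist z x))"

definition cheeger_energy :: "'y::polish_space measure \<Rightarrow> ('y \<Rightarrow> real) \<Rightarrow> ennreal" where
  "cheeger_energy m f =
     Inf {liminf (\<lambda>n. 1 / 2 * (\<integral>\<^sup>+ x. (local_lip (F n) x)\<^sup>2 \<partial>m)) | F.
       (\<forall>n. L2_fun m (F n) \<and> (\<exists>C. lipschitz_on C UNIV (F n))) \<and>
       (\<lambda>n. \<integral>\<^sup>+ x. ennreal ((F n x - f x)\<^sup>2) \<partial>m) \<longlonglongrightarrow> 0}"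

definition W12_space :: "'y::polish_space measure \<Rightarrow> ('y \<Rightarrow> real) set" where
  "W12_space m = {f. L2_fun m f \<and> cheeger_energy m f < \<infinity>}"

text \<open>The norm \<open>\<parallel>f\<parallel>\<^sup>2 = \<parallel>f\<parallel>\<^sup>2\<^sub>L\<^sub>2 + 2 Ch(f)\<close> of \<open>W\<^bsup>1,2\<^esup>\<close> comes from an inner product.\<close>

definition W12_Hilbert :: "'y::polish_space measure \<Rightarrow> bool" where
  "W12_Hilbert m \<longleftrightarrow>
     (\<exists>B. (\<forall>f\<in>W12_space m. \<forall>h\<in>W12_space m. B f h = B h f) \<and>
        (\<forall>f\<in>W12_space m. \<forall>f'\<in>W12_space m. \<forall>h\<in>W12_space m. \<forall>a b.
           B (\<lambda>x. a * f x + b * f' x) h = a * B f h + b * B f' h) \<and>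
        (\<forall>f\<in>W12_space m. B f f = (LINT x|m. (f x)\<^sup>2) + 2 * enn2real (cheeger_energy m f)))"

definition RCD0 :: "'y::polish_space measure \<Rightarrow> real \<Rightarrow> bool" where
  "RCD0 m N \<longleftrightarrow> metric_measure_space m \<and> CD0 m N \<and> W12_Hilbert m"


section \<open>Isometric actions, quotients, Hausdorff dimension\<close>

definition isometries :: "('y::metric_space \<Rightarrow> 'y) set" where
  "isometries = {f. surj f \<and> (\<forall>x z. dist (f x) (f z) = dist x z)}"

text \<open>The action identifies the group with a closed subgroup of the isometry group. The function type
  carries the topology of pointwise convergence, which on isometries is the compact-open topology.\<close>

definition closed_isometry_subgroup ::
  "'h::topological_space monoid \<Rightarrow> ('h \<Rightarrow> 'y::metric_space \<Rightarrow> 'y) \<Rightarrow> bool" where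
  "closed_isometry_subgroup G \<alpha> \<longleftrightarrow>
     range \<alpha> \<subseteq> isometries \<and>
     (\<forall>a b. \<alpha> (a \<otimes>\<^bsub>G\<^esub> b) = \<alpha> a \<circ> \<alpha> b) \<and>
     homeomorphism UNIV (range \<alpha>) \<alpha> (inv_into UNIV \<alpha>) \<and>
     closedin (top_of_set isometries) (range \<alpha>)"

definition measure_preserving_action :: "('h \<Rightarrow> 'y::metric_space \<Rightarrow> 'y) \<Rightarrow> 'y measure \<Rightarrow> bool" where
  "measure_preserving_action \<alpha> m \<longleftrightarrow> (\<forall>h. distr m borel (\<alpha> h) = m)"

definition orbit_of :: "('h \<Rightarrow> 'y \<Rightarrow> 'y) \<Rightarrow> 'y \<Rightarrow> 'y set" where
  "orbit_of \<alpha> x = range (\<lambda>h. \<alpha> h x)"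

definition orbit_dist :: "'y::metric_space set \<Rightarrow> 'y set \<Rightarrow> real" where
  "orbit_dist O1 O2 = Inf {dist a b | a b. a \<in> O1 \<and> b \<in> O2}"

definition quotient_is_half_line :: "('h \<Rightarrow> 'y::metric_space \<Rightarrow> 'y) \<Rightarrow> 'y \<Rightarrow> bool" where
  "quotient_is_half_line \<alpha> y \<longleftrightarrow>
     (\<exists>f :: 'y set \<Rightarrow> real. bij_betw f (range (orbit_of \<alpha>)) {0..} \<and>
        (\<forall>O1\<in>range (orbit_of \<alpha>). \<forall>O2\<in>range (orbit_of \<alpha>). dist (f O1) (f O2) = orbit_dist O1 O2) \<and>
        f (orbit_of \<alpha> y) = 0)"

definition closed_line_subgroup :: "'h::topological_space monoid \<Rightarrow> 'h set \<Rightarrow> bool" where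
  "closed_line_subgroup G L \<longleftrightarrow>
     subgroup L G \<and> closed L \<and>
     (\<exists>c c'. homeomorphism (UNIV :: real set) L c c' \<and> (\<forall>s t. c (s + t) = c s \<otimes>\<^bsub>G\<^esub> c t))"

text \<open>Used for \<open>s > 0\<close>. Boundedness is required because \<^const>\<open>diameter\<close> is unspecified otherwise.\<close>

definition hausdorff_content :: "real \<Rightarrow> real \<Rightarrow> 'y::metric_space set \<Rightarrow> ennreal" where
  "hausdorff_content s \<delta> S =
     Inf {(\<Sum>n. ennreal (diameter (C n) powr s)) | C :: nat \<Rightarrow> 'y set.
       S \<subseteq> (\<Union>n. C n) \<and> (\<forall>n. bounded (C n) \<and> diameter (C n) \<le> \<delta>)}"

definition hausdorff_measure :: "real \<Rightarrow> 'y::metric_space set \<Rightarrow> ennreal" where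
  "hausdorff_measure s S = (SUP \<delta>\<in>{0<..}. hausdorff_content s \<delta> S)"

definition hausdorff_dim :: "'y::metric_space set \<Rightarrow> ereal" where
  "hausdorff_dim S = Inf {ereal s | s. s > 0 \<and> hausdorff_measure s S = 0}"


section \<open>Distributions and weak derivatives on open subsets of Euclidean space\<close>

text \<open>Distributions are represented by their action on test functions, paired by Lebesgue measure.\<close>

definition test_fun :: "'e::euclidean_space set \<Rightarrow> ('e \<Rightarrow> real) \<Rightarrow> bool" where
  "test_fun U \<phi> \<longleftrightarrow> smooth_on UNIV \<phi> \<and> (\<exists>K. compact K \<and> K \<subseteq> U \<and> (\<forall>x. x \<notin> K \<longrightarrow> \<phi> x = 0))"

definition distribution_le ::
  "'e::euclidean_space set \<Rightarrow> (('e \<Rightarrow> real) \<Rightarrow> real) \<Rightarrow> (('e \<Rightarrow> real) \<Rightarrow> real) \<Rightarrow> bool" where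
  "distribution_le U S T \<longleftrightarrow> (\<forall>\<phi>. test_fun U \<phi> \<and> (\<forall>x. 0 \<le> \<phi> x) \<longrightarrow> S \<phi> \<le> T \<phi>)"

definition L2_loc :: "'e::euclidean_space set \<Rightarrow> ('e \<Rightarrow> 'b::euclidean_space) \<Rightarrow> bool" where
  "L2_loc U f \<longleftrightarrow> set_borel_measurable lborel U f \<and>
     (\<forall>K. compact K \<and> K \<subseteq> U \<longrightarrow> set_integrable lborel K (\<lambda>x. (norm (f x))\<^sup>2))"

definition weak_gradient :: "'e::euclidean_space set \<Rightarrow> ('e \<Rightarrow> real) \<Rightarrow> ('e \<Rightarrow> 'e) \<Rightarrow> bool" where
  "weak_gradient U u D \<longleftrightarrow> L2_loc U D \<and>
     (\<forall>\<phi> v. test_fun U \<phi> \<longrightarrow>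
        (LINT x:U|lborel. u x * frechet_derivative \<phi> (at x) v) = - (LINT x:U|lborel. (D x \<bullet> v) * \<phi> x))"

definition W12_loc :: "'e::euclidean_space set \<Rightarrow> ('e \<Rightarrow> real) \<Rightarrow> bool" where
  "W12_loc U u \<longleftrightarrow> L2_loc U u \<and> (\<exists>D. weak_gradient U u D)"

text \<open>Determined almost everywhere on \<open>U\<close>; for functions on \<open>(0,\<infinity>)\<close> it is the weak derivative.\<close>

definition wgrad :: "'e::euclidean_space set \<Rightarrow> ('e \<Rightarrow> real) \<Rightarrow> 'e \<Rightarrow> 'e" where
  "wgrad U u = (SOME D. weak_gradient U u D)"

definition divergence :: "('e::euclidean_space \<Rightarrow> 'e) \<Rightarrow> 'e \<Rightarrow> real" where
  "divergence X x = (\<Sum>b\<in>Basis. frechet_derivative X (at x) b \<bullet> b)"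

definition dist_deriv ::
  "'e::euclidean_space set \<Rightarrow> ('e \<Rightarrow> 'e) \<Rightarrow> ('e \<Rightarrow> real) \<Rightarrow> ('e \<Rightarrow> real) \<Rightarrow> real" where
  "dist_deriv U X u \<phi> = - (LINT x:U|lborel. u x * divergence (\<lambda>z. \<phi> z *\<^sub>R X z) x)"

definition lie_bracket :: "('e::euclidean_space \<Rightarrow> 'e) \<Rightarrow> ('e \<Rightarrow> 'e) \<Rightarrow> 'e \<Rightarrow> 'e" where
  "lie_bracket X Y x = frechet_derivative Y (at x) (X x) - frechet_derivative X (at x) (Y x)"


section \<open>Distributional curvature of a continuous metric of class \<open>W\<^bsup>1,2\<^esup>\<close>\<close>

text \<open>A metric on \<open>U\<close> is a field \<open>g\<close> of bilinear forms. One-forms are given by their components, so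
  that \<open>\<langle>\<theta>, Z\<rangle> = \<theta> x \<bullet> Z x\<close>, independently of \<open>g\<close>. As \<open>g\<close> is continuous, being locally square integrable
  with respect to \<open>g\<close> and to the Euclidean norm are the same. The fields \<open>\<nabla>\<^sub>X Y\<close> and \<open>\<nabla>\<^sub>X \<theta>\<close> are
  determined by their characterizations up to null sets.\<close>

definition koszul ::
  "'e::euclidean_space set \<Rightarrow> ('e \<Rightarrow> 'e \<Rightarrow> 'e \<Rightarrow> real) \<Rightarrow> ('e \<Rightarrow> 'e) \<Rightarrow> ('e \<Rightarrow> 'e) \<Rightarrow> ('e \<Rightarrow> 'e) \<Rightarrow> bool" where
  "koszul U g X Y W \<longleftrightarrow>
     (\<forall>Z \<phi>. smooth_on U Z \<and> test_fun U \<phi> \<longrightarrow>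
        2 * (LINT x:U|lborel. g x (W x) (Z x) * \<phi> x) =
          dist_deriv U X (\<lambda>x. g x (Y x) (Z x)) \<phi>
        + dist_deriv U Y (\<lambda>x. g x (X x) (Z x)) \<phi>
        - dist_deriv U Z (\<lambda>x. g x (X x) (Y x)) \<phi>
        + (LINT x:U|lborel. (g x (lie_bracket X Y x) (Z x) - g x (lie_bracket X Z x) (Y x)
            - g x (lie_bracket Y Z x) (X x)) * \<phi> x))"

definition nabla ::
  "'e::euclidean_space set \<Rightarrow> ('e \<Rightarrow> 'e \<Rightarrow> 'e \<Rightarrow> real) \<Rightarrow> ('e \<Rightarrow> 'e) \<Rightarrow> ('e \<Rightarrow> 'e) \<Rightarrow> 'e \<Rightarrow> 'e" where
  "nabla U g X Y = (SOME W. L2_loc U W \<and> koszul U g X Y W)"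

definition nabla_form ::
  "'e::euclidean_space set \<Rightarrow> ('e \<Rightarrow> 'e \<Rightarrow> 'e \<Rightarrow> real) \<Rightarrow> ('e \<Rightarrow> 'e) \<Rightarrow> ('e \<Rightarrow> 'e) \<Rightarrow> 'e \<Rightarrow> 'e" where
  "nabla_form U g X \<theta> = (SOME \<omega>. L2_loc U \<omega> \<and>
     (\<forall>Z. smooth_on U Z \<longrightarrow> (AE x in lborel. x \<in> U \<longrightarrow>
        \<omega> x \<bullet> Z x = frechet_derivative (\<lambda>z. \<theta> z \<bullet> Z z) (at x) (X x) - \<theta> x \<bullet> nabla U g X Z x)))"

definition riem_dist ::
  "'e::euclidean_space set \<Rightarrow> ('e \<Rightarrow> 'e \<Rightarrow> 'e \<Rightarrow> real) \<Rightarrow>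
    ('e \<Rightarrow> 'e) \<Rightarrow> ('e \<Rightarrow> 'e) \<Rightarrow> ('e \<Rightarrow> 'e) \<Rightarrow> ('e \<Rightarrow> 'e) \<Rightarrow> ('e \<Rightarrow> real) \<Rightarrow> real" where
  "riem_dist U g X Y Z \<theta> \<phi> =
     dist_deriv U X (\<lambda>x. nabla U g Y Z x \<bullet> \<theta> x) \<phi>
   - dist_deriv U Y (\<lambda>x. nabla U g X Z x \<bullet> \<theta> x) \<phi>
   - (LINT x:U|lborel. (nabla U g Y Z x \<bullet> nabla_form U g X \<theta> x) * \<phi> x)
   + (LINT x:U|lborel. (nabla U g X Z x \<bullet> nabla_form U g Y \<theta> x) * \<phi> x)
   - (LINT x:U|lborel. (nabla U g (lie_bracket X Y) Z x \<bullet> \<theta> x) * \<phi> x)"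

text \<open>The trace \<open>g\<^bsup>ij\<^esup> g(Rm(E\<^sub>i, Y)Z, E\<^sub>j) = \<langle>Rm(E\<^sub>i, Y)Z, E\<^sup>i\<rangle>\<close> over the coordinate frame \<open>E\<^sub>i\<close>, where
  \<open>E\<^sup>i = g\<^bsup>ij\<^esup> g(E\<^sub>j, \<cdot>)\<close> is the dual coframe, which is smooth although \<open>g\<close> is not.\<close>

definition ric_dist ::
  "'e::euclidean_space set \<Rightarrow> ('e \<Rightarrow> 'e \<Rightarrow> 'e \<Rightarrow> real) \<Rightarrow> ('e \<Rightarrow> 'e) \<Rightarrow> ('e \<Rightarrow> 'e) \<Rightarrow> ('e \<Rightarrow> real) \<Rightarrow> real" where
  "ric_dist U g Y Z \<phi> = (\<Sum>b\<in>Basis. riem_dist U g (\<lambda>_. b) Y Z (\<lambda>_. b) \<phi>)"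

definition hess_dist ::
  "'e::euclidean_space set \<Rightarrow> ('e \<Rightarrow> 'e \<Rightarrow> 'e \<Rightarrow> real) \<Rightarrow> ('e \<Rightarrow> real) \<Rightarrow>
    ('e \<Rightarrow> 'e) \<Rightarrow> ('e \<Rightarrow> 'e) \<Rightarrow> ('e \<Rightarrow> real) \<Rightarrow> real" where
  "hess_dist U g V X Y \<phi> =
     dist_deriv U X (\<lambda>x. wgrad U V x \<bullet> Y x) \<phi>
   - (LINT x:U|lborel. (wgrad U V x \<bullet> nabla U g X Y x) * \<phi> x)"

definition ric_m_infty ::
  "'e::euclidean_space set \<Rightarrow> ('e \<Rightarrow> 'e \<Rightarrow> 'e \<Rightarrow> real) \<Rightarrow> ('e \<Rightarrow> real) \<Rightarrow>
    ('e \<Rightarrow> 'e) \<Rightarrow> ('e \<Rightarrow> 'e) \<Rightarrow> ('e \<Rightarrow> real) \<Rightarrow> real" where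
  "ric_m_infty U g V X Y \<phi> = ric_dist U g X Y \<phi> + hess_dist U g V X Y \<phi>"


section \<open>The weighted Riemannian description\<close>

text \<open>A family \<open>g\<close> of metrics on the group gives the metric \<open>dr\<^sup>2 + g\<^sub>r\<close> on the product of \<open>(0,\<infinity>)\<close> with
  the group. Product charts are indexed by the charts of the group.\<close>

definition half_cylinder :: "('h, 'k::finite) chart \<Rightarrow> (real \<times> (real ^ 'k)) set" where
  "half_cylinder \<kappa> = {0<..} \<times> chart_img \<kappa>"

definition cylinder_metric ::
  "(real \<Rightarrow> ('h, 'k::finite) metric_tensor) \<Rightarrow> ('h, 'k) chart \<Rightarrow>
    real \<times> (real ^ 'k) \<Rightarrow> real \<times> (real ^ 'k) \<Rightarrow> real \<times> (real ^ 'k) \<Rightarrow> real" where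
  "cylinder_metric g \<kappa> p u v =
     fst u * fst v + g (fst p) \<kappa> (chart_inv \<kappa> (snd p)) (snd u) (snd v)"

definition d_r :: "real \<times> (real ^ 'k::finite) \<Rightarrow> real \<times> (real ^ 'k)" where
  "d_r = (\<lambda>_. (1, 0))"

definition chart_curve ::
  "('h, 'k::finite) chart \<Rightarrow> (real \<Rightarrow> real \<times> 'h) \<Rightarrow> real \<Rightarrow> real \<times> (real ^ 'k)" where
  "chart_curve \<kappa> \<gamma> t = (fst (\<gamma> t), snd \<kappa> (snd (\<gamma> t)))"

definition piecewise_C1_curves ::
  "('h::topological_space, 'k::finite) chart set \<Rightarrow> real \<times> 'h \<Rightarrow> real \<times> 'h \<Rightarrow>
    (real \<Rightarrow> real \<times> 'h) set" where
  "piecewise_C1_curves A p q = {\<gamma>. continuous_on {0..1} \<gamma> \<and> \<gamma> ` {0..1} \<subseteq> {0<..} \<times> UNIV \<and>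
     \<gamma> 0 = p \<and> \<gamma> 1 = q \<and>
     (\<exists>S. finite S \<and> (\<forall>t\<in>{0<..<1} - S. \<forall>\<kappa>\<in>A. snd (\<gamma> t) \<in> fst \<kappa> \<longrightarrow>
        (\<exists>e>0. chart_curve \<kappa> \<gamma> C1_differentiable_on ball t e)))}"

text \<open>The speed does not depend on the chart.\<close>

definition curve_speed ::
  "('h, 'k::finite) chart set \<Rightarrow> (real \<Rightarrow> ('h, 'k) metric_tensor) \<Rightarrow> (real \<Rightarrow> real \<times> 'h) \<Rightarrow> real \<Rightarrow> real" where
  "curve_speed A g \<gamma> t =
     (let \<kappa> = chart_at A (snd (\<gamma> t)); v = vector_derivative (chart_curve \<kappa> \<gamma>) (at t)
      in sqrt (cylinder_metric g \<kappa> (chart_curve \<kappa> \<gamma> t) v v))"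

definition cylinder_distance ::
  "('h::topological_space, 'k::finite) chart set \<Rightarrow> (real \<Rightarrow> ('h, 'k) metric_tensor) \<Rightarrow>
    real \<times> 'h \<Rightarrow> real \<times> 'h \<Rightarrow> ennreal" where
  "cylinder_distance A g p q =
     (INF \<gamma>\<in>piecewise_C1_curves A p q.
        \<integral>\<^sup>+ t. ennreal (curve_speed A g \<gamma> t) * indicator {0<..<1} t \<partial>lborel)"

definition weight_potential ::
  "'h monoid \<Rightarrow> ('h, 'k::finite) chart set \<Rightarrow> ('k \<Rightarrow> ('h, 'k) vfield) \<Rightarrow>
    (real \<Rightarrow> ('h, 'k) metric_tensor) \<Rightarrow> (real \<Rightarrow> real) \<Rightarrow> real \<Rightarrow> real" where
  "weight_potential G A X g \<rho> r = ln (sqrt (det (gram_matrix G A X (g r)))) - ln (\<rho> r)"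

text \<open>\<open>F\<close> is the equivariant homeomorphism, \<open>\<Omega>\<close> the Haar measure given by the coframe dual to \<open>X\<close>, and
  \<open>m\<close> corresponds to \<open>\<rho> dr \<and> \<Omega>\<close>.\<close>

definition weighted_description ::
  "'h::{t2_space, second_countable_topology} monoid \<Rightarrow> ('h, 'k::finite) chart set \<Rightarrow>
    ('h \<Rightarrow> 'y::polish_space \<Rightarrow> 'y) \<Rightarrow> 'y measure \<Rightarrow> real \<Rightarrow> ('k \<Rightarrow> ('h, 'k) vfield) \<Rightarrow>
    (real \<times> 'h \<Rightarrow> 'y) \<Rightarrow> 'h measure \<Rightarrow> (real \<Rightarrow> real) \<Rightarrow> (real \<Rightarrow> ('h, 'k) metric_tensor) \<Rightarrow> bool" where
  "weighted_description G A \<alpha> m N X F \<Omega> \<rho> g \<longleftrightarrow>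
     (\<exists>F'. homeomorphism ({0..} \<times> UNIV) UNIV F F') \<and>
     (\<forall>a. \<forall>r\<ge>0. \<forall>h. F (r, a \<otimes>\<^bsub>G\<^esub> h) = \<alpha> a (F (r, h))) \<and>
     coframe_volume A X \<Omega> \<and>
     (\<forall>r\<ge>0. \<rho> r \<ge> 0) \<and>
     concave_on {0..} (\<lambda>r. \<rho> r powr (1 / (N - 1))) \<and>
     (\<forall>B\<in>sets borel. emeasure m B =
        (\<integral>\<^sup>+ p. ennreal (\<rho> (fst p)) * indicator {p. 0 \<le> fst p \<and> F p \<in> B} p \<partial>(lborel \<Otimes>\<^sub>M \<Omega>))) \<and>
     (\<forall>r>0. left_invariant_metric G A (g r)) \<and>
     (\<forall>i j. continuous_on {0<..} (\<lambda>r. gram_matrix G A X (g r) $ i $ j) \<and>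
            W12_loc {0<..} (\<lambda>r. gram_matrix G A X (g r) $ i $ j)) \<and>
     (\<forall>p\<in>{0<..} \<times> UNIV. \<forall>q\<in>{0<..} \<times> UNIV.
        ennreal (dist (F p) (F q)) = cylinder_distance A g p q) \<and>
     closure (F ` ({0<..} \<times> UNIV)) = UNIV"

end

theory Submission
  imports Defs
begin

text \<open>
  For a cylinder metric \<open>g = dr\<^sup>2 + g\<^sub>r\<close> with Gram matrix \<open>M\<close>, the fields \<open>\<nabla>\<^sub>\<partial>\<^sub>r Z\<close> are \<open>\<partial>\<^sub>r Z + S Z\<close> with a shape
  operator \<open>S\<close> conjugate to \<open>M\<^sup>-\<^sup>1 M' / 2\<close>, so that \<open>Ric(\<partial>\<^sub>r, \<partial>\<^sub>r) = - (tr S)' - tr S\<^sup>2\<close>. By Jacobi's formula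
  \<open>V' = tr S - \<rho>' / \<rho>\<close>, the terms \<open>(tr S)'\<close> cancel, and the claim reduces to the inequality
  \<open>\<Sum>\<^sub>j (\<lambda>\<^sub>j' / \<lambda>\<^sub>j)\<^sup>2 \<le> tr (M\<^sup>-\<^sup>1 M' M\<^sup>-\<^sup>1 M')\<close> almost everywhere.

  No differentiability of the eigenvalues is used for it. For positive matrices \<open>A\<close>, \<open>B\<close> with ordered
  eigenvalues \<open>a\<^sub>j\<close>, \<open>b\<^sub>j\<close> one has \<open>\<Sum>\<^sub>j b\<^sub>j / a\<^sub>j \<le> tr (A\<^sup>-\<^sup>1 B)\<close>, because the left-hand side is the least value of
  \<open>\<Sum>\<^sub>i\<^sub>j P\<^sub>i\<^sub>j b\<^sub>j / a\<^sub>i\<close> over doubly stochastic \<open>P\<close>. Adding the same inequality with \<open>A\<close> and \<open>B\<close> exchanged gives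
  \<open>\<Sum>\<^sub>j (ln b\<^sub>j - ln a\<^sub>j)\<^sup>2 \<le> tr ((B - A) A\<^sup>-\<^sup>1 (B - A) B\<^sup>-\<^sup>1)\<close>; this is applied to the increments of \<open>M\<close> over short
  intervals, which are integrals of \<open>M'\<close>, and summed over a partition.
\<close>

section \<open>Eigenvalues of symmetric matrices\<close>

text \<open>The Gram matrix is continuous with one square integrable weak derivative, so its
  eigenvectors cannot be differentiated, and \<open>tr S\<close> has no pointwise derivative either;
  that derivative stays on the test function throughout. The fields \<open>nabla\<close>,
  \<open>nabla_form\<close> and \<open>wgrad\<close> are choices among solutions, so each is
  identified almost everywhere by exhibiting one solution and proving uniqueness. Tangential
  covariant derivatives never have to be computed: in the trace over \<open>b\<close> of
  \<open>Rm(b, d_r) d_r\<close> they meet only the factor \<open>\<nabla>_{d_r} d_r\<close>, which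
  vanishes, and \<open>\<nabla>_b d_r\<close> equals \<open>\<nabla>_{d_r} b\<close> because
  \<open>b\<close> is a constant field. Squares of increments do not add up over a partition,
  whereas the lower bound \<open>2 c x - c^2 h <= x^2 / h\<close> is linear in the increment
  \<open>x\<close> over a step of length \<open>h\<close>. For fixed slopes \<open>c\<close> it
  telescopes, and optimizing over countably many slopes restores the squares. Regularity of
  \<open>\<rho>\<close> comes from the concavity of its power, and its positivity from that
  concavity together with the full support of the measure.\<close>

lemma selfadjoint_max_eigenvector:
  fixes f :: "'a::euclidean_space \<Rightarrow> 'a"
  assumes lin: "linear f" and sa: "\<And>x y. f x \<bullet> y = x \<bullet> f y"
    and S: "subspace S" and inv: "f ` S \<subseteq> S" and ne: "S \<noteq> {0}"
  obtains x c where "x \<in> S" "norm x = 1" "f x = c *\<^sub>R x"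
proof -
  have comp: "compact (sphere 0 1 \<inter> S)"
    by (intro compact_Int_closed closed_subspace S) auto
  obtain z where z: "z \<in> S" "z \<noteq> 0" using ne subspace_0[OF S] by blast
  have "(1 / norm z) *\<^sub>R z \<in> sphere 0 1 \<inter> S"
    using z S by (auto simp: subspace_scale)
  then have "sphere 0 1 \<inter> S \<noteq> {}" by blast
  moreover have "continuous_on (sphere 0 1 \<inter> S) (\<lambda>x. f x \<bullet> x)"
    using lin by (intro continuous_on_inner linear_continuous_on continuous_on_id) (simp add: linear_conv_bounded_linear)
  ultimately obtain x where x: "x \<in> sphere 0 1 \<inter> S"
    and max: "\<And>y. y \<in> sphere 0 1 \<inter> S \<Longrightarrow> f y \<bullet> y \<le> f x \<bullet> x"
    using continuous_attains_sup[OF comp, of "\<lambda>x. f x \<bullet> x"] by blast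
  define c where "c = f x \<bullet> x"
  have le: "f y \<bullet> y \<le> c * (y \<bullet> y)" if "y \<in> S" for y
  proof (cases "y = 0")
    case True then show ?thesis using lin by (simp add: linear_0)
  next
    case False
    have "(1 / norm y) *\<^sub>R y \<in> sphere 0 1 \<inter> S"
      using False that S by (auto simp: subspace_scale)
    from max[OF this] have "(f y \<bullet> y) / (norm y)\<^sup>2 \<le> c"
      by (simp add: linear_scale[OF lin] c_def power2_eq_square)
    then show ?thesis using False
      by (simp add: field_simps dot_square_norm)
  qed
  \<comment> \<open>The residual of the eigenvalue equation at a maximizer of the Rayleigh quotient.
    If it were nonzero, moving \<open>x\<close> in its direction would raise the quotient to first
    order.\<close>
  define y where "y = f x - c *\<^sub>R x"
  have xS: "x \<in> S" and nx: "norm x = 1" using x by auto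
  have yS: "y \<in> S" using xS inv S by (auto simp: y_def intro!: subspace_diff subspace_scale)
  have key: "2 * t * (y \<bullet> y) \<le> t\<^sup>2 * (c * (y \<bullet> y) - f y \<bullet> y)" for t
  proof -
    have "x + t *\<^sub>R y \<in> S" using xS yS S by (intro subspace_add subspace_scale)
    from le[OF this] have "f (x + t *\<^sub>R y) \<bullet> (x + t *\<^sub>R y) \<le> c * ((x + t *\<^sub>R y) \<bullet> (x + t *\<^sub>R y))" .
    moreover have "f (x + t *\<^sub>R y) \<bullet> (x + t *\<^sub>R y) = c + 2 * t * (f x \<bullet> y) + t\<^sup>2 * (f y \<bullet> y)"
      using sa[of x y] sa[of x x] by (simp add: linear_add[OF lin] linear_scale[OF lin] inner_add_left inner_add_right
          c_def power2_eq_square algebra_simps inner_commute)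
    moreover have "(x + t *\<^sub>R y) \<bullet> (x + t *\<^sub>R y) = 1 + 2 * t * (x \<bullet> y) + t\<^sup>2 * (y \<bullet> y)"
      using nx by (simp add: inner_add_left inner_add_right power2_eq_square algebra_simps inner_commute norm_eq_1)
    ultimately have "c + 2 * t * (f x \<bullet> y) + t\<^sup>2 * (f y \<bullet> y) \<le> c * (1 + 2 * t * (x \<bullet> y) + t\<^sup>2 * (y \<bullet> y))"
      by (simp only:)
    moreover have "f x \<bullet> y = y \<bullet> y + c * (x \<bullet> y)"
      by (subst (2) y_def) (simp add: inner_diff_left)
    ultimately have "c + 2 * t * (y \<bullet> y + c * (x \<bullet> y)) + t\<^sup>2 * (f y \<bullet> y) \<le> c * (1 + 2 * t * (x \<bullet> y) + t\<^sup>2 * (y \<bullet> y))"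
      by (simp only:)
    then show ?thesis by (simp add: algebra_simps)
  qed
  have "y \<bullet> y = 0"
  proof (rule ccontr)
    assume "y \<bullet> y \<noteq> 0"
    then have pos: "y \<bullet> y > 0" by simp
    \<comment> \<open>\<open>K\<close> is a positive upper bound for the coefficient of
      \<open>t^2\<close>, and \<open>t = (y \<bullet> y) / K\<close> makes the quadratic term at
      most half of the linear one.\<close>
    define K where "K = \<bar>c * (y \<bullet> y) - f y \<bullet> y\<bar> + 1"
    have K: "K > 0" "c * (y \<bullet> y) - f y \<bullet> y \<le> K" by (auto simp: K_def)
    define t where "t = (y \<bullet> y) / K"
    have t: "t > 0" using pos K by (simp add: t_def)
    have "2 * t * (y \<bullet> y) \<le> t\<^sup>2 * K"
      using key[of t] K by (meson mult_left_mono order_trans zero_le_power2)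
    also have "\<dots> = t * (y \<bullet> y)" using K by (simp add: t_def power2_eq_square)
    finally show False using t pos by simp
  qed
  then have "f x = c *\<^sub>R x" by (simp add: y_def)
  with xS nx that show ?thesis by blast
qed

text \<open>An invariant subspace in place of the whole space makes the induction on the dimension
  possible: by self-adjointness the part of \<open>S\<close> orthogonal to one eigenvector is again
  invariant, and its dimension is one less.\<close>

lemma selfadjoint_orthonormal_eigenvectors:
  fixes f :: "'a::euclidean_space \<Rightarrow> 'a"
  assumes lin: "linear f" and sa: "\<And>x y. f x \<bullet> y = x \<bullet> f y"
    and "subspace S" and "f ` S \<subseteq> S"
  shows "\<exists>B \<subseteq> S. finite B \<and> card B = dim S \<and> pairwise orthogonal B \<and> (\<forall>x\<in>B. norm x = 1) \<and>
           (\<forall>x\<in>B. \<exists>c. f x = c *\<^sub>R x)"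
  using assms(3,4)
proof (induction "dim S" arbitrary: S)
  case 0
  then show ?case by (intro exI[of _ "{}"]) auto
next
  case (Suc n)
  then have "S \<noteq> {0}" by auto
  then obtain x c where x: "x \<in> S" "norm x = 1" "f x = c *\<^sub>R x"
    using selfadjoint_max_eigenvector[OF lin sa Suc.prems] by blast
  define T where "T = S \<inter> {y. orthogonal x y}"
  have T: "subspace T" unfolding T_def
    using Suc.prems(1) by (auto simp: subspace_def orthogonal_def inner_add_right)
  have fT: "f ` T \<subseteq> T" 
    using Suc.prems x sa by (force simp: T_def orthogonal_def inner_commute)
  have dT: "dim T = n"
  proof -
    have "T = {y \<in> S. \<forall>z\<in>span {x}. orthogonal z y}"
      by (auto simp: T_def span_singleton orthogonal_def)
    moreover have "dim {y \<in> S. \<forall>z\<in>span {x}. orthogonal z y} + dim (span {x}) = dim S"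
      using x Suc.prems by (intro dim_subspace_orthogonal_to_vectors) (auto simp: span_minimal)
    ultimately have "dim T + dim (span {x}) = dim S" by simp
    moreover have "dim (span {x}) = 1" using x by (auto simp: dim_eq_card_independent)
    ultimately show ?thesis using Suc.hyps by simp
  qed
  obtain B where B: "B \<subseteq> T" "finite B" "card B = n" "pairwise orthogonal B" "\<forall>x\<in>B. norm x = 1"
    "\<forall>x\<in>B. \<exists>c. f x = c *\<^sub>R x"
    using Suc.hyps(1)[of T] T fT dT by metis
  have xB: "x \<notin> B" using B x by (auto simp: T_def orthogonal_def norm_eq_1)
  have "pairwise orthogonal (insert x B)"
    using B by (auto simp: pairwise_insert T_def orthogonal_commute)
  with B x xB Suc.hyps(2) show ?case
    by (intro exI[of _ "insert x B"]) (auto simp: T_def)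
qed

text \<open>Indexed by 1, ..., k like \<open>ordered_eigenvalues\<close>, so that the j-th vector
  can be paired with the j-th eigenvalue. Having full length, such a family is an orthonormal
  basis.\<close>

definition orthonormal_seq :: "(nat \<Rightarrow> real ^ 'k::finite) \<Rightarrow> bool" where
  "orthonormal_seq v \<longleftrightarrow>
     (\<forall>i\<in>{1..CARD('k)}. \<forall>j\<in>{1..CARD('k)}. v i \<bullet> v j = (if i = j then 1 else 0))"

lemma matrix_add_rdistrib:
  fixes A B :: "real ^ 'n::finite ^ 'm::finite" and C :: "real ^ 'p::finite ^ 'n"
  shows "(A + B) ** C = A ** C + B ** C"
  by (simp add: vec_eq_iff matrix_matrix_mult_def distrib_right sum.distrib)

lemma matrix_diff_ldistrib:
  fixes A :: "real ^ 'n::finite ^ 'm::finite" and B C :: "real ^ 'p::finite ^ 'n"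
  shows "A ** (B - C) = A ** B - A ** C"
  by (simp add: vec_eq_iff matrix_matrix_mult_def right_diff_distrib sum_subtractf)

lemma matrix_diff_rdistrib:
  fixes A B :: "real ^ 'n::finite ^ 'm::finite" and C :: "real ^ 'p::finite ^ 'n"
  shows "(A - B) ** C = A ** C - B ** C"
  by (simp add: vec_eq_iff matrix_matrix_mult_def left_diff_distrib sum_subtractf)

text \<open>\<open>Q\<close> has the vectors \<open>w j\<close> as columns and intertwines
  \<open>mat x - A\<close> with a diagonal matrix; its nonzero determinant cancels on both
  sides.\<close>

lemma det_eigenbasis:
  fixes A :: "real ^ 'k::finite ^ 'k" and w :: "'k \<Rightarrow> real ^ 'k"
  assumes w: "\<And>i j. w i \<bullet> w j = (if i = j then 1 else 0)" and A: "\<And>i. A *v w i = c i *\<^sub>R w i"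
  shows "det (mat x - A) = (\<Prod>i\<in>UNIV. (x - c i))"
proof -
  define Q where "Q = (\<chi> i j. w j $ i)"
  define E where "E = (\<chi> i j. if i = j then x - c i else (0::real))"
  have QQ: "transpose Q ** Q = mat 1"
    by (simp add: Q_def matrix_matrix_mult_def transpose_def mat_def vec_eq_iff w[unfolded inner_vec_def, simplified])
  have "(mat x - A) ** Q = Q ** E"
  proof -
    have "((mat x - A) ** Q) $ i $ j = (Q ** E) $ i $ j" for i j
    proof -
      have "((mat x - A) ** Q) $ i $ j = ((mat x - A) *v w j) $ i"
        by (simp add: Q_def matrix_matrix_mult_def matrix_vector_mult_def)
      also have "mat x *v w j = x *\<^sub>R w j"
        by (simp add: vec_eq_iff matrix_vector_mult_def mat_def if_distrib[of "\<lambda>a. a * _"] sum.delta cong: if_cong)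
      then have "((mat x - A) *v w j) = (x - c j) *\<^sub>R w j"
        by (simp add: matrix_vector_mult_diff_rdistrib A scaleR_diff_left)
      also have "((x - c j) *\<^sub>R w j) $ i = (Q ** E) $ i $ j"
        by (simp add: Q_def E_def matrix_matrix_mult_def if_distrib cong: if_cong)
      finally show ?thesis .
    qed
    then show ?thesis by (simp add: vec_eq_iff)
  qed
  then have "det (mat x - A) * det Q = det Q * det E" by (metis det_mul)
  moreover have "det Q \<noteq> 0" using QQ by (metis det_I det_mul det_transpose mult_zero_left zero_neq_one)
  moreover have "det E = (\<Prod>i\<in>UNIV. (x - c i))" by (subst det_diagonal) (auto simp: E_def)
  ultimately show ?thesis by simp
qed

text \<open>Polynomials that agree at all reals are equal, so their multisets of roots coincide.
  Multisets rather than sets of roots are compared in order to keep multiplicities.\<close>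

lemma linear_factors_permutes:
  fixes a c :: "nat \<Rightarrow> real"
  assumes "\<And>x. (\<Prod>j=1..n. (x - a j)) = (\<Prod>j=1..n. (x - c j))"
  shows "\<exists>p. p permutes {1..n} \<and> (\<forall>j\<in>{1..n}. a j = c (p j))"
proof -
  have *: "proots (\<Prod>j\<in>I. [:- f j, 1:]) = image_mset f (mset_set I)" if "finite I"
    for f :: "nat \<Rightarrow> real" and I
    using that
  proof induction
    case (insert i I)
    have "[:- f i, 1:] \<noteq> 0" "(\<Prod>j\<in>I. [:- f j, 1:]) \<noteq> 0" using insert by auto
    then have "proots ([:- f i, 1:] * (\<Prod>j\<in>I. [:- f j, 1:])) = proots [:- f i, 1:] + proots (\<Prod>j\<in>I. [:- f j, 1:])"
      by (rule proots_mult)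
    with insert show ?case by (simp del: mult_pCons_left)
  qed simp
  have "poly (\<Prod>j=1..n. [:- a j, 1:]) = poly (\<Prod>j=1..n. [:- c j, 1:])"
    using assms by (auto simp: poly_prod fun_eq_iff)
  then have "(\<Prod>j=1..n. [:- a j, 1:]) = (\<Prod>j=1..n. [:- c j, 1:])"
    by (simp only: poly_eq_poly_eq_iff)
  then have "image_mset a (mset_set {1..n}) = image_mset c (mset_set {1..n})"
    using *[of "{1..n}" a] *[of "{1..n}" c] by simp
  then obtain p where "p permutes {1..n}" "\<forall>j\<in>{1..n}. a j = c (p j)"
    using image_mset_eq_implies_permutes[of "{1..n}" a c] by blast
  then show ?thesis by blast
qed

text \<open>\<open>ordered_eigenvalues\<close> speaks only of the characteristic polynomial. An
  eigenbasis in arbitrary order gives a second factorization of that polynomial, and the permutation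
  matching the linear factors puts the eigenvectors into the prescribed order.\<close>

lemma ordered_eigenvalues_eigenbasis:
  fixes A :: "real ^ 'k::finite ^ 'k"
  assumes sym: "transpose A = A" and ev: "ordered_eigenvalues A a"
  obtains v where "orthonormal_seq v" "\<And>i. i \<in> {1..CARD('k)} \<Longrightarrow> A *v v i = a i *\<^sub>R v i"
proof -
  let ?n = "CARD('k)"
  have sa: "(A *v x) \<bullet> y = x \<bullet> (A *v y)" for x y
    by (metis dot_lmul_matrix sym transpose_matrix_vector vector_transpose_matrix)
  from selfadjoint_orthonormal_eigenvectors[OF matrix_vector_mul_linear sa, of UNIV]
  obtain B where B: "finite B" "card B = ?n" "pairwise orthogonal B" "\<forall>x\<in>B. norm x = 1"
    "\<forall>x\<in>B. \<exists>c. A *v x = c *\<^sub>R x"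
    by auto
  obtain e :: "'k \<Rightarrow> nat" where e: "bij_betw e UNIV {1..?n}"
    using finite_same_card_bij[of "UNIV :: 'k set" "{1..?n}"] by auto
  obtain h where h: "bij_betw h {1..?n} B"
    using finite_same_card_bij[of "{1..?n}" B] B by auto
  obtain c where c: "\<And>x. x \<in> B \<Longrightarrow> A *v x = c x *\<^sub>R x" using B by metis
  have hB: "h i \<in> B" if "i \<in> {1..?n}" for i using h that by (auto simp: bij_betw_def)
  have eI: "e i \<in> {1..?n}" for i using e by (auto simp: bij_betw_def)
  have ortho: "h i \<bullet> h j = (if i = j then 1 else 0)" if "i \<in> {1..?n}" "j \<in> {1..?n}" for i j
  proof (cases "i = j")
    case True
    then show ?thesis using B(4) hB[OF that(1)] by (simp add: norm_eq_1)
  next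
    case False
    then have "h i \<noteq> h j" using h that by (metis bij_betw_def inj_on_def)
    then show ?thesis using B(3) hB[OF that(1)] hB[OF that(2)] False
      by (simp add: pairwise_def orthogonal_def)
  qed
  have "det (mat x - A) = (\<Prod>i\<in>UNIV. (x - c (h (e i))))" for x
  proof (rule det_eigenbasis)
    show "A *v h (e i) = c (h (e i)) *\<^sub>R h (e i)" for i using c hB eI by blast
    show "h (e i) \<bullet> h (e j) = (if i = j then 1 else 0)" for i j
      using ortho[OF eI eI, of i j] e by (auto simp: bij_betw_def inj_on_def)
  qed
  also have "(\<Prod>i\<in>UNIV. (x - c (h (e i)))) = (\<Prod>j=1..?n. (x - c (h j)))" for x
    by (rule prod.reindex_bij_betw[OF e])
  finally have "(\<Prod>j=1..?n. (x - a j)) = (\<Prod>j=1..?n. (x - c (h j)))" for x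
    using ev unfolding ordered_eigenvalues_def by metis
  from linear_factors_permutes[of a ?n "\<lambda>j. c (h j)", OF this]
  obtain p where "p permutes {1..?n} \<and> (\<forall>j\<in>{1..?n}. a j = c (h (p j)))" ..
  then have p: "p permutes {1..?n}" "\<And>j. j \<in> {1..?n} \<Longrightarrow> a j = c (h (p j))"
    by simp_all
  have pI: "p i \<in> {1..?n}" if "i \<in> {1..?n}" for i using permutes_in_image[OF p(1)] that by blast
  show thesis
  proof (rule that[of "h \<circ> p"])
    show "orthonormal_seq (h \<circ> p)"
      using ortho pI permutes_inj[OF p(1)] by (auto simp: orthonormal_seq_def inj_eq)
    show "A *v (h \<circ> p) i = a i *\<^sub>R (h \<circ> p) i" if "i \<in> {1..?n}" for i
      using c[OF hB[OF pI[OF that]]] p(2)[OF that] by simp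
  qed
qed

section \<open>Traces in orthonormal bases and sums over doubly stochastic matrices\<close>

lemma orthonormal_seq_parseval:
  fixes v :: "nat \<Rightarrow> real ^ 'k::finite"
  assumes "orthonormal_seq v"
  shows "(\<Sum>i=1..CARD('k). (x \<bullet> v i) * (y \<bullet> v i)) = x \<bullet> y"
proof -
  let ?n = "CARD('k)"
  have o: "v i \<bullet> v j = (if i = j then 1 else 0)" if "i \<in> {1..?n}" "j \<in> {1..?n}" for i j
    using assms that by (auto simp: orthonormal_seq_def)
  have inj: "inj_on v {1..?n}"
    by (rule inj_onI) (metis o zero_neq_one)
  have po: "pairwise orthogonal (v ` {1..?n})"
    using o by (auto simp: pairwise_def orthogonal_def)
  have "0 \<notin> v ` {1..?n}" using o by (metis imageE inner_zero_left zero_neq_one)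
  then have "independent (v ` {1..?n})" by (intro pairwise_orthogonal_independent po)
  then have sp: "span (v ` {1..?n}) = UNIV"
    using inj by (intro card_ge_dim_independent[of _ UNIV, simplified, THEN subset_antisym[OF subset_UNIV]])
       (auto simp: card_image)
  have "x = (\<Sum>b\<in>v ` {1..?n}. (b \<bullet> x) *\<^sub>R b)"
  proof -
    have "norm b = 1" if "b \<in> v ` {1..?n}" for b using that o by (auto simp: norm_eq_1)
    then show ?thesis using orthonormal_basis_expand[OF po, of x] sp by (simp add: inner_commute)
  qed
  then have "x = (\<Sum>i=1..?n. (v i \<bullet> x) *\<^sub>R v i)" by (simp only: sum.reindex[OF inj] o_def)
  then have "x \<bullet> y = (\<Sum>i=1..?n. (v i \<bullet> x) *\<^sub>R v i) \<bullet> y" by simp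
  also have "\<dots> = (\<Sum>i=1..?n. (x \<bullet> v i) * (y \<bullet> v i))"
    by (simp add: inner_sum_left inner_sum_right inner_commute del: One_nat_def)
  finally show ?thesis by simp
qed

lemma trace_orthonormal_seq:
  fixes v :: "nat \<Rightarrow> real ^ 'k::finite" and A :: "real ^ 'k ^ 'k"
  assumes "orthonormal_seq v"
  shows "trace A = (\<Sum>i=1..CARD('k). (A *v v i) \<bullet> v i)"
proof -
  have "(\<Sum>i=1..CARD('k). (A *v v i) \<bullet> v i) = (\<Sum>i=1..CARD('k). \<Sum>k\<in>UNIV. (row k A \<bullet> v i) * (axis k 1 \<bullet> v i))"
    by (simp add: inner_vec_def matrix_vector_mult_def row_def axis_def if_distrib[of "\<lambda>a. a * _"] cong: if_cong)
  also have "\<dots> = (\<Sum>k\<in>UNIV. row k A \<bullet> axis k 1)"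
    by (subst sum.swap) (simp only: orthonormal_seq_parseval[OF assms])
  also have "\<dots> = trace A" by (simp add: trace_def inner_axis row_def)
  finally show ?thesis by simp
qed

text \<open>Duality of linear programming in place of a decomposition into permutations:
  \<open>\<beta>\<close> is a Kantorovich potential, so
  \<open>b i * c i - \<beta> i + \<beta> j\<close> bounds the cost \<open>b j * c i\<close> from
  below. In the average against \<open>P\<close> the potentials cancel, since rows and columns sum
  to 1.\<close>

lemma doubly_stochastic_antitone_sum:
  fixes P :: "nat \<Rightarrow> nat \<Rightarrow> real" and b c :: "nat \<Rightarrow> real"
  assumes P: "\<And>i j. i \<in> {1..n} \<Longrightarrow> j \<in> {1..n} \<Longrightarrow> 0 \<le> P i j"
    and row: "\<And>i. i \<in> {1..n} \<Longrightarrow> (\<Sum>j=1..n. P i j) = 1"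
    and col: "\<And>j. j \<in> {1..n} \<Longrightarrow> (\<Sum>i=1..n. P i j) = 1"
    and b: "\<And>i j. 1 \<le> i \<Longrightarrow> i \<le> j \<Longrightarrow> j \<le> n \<Longrightarrow> b i \<le> b j"
    and c: "\<And>i j. 1 \<le> i \<Longrightarrow> i \<le> j \<Longrightarrow> j \<le> n \<Longrightarrow> c j \<le> c i"
  shows "(\<Sum>i=1..n. b i * c i) \<le> (\<Sum>i=1..n. \<Sum>j=1..n. P i j * (b j * c i))"
proof -
  \<comment> \<open>A discrete integral of \<open>c\<close> against the increments of
    \<open>b\<close>. As \<open>c\<close> is antitone, on the stretch between \<open>i\<close> and
    \<open>j\<close> it can be compared with its value at \<open>i\<close>, which gives the
    potential inequality for either order of the two indices.\<close>
  define \<beta> where "\<beta> j = (\<Sum>m=1..<j. c m * (b (Suc m) - b m))" for j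
  have dif: "\<beta> j - \<beta> i = (\<Sum>m=i..<j. c m * (b (Suc m) - b m))" if "1 \<le> i" "i \<le> j" for i j
    using that sum.atLeastLessThan_concat[of 1 i j "\<lambda>m. c m * (b (Suc m) - b m)"] by (simp add: \<beta>_def)
  have tel: "b j - b i = (\<Sum>m=i..<j. b (Suc m) - b m)" if "i \<le> j" for i j
    using that by (simp add: sum_Suc_diff')
  have pot: "b i * c i - \<beta> i + \<beta> j \<le> b j * c i" if "i \<in> {1..n}" "j \<in> {1..n}" for i j
  proof (cases "i \<le> j")
    case True
    have "\<beta> j - \<beta> i \<le> (\<Sum>m=i..<j. c i * (b (Suc m) - b m))"
      using that True by (subst dif) (auto intro!: sum_mono mult_right_mono b c)
    also have "\<dots> = c i * (b j - b i)" using tel[OF True] by (simp add: sum_distrib_left)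
    finally show ?thesis by (simp add: algebra_simps)
  next
    case False
    then have le: "j \<le> i" by simp
    have "(\<Sum>m=j..<i. c i * (b (Suc m) - b m)) \<le> \<beta> i - \<beta> j"
      using that le by (subst dif) (auto intro!: sum_mono mult_right_mono b c)
    moreover have "(\<Sum>m=j..<i. c i * (b (Suc m) - b m)) = c i * (b i - b j)"
      using tel[OF le] by (simp add: sum_distrib_left)
    ultimately show ?thesis by (simp add: algebra_simps)
  qed
  have "(\<Sum>i=1..n. \<Sum>j=1..n. P i j * (b i * c i - \<beta> i + \<beta> j)) \<le> (\<Sum>i=1..n. \<Sum>j=1..n. P i j * (b j * c i))"
    by (intro sum_mono mult_left_mono pot P) auto
  moreover have "(\<Sum>i=1..n. \<Sum>j=1..n. P i j * (b i * c i - \<beta> i + \<beta> j)) = (\<Sum>i=1..n. b i * c i)"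
  proof -
    have "(\<Sum>i=1..n. \<Sum>j=1..n. P i j * (b i * c i - \<beta> i + \<beta> j))
        = (\<Sum>i=1..n. (\<Sum>j=1..n. P i j) * (b i * c i - \<beta> i)) + (\<Sum>i=1..n. \<Sum>j=1..n. P i j * \<beta> j)"
      by (simp only: distrib_left sum.distrib sum_distrib_right)
    also have "(\<Sum>i=1..n. \<Sum>j=1..n. P i j * \<beta> j) = (\<Sum>j=1..n. (\<Sum>i=1..n. P i j) * \<beta> j)"
      by (subst sum.swap) (simp only: sum_distrib_right)
    also have "\<dots> = (\<Sum>j=1..n. \<beta> j)" by (intro sum.cong) (use col in auto)
    also have "(\<Sum>i=1..n. (\<Sum>j=1..n. P i j) * (b i * c i - \<beta> i)) = (\<Sum>i=1..n. b i * c i - \<beta> i)"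
      by (intro sum.cong) (use row in auto)
    finally show ?thesis by (simp add: sum_subtractf)
  qed
  ultimately show ?thesis by simp
qed

section \<open>Positive definite matrices and the logarithms of their eigenvalues\<close>

definition pos_spectrum :: "real ^ 'k::finite ^ 'k \<Rightarrow> (nat \<Rightarrow> real) \<Rightarrow> bool" where
  "pos_spectrum A a \<longleftrightarrow> transpose A = A \<and> ordered_eigenvalues A a \<and> (\<forall>j\<in>{1..CARD('k)}. a j > 0)"

lemma pos_spectrum_pos:
  fixes A :: "real ^ 'k::finite ^ 'k"
  shows "pos_spectrum A a \<Longrightarrow> i \<in> {1..CARD('k)} \<Longrightarrow> a i > 0"
  by (simp add: pos_spectrum_def)

text \<open>The characteristic polynomial is evaluated at 0; the sign
  \<open>(- 1) ^ CARD('k)\<close> occurs on both sides.\<close>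

lemma pos_spectrum_det:
  fixes A :: "real ^ 'k::finite ^ 'k"
  assumes "pos_spectrum A a"
  shows "det A = (\<Prod>j=1..CARD('k). a j)"
proof -
  have "det (mat x - A) = (\<Prod>j=1..CARD('k). (x - a j))" for x
    using assms by (auto simp: pos_spectrum_def ordered_eigenvalues_def)
  from this[of 0] have "det (- A) = (\<Prod>j=1..CARD('k). - a j)" by (simp add: mat_0)
  moreover have "det (- A) = (- 1) ^ CARD('k) * det A"
    using det_rows_mul[of "\<lambda>i. -1" "\<lambda>i. row i A"] by (simp add: det_def prod_uminus sum_distrib_left mult_ac)
  moreover have "(\<Prod>j=1..CARD('k). - a j) = (- 1) ^ CARD('k) * (\<Prod>j=1..CARD('k). a j)"
    by (simp add: prod_uminus)
  ultimately show ?thesis by simp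
qed

lemma pos_spectrum_det_pos:
  fixes A :: "real ^ 'k::finite ^ 'k"
  assumes "pos_spectrum A a"
  shows "det A > 0"
  using assms by (auto simp: pos_spectrum_det[OF assms] pos_spectrum_def intro!: prod_pos)

lemma matrix_inv_mult:
  fixes A :: "real ^ 'k::finite ^ 'k"
  assumes "invertible A"
  shows "matrix_inv A ** A = mat 1" "A ** matrix_inv A = mat 1"
    "matrix_inv A *v (A *v x) = x" "A *v (matrix_inv A *v x) = x"
proof -
  have "A ** matrix_inv A = mat 1 \<and> matrix_inv A ** A = mat 1"
    using someI_ex[OF assms[unfolded invertible_def]] by (simp add: matrix_inv_def)
  then show "matrix_inv A ** A = mat 1" "A ** matrix_inv A = mat 1"
    "matrix_inv A *v (A *v x) = x" "A *v (matrix_inv A *v x) = x"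
    by (auto simp: matrix_vector_mul_assoc)
qed

lemma pos_spectrum_invertible:
  fixes A :: "real ^ 'k::finite ^ 'k"
  assumes "pos_spectrum A a"
  shows "invertible A"
  using pos_spectrum_det_pos[OF assms] by (simp add: invertible_det_nz)

lemma transpose_matrix_inv:
  fixes A :: "real ^ 'k::finite ^ 'k"
  assumes "invertible A" "transpose A = A"
  shows "transpose (matrix_inv A) = matrix_inv A"
proof -
  have "transpose (matrix_inv A) ** A = mat 1"
    by (metis assms matrix_inv_mult(2) matrix_transpose_mul transpose_mat)
  then show ?thesis
    by (metis assms(1) matrix_inv_mult(2) matrix_mul_assoc matrix_mul_lid matrix_mul_rid)
qed

lemma matrix_inv_eigenvector:
  fixes A :: "real ^ 'k::finite ^ 'k"
  assumes "invertible A" "A *v x = c *\<^sub>R x" "c \<noteq> 0"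
  shows "matrix_inv A *v x = (1 / c) *\<^sub>R x"
proof -
  have "x = matrix_inv A *v (c *\<^sub>R x)" using matrix_inv_mult(3)[OF assms(1)] assms(2) by metis
  also have "\<dots> = c *\<^sub>R (matrix_inv A *v x)" by (simp add: matrix_vector_mult_scaleR)
  finally have "(1 / c) *\<^sub>R x = (1 / c) *\<^sub>R (c *\<^sub>R (matrix_inv A *v x))" by simp
  then show ?thesis using assms(3) by simp
qed

lemma symmetric_matrix_inner:
  fixes A :: "real ^ 'k::finite ^ 'k"
  assumes "transpose A = A"
  shows "(A *v x) \<bullet> y = x \<bullet> (A *v y)"
  by (metis dot_lmul_matrix assms transpose_matrix_vector vector_transpose_matrix)

lemma pos_spectrum_inv_trace:
  fixes A X :: "real ^ 'k::finite ^ 'k"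
  assumes A: "pos_spectrum A a" and v: "orthonormal_seq v"
    "\<And>i. i \<in> {1..CARD('k)} \<Longrightarrow> A *v v i = a i *\<^sub>R v i"
  shows "trace (matrix_inv A ** X) = (\<Sum>i=1..CARD('k). (1 / a i) * ((X *v v i) \<bullet> v i))"
proof -
  have inv: "invertible A" by (rule pos_spectrum_invertible[OF A])
  have "((matrix_inv A ** X) *v v i) \<bullet> v i = (1 / a i) * ((X *v v i) \<bullet> v i)" if i: "i \<in> {1..CARD('k)}" for i
  proof -
    have "a i \<noteq> 0" using pos_spectrum_pos[OF A i] by simp
    then have "matrix_inv A *v v i = (1 / a i) *\<^sub>R v i"
      by (rule matrix_inv_eigenvector[OF inv v(2)[OF i]])
    moreover have "transpose (matrix_inv A) = matrix_inv A"
      using A by (intro transpose_matrix_inv inv) (simp add: pos_spectrum_def)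
    ultimately show ?thesis
      by (simp add: matrix_vector_mul_assoc[symmetric] symmetric_matrix_inner)
  qed
  then show ?thesis by (simp only: trace_orthonormal_seq[OF v(1)] cong: sum.cong)
qed

lemma pos_spectrum_inv_nonneg:
  fixes A :: "real ^ 'k::finite ^ 'k"
  assumes A: "pos_spectrum A a"
  shows "0 \<le> (matrix_inv A *v x) \<bullet> x"
proof -
  obtain v where v: "orthonormal_seq v" "\<And>i. i \<in> {1..CARD('k)} \<Longrightarrow> A *v v i = a i *\<^sub>R v i"
    using A ordered_eigenvalues_eigenbasis unfolding pos_spectrum_def by metis
  have inv: "invertible A" by (rule pos_spectrum_invertible[OF A])
  have s: "transpose (matrix_inv A) = matrix_inv A"
    using A by (intro transpose_matrix_inv inv) (simp add: pos_spectrum_def)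
  have "(matrix_inv A *v x) \<bullet> x = (\<Sum>i=1..CARD('k). ((matrix_inv A *v x) \<bullet> v i) * (x \<bullet> v i))"
    by (simp only: orthonormal_seq_parseval[OF v(1)])
  also have "\<dots> \<ge> 0"
  proof (intro sum_nonneg)
    fix i assume i: "i \<in> {1..CARD('k)}"
    then have a: "a i > 0" by (rule pos_spectrum_pos[OF A])
    then have "matrix_inv A *v v i = (1 / a i) *\<^sub>R v i"
      by (intro matrix_inv_eigenvector[OF inv v(2)[OF i]]) simp
    then have "(matrix_inv A *v x) \<bullet> v i = (1 / a i) * (x \<bullet> v i)"
      by (simp add: symmetric_matrix_inner[OF s])
    then have "((matrix_inv A *v x) \<bullet> v i) * (x \<bullet> v i) = (1 / a i) * (x \<bullet> v i)\<^sup>2"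
      by (simp add: power2_eq_square)
    then show "0 \<le> ((matrix_inv A *v x) \<bullet> v i) * (x \<bullet> v i)" using a by simp
  qed
  finally show ?thesis .
qed

lemma pos_spectrum_quadratic_nonneg:
  fixes A B X :: "real ^ 'k::finite ^ 'k"
  assumes A: "pos_spectrum A a" and B: "pos_spectrum B b" and X: "transpose X = X"
  shows "0 \<le> trace (X ** matrix_inv A ** X ** matrix_inv B)"
proof -
  obtain u where u: "orthonormal_seq u" "\<And>i. i \<in> {1..CARD('k)} \<Longrightarrow> B *v u i = b i *\<^sub>R u i"
    using B ordered_eigenvalues_eigenbasis unfolding pos_spectrum_def by metis
  have "trace (X ** matrix_inv A ** X ** matrix_inv B) = trace (matrix_inv B ** (X ** matrix_inv A ** X))"
    by (rule trace_mul_sym)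
  also have "\<dots> = (\<Sum>i=1..CARD('k). (1 / b i) * (((X ** matrix_inv A ** X) *v u i) \<bullet> u i))"
    by (rule pos_spectrum_inv_trace[OF B u])
  also have "\<dots> \<ge> 0"
  proof (intro sum_nonneg mult_nonneg_nonneg)
    fix i assume i: "i \<in> {1..CARD('k)}"
    show "0 \<le> 1 / b i" using pos_spectrum_pos[OF B i] by simp
    have "((X ** matrix_inv A ** X) *v u i) \<bullet> u i = (matrix_inv A *v (X *v u i)) \<bullet> (X *v u i)"
      by (simp add: matrix_vector_mul_assoc[symmetric] symmetric_matrix_inner[OF X])
    also have "\<dots> \<ge> 0" by (rule pos_spectrum_inv_nonneg[OF A])
    finally show "0 \<le> ((X ** matrix_inv A ** X) *v u i) \<bullet> u i" .
  qed
  finally show ?thesis .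
qed

text \<open>For eigenbases \<open>v\<close> of \<open>A\<close> and \<open>u\<close> of
  \<open>B\<close> the squares \<open>(v i \<bullet> u j)\<^sup>2\<close> form a doubly stochastic
  matrix, by Parseval's identity in each of the two bases. They express the trace as an average of
  the products \<open>b j / a i\<close>, where \<open>1 / a i\<close> decreases while
  \<open>b j\<close> increases.\<close>

lemma pos_spectrum_trace_ge:
  fixes A B :: "real ^ 'k::finite ^ 'k"
  assumes A: "pos_spectrum A a" and B: "pos_spectrum B b"
  shows "(\<Sum>i=1..CARD('k). b i / a i) \<le> trace (matrix_inv A ** B)"
proof -
  let ?n = "CARD('k)"
  obtain v where v: "orthonormal_seq v" "\<And>i. i \<in> {1..?n} \<Longrightarrow> A *v v i = a i *\<^sub>R v i"
    using A ordered_eigenvalues_eigenbasis unfolding pos_spectrum_def by metis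
  obtain u where u: "orthonormal_seq u" "\<And>i. i \<in> {1..?n} \<Longrightarrow> B *v u i = b i *\<^sub>R u i"
    using B ordered_eigenvalues_eigenbasis unfolding pos_spectrum_def by metis
  have sB: "transpose B = B" using B by (simp add: pos_spectrum_def)
  define P where "P i j = (v i \<bullet> u j)\<^sup>2" for i j
  have Bv: "(B *v v i) \<bullet> v i = (\<Sum>j=1..?n. P i j * b j)" for i
  proof -
    have "(B *v v i) \<bullet> v i = (\<Sum>j=1..?n. ((B *v v i) \<bullet> u j) * (v i \<bullet> u j))"
      by (simp only: orthonormal_seq_parseval[OF u(1)])
    also have "\<dots> = (\<Sum>j=1..?n. P i j * b j)"
      by (intro sum.cong refl)
        (simp add: symmetric_matrix_inner[OF sB] u(2) P_def power2_eq_square del: One_nat_def)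
    finally show ?thesis .
  qed
  have "(\<Sum>i=1..?n. b i * (1 / a i)) \<le> (\<Sum>i=1..?n. \<Sum>j=1..?n. P i j * (b j * (1 / a i)))"
  proof (rule doubly_stochastic_antitone_sum)
    show "(\<Sum>j=1..?n. P i j) = 1" if "i \<in> {1..?n}" for i
      using orthonormal_seq_parseval[OF u(1), of "v i" "v i"] v(1) that
      by (simp add: P_def power2_eq_square orthonormal_seq_def)
    show "(\<Sum>i=1..?n. P i j) = 1" if "j \<in> {1..?n}" for j
      using orthonormal_seq_parseval[OF v(1), of "u j" "u j"] u(1) that
      by (simp add: P_def power2_eq_square orthonormal_seq_def inner_commute)
    show "b i \<le> b j" if "1 \<le> i" "i \<le> j" "j \<le> ?n" for i j
      using B that by (auto simp: pos_spectrum_def ordered_eigenvalues_def)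
    show "1 / a j \<le> 1 / a i" if "1 \<le> i" "i \<le> j" "j \<le> ?n" for i j
      using A that by (auto simp: pos_spectrum_def ordered_eigenvalues_def intro!: divide_left_mono mult_pos_pos)
  qed (simp add: P_def)
  also have "\<dots> = (\<Sum>i=1..?n. (1 / a i) * ((B *v v i) \<bullet> v i))"
    unfolding Bv sum_distrib_left by (intro sum.cong refl) (simp add: mult_ac)
  also have "\<dots> = trace (matrix_inv A ** B)" by (rule pos_spectrum_inv_trace[OF A v, symmetric])
  finally show ?thesis by simp
qed

text \<open>This is \<open>x\<^sup>2 \<le> 2 cosh x - 2\<close> at \<open>x = ln (t / s)\<close>.\<close>

lemma ln_ratio_sq_le:
  assumes "s > 0" "t > (0::real)"
  shows "(ln t - ln s)\<^sup>2 \<le> t / s + s / t - 2"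
proof -
  have "1 + x\<^sup>2 / 2 \<le> cosh x" for x :: real
  proof -
    have "1 + 2 * (x / 2)\<^sup>2 \<le> 1 + 2 * (sinh (x / 2))\<^sup>2"
      using abs_le_square_iff[of "x / 2" "sinh (x / 2)"] real_le_abs_sinh[of "x / 2"]
      by (simp add: sinh_field_def exp_minus)
    then show ?thesis using cosh_double[of "x / 2"] cosh_square_eq[of "x / 2"]
      by (simp add: power_divide)
  qed
  from this[of "ln t - ln s"] show ?thesis
    using assms by (simp add: cosh_def exp_diff exp_minus field_simps)
qed

text \<open>The product on the right expands to the two traces of \<open>matrix_inv A ** B\<close>
  and \<open>matrix_inv B ** A\<close> minus twice the dimension. Written in this form the bound is
  quadratic in \<open>B - A\<close>, as an estimate for squared increments must be.\<close>

lemma pos_spectrum_ln_ratio_le: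
  fixes A B :: "real ^ 'k::finite ^ 'k"
  assumes A: "pos_spectrum A a" and B: "pos_spectrum B b"
  shows "(\<Sum>i=1..CARD('k). (ln (b i) - ln (a i))\<^sup>2) \<le>
    trace ((B - A) ** matrix_inv A ** (B - A) ** matrix_inv B)"
proof -
  let ?n = "CARD('k)"
  have iA: "invertible A" and iB: "invertible B" using A B by (auto intro: pos_spectrum_invertible)
  have "(\<Sum>i=1..?n. (ln (b i) - ln (a i))\<^sup>2) \<le> (\<Sum>i=1..?n. b i / a i + a i / b i - 2)"
    using A B by (intro sum_mono ln_ratio_sq_le) (auto simp: pos_spectrum_def)
  also have "\<dots> = (\<Sum>i=1..?n. b i / a i) + (\<Sum>i=1..?n. a i / b i) - 2 * real ?n"
    by (simp add: sum.distrib sum_subtractf)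
  also have "\<dots> \<le> trace (matrix_inv A ** B) + trace (matrix_inv B ** A) - 2 * real ?n"
    using pos_spectrum_trace_ge[OF A B] pos_spectrum_trace_ge[OF B A] by simp
  also have "\<dots> = trace ((B - A) ** matrix_inv A ** (B - A) ** matrix_inv B)"
  proof -
    have "(B - A) ** matrix_inv A = B ** matrix_inv A - mat 1"
      by (simp add: matrix_diff_rdistrib matrix_inv_mult[OF iA])
    moreover have "(B - A) ** matrix_inv B = mat 1 - A ** matrix_inv B"
      by (simp add: matrix_diff_rdistrib matrix_inv_mult[OF iB])
    ultimately have "(B - A) ** matrix_inv A ** ((B - A) ** matrix_inv B) =
        (B ** matrix_inv A - mat 1) ** (mat 1 - A ** matrix_inv B)" by simp
    also have "\<dots> = B ** matrix_inv A + A ** matrix_inv B - mat 1 - (B ** matrix_inv A) ** (A ** matrix_inv B)"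
      by (simp add: matrix_diff_rdistrib matrix_diff_ldistrib)
    finally have "(B - A) ** matrix_inv A ** ((B - A) ** matrix_inv B) =
      B ** matrix_inv A + A ** matrix_inv B - mat 1 - (B ** matrix_inv A) ** (A ** matrix_inv B)" .
    moreover have "(B ** matrix_inv A) ** (A ** matrix_inv B) = mat 1"
      by (metis iA iB matrix_inv_mult(1,2) matrix_mul_assoc matrix_mul_lid)
    moreover have "trace (2 * mat 1 :: real ^ 'k ^ 'k) = 2 * real ?n" by (simp add: trace_def mat_def)
    ultimately show ?thesis
      by (simp add: matrix_mul_assoc trace_add trace_sub trace_I trace_mul_sym[of B] trace_mul_sym[of A])
  qed
  finally show ?thesis .
qed

text \<open>The tangent inequality of the concave function \<open>ln det\<close> at
  \<open>A\<close>. It follows from \<open>ln x <= x - 1\<close> at the ratios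
  \<open>b j / a j\<close> and the trace inequality.\<close>

lemma pos_spectrum_ln_det_le:
  fixes A B :: "real ^ 'k::finite ^ 'k"
  assumes A: "pos_spectrum A a" and B: "pos_spectrum B b"
  shows "ln (det B) - ln (det A) \<le> trace (matrix_inv A ** (B - A))"
proof -
  let ?n = "CARD('k)"
  have pos: "a j > 0" "b j > 0" if "j \<in> {1..?n}" for j using A B that by (auto simp: pos_spectrum_def)
  have "ln (det B) - ln (det A) = (\<Sum>j=1..?n. ln (b j / a j))"
    unfolding pos_spectrum_det[OF A] pos_spectrum_det[OF B]
    using pos by (subst (1 2) ln_prod) (auto simp: ln_div sum_subtractf less_imp_neq[symmetric])
  also have "\<dots> \<le> (\<Sum>j=1..?n. b j / a j - 1)"
    using pos by (intro sum_mono ln_le_minus_one divide_pos_pos) auto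
  also have "\<dots> \<le> trace (matrix_inv A ** B) - real ?n"
    using pos_spectrum_trace_ge[OF A B] by (simp add: sum_subtractf)
  also have "\<dots> = trace (matrix_inv A ** (B - A))"
    by (simp add: matrix_diff_ldistrib trace_sub matrix_inv_mult[OF pos_spectrum_invertible[OF A]] trace_I)
  finally show ?thesis .
qed

section \<open>Smooth cut-off functions\<close>

text \<open>Replaces the choice operator \<open>frechet_derivative\<close> in the recursion of
  \<open>Ck_on\<close> by any explicitly given derivative.\<close>

lemma Ck_on_SucI:
  assumes "\<And>x. (f has_derivative f' x) (at x)" "\<And>v. Ck_on n UNIV (\<lambda>x. f' x v)"
  shows "Ck_on (Suc n) UNIV f"
proof -
  have "frechet_derivative f (at x) = f' x" for x
    using frechet_derivative_at[OF assms(1)] by simp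
  then show ?thesis
    using assms by (auto simp: differentiable_on_def differentiable_def intro: has_derivative_at_withinI)
qed

lemma Ck_on_SucD:
  assumes "Ck_on (Suc n) UNIV f"
  shows "(f has_derivative frechet_derivative f (at x)) (at x)"
    "Ck_on n UNIV (\<lambda>x. frechet_derivative f (at x) v)"
  using assms by (auto simp: differentiable_on_def frechet_derivative_works)

lemma Ck_on_Suc_le: "Ck_on (Suc n) UNIV f \<Longrightarrow> Ck_on n UNIV f"
proof (induction n arbitrary: f)
  case 0
  then show ?case by (auto intro: differentiable_imp_continuous_on)
next
  case (Suc n)
  show ?case
    by (rule Ck_on_SucI[of f "\<lambda>x. frechet_derivative f (at x)"]) (use Ck_on_SucD[OF Suc.prems] Suc.IH in blast)+
qed

lemma Ck_on_const: "Ck_on n UNIV (\<lambda>x. c)"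
proof (induction n arbitrary: c)
  case (Suc n)
  show ?case by (rule Ck_on_SucI[of _ "\<lambda>x v. 0"]) (use Suc in auto)
qed auto

lemma Ck_on_add: "Ck_on n UNIV f \<Longrightarrow> Ck_on n UNIV g \<Longrightarrow> Ck_on n UNIV (\<lambda>x. f x + g x)"
proof (induction n arbitrary: f g)
  case (Suc n)
  note f = Ck_on_SucD[OF Suc.prems(1)] and g = Ck_on_SucD[OF Suc.prems(2)]
  show ?case
    by (rule Ck_on_SucI[OF has_derivative_add[OF f(1) g(1)]]) (intro Suc.IH f g)
qed (auto intro: continuous_intros)

lemma Ck_on_mult:
  fixes f g :: "'a::real_normed_vector \<Rightarrow> real"
  shows "Ck_on n UNIV f \<Longrightarrow> Ck_on n UNIV g \<Longrightarrow> Ck_on n UNIV (\<lambda>x. f x * g x)"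
proof (induction n arbitrary: f g)
  case (Suc n)
  note f = Ck_on_SucD[OF Suc.prems(1)] and g = Ck_on_SucD[OF Suc.prems(2)]
  show ?case
    by (rule Ck_on_SucI[OF has_derivative_mult[OF f(1) g(1)]])
      (rule Ck_on_add[OF Suc.IH[OF Ck_on_Suc_le[OF Suc.prems(1)] g(2)] Suc.IH[OF f(2) Ck_on_Suc_le[OF Suc.prems(2)]]])
qed (auto intro: continuous_intros)

lemma Ck_on_prod:
  fixes f :: "'i \<Rightarrow> 'a::real_normed_vector \<Rightarrow> real"
  assumes "\<And>i. i \<in> I \<Longrightarrow> Ck_on n UNIV (f i)"
  shows "Ck_on n UNIV (\<lambda>x. \<Prod>i\<in>I. f i x)"
  using assms by (induction I rule: infinite_finite_induct) (auto intro: Ck_on_mult Ck_on_const)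

text \<open>The cut-off functions below are products of functions of a single affine coordinate, so
  this case of the chain rule suffices for them.\<close>

lemma Ck_on_compose_affine:
  fixes h :: "real \<Rightarrow> real" and b :: "'a::real_inner"
  shows "Ck_on n UNIV h \<Longrightarrow> Ck_on n UNIV (\<lambda>x. h (c * (x \<bullet> b) + d))"
proof (induction n arbitrary: h)
  case 0
  then show ?case by (auto intro!: continuous_intros continuous_on_compose2[of UNIV h])
next
  case (Suc n)
  note h = Ck_on_SucD[OF Suc.prems(1)]
  have "((\<lambda>x. c * (x \<bullet> b) + d) has_derivative (\<lambda>v. c * (v \<bullet> b))) (at x)" for x :: 'a
    by (auto intro!: derivative_eq_intros)
  from has_derivative_compose[OF this h(1)] show ?case
    by (rule Ck_on_SucI) (intro Suc.IH h)
qed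

text \<open>The power makes the family closed under differentiation: the derivative of member
  \<open>m\<close> is a combination of the members \<open>m + 2\<close> and \<open>m + 1\<close>.
  One induction over the order of differentiability, with \<open>m\<close> arbitrary, then gives
  smoothness.\<close>

definition flat_fun :: "nat \<Rightarrow> real \<Rightarrow> real" where
  "flat_fun m x = (if x > 0 then (1 / x) ^ m * exp (- (1 / x)) else 0)"

lemma flat_fun_tendsto_0: "(flat_fun m \<longlongrightarrow> 0) (at_right 0)"
proof -
  have "((\<lambda>x. x ^ m / exp x) \<longlongrightarrow> (0::real)) at_top" by (rule tendsto_power_div_exp_0)
  from filterlim_compose[OF this filterlim_inverse_at_top_right]
  have "((\<lambda>x. inverse x ^ m / exp (inverse x)) \<longlongrightarrow> (0::real)) (at_right 0)" .
  moreover have "\<forall>\<^sub>F x in at_right 0. inverse x ^ m / exp (inverse x) = flat_fun m x"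
    using eventually_at_right_less[of "0::real"]
    by eventually_elim (auto simp: flat_fun_def exp_minus field_simps)
  ultimately show ?thesis by (rule Lim_transform_eventually)
qed

lemma flat_fun_deriv:
  "(flat_fun m has_real_derivative (flat_fun (m + 2) x - real m * flat_fun (m + 1) x)) (at x)"
proof (cases x "0::real" rule: linorder_cases)
  case less
  have "((\<lambda>x. 0) has_real_derivative (flat_fun (m + 2) x - real m * flat_fun (m + 1) x)) (at x)"
    using less by (auto simp: flat_fun_def)
  then show ?thesis
    by (rule has_field_derivative_transform_within_open[of _ _ _ "{..<0}"]) (use less in \<open>auto simp: flat_fun_def\<close>)
next
  case greater
  have "((\<lambda>x. 1 / x) has_real_derivative - ((1 / x) ^ 2)) (at x)"
    using greater by (auto intro!: derivative_eq_intros simp: power2_eq_square)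
  note inv = this DERIV_power[OF this, of m]
  have pow: "real m * (- ((1 / x) ^ 2) * (1 / x) ^ (m - Suc 0)) = - (real m * (1 / x) ^ (m + 1))"
    by (cases m) (simp_all add: power2_eq_square)
  have "((\<lambda>x. (1 / x) ^ m * exp (- (1 / x))) has_real_derivative
      - (real m * (1 / x) ^ (m + 1)) * exp (- (1 / x)) + exp (- (1 / x)) * (1 / x) ^ 2 * (1 / x) ^ m) (at x)"
    using DERIV_mult[OF inv(2)[unfolded pow] DERIV_fun_exp[OF DERIV_minus[OF inv(1)]]] by simp
  moreover have "- (real m * (1 / x) ^ (m + 1)) * exp (- (1 / x)) + exp (- (1 / x)) * (1 / x) ^ 2 * (1 / x) ^ m =
      flat_fun (m + 2) x - real m * flat_fun (m + 1) x"
    using greater by (simp add: flat_fun_def power2_eq_square mult_ac)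
  ultimately have "((\<lambda>x. (1 / x) ^ m * exp (- (1 / x))) has_real_derivative
      (flat_fun (m + 2) x - real m * flat_fun (m + 1) x)) (at x)" by simp
  then show ?thesis
    by (rule has_field_derivative_transform_within_open[of _ _ _ "{0<..}"]) (use greater in \<open>auto simp: flat_fun_def\<close>)
next
  case equal
  \<comment> \<open>The difference quotient at 0: zero on the left, and on the right the next member
    of the family, which tends to 0.\<close>
  have "((\<lambda>y. flat_fun m y / y) \<longlongrightarrow> 0) (at 0)"
  proof (rule filterlim_split_at_real)
    have "\<forall>\<^sub>F y in at_left 0. 0 = flat_fun m y / y"
      using eventually_at_left_real[of "-1" "0::real"] by (auto simp: flat_fun_def elim: eventually_mono)
    then show "((\<lambda>y. flat_fun m y / y) \<longlongrightarrow> 0) (at_left 0)"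
      by (rule Lim_transform_eventually[OF tendsto_const])
    have "\<forall>\<^sub>F y in at_right 0. flat_fun (m + 1) y = flat_fun m y / y"
      using eventually_at_right_less[of "0::real"] by eventually_elim (auto simp: flat_fun_def)
    then show "((\<lambda>y. flat_fun m y / y) \<longlongrightarrow> 0) (at_right 0)"
      by (rule Lim_transform_eventually[OF flat_fun_tendsto_0])
  qed
  then show ?thesis using equal by (simp add: has_field_derivative_iff flat_fun_def)
qed

lemma Ck_on_flat_fun: "Ck_on n UNIV (flat_fun m)"
proof (induction n arbitrary: m)
  case 0
  show ?case using DERIV_isCont[OF flat_fun_deriv] by (simp add: continuous_at_imp_continuous_on)
next
  case (Suc n)
  show ?case
    by (rule Ck_on_SucI[OF flat_fun_deriv[unfolded has_field_derivative_def]])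
      (use Ck_on_add[OF Suc.IH Ck_on_mult[OF Ck_on_const Suc.IH], of "m + 2" "- real m" "m + 1"]
        in \<open>auto intro!: Ck_on_mult Ck_on_const\<close>)
qed

text \<open>\<open>\<psi>\<close> is the normalized antiderivative of a bump supported in the unit
  interval. Its derivative \<open>\<psi>'\<close> is exported too, because it later serves as the
  kernel of a mollifier.\<close>

lemma smooth_step:
  obtains \<psi> \<psi>' :: "real \<Rightarrow> real" where "smooth_on UNIV \<psi>"
    "\<And>x. x \<le> 0 \<Longrightarrow> \<psi> x = 0" "\<And>x. x \<ge> 1 \<Longrightarrow> \<psi> x = 1" "\<And>x. 0 \<le> \<psi> x" "\<And>x. \<psi> x \<le> 1"
    "\<And>x. (\<psi> has_real_derivative \<psi>' x) (at x)" "continuous_on UNIV \<psi>'"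
    "\<And>x. x \<notin> {0..1} \<Longrightarrow> \<psi>' x = 0" "\<And>x. 0 \<le> \<psi>' x"
proof -
  define \<beta> where "\<beta> x = flat_fun 0 x * flat_fun 0 (1 - x)" for x
  have C\<beta>: "Ck_on n UNIV \<beta>" for n
    using Ck_on_mult[OF Ck_on_flat_fun Ck_on_compose_affine[OF Ck_on_flat_fun, where b="1::real" and c="-1" and d=1], of n 0 0]
    by (simp add: \<beta>_def[abs_def])
  have cont: "continuous_on UNIV \<beta>" using C\<beta>[of 0] by simp
  obtain B where B: "\<And>x. (B has_real_derivative \<beta> x) (at x)"
    using einterval_antiderivative[of "-\<infinity>" "\<infinity>" \<beta>] cont
    by (auto simp: continuous_on_eq_continuous_at has_real_derivative_iff_has_vector_derivative)
  have \<beta>0: "\<beta> x = 0" if "x \<notin> {0<..<1}" for x using that by (auto simp: \<beta>_def flat_fun_def)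
  have \<beta>pos: "\<beta> x > 0" if "x \<in> {0<..<1}" for x using that by (auto simp: \<beta>_def flat_fun_def)
  have \<beta>nn: "\<beta> x \<ge> 0" for x using \<beta>0[of x] \<beta>pos[of x] by fastforce
  have mono: "B x \<le> B y" if "x \<le> y" for x y
    by (rule DERIV_nonneg_imp_nondecreasing[OF that]) (use B \<beta>nn in blast)
  have le: "B y \<le> B x" if "x \<le> y" "\<And>z. x \<le> z \<Longrightarrow> z \<le> y \<Longrightarrow> \<beta> z = 0" for x y
    by (rule DERIV_nonpos_imp_nonincreasing[OF that(1)]) (use B that(2) in force)
  have Bl: "B x = B 0" if "x \<le> 0" for x
    using mono[OF that] le[OF that] \<beta>0 by force
  have Br: "B x = B 1" if "x \<ge> 1" for x
    using mono[OF that] le[OF that] \<beta>0 by force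
  have B01: "B 0 < B 1"
    by (rule DERIV_pos_imp_increasing_open[of 0 1 B]) (use B \<beta>pos in \<open>auto intro!: DERIV_continuous_on continuous_at_imp_continuous_on DERIV_isCont\<close>)
  define c where "c = B 1 - B 0"
  have c: "c > 0" using B01 by (simp add: c_def)
  define \<psi> where "\<psi> x = (B x - B 0) / c" for x
  have der: "(\<psi> has_real_derivative \<beta> x / c) (at x)" for x
    unfolding \<psi>_def[abs_def] using c by (auto intro!: derivative_eq_intros B)
  have cont': "Ck_on n UNIV (\<lambda>x. \<beta> x / c)" for n
    using Ck_on_mult[OF C\<beta> Ck_on_const[of n "1 / c"]] by simp
  show thesis
  proof (rule that[of \<psi> "\<lambda>x. \<beta> x / c"])
    show "smooth_on UNIV \<psi>" unfolding smooth_on_def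
    proof
      fix n show "Ck_on n UNIV \<psi>"
      proof (cases n)
        case 0 then show ?thesis using DERIV_isCont[OF der] by (simp add: continuous_at_imp_continuous_on)
      next
        case (Suc k)
        show ?thesis unfolding Suc
          by (rule Ck_on_SucI[OF der[unfolded has_field_derivative_def]]) (intro Ck_on_mult Ck_on_const cont')
      qed
    qed
    show "continuous_on UNIV (\<lambda>x. \<beta> x / c)" using cont'[of 0] by simp
    show "0 \<le> \<psi> x" for x using mono[of 0 x] Bl[of x] c by (cases "x \<le> 0") (auto simp: \<psi>_def)
    show "\<psi> x \<le> 1" for x using mono[of x 1] Br[of x] c by (cases "x \<le> 1") (auto simp: \<psi>_def c_def)
    show "\<psi> x = 0" if "x \<le> 0" for x using Bl[OF that] by (simp add: \<psi>_def)
    show "\<psi> x = 1" if "x \<ge> 1" for x using Br[OF that] c by (simp add: \<psi>_def c_def)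
    show "(\<psi> has_real_derivative \<beta> x / c) (at x)" for x by (rule der)
    show "\<beta> x / c = 0" if "x \<notin> {0..1}" for x
    proof -
      have "x \<notin> {0<..<1}" using that by auto
      then show ?thesis using \<beta>0 by simp
    qed
    show "0 \<le> \<beta> x / c" for x using \<beta>nn[of x] c by simp
  qed
qed

text \<open>In every coordinate two steps of width 1/n are placed inside the box, one at each face.
  Hence the functions vanish outside the open box, and their limit is its indicator at every point,
  not only almost everywhere.\<close>

lemma box_test_funs:
  fixes a b :: "'a::euclidean_space"
  obtains \<phi> :: "nat \<Rightarrow> 'a \<Rightarrow> real" where "\<And>n. smooth_on UNIV (\<phi> n)"
    "\<And>n x. 0 \<le> \<phi> n x" "\<And>n x. \<phi> n x \<le> 1" "\<And>n x. x \<notin> box a b \<Longrightarrow> \<phi> n x = 0"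
    "\<And>x. (\<lambda>n. \<phi> n x) \<longlonglongrightarrow> indicator (box a b) x"
proof -
  obtain \<psi> \<psi>' :: "real \<Rightarrow> real" where \<psi>: "smooth_on UNIV \<psi>"
    "\<And>x. x \<le> 0 \<Longrightarrow> \<psi> x = 0" "\<And>x. x \<ge> 1 \<Longrightarrow> \<psi> x = 1" "\<And>x. 0 \<le> \<psi> x" "\<And>x. \<psi> x \<le> 1"
    using smooth_step by metis
  define \<phi> where "\<phi> n x = (\<Prod>i\<in>Basis. \<psi> (real n * (x \<bullet> i - a \<bullet> i)) * \<psi> (real n * (b \<bullet> i - x \<bullet> i)))"
    for n :: nat and x :: 'a
  have 0: "\<phi> n x = 0" if "x \<notin> box a b" for n x
  proof -
    obtain i where i: "i \<in> Basis" "x \<bullet> i \<le> a \<bullet> i \<or> b \<bullet> i \<le> x \<bullet> i"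
      using \<open>x \<notin> box a b\<close> by (auto simp: mem_box not_less)
    then have "\<psi> (real n * (x \<bullet> i - a \<bullet> i)) * \<psi> (real n * (b \<bullet> i - x \<bullet> i)) = 0"
      using \<psi>(2) by (auto simp: mult_nonneg_nonpos)
    with i(1) show ?thesis unfolding \<phi>_def by (meson finite_Basis prod_zero)
  qed
  show thesis
  proof (rule that[of \<phi>])
    show "smooth_on UNIV (\<phi> n)" for n
    proof -
      have "Ck_on m UNIV (\<lambda>x. \<psi> (real n * (x \<bullet> i - a \<bullet> i)))" for m and i :: 'a
        using Ck_on_compose_affine[of m \<psi> "real n" i "- (real n * (a \<bullet> i))"] \<psi>(1)
        by (simp add: smooth_on_def right_diff_distrib)
      moreover have "Ck_on m UNIV (\<lambda>x. \<psi> (real n * (b \<bullet> i - x \<bullet> i)))" for m and i :: 'a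
        using Ck_on_compose_affine[of m \<psi> "- real n" i "real n * (b \<bullet> i)"] \<psi>(1)
        by (simp add: smooth_on_def right_diff_distrib)
      ultimately show ?thesis unfolding smooth_on_def \<phi>_def by (intro allI Ck_on_prod Ck_on_mult)
    qed
    show "0 \<le> \<phi> n x" "\<phi> n x \<le> 1" for n x
      unfolding \<phi>_def using \<psi>(4,5) by (auto intro!: prod_nonneg prod_le_1 mult_le_one)
    show "(\<lambda>n. \<phi> n x) \<longlonglongrightarrow> indicator (box a b) x" for x
    proof (cases "x \<in> box a b")
      case True
      have "(\<lambda>n. \<psi> (real n * (x \<bullet> i - a \<bullet> i)) * \<psi> (real n * (b \<bullet> i - x \<bullet> i))) \<longlonglongrightarrow> 1" if "i \<in> Basis" for i
      proof (rule tendsto_eventually)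
        have ev: "\<forall>\<^sub>F n in sequentially. real n * d \<ge> 1" if "d > 0" for d
          using eventually_ge_at_top[of "nat \<lceil>1 / d\<rceil>"]
          by eventually_elim (use that in \<open>simp add: nat_le_iff ceiling_le_iff divide_le_eq\<close>)
        show "\<forall>\<^sub>F n in sequentially. \<psi> (real n * (x \<bullet> i - a \<bullet> i)) * \<psi> (real n * (b \<bullet> i - x \<bullet> i)) = 1"
          using ev[of "x \<bullet> i - a \<bullet> i"] ev[of "b \<bullet> i - x \<bullet> i"] True that
          by (auto simp: mem_box \<psi>(3) elim: eventually_elim2)
      qed
      from tendsto_prod[OF this] show ?thesis using True by (simp add: \<phi>_def)
    qed (simp add: 0)
  qed (use 0 in auto)
qed

section \<open>Locally absolutely continuous functions on the half-line\<close>

definition L1_loc :: "'e::euclidean_space set \<Rightarrow> ('e \<Rightarrow> 'b::euclidean_space) \<Rightarrow> bool" where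
  "L1_loc U f \<longleftrightarrow> set_borel_measurable lborel U f \<and> (\<forall>K. compact K \<and> K \<subseteq> U \<longrightarrow> set_integrable lborel K f)"

text \<open>A Dynkin argument for a density \<open>f\<close> of arbitrary sign, which need not
  define a measure of its own. The equality on the whole space is a separate hypothesis because the
  step to complements uses it.\<close>

lemma dynkin_set_integral:
  fixes f :: "'a::euclidean_space \<Rightarrow> real"
  assumes \<nu>: "finite_measure \<nu>" "sets \<nu> = sets borel" and f: "integrable lborel f"
    and G: "Int_stable G" "sets borel = sigma_sets UNIV G"
    and eq: "\<And>A. A \<in> G \<Longrightarrow> measure \<nu> A = (LINT x:A|lborel. f x)"
    and top: "measure \<nu> UNIV = (LINT x|lborel. f x)" and A: "A \<in> sets borel"
  shows "measure \<nu> A = (LINT x:A|lborel. f x)"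
proof -
  interpret finite_measure \<nu> by fact
  have sp: "space \<nu> = UNIV" using \<nu>(2) by (metis sets_eq_imp_space_eq space_borel)
  have si: "set_integrable lborel A f" if "A \<in> sets borel" for A
    using f that unfolding set_integrable_def by (intro integrable_mult_indicator) auto
  have "G \<subseteq> Pow UNIV" "A \<in> sigma_sets UNIV G" using A G(2) by auto
  with G(1) show ?thesis
  proof (induction rule: sigma_sets_induct_disjoint)
    case (compl A)
    then have A: "A \<in> sets borel" using G(2) by simp
    have "(LINT x:A \<union> (UNIV - A)|lborel. f x) = (LINT x:A|lborel. f x) + (LINT x:UNIV - A|lborel. f x)"
      using A by (intro set_integral_Un si) auto
    moreover have "A \<union> (UNIV - A) = UNIV" by auto
    ultimately show ?case using finite_measure_compl[of A] A \<nu>(2) sp compl top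
      by (simp add: set_lebesgue_integral_def)
  next
    case (union A)
    then have A: "A i \<in> sets borel" for i using G(2) by auto
    have "(\<lambda>i. measure \<nu> (A i)) sums measure \<nu> (\<Union>i. A i)"
      using A \<nu>(2) union by (intro finite_measure_UNION) auto
    moreover have "(LINT x:(\<Union>i. A i)|lborel. f x) = (\<Sum>i. LINT x:A i|lborel. f x)"
      using A union by (intro lebesgue_integral_countable_add si) (auto simp: disjoint_family_on_def)
    ultimately show ?case using union by (simp add: sums_iff)
  qed (use eq in \<open>auto simp: set_lebesgue_integral_def\<close>)
qed

lemma AE_zero_if_box_integrals_zero:
  fixes f :: "'a::euclidean_space \<Rightarrow> real"
  assumes f: "integrable lborel f" and box: "\<And>a b. (LINT x:box a b|lborel. f x) = 0"
  shows "AE x in lborel. f x = 0"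
proof (rule sigma_finite_measure.density_unique_banach[OF sigma_finite_lborel, of f "\<lambda>x. 0"])
  fix A assume A: "A \<in> sets (lborel :: 'a measure)"
  have "(\<lambda>i. LINT x:box (- (real i *\<^sub>R One)) (real i *\<^sub>R One)|lborel. f x)
      \<longlonglongrightarrow> (LINT x:(\<Union>i. box (- (real i *\<^sub>R One)) (real i *\<^sub>R One))|lborel. f x)"
  proof (intro set_integral_cont_up)
    show "incseq (\<lambda>i. box (- (real i *\<^sub>R One)) (real i *\<^sub>R One) :: 'a set)"
      by (auto simp: incseq_def intro!: subset_box_imp)
  qed (use f in \<open>simp_all add: set_integrable_def UN_box_eq_UNIV\<close>)
  from this[unfolded box UN_box_eq_UNIV] have top: "(LINT x|lborel. f x) = 0"
    by (simp add: LIMSEQ_const_iff set_lebesgue_integral_def)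
  \<comment> \<open>The comparison measure is identically 0, and the open boxes generate the Borel
    sets.\<close>
  have "measure (null_measure lborel) A = (LINT x:A|lborel. f x)"
  proof (rule dynkin_set_integral[of _ f "range (\<lambda>(a, b). box a b)"])
    show "finite_measure (null_measure (lborel :: 'a measure))" by (rule finite_measureI) auto
    show "Int_stable (range (\<lambda>(a, b). box a b :: 'a set))"
      by (auto simp: Int_stable_def box_Int_box)
    show "sets borel = sigma_sets UNIV (range (\<lambda>(a, b). box a b :: 'a set))"
      by (subst borel_eq_box) (simp add: sets_measure_of)
  qed (use f box top A in auto)
  then show "(LINT x:A|lborel. f x) = (LINT x:A|lborel. 0)" by simp
qed (use f in auto)

text \<open>On a closed box inside \<open>U\<close>, test functions converge boundedly to the
  indicator of any open subbox, so that all integrals over subboxes vanish. Countably many closed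
  boxes exhaust \<open>U\<close>.\<close>

lemma fundamental_lemma_variations:
  fixes f :: "'a::euclidean_space \<Rightarrow> real"
  assumes U: "open U" and f: "L1_loc U f"
    and test: "\<And>\<phi>. test_fun U \<phi> \<Longrightarrow> (LINT x:U|lborel. f x * \<phi> x) = 0"
  shows "AE x in lborel. x \<in> U \<longrightarrow> f x = 0"
proof -
  have "AE x in lborel. x \<in> cbox a b \<longrightarrow> f x = 0" if ab: "cbox a b \<subseteq> U" for a b
  proof -
    have int: "set_integrable lborel (cbox a b) f" using f ab by (auto simp: L1_loc_def)
    then have int': "set_integrable lborel (box c d) f" if "box c d \<subseteq> cbox a b" for c d
      by (rule set_integrable_subset) (use that in auto)
    define h where "h x = indicator (cbox a b) x * f x" for x
    have zero: "(LINT x:box c d|lborel. f x) = 0" if cd: "box c d \<subseteq> cbox a b" for c d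
    proof -
      obtain \<phi> :: "nat \<Rightarrow> 'a \<Rightarrow> real" where \<phi>: "\<And>n. smooth_on UNIV (\<phi> n)"
        "\<And>n x. 0 \<le> \<phi> n x" "\<And>n x. \<phi> n x \<le> 1" "\<And>n x. x \<notin> box c d \<Longrightarrow> \<phi> n x = 0"
        "\<And>x. (\<lambda>n. \<phi> n x) \<longlonglongrightarrow> indicator (box c d) x"
        using box_test_funs by metis
      have tf: "test_fun U (\<phi> n)" for n
        unfolding test_fun_def
      proof (intro conjI exI[of _ "closure (box c d)"])
        show "closure (box c d) \<subseteq> U" using closure_minimal[OF cd] ab by auto
        show "compact (closure (box c d))" by simp
        show "\<forall>x. x \<notin> closure (box c d) \<longrightarrow> \<phi> n x = 0"
          using \<phi>(4) closure_subset[of "box c d"] by blast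
      qed (use \<phi> in auto)
      have m: "\<phi> n \<in> borel_measurable borel" for n
      proof (rule borel_measurable_continuous_onI)
        have "Ck_on 0 UNIV (\<phi> n)" using \<phi>(1)[of n] unfolding smooth_on_def by blast
        then show "continuous_on UNIV (\<phi> n)" by simp
      qed
      have cdU: "box c d \<subseteq> U" using cd ab by auto
      have "(\<lambda>n. LINT x|lborel. \<phi> n x *\<^sub>R (indicator (box c d) x *\<^sub>R f x)) \<longlonglongrightarrow>
          (LINT x|lborel. indicator (box c d) x *\<^sub>R f x)"
      proof (rule integral_dominated_convergence)
        show "integrable lborel (\<lambda>x. norm (indicator (box c d) x *\<^sub>R f x))"
          using int'[OF cd] unfolding set_integrable_def by (rule integrable_norm)
        show "(\<lambda>x. indicator (box c d) x *\<^sub>R f x) \<in> borel_measurable lborel"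
          using int'[OF cd] unfolding set_integrable_def by (rule borel_measurable_integrable)
        then show "(\<lambda>x. \<phi> n x *\<^sub>R (indicator (box c d) x *\<^sub>R f x)) \<in> borel_measurable lborel" for n
          using m[of n] by measurable
        show "AE x in lborel. (\<lambda>n. \<phi> n x *\<^sub>R (indicator (box c d) x *\<^sub>R f x)) \<longlonglongrightarrow> indicator (box c d) x *\<^sub>R f x"
        proof (intro AE_I2)
          fix x
          show "(\<lambda>n. \<phi> n x *\<^sub>R (indicator (box c d) x *\<^sub>R f x)) \<longlonglongrightarrow> indicator (box c d) x *\<^sub>R f x"
            using tendsto_scaleR[OF \<phi>(5)[of x] tendsto_const[of "indicator (box c d) x *\<^sub>R f x"]]
            by (simp split: split_indicator_asm split_indicator)
        qed
        show "AE x in lborel. norm (\<phi> n x *\<^sub>R (indicator (box c d) x *\<^sub>R f x)) \<le> norm (indicator (box c d) x *\<^sub>R f x)" for n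
          using \<phi>(2,3) by (intro AE_I2) (auto simp: abs_mult intro!: mult_left_le_one_le)
      qed
      moreover have "(LINT x|lborel. \<phi> n x *\<^sub>R (indicator (box c d) x *\<^sub>R f x)) = 0" for n
      proof -
        have "\<phi> n x *\<^sub>R (indicator (box c d) x *\<^sub>R f x) = indicator U x *\<^sub>R (f x * \<phi> n x)" for x
          using \<phi>(4)[of x n] cdU by (auto split: split_indicator)
        then have "(LINT x|lborel. \<phi> n x *\<^sub>R (indicator (box c d) x *\<^sub>R f x)) =
            (LINT x|lborel. indicator U x *\<^sub>R (f x * \<phi> n x))"
          by (intro Bochner_Integration.integral_cong refl)
        then show ?thesis using test[OF tf] by (simp only: set_lebesgue_integral_def)
      qed
      ultimately show ?thesis by (simp add: LIMSEQ_const_iff set_lebesgue_integral_def)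
    qed
    have "AE x in lborel. h x = 0"
    proof (rule AE_zero_if_box_integrals_zero)
      show "integrable lborel h" using int by (simp add: set_integrable_def h_def[abs_def])
      fix c d :: 'a
      \<comment> \<open>The intersection of two open boxes is an open box, and the closed box
        differs from its interior by a null set.\<close>
      obtain e g where eg: "box c d \<inter> box a b = box e g" by (rule that[OF box_Int_box])
      have "cbox a b - box a b \<in> null_sets lborel"
        using negligible_frontier_interval[of a b]
        by (simp add: negligible_iff_null_sets null_sets_completion_iff)
      then have "AE x in lborel. x \<notin> cbox a b - box a b" by (rule AE_not_in)
      then have "AE x in lborel. indicator (box c d) x *\<^sub>R h x = indicator (box e g) x *\<^sub>R f x"
      proof eventually_elim
        case (elim x)
        then have "x \<in> box c d \<and> x \<in> cbox a b \<longleftrightarrow> x \<in> box e g" using eg box_subset_cbox[of a b] by blast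
        then show ?case by (auto simp: h_def indicator_def)
      qed
      then have "(LINT x:box c d|lborel. h x) = (LINT x:box e g|lborel. f x)"
        unfolding set_lebesgue_integral_def
      proof (rule integral_cong_AE[rotated 2])
        show "(\<lambda>x. indicator (box c d) x *\<^sub>R h x) \<in> borel_measurable lborel"
          using borel_measurable_integrable[OF \<open>integrable lborel h\<close>] by measurable
        show "(\<lambda>x. indicator (box e g) x *\<^sub>R f x) \<in> borel_measurable lborel"
          using int'[of e g] eg box_subset_cbox[of a b] unfolding set_integrable_def
          by (intro borel_measurable_integrable) auto
      qed
      also have "\<dots> = 0" using eg box_subset_cbox[of a b] by (intro zero) auto
      finally show "(LINT x:box c d|lborel. h x) = 0" .
    qed
    then show ?thesis by eventually_elim (auto simp: h_def)
  qed
  note cb = this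
  obtain D where D: "countable D" "D \<subseteq> Pow U" "\<And>X. X \<in> D \<Longrightarrow> \<exists>a b. X = cbox a b" "\<Union>D = U"
    using open_countable_Union_open_cbox[OF U] by metis
  have "AE x in lborel. \<forall>X\<in>D. x \<in> X \<longrightarrow> f x = 0"
    using D cb by (subst AE_ball_countable) (auto, metis PowD subsetD)
  then show ?thesis using D(4) by (auto elim: eventually_mono)
qed

text \<open>Local absolute continuity on the open half-line in integral form, with \<open>d\<close>
  a derivative determined up to null sets. Nothing is said about pointwise derivatives or about
  nonpositive arguments.\<close>

definition ac_deriv :: "(real \<Rightarrow> 'b::euclidean_space) \<Rightarrow> (real \<Rightarrow> 'b) \<Rightarrow> bool" where
  "ac_deriv u d \<longleftrightarrow> (\<forall>s t. 0 < s \<and> s \<le> t \<longrightarrow>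
     set_integrable lborel {s..t} d \<and> u t - u s = (LINT x:{s..t}|lborel. d x))"

lemma ac_derivD:
  assumes "ac_deriv u d" "0 < s" "s \<le> t"
  shows "set_integrable lborel {s..t} d" "u t - u s = (LINT x:{s..t}|lborel. d x)"
  using assms by (auto simp: ac_deriv_def)

lemma ac_deriv_continuous:
  assumes "ac_deriv u d"
  shows "continuous_on {0<..} u"
proof -
  have "isCont u x" if x: "x > 0" for x
  proof -
    have "continuous_on {x/2..2*x} (\<lambda>t. u (x/2) + integral {x/2..t} d)"
      by (intro continuous_intros indefinite_integral_continuous_1 set_borel_integral_eq_integral(1)
          ac_derivD(1)[OF assms]) (use x in auto)
    moreover have "u t = u (x/2) + integral {x/2..t} d" if "t \<in> {x/2..2*x}" for t
      using ac_derivD[OF assms, of "x/2" t] that x set_borel_integral_eq_integral(2)[of "{x/2..t}" d]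
      by (auto simp: diff_eq_eq add.commute)
    ultimately have "continuous_on {x/2..2*x} u" by (metis (no_types, lifting) continuous_on_cong)
    then show ?thesis by (rule continuous_on_interior) (use x in auto)
  qed
  then show ?thesis by (simp add: continuous_at_imp_continuous_on)
qed

lemma AE_pos_if_AE_intervals:
  assumes "\<And>a b :: real. 0 < a \<Longrightarrow> a \<le> b \<Longrightarrow> AE x in lborel. x \<in> {a..b} \<longrightarrow> P x"
  shows "AE x in lborel. 0 < x \<longrightarrow> P x"
proof -
  have "AE x in lborel. \<forall>n::nat. x \<in> {1 / real (Suc n)..real (Suc n)} \<longrightarrow> P x"
    unfolding AE_all_countable by (intro allI assms) (auto simp: field_simps)
  then show ?thesis
  proof eventually_elim
    case (elim x)
    show ?case
    proof
      assume x: "0 < x"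
      obtain n where "max x (1 / x) < real n" using reals_Archimedean2 by blast
      then have "x \<in> {1 / real (Suc n)..real (Suc n)}" using x by (auto simp: field_simps)
      then show "P x" using elim by blast
    qed
  qed
qed

text \<open>The monotone function is not differentiated. Its Stieltjes measure agrees with the
  integrals of \<open>f\<close> on half-open intervals, hence on all Borel sets, so no set integral
  of \<open>f\<close> is negative.\<close>

lemma ac_deriv_mono_AE_nonneg:
  fixes W :: "real \<Rightarrow> real"
  assumes ac: "ac_deriv W f" and mono: "\<And>s t. 0 < s \<Longrightarrow> s \<le> t \<Longrightarrow> W s \<le> W t"
  shows "AE x in lborel. 0 < x \<longrightarrow> 0 \<le> f x"
proof (rule AE_pos_if_AE_intervals)
  fix a b :: real assume ab: "0 < a" "a \<le> b"
  define h where "h x = indicator {a..b} x *\<^sub>R f x" for x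
  have int: "integrable lborel h"
    using ac_derivD(1)[OF ac ab] by (simp add: h_def[abs_def] set_integrable_def)
  \<comment> \<open>Clamping the argument to the interval freezes \<open>W\<close> outside of it, so
    the Stieltjes measure becomes finite and has the density \<open>f\<close> cut off to the
    interval.\<close>
  define c where "c x = max a (min b x)" for x :: real
  define T where "T x = W (c x)" for x
  have c: "a \<le> c x" "c x \<le> b" "x \<le> y \<Longrightarrow> c x \<le> c y" for x y using ab by (auto simp: c_def)
  have Tmono: "T x \<le> T y" if "x \<le> y" for x y
    unfolding T_def using c[of x] c[of y] that ab by (intro mono) auto
  have "continuous_on UNIV T" unfolding T_def
  proof (rule continuous_on_compose2[OF ac_deriv_continuous[OF ac]])
    show "continuous_on UNIV c" unfolding c_def by (intro continuous_intros)
    show "c ` UNIV \<subseteq> {0<..}" using c(1) ab by (force intro: less_le_trans)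
  qed
  then have Tcont: "continuous (at_right x) T" for x
    by (simp add: continuous_on_eq_continuous_at continuous_at_imp_continuous_at_within)
  have eT: "emeasure (interval_measure T) {x<..y} = ennreal (T y - T x)" if "x \<le> y" for x y
    by (rule emeasure_interval_measure_Ioc[OF that Tmono Tcont])
  have UN: "(\<Union>n::nat. {- real n<..real n}) = UNIV"
  proof -
    have "\<exists>n::nat. x \<in> {- real n<..real n}" for x
    proof -
      obtain n where "\<bar>x\<bar> < real n" using reals_Archimedean2 by blast
      then show ?thesis by (intro exI[of _ n]) auto
    qed
    then show ?thesis by auto
  qed
  have inc: "incseq (\<lambda>n::nat. {- real n<..real n})" by (auto simp: incseq_def)
  have fin: "finite_measure (interval_measure T)"
  proof (rule finite_measureI)
    have "emeasure (interval_measure T) (\<Union>n::nat. {- real n<..real n}) =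
        (SUP n::nat. emeasure (interval_measure T) {- real n<..real n})"
      by (rule SUP_emeasure_incseq[symmetric]) (use inc in auto)
    also have "\<dots> \<le> ennreal (W b - W a)"
    proof (rule SUP_least)
      fix n :: nat
      have "T (real n) \<le> W b" "W a \<le> T (- real n)" unfolding T_def using c ab by (auto intro!: mono less_le_trans[OF ab(1)])
      then show "emeasure (interval_measure T) {- real n<..real n} \<le> ennreal (W b - W a)"
        by (subst eT) (auto intro!: ennreal_leI)
    qed
    finally show "emeasure (interval_measure T) (space (interval_measure T)) \<noteq> \<infinity>"
      unfolding UN by (auto simp: top_unique)
  qed
  interpret \<nu>: finite_measure "interval_measure T" by (rule fin)
  have mIoc: "measure (interval_measure T) {x<..y} = (LINT z:{x<..y}|lborel. h z)" for x y
  proof (cases "x \<le> y")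
    case True
    have "measure (interval_measure T) {x<..y} = T y - T x"
      by (rule measure_interval_measure_Ioc[OF True Tmono Tcont])
    also have "\<dots> = (LINT z:{c x..c y}|lborel. f z)"
      unfolding T_def using c[of x] c[of y] True ab by (intro ac_derivD(2)[OF ac]) auto
    also have "\<dots> = (LINT z:{x<..y}|lborel. h z)"
      unfolding set_lebesgue_integral_def
    proof (rule integral_cong_AE)
      show "(\<lambda>z. indicator {c x..c y} z *\<^sub>R f z) \<in> borel_measurable lborel"
        using ac_derivD(1)[OF ac, of "c x" "c y"] c[of x] c[of y] True ab
        by (intro borel_measurable_integrable) (auto simp: set_integrable_def)
      show "(\<lambda>z. indicator {x<..y} z *\<^sub>R h z) \<in> borel_measurable lborel"
        using borel_measurable_integrable[OF int] by measurable
      have "AE z in lborel. z \<noteq> x \<and> z \<noteq> y \<and> z \<noteq> a \<and> z \<noteq> b"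
        using AE_lborel_singleton[of x] AE_lborel_singleton[of y] AE_lborel_singleton[of a] AE_lborel_singleton[of b]
        by eventually_elim auto
      then show "AE z in lborel. indicator {c x..c y} z *\<^sub>R f z = indicator {x<..y} z *\<^sub>R h z"
        by eventually_elim (use True ab in \<open>auto simp: c_def h_def min_def max_def split: split_indicator\<close>)
    qed
    finally show ?thesis .
  qed (simp add: set_lebesgue_integral_def)
  have "(\<lambda>n. measure (interval_measure T) {- real n<..real n}) \<longlonglongrightarrow> measure (interval_measure T) (\<Union>n::nat. {- real n<..real n})"
    by (rule \<nu>.finite_Lim_measure_incseq) (use inc in auto)
  note lim1 = this[unfolded mIoc UN]
  have lim2: "(\<lambda>n. LINT z:{- real n<..real n}|lborel. h z) \<longlonglongrightarrow> (LINT z:(\<Union>n::nat. {- real n<..real n})|lborel. h z)"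
    by (rule set_integral_cont_up) (use inc int in \<open>auto simp: UN set_integrable_def\<close>)
  have top: "measure (interval_measure T) UNIV = (LINT z|lborel. h z)"
    using LIMSEQ_unique[OF lim1 lim2[unfolded UN]] by (simp add: set_lebesgue_integral_def)
  have "(LINT z:A|lborel. h z) \<ge> 0" if "A \<in> sets borel" for A
  proof -
    have "measure (interval_measure T) A = (LINT z:A|lborel. h z)"
    proof (rule dynkin_set_integral[OF fin _ int _ _ _ top that])
      show "Int_stable (range (\<lambda>(x, y). {x<..y::real}))"
        by (auto simp: Int_stable_def)
      show "sets borel = sigma_sets UNIV (range (\<lambda>(x, y). {x<..y::real}))"
        by (subst borel_sigma_sets_Ioc) (simp add: sets_measure_of)
    qed (auto simp: mIoc)
    then show ?thesis by (metis measure_nonneg)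
  qed
  then have "AE z in lborel. h z \<ge> 0" by (intro sigma_finite_measure.density_nonneg[OF sigma_finite_lborel] int) auto
  then show "AE z in lborel. z \<in> {a..b} \<longrightarrow> 0 \<le> f z" by eventually_elim (auto simp: h_def)
qed

text \<open>An error that is a small multiple of the increment of one fixed function
  \<open>H\<close> telescopes over a uniform partition to \<open>\<epsilon> * (H b - H a)\<close>,
  whatever the number of steps.\<close>

lemma increments_nonpos:
  fixes W H :: "real \<Rightarrow> real"
  assumes ab: "a \<le> b"
    and loc: "\<And>\<epsilon>. \<epsilon> > 0 \<Longrightarrow> \<exists>\<delta>>0. \<forall>s t. a \<le> s \<and> s \<le> t \<and> t \<le> b \<and> t - s < \<delta> \<longrightarrow>
      W t - W s \<le> \<epsilon> * (H t - H s)"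
  shows "W b \<le> W a"
proof -
  have le: "W b - W a \<le> \<epsilon> * (H b - H a)" if \<epsilon>: "\<epsilon> > 0" for \<epsilon>
  proof -
    obtain \<delta> where \<delta>: "\<delta> > 0" "\<And>s t. a \<le> s \<Longrightarrow> s \<le> t \<Longrightarrow> t \<le> b \<Longrightarrow> t - s < \<delta> \<Longrightarrow> W t - W s \<le> \<epsilon> * (H t - H s)"
      using loc[OF \<epsilon>] by blast
    obtain n :: nat where n: "(b - a) / \<delta> < real n" using reals_Archimedean2 by blast
    then have n0: "n > 0" using ab \<delta>(1) by (cases n) (auto simp: divide_less_0_iff not_less)
    define c where "c = (b - a) / real n"
    define x where "x i = a + real i * c" for i
    have step: "x (Suc i) - x i = (b - a) / real n" for i by (simp add: x_def distrib_right c_def[symmetric])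
    have small: "(b - a) / real n < \<delta>" using n \<delta>(1) n0 by (simp add: field_simps)
    have xa: "a \<le> x i" for i using ab by (simp add: x_def c_def)
    have xb: "x i \<le> b" if "i \<le> n" for i
    proof -
      have "real i * ((b - a) / real n) \<le> real n * ((b - a) / real n)"
        using that ab by (intro mult_right_mono) auto
      then show ?thesis using n0 by (simp add: x_def c_def)
    qed
    have "(\<Sum>i<n. W (x (Suc i)) - W (x i)) \<le> (\<Sum>i<n. \<epsilon> * (H (x (Suc i)) - H (x i)))"
    proof (intro sum_mono \<delta>(2) xa)
      fix i assume "i \<in> {..<n}"
      then show "x (Suc i) \<le> b" by (intro xb) auto
      have "0 \<le> (b - a) / real n" using ab by simp
      then show "x i \<le> x (Suc i)" using step[of i] by linarith
      show "x (Suc i) - x i < \<delta>" using step small by simp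
    qed
    also have "\<dots> = \<epsilon> * (\<Sum>i<n. H (x (Suc i)) - H (x i))" by (simp only: sum_distrib_left)
    finally show ?thesis
      using n0 unfolding sum_lessThan_telescope[of "\<lambda>i. W (x i)"] sum_lessThan_telescope[of "\<lambda>i. H (x i)"]
      by (simp add: x_def c_def)
  qed
  have "W b - W a \<le> e" if e: "e > 0" for e
  proof -
    define C where "C = \<bar>H b - H a\<bar> + 1"
    have C: "C > 0" "H b - H a \<le> C" by (auto simp: C_def)
    have "W b - W a \<le> (e / C) * (H b - H a)" using e C by (intro le) simp
    also have "\<dots> \<le> (e / C) * C" using e C by (intro mult_left_mono) auto
    finally show ?thesis using C by simp
  qed
  then have "W b - W a \<le> 0" by (rule field_le_epsilon) simp
  then show ?thesis by simp
qed

lemma set_integral_Icc_combine: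
  fixes d :: "real \<Rightarrow> 'b::euclidean_space"
  assumes "a \<le> s" "s \<le> t" "set_integrable lborel {a..t} d"
  shows "(LINT x:{a..t}|lborel. d x) = (LINT x:{a..s}|lborel. d x) + (LINT x:{s..t}|lborel. d x)"
proof -
  have "AE x in lborel. \<not> (x \<in> {a..s} \<and> x \<in> {s..t})"
    using AE_lborel_singleton[of s] by eventually_elim auto
  then have "(LINT x:{a..s} \<union> {s..t}|lborel. d x) = (LINT x:{a..s}|lborel. d x) + (LINT x:{s..t}|lborel. d x)"
    by (intro set_integral_Un_AE set_integrable_subset[OF assms(3)]) (use assms in auto)
  moreover have "{a..s} \<union> {s..t} = {a..t}" using assms by auto
  ultimately show ?thesis by simp
qed

text \<open>The form in which estimates with coefficients frozen at an endpoint of a short interval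
  are summed up over a long one.\<close>

lemma increment_le_set_integral:
  fixes w d H :: "real \<Rightarrow> real"
  assumes ab: "a \<le> b" and int: "set_integrable lborel {a..b} d"
    and loc: "\<And>\<epsilon>. \<epsilon> > 0 \<Longrightarrow> \<exists>\<delta>>0. \<forall>s t. a \<le> s \<and> s \<le> t \<and> t \<le> b \<and> t - s < \<delta> \<longrightarrow>
      w t - w s \<le> (LINT x:{s..t}|lborel. d x) + \<epsilon> * (H t - H s)"
  shows "w b - w a \<le> (LINT x:{a..b}|lborel. d x)"
proof -
  define W where "W t = w t - (LINT x:{a..t}|lborel. d x)" for t
  have W: "W t - W s = w t - w s - (LINT x:{s..t}|lborel. d x)" if "a \<le> s" "s \<le> t" "t \<le> b" for s t
    using set_integral_Icc_combine[OF that(1,2) set_integrable_subset[OF int]] that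
    by (simp add: W_def)
  have "W b \<le> W a"
  proof (rule increments_nonpos[OF ab])
    fix \<epsilon> :: real assume "\<epsilon> > 0"
    from loc[OF this] obtain \<delta> where \<delta>: "\<delta> > 0" "\<And>s t. a \<le> s \<and> s \<le> t \<and> t \<le> b \<and> t - s < \<delta> \<Longrightarrow>
      w t - w s \<le> (LINT x:{s..t}|lborel. d x) + \<epsilon> * (H t - H s)" by blast
    show "\<exists>\<delta>>0. \<forall>s t. a \<le> s \<and> s \<le> t \<and> t \<le> b \<and> t - s < \<delta> \<longrightarrow> W t - W s \<le> \<epsilon> * (H t - H s)"
    proof (intro exI[of _ \<delta>] conjI \<delta>(1) allI impI)
      fix s t assume st: "a \<le> s \<and> s \<le> t \<and> t \<le> b \<and> t - s < \<delta>"
      show "W t - W s \<le> \<epsilon> * (H t - H s)" using \<delta>(2)[OF st] W[of s t] st by linarith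
    qed
  qed
  \<comment> \<open>Splitting the degenerate interval at its only point shows that this integral
    equals twice itself.\<close>
  moreover have "(LINT x:{a..a}|lborel. d x) = 0"
    using set_integral_Icc_combine[of a a a d] set_integrable_subset[OF int, of "{a..a}"] ab by simp
  ultimately show ?thesis by (simp add: W_def)
qed

lemma ac_derivI:
  fixes w d :: "real \<Rightarrow> real"
  assumes int: "\<And>s t. 0 < s \<Longrightarrow> s \<le> t \<Longrightarrow> set_integrable lborel {s..t} d"
    and loc: "\<And>a b. 0 < a \<Longrightarrow> a \<le> b \<Longrightarrow> \<exists>H. \<forall>\<epsilon>>0. \<exists>\<delta>>0. \<forall>s t. a \<le> s \<and> s \<le> t \<and> t \<le> b \<and> t - s < \<delta> \<longrightarrow>
      \<bar>w t - w s - (LINT x:{s..t}|lborel. d x)\<bar> \<le> \<epsilon> * (H t - H s)"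
  shows "ac_deriv w d"
  unfolding ac_deriv_def
proof (intro allI impI conjI)
  fix a b :: real assume "0 < a \<and> a \<le> b"
  then have ab: "0 < a" "a \<le> b" by auto
  show "set_integrable lborel {a..b} d" by (rule int[OF ab])
  obtain H :: "real \<Rightarrow> real" where H: "\<And>\<epsilon>. \<epsilon> > 0 \<Longrightarrow> \<exists>\<delta>>0. \<forall>s t. a \<le> s \<and> s \<le> t \<and> t \<le> b \<and> t - s < \<delta> \<longrightarrow>
      \<bar>w t - w s - (LINT x:{s..t}|lborel. d x)\<bar> \<le> \<epsilon> * (H t - H s)"
    using loc[OF ab] by blast
  have "w b - w a \<le> (LINT x:{a..b}|lborel. d x)"
  proof (rule increment_le_set_integral[OF ab(2) int[OF ab], where H = H])
    fix \<epsilon> :: real assume "\<epsilon> > 0"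
    then obtain \<delta> where \<delta>: "\<delta> > 0" "\<And>s t. a \<le> s \<and> s \<le> t \<and> t \<le> b \<and> t - s < \<delta> \<Longrightarrow>
      \<bar>w t - w s - (LINT x:{s..t}|lborel. d x)\<bar> \<le> \<epsilon> * (H t - H s)"
      using H by blast
    show "\<exists>\<delta>>0. \<forall>s t. a \<le> s \<and> s \<le> t \<and> t \<le> b \<and> t - s < \<delta> \<longrightarrow>
      w t - w s \<le> (LINT x:{s..t}|lborel. d x) + \<epsilon> * (H t - H s)"
      by (intro exI[of _ \<delta>] conjI \<delta>(1) allI impI) (drule \<delta>(2), linarith)
  qed
  moreover have "- w b - - w a \<le> (LINT x:{a..b}|lborel. - d x)"
  proof (rule increment_le_set_integral[OF ab(2), where H = H])
    show "set_integrable lborel {a..b} (\<lambda>x. - d x)"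
      using int[OF ab] by (simp add: set_integrable_def)
    fix \<epsilon> :: real assume "\<epsilon> > 0"
    then obtain \<delta> where \<delta>: "\<delta> > 0" "\<And>s t. a \<le> s \<and> s \<le> t \<and> t \<le> b \<and> t - s < \<delta> \<Longrightarrow>
      \<bar>w t - w s - (LINT x:{s..t}|lborel. d x)\<bar> \<le> \<epsilon> * (H t - H s)"
      using H by blast
    show "\<exists>\<delta>>0. \<forall>s t. a \<le> s \<and> s \<le> t \<and> t \<le> b \<and> t - s < \<delta> \<longrightarrow>
      - w t - - w s \<le> (LINT x:{s..t}|lborel. - d x) + \<epsilon> * (H t - H s)"
    proof (intro exI[of _ \<delta>] conjI \<delta>(1) allI impI)
      fix s t assume st: "a \<le> s \<and> s \<le> t \<and> t \<le> b \<and> t - s < \<delta>"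
      have "(LINT x:{s..t}|lborel. - d x) = - (LINT x:{s..t}|lborel. d x)"
        using st ab by (intro set_integral_uminus int) auto
      then show "- w t - - w s \<le> (LINT x:{s..t}|lborel. - d x) + \<epsilon> * (H t - H s)"
        using \<delta>(2)[OF st] by linarith
    qed
  qed
  moreover have "(LINT x:{a..b}|lborel. - d x) = - (LINT x:{a..b}|lborel. d x)"
    by (intro set_integral_uminus int ab)
  ultimately show "w b - w a = (LINT x:{a..b}|lborel. d x)" by simp
qed

section \<open>Calculus rules for locally absolutely continuous functions\<close>

lemma set_integrable_continuous_scaleR:
  fixes f :: "'a::euclidean_space \<Rightarrow> real" and c :: "'a \<Rightarrow> 'b::euclidean_space"
  assumes K: "compact K" and c: "continuous_on K c" and f: "set_integrable lborel K f"
  shows "set_integrable lborel K (\<lambda>x. f x *\<^sub>R c x)"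
proof -
  obtain B where B: "\<And>x. x \<in> K \<Longrightarrow> norm (c x) \<le> B"
    using compact_imp_bounded[OF compact_continuous_image[OF c K]] by (auto simp: bounded_iff)
  have [measurable]: "(\<lambda>x. indicator K x *\<^sub>R c x) \<in> borel_measurable borel"
    using K c by (intro borel_measurable_continuous_on_indicator) (auto simp: borel_compact)
  have [measurable]: "(\<lambda>x. indicator K x *\<^sub>R f x) \<in> borel_measurable borel"
    using borel_measurable_integrable[OF f[unfolded set_integrable_def]] by simp
  show ?thesis unfolding set_integrable_def
  proof (rule Bochner_Integration.integrable_bound)
    show "integrable lborel (\<lambda>x. B *\<^sub>R (indicator K x *\<^sub>R f x))"
      using f unfolding set_integrable_def by (rule integrable_scaleR_right)
    have "(\<lambda>x. (indicator K x *\<^sub>R f x) *\<^sub>R (indicator K x *\<^sub>R c x)) \<in> borel_measurable lborel"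
      by measurable
    also have "(\<lambda>x. (indicator K x *\<^sub>R f x) *\<^sub>R (indicator K x *\<^sub>R c x)) = (\<lambda>x. indicator K x *\<^sub>R (f x *\<^sub>R c x))"
      by (auto simp: indicator_def)
    finally show "(\<lambda>x. indicator K x *\<^sub>R (f x *\<^sub>R c x)) \<in> borel_measurable lborel" .
    have "norm (indicator K x *\<^sub>R (f x *\<^sub>R c x)) \<le> norm (B *\<^sub>R (indicator K x *\<^sub>R f x))" for x
    proof (cases "x \<in> K")
      case True
      then have "\<bar>f x\<bar> * norm (c x) \<le> \<bar>f x\<bar> * \<bar>B\<bar>" using B[of x] by (intro mult_left_mono) auto
      then show ?thesis using True by (simp add: abs_mult mult.commute)
    qed simp
    then show "AE x in lborel. norm (indicator K x *\<^sub>R (f x *\<^sub>R c x)) \<le> norm (B *\<^sub>R (indicator K x *\<^sub>R f x))"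
      by simp
  qed
qed

lemma set_integrable_continuous_mult:
  fixes f c :: "'a::euclidean_space \<Rightarrow> real"
  assumes "compact K" "continuous_on K c" "set_integrable lborel K f"
  shows "set_integrable lborel K (\<lambda>x. c x * f x)"
  using set_integrable_continuous_scaleR[OF assms] by (simp add: mult.commute)

lemma uniform_continuity_Icc:
  fixes u :: "real \<Rightarrow> 'b::real_normed_vector"
  assumes "continuous_on {0<..} u" "0 < a" "\<epsilon> > (0::real)"
  obtains \<delta> where "\<delta> > 0" "\<And>x y. x \<in> {a..b} \<Longrightarrow> y \<in> {a..b} \<Longrightarrow> \<bar>x - y\<bar> < \<delta> \<Longrightarrow> norm (u x - u y) < \<epsilon>"
proof -
  have "continuous_on {a..b} u" by (rule continuous_on_subset[OF assms(1)]) (use assms in auto)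
  then have "uniformly_continuous_on {a..b} u" by (rule compact_uniformly_continuous) simp
  then show thesis using assms(3) that unfolding uniformly_continuous_on_def dist_norm real_norm_def
    by (metis abs_minus_commute norm_minus_commute)
qed

lemma set_integral_abs_le:
  fixes f h :: "'a \<Rightarrow> real"
  assumes "set_integrable M A f" "set_integrable M A h" "\<And>x. x \<in> A \<Longrightarrow> \<bar>f x\<bar> \<le> h x"
  shows "\<bar>LINT x:A|M. f x\<bar> \<le> (LINT x:A|M. h x)"
proof -
  have "\<bar>LINT x:A|M. f x\<bar> \<le> (LINT x:A|M. \<bar>f x\<bar>)"
    using set_integral_norm_bound[OF assms(1)] by simp
  also have "\<dots> \<le> (LINT x:A|M. h x)"
    by (rule set_integral_mono) (use assms in \<open>auto intro: set_integrable_abs\<close>)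
  finally show ?thesis .
qed

lemma ac_derivI_density:
  fixes w d :: "real \<Rightarrow> real"
  assumes int: "\<And>s t. 0 < s \<Longrightarrow> s \<le> t \<Longrightarrow> set_integrable lborel {s..t} d"
    and h: "\<And>s t. 0 < s \<Longrightarrow> s \<le> t \<Longrightarrow> set_integrable lborel {s..t} h"
    and loc: "\<And>a b \<epsilon>. 0 < a \<Longrightarrow> a \<le> b \<Longrightarrow> \<epsilon> > 0 \<Longrightarrow> \<exists>\<delta>>0. \<forall>s t. a \<le> s \<and> s \<le> t \<and> t \<le> b \<and> t - s < \<delta> \<longrightarrow>
      \<bar>w t - w s - (LINT x:{s..t}|lborel. d x)\<bar> \<le> (LINT x:{s..t}|lborel. \<epsilon> * h x)"
  shows "ac_deriv w d"
proof (rule ac_derivI[OF int])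
  fix a b :: real assume ab: "0 < a" "a \<le> b"
  show "\<exists>H. \<forall>\<epsilon>>0. \<exists>\<delta>>0. \<forall>s t. a \<le> s \<and> s \<le> t \<and> t \<le> b \<and> t - s < \<delta> \<longrightarrow>
      \<bar>w t - w s - (LINT x:{s..t}|lborel. d x)\<bar> \<le> \<epsilon> * (H t - H s)"
  proof (intro exI[of _ "\<lambda>t. LINT x:{a..t}|lborel. h x"] allI impI)
    fix \<epsilon> :: real assume "\<epsilon> > 0"
    from loc[OF ab this] obtain \<delta> where \<delta>: "\<delta> > 0" "\<And>s t. a \<le> s \<and> s \<le> t \<and> t \<le> b \<and> t - s < \<delta> \<Longrightarrow>
      \<bar>w t - w s - (LINT x:{s..t}|lborel. d x)\<bar> \<le> (LINT x:{s..t}|lborel. \<epsilon> * h x)" by blast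
    show "\<exists>\<delta>>0. \<forall>s t. a \<le> s \<and> s \<le> t \<and> t \<le> b \<and> t - s < \<delta> \<longrightarrow>
      \<bar>w t - w s - (LINT x:{s..t}|lborel. d x)\<bar> \<le> \<epsilon> * ((LINT x:{a..t}|lborel. h x) - (LINT x:{a..s}|lborel. h x))"
    proof (intro exI[of _ \<delta>] conjI \<delta>(1) allI impI)
      fix s t assume st: "a \<le> s \<and> s \<le> t \<and> t \<le> b \<and> t - s < \<delta>"
      have "(LINT x:{a..t}|lborel. h x) = (LINT x:{a..s}|lborel. h x) + (LINT x:{s..t}|lborel. h x)"
        using st ab by (intro set_integral_Icc_combine h) auto
      then show "\<bar>w t - w s - (LINT x:{s..t}|lborel. d x)\<bar> \<le> \<epsilon> * ((LINT x:{a..t}|lborel. h x) - (LINT x:{a..s}|lborel. h x))"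
        using \<delta>(2)[OF st] by simp
    qed
  qed
qed

text \<open>With one factor frozen at each endpoint the increment of the product is exactly an
  integral. Its distance to the integral of the product rule is the oscillation of the factors times
  \<open>\<bar>d x\<bar> + \<bar>e x\<bar>\<close>, which is small by uniform continuity.\<close>

lemma ac_deriv_mult:
  fixes u v :: "real \<Rightarrow> real"
  assumes u: "ac_deriv u d" and v: "ac_deriv v e"
  shows "ac_deriv (\<lambda>x. u x * v x) (\<lambda>x. d x * v x + u x * e x)"
proof (rule ac_derivI_density)
  have cu: "continuous_on {s..t} u" and cv: "continuous_on {s..t} v" if "0 < s" for s t
    using ac_deriv_continuous[OF u] ac_deriv_continuous[OF v] that
    by (auto elim!: continuous_on_subset)
  have iu: "set_integrable lborel {s..t} d" and iv: "set_integrable lborel {s..t} e" if "0 < s" "s \<le> t" for s t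
    using ac_derivD(1)[OF u that] ac_derivD(1)[OF v that] by auto
  show int: "set_integrable lborel {s..t} (\<lambda>x. d x * v x + u x * e x)" if "0 < s" "s \<le> t" for s t
    using set_integrable_continuous_mult[OF _ cv iu, of s t] set_integrable_continuous_mult[OF _ cu iv, of s t] that
    by (auto intro!: set_integral_add simp: mult.commute)
  show "set_integrable lborel {s..t} (\<lambda>x. \<bar>d x\<bar> + \<bar>e x\<bar>)" if "0 < s" "s \<le> t" for s t
    using iu[OF that] iv[OF that] by (intro set_integral_add set_integrable_abs)
  fix a b \<epsilon> :: real assume ab: "0 < a" "a \<le> b" and \<epsilon>: "\<epsilon> > 0"
  obtain \<delta>1 where \<delta>1: "\<delta>1 > 0" "\<And>x y. x \<in> {a..b} \<Longrightarrow> y \<in> {a..b} \<Longrightarrow> \<bar>x - y\<bar> < \<delta>1 \<Longrightarrow> norm (u x - u y) < \<epsilon>"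
    using uniform_continuity_Icc[OF ac_deriv_continuous[OF u] ab(1) \<epsilon>] by blast
  obtain \<delta>2 where \<delta>2: "\<delta>2 > 0" "\<And>x y. x \<in> {a..b} \<Longrightarrow> y \<in> {a..b} \<Longrightarrow> \<bar>x - y\<bar> < \<delta>2 \<Longrightarrow> norm (v x - v y) < \<epsilon>"
    using uniform_continuity_Icc[OF ac_deriv_continuous[OF v] ab(1) \<epsilon>] by blast
  show "\<exists>\<delta>>0. \<forall>s t. a \<le> s \<and> s \<le> t \<and> t \<le> b \<and> t - s < \<delta> \<longrightarrow>
      \<bar>u t * v t - u s * v s - (LINT x:{s..t}|lborel. d x * v x + u x * e x)\<bar> \<le>
      (LINT x:{s..t}|lborel. \<epsilon> * (\<bar>d x\<bar> + \<bar>e x\<bar>))"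
  proof (intro exI[of _ "min \<delta>1 \<delta>2"] conjI allI impI)
    fix s t assume st: "a \<le> s \<and> s \<le> t \<and> t \<le> b \<and> t - s < min \<delta>1 \<delta>2"
    then have s0: "0 < s" "s \<le> t" using ab by auto
    have "u t * v t - u s * v s = v s * (u t - u s) + u t * (v t - v s)" by (simp add: algebra_simps)
    also have "\<dots> = (LINT x:{s..t}|lborel. v s * d x) + (LINT x:{s..t}|lborel. u t * e x)"
      using ac_derivD(2)[OF u s0] ac_derivD(2)[OF v s0] by simp
    also have "\<dots> = (LINT x:{s..t}|lborel. v s * d x + u t * e x)"
      by (intro set_integral_add(2)[symmetric] set_integrable_mult_right iu iv s0)
    finally have eq: "u t * v t - u s * v s - (LINT x:{s..t}|lborel. d x * v x + u x * e x) =
        (LINT x:{s..t}|lborel. (v s * d x + u t * e x) - (d x * v x + u x * e x))"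
      by (subst set_integral_diff(2)) (auto intro!: set_integral_add set_integrable_mult_right iu iv s0 int)
    show "\<bar>u t * v t - u s * v s - (LINT x:{s..t}|lborel. d x * v x + u x * e x)\<bar> \<le>
      (LINT x:{s..t}|lborel. \<epsilon> * (\<bar>d x\<bar> + \<bar>e x\<bar>))"
      unfolding eq
    proof (rule set_integral_abs_le)
      show "set_integrable lborel {s..t} (\<lambda>x. (v s * d x + u t * e x) - (d x * v x + u x * e x))"
        by (intro set_integral_diff set_integral_add(1) set_integrable_mult_right iu iv s0 int)
      show "set_integrable lborel {s..t} (\<lambda>x. \<epsilon> * (\<bar>d x\<bar> + \<bar>e x\<bar>))"
        by (intro set_integral_add(1) set_integrable_mult_right set_integrable_abs iu iv s0)
      fix x assume x: "x \<in> {s..t}"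
      have "\<bar>v s - v x\<bar> \<le> \<epsilon>" using \<delta>2(2)[of s x] x st by auto
      moreover have "\<bar>u t - u x\<bar> \<le> \<epsilon>" using \<delta>1(2)[of t x] x st by auto
      moreover have "(v s * d x + u t * e x) - (d x * v x + u x * e x) = (v s - v x) * d x + (u t - u x) * e x"
        by (simp add: algebra_simps)
      ultimately show "\<bar>(v s * d x + u t * e x) - (d x * v x + u x * e x)\<bar> \<le> \<epsilon> * (\<bar>d x\<bar> + \<bar>e x\<bar>)"
        by (auto simp: abs_mult distrib_left intro!: order.trans[OF abs_triangle_ineq] add_mono mult_right_mono)
    qed
  qed (use \<delta>1 \<delta>2 in auto)
qed

text \<open>The mean value theorem gives a value between \<open>u s\<close> and \<open>u t\<close>,
  and the intermediate value theorem places it at some \<open>u x0\<close> with \<open>x0\<close> in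
  the interval. Freezing \<open>\<Phi>' (u x)\<close> at \<open>x0\<close> then costs only its
  oscillation.\<close>

lemma ac_deriv_compose:
  fixes u :: "real \<Rightarrow> real"
  assumes u: "ac_deriv u d" and pos: "\<And>x. x > 0 \<Longrightarrow> u x > 0"
    and \<Phi>: "\<And>y. y > 0 \<Longrightarrow> (\<Phi> has_real_derivative \<Phi>' y) (at y)" and c\<Phi>: "continuous_on {0<..} \<Phi>'"
  shows "ac_deriv (\<lambda>x. \<Phi> (u x)) (\<lambda>x. \<Phi>' (u x) * d x)"
proof (rule ac_derivI_density)
  note cu = ac_deriv_continuous[OF u]
  have c: "continuous_on {0<..} (\<lambda>x. \<Phi>' (u x))"
    by (rule continuous_on_compose2[OF c\<Phi> cu]) (use pos in auto)
  have iu: "set_integrable lborel {s..t} d" if "0 < s" "s \<le> t" for s t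
    using ac_derivD(1)[OF u that] .
  show int: "set_integrable lborel {s..t} (\<lambda>x. \<Phi>' (u x) * d x)" if "0 < s" "s \<le> t" for s t
    by (intro set_integrable_continuous_mult iu that continuous_on_subset[OF c]) (use that in auto)
  show "set_integrable lborel {s..t} (\<lambda>x. \<bar>d x\<bar>)" if "0 < s" "s \<le> t" for s t
    using iu[OF that] by (intro set_integrable_abs)
  fix a b \<epsilon> :: real assume ab: "0 < a" "a \<le> b" and \<epsilon>: "\<epsilon> > 0"
  obtain \<delta> where \<delta>: "\<delta> > 0" "\<And>x y. x \<in> {a..b} \<Longrightarrow> y \<in> {a..b} \<Longrightarrow> \<bar>x - y\<bar> < \<delta> \<Longrightarrow> norm (\<Phi>' (u x) - \<Phi>' (u y)) < \<epsilon>"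
    using uniform_continuity_Icc[OF c ab(1) \<epsilon>] by blast
  show "\<exists>\<delta>>0. \<forall>s t. a \<le> s \<and> s \<le> t \<and> t \<le> b \<and> t - s < \<delta> \<longrightarrow>
      \<bar>\<Phi> (u t) - \<Phi> (u s) - (LINT x:{s..t}|lborel. \<Phi>' (u x) * d x)\<bar> \<le> (LINT x:{s..t}|lborel. \<epsilon> * \<bar>d x\<bar>)"
  proof (intro exI[of _ \<delta>] conjI allI impI)
    fix s t assume st: "a \<le> s \<and> s \<le> t \<and> t \<le> b \<and> t - s < \<delta>"
    then have s0: "0 < s" "s \<le> t" using ab by auto
    have "\<exists>x\<in>{s..t}. \<Phi> (u t) - \<Phi> (u s) = \<Phi>' (u x) * (u t - u s)"
    proof -
      have "connected (u ` {s..t})"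
        by (intro connected_continuous_image continuous_on_subset[OF cu]) (use s0 in auto)
      then have ivt: "\<exists>x\<in>{s..t}. u x = z" if "min (u s) (u t) \<le> z" "z \<le> max (u s) (u t)" for z
      proof -
        have "min (u s) (u t) \<in> u ` {s..t}" "max (u s) (u t) \<in> u ` {s..t}"
          using s0 by (auto simp: min_def max_def)
        from connectedD_interval[OF \<open>connected (u ` {s..t})\<close> this that] show ?thesis by (force simp: image_iff)
      qed
      show ?thesis
      proof (cases "u s" "u t" rule: linorder_cases)
        case less
        then obtain z where "u s < z" "z < u t" "\<Phi> (u t) - \<Phi> (u s) = (u t - u s) * \<Phi>' z"
          using MVT2[of "u s" "u t" \<Phi> \<Phi>'] \<Phi> pos[OF s0(1)] by force
        with ivt[of z] show ?thesis by (auto simp: mult.commute)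
      next
        case greater
        then obtain z where "u t < z" "z < u s" "\<Phi> (u s) - \<Phi> (u t) = (u s - u t) * \<Phi>' z"
          using MVT2[of "u t" "u s" \<Phi> \<Phi>'] \<Phi> pos[of t] s0 by force
        with ivt[of z] show ?thesis by (force simp: algebra_simps)
      qed (use s0 in auto)
    qed
    then obtain x0 where x0: "x0 \<in> {s..t}" "\<Phi> (u t) - \<Phi> (u s) = \<Phi>' (u x0) * (u t - u s)" by blast
    have eq: "\<Phi> (u t) - \<Phi> (u s) - (LINT x:{s..t}|lborel. \<Phi>' (u x) * d x) =
        (LINT x:{s..t}|lborel. \<Phi>' (u x0) * d x - \<Phi>' (u x) * d x)"
      unfolding x0(2) ac_derivD(2)[OF u s0]
      by (subst set_integral_diff(2)) (auto intro!: set_integrable_mult_right iu s0 int)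
    show "\<bar>\<Phi> (u t) - \<Phi> (u s) - (LINT x:{s..t}|lborel. \<Phi>' (u x) * d x)\<bar> \<le> (LINT x:{s..t}|lborel. \<epsilon> * \<bar>d x\<bar>)"
      unfolding eq
    proof (rule set_integral_abs_le)
      show "set_integrable lborel {s..t} (\<lambda>x. \<Phi>' (u x0) * d x - \<Phi>' (u x) * d x)"
        by (intro set_integral_diff(1) set_integrable_mult_right iu s0 int)
      show "set_integrable lborel {s..t} (\<lambda>x. \<epsilon> * \<bar>d x\<bar>)"
        by (intro set_integrable_mult_right set_integrable_abs iu s0)
      fix x assume x: "x \<in> {s..t}"
      have "\<bar>x0 - x\<bar> < \<delta>" using x x0(1) st by (auto simp: abs_less_iff)
      then have "\<bar>\<Phi>' (u x0) - \<Phi>' (u x)\<bar> \<le> \<epsilon>" using \<delta>(2)[of x0 x] x x0(1) st by auto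
      then show "\<bar>\<Phi>' (u x0) * d x - \<Phi>' (u x) * d x\<bar> \<le> \<epsilon> * \<bar>d x\<bar>"
        by (metis abs_ge_zero abs_mult left_diff_distrib mult_right_mono)
    qed
  qed (use \<delta> in auto)
qed

lemma ac_deriv_add:
  assumes "ac_deriv u d" "ac_deriv v e"
  shows "ac_deriv (\<lambda>x. u x + v x) (\<lambda>x. d x + e x)"
  using assms by (auto simp: ac_deriv_def set_integral_add add_diff_add intro!: set_integral_add)

lemma ac_deriv_linear:
  assumes T: "bounded_linear T" and u: "ac_deriv u d"
  shows "ac_deriv (\<lambda>x. T (u x)) (\<lambda>x. T (d x))"
proof -
  have "set_integrable lborel {s..t} (\<lambda>x. T (d x)) \<and> T (u t) - T (u s) = (LINT x:{s..t}|lborel. T (d x))"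
    if "0 < s" "s \<le> t" for s t
  proof -
    interpret bounded_linear T by fact
    have e: "indicator {s..t} x *\<^sub>R T (d x) = T (indicator {s..t} x *\<^sub>R d x)" for x by (simp add: scaleR)
    have i: "integrable lborel (\<lambda>x. indicator {s..t} x *\<^sub>R d x)"
      using ac_derivD(1)[OF u that] by (simp add: set_integrable_def)
    show ?thesis
      using ac_derivD(2)[OF u that] integrable_bounded_linear[OF T i] integral_bounded_linear[OF T i]
      by (simp add: set_integrable_def set_lebesgue_integral_def e diff[symmetric])
  qed
  then show ?thesis by (auto simp: ac_deriv_def)
qed

lemma ac_deriv_sum:
  assumes "\<And>i. i \<in> I \<Longrightarrow> ac_deriv (u i) (d i)"
  shows "ac_deriv (\<lambda>x. \<Sum>i\<in>I. u i x) (\<lambda>x. \<Sum>i\<in>I. d i x)"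
  using assms
proof (induction I rule: infinite_finite_induct)
  case (insert i I)
  then show ?case by (simp add: ac_deriv_add)
qed (auto simp: ac_deriv_def set_integrable_def set_lebesgue_integral_def)

lemma ac_deriv_componentwise:
  fixes u d :: "real \<Rightarrow> 'b::euclidean_space"
  assumes "\<And>b. b \<in> Basis \<Longrightarrow> ac_deriv (\<lambda>x. u x \<bullet> b) (\<lambda>x. d x \<bullet> b)"
  shows "ac_deriv u d"
proof -
  have "ac_deriv (\<lambda>x. \<Sum>b\<in>Basis. (u x \<bullet> b) *\<^sub>R b) (\<lambda>x. \<Sum>b\<in>Basis. (d x \<bullet> b) *\<^sub>R b)"
    by (intro ac_deriv_sum ac_deriv_linear[OF bounded_linear_scaleR_left] assms)
  then show ?thesis by (simp add: euclidean_representation)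
qed

lemma ac_deriv_C1:
  fixes u :: "real \<Rightarrow> 'b::euclidean_space"
  assumes "\<And>x. x > 0 \<Longrightarrow> (u has_vector_derivative d x) (at x)" "continuous_on {0<..} d"
  shows "ac_deriv u d"
  unfolding ac_deriv_def
proof (intro allI impI)
  fix s t :: real assume st: "0 < s \<and> s \<le> t"
  have c: "continuous_on {s..t} d" by (rule continuous_on_subset[OF assms(2)]) (use st in auto)
  have "(LBINT x. indicator {s..t} x *\<^sub>R d x) = u t - u s"
    by (rule integral_FTC_atLeastAtMost) (use st assms(1) c in \<open>auto intro: has_vector_derivative_at_within\<close>)
  then show "set_integrable lborel {s..t} d \<and> u t - u s = (LINT x:{s..t}|lborel. d x)"
    using borel_integrable_compact[OF compact_Icc c] by (simp add: set_integrable_def set_lebesgue_integral_def indicator_scaleR_eq_if cong: if_cong)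
qed

lemma ac_deriv_compact_support:
  fixes u :: "real \<Rightarrow> 'b::euclidean_space"
  assumes u: "ac_deriv u d" and ab: "0 < a" "a \<le> b" and 0: "u a = 0" "u b = 0"
    and d: "\<And>x. x > 0 \<Longrightarrow> x \<notin> {a..b} \<Longrightarrow> d x = 0"
  shows "(LINT x:{0<..}|lborel. d x) = 0"
proof -
  have "indicator {0<..} x *\<^sub>R d x = indicator {a..b} x *\<^sub>R d x" for x
    using d[of x] ab by (auto split: split_indicator)
  then have "(LINT x:{0<..}|lborel. d x) = (LINT x:{a..b}|lborel. d x)"
    unfolding set_lebesgue_integral_def by (intro Bochner_Integration.integral_cong refl)
  also have "\<dots> = u b - u a" by (rule ac_derivD(2)[OF u ab, symmetric])
  finally show ?thesis using 0 by simp
qed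

text \<open>The kernel is one-sided, and the sign of the scale \<open>c n\<close> decides on which
  side of \<open>p\<close> it sits. Both signs are used, at the two ends of an interval.\<close>

lemma mollifier_tendsto:
  fixes u \<psi>' :: "real \<Rightarrow> real"
  assumes \<psi>': "continuous_on UNIV \<psi>'" "\<And>x. x \<notin> {0..1} \<Longrightarrow> \<psi>' x = 0" "\<And>x. 0 \<le> \<psi>' x"
    and one: "(LINT x:{0..1}|lborel. \<psi>' x) = 1"
    and u: "continuous_on {0<..} u" and p: "p > 0"
    and c: "c \<longlonglongrightarrow> 0" "\<And>n. c n \<noteq> 0" "\<And>n. \<bar>c n\<bar> < p / 2"
  shows "(\<lambda>n. LINT x:{0<..}|lborel. u x * (\<psi>' ((x - p) / c n) / \<bar>c n\<bar>)) \<longlonglongrightarrow> u p"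
    and "\<And>n. set_integrable lborel {0<..} (\<lambda>x. u x * (\<psi>' ((x - p) / c n) / \<bar>c n\<bar>))"
proof -
  let ?f = "\<lambda>n x. indicator {0<..} x *\<^sub>R (u x * (\<psi>' ((x - p) / c n) / \<bar>c n\<bar>))"
  let ?g = "\<lambda>n y. indicator {0..1} y *\<^sub>R (u (p + c n * y) * \<psi>' y)"
  \<comment> \<open>The bound \<open>\<bar>c n\<bar> < p / 2\<close> keeps all sampled points in one
    compact subinterval of the half-line, on which \<open>u\<close> is bounded.\<close>
  have near: "p + c n * y \<in> {p/2..2*p}" if "y \<in> {0..1}" for n y
  proof -
    have "\<bar>c n * y\<bar> \<le> \<bar>c n\<bar> * 1" using that unfolding abs_mult by (intro mult_left_mono) auto
    then have "\<bar>c n * y\<bar> \<le> p / 2" using c(3)[of n] by simp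
    then show ?thesis using p by auto
  qed
  have sub: "\<bar>c n\<bar> *\<^sub>R ?f n (p + c n * y) = ?g n y" for n y
  proof (cases "y \<in> {0..1}")
    case True
    then have "p + c n * y > 0" using near[OF True, of n] p by auto
    with True c(2)[of n] show ?thesis by simp
  next
    case False
    then show ?thesis using \<psi>'(2)[OF False] c(2)[of n] by simp
  qed
  have cg: "continuous_on {0..1} (\<lambda>y. u (p + c n * y) * \<psi>' y)" for n
  proof (intro continuous_intros continuous_on_compose2[OF u] continuous_on_subset[OF \<psi>'(1)])
    show "(\<lambda>y. p + c n * y) ` {0..1} \<subseteq> {0<..}"
    proof
      fix x assume "x \<in> (\<lambda>y. p + c n * y) ` {0..1}"
      then obtain y where "y \<in> {0..1}" "x = p + c n * y" by blast
      then show "x \<in> {0<..}" using near[of y n] p by auto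
    qed
  qed simp
  have ig: "integrable lborel (?g n)" for n
    using borel_integrable_compact[OF compact_Icc cg, of n] by (simp add: indicator_scaleR_eq_if cong: if_cong)
  have "integrable lborel (\<lambda>y. \<bar>c n\<bar> *\<^sub>R ?f n (p + c n * y))" for n
    using ig[of n] by (simp only: sub)
  then have "integrable lborel (\<lambda>y. (1 / \<bar>c n\<bar>) *\<^sub>R (\<bar>c n\<bar> *\<^sub>R ?f n (p + c n * y)))" for n
    by (rule integrable_scaleR_right)
  moreover have "(1 / \<bar>c n\<bar>) *\<^sub>R (\<bar>c n\<bar> *\<^sub>R z) = z" for n and z :: real
    using c(2)[of n] by simp
  ultimately have i1: "integrable lborel (\<lambda>y. ?f n (p + c n * y))" for n
    by (simp only:)
  show "set_integrable lborel {0<..} (\<lambda>x. u x * (\<psi>' ((x - p) / c n) / \<bar>c n\<bar>))" for n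
    using i1[of n] unfolding set_integrable_def
    by (subst lborel_integrable_real_affine_iff[OF c(2)[of n], symmetric]) assumption
  have eq: "(LINT x:{0<..}|lborel. u x * (\<psi>' ((x - p) / c n) / \<bar>c n\<bar>)) = (LINT y|lborel. ?g n y)" for n
  proof -
    have "(LINT x|lborel. ?f n x) = \<bar>c n\<bar> *\<^sub>R (LINT y|lborel. ?f n (p + c n * y))"
      by (rule lborel_integral_real_affine[OF c(2)])
    also have "\<dots> = (LINT y|lborel. \<bar>c n\<bar> *\<^sub>R ?f n (p + c n * y))"
      by (rule integral_scaleR_right[symmetric])
    finally show ?thesis unfolding sub set_lebesgue_integral_def .
  qed
  obtain B where B: "\<And>x. x \<in> {p/2..2*p} \<Longrightarrow> \<bar>u x\<bar> \<le> B"
  proof -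
    have "compact (u ` {p/2..2*p})"
      by (intro compact_continuous_image continuous_on_subset[OF u]) (use p in auto)
    from compact_imp_bounded[OF this] obtain B where "\<forall>y\<in>u ` {p/2..2*p}. norm y \<le> B"
      by (auto simp only: bounded_iff)
    then show thesis by (intro that[of B]) simp
  qed
  have "(\<lambda>n. LINT y|lborel. ?g n y) \<longlonglongrightarrow> (LINT y|lborel. indicator {0..1} y *\<^sub>R (u p * \<psi>' y))"
  proof (rule integral_dominated_convergence)
    have cp: "continuous_on {0..1} \<psi>'" by (rule continuous_on_subset[OF \<psi>'(1)]) simp
    have ip: "integrable lborel (\<lambda>y. indicator {0..1} y *\<^sub>R \<psi>' y)"
      using borel_integrable_compact[OF compact_Icc cp] by (simp add: indicator_scaleR_eq_if cong: if_cong)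
    show "integrable lborel (\<lambda>y. B *\<^sub>R (indicator {0..1} y *\<^sub>R \<psi>' y))"
      using ip by (rule integrable_scaleR_right)
    show "?g n \<in> borel_measurable lborel" for n using ig by (rule borel_measurable_integrable)
    have "(\<lambda>y. u p *\<^sub>R (indicator {0..1} y *\<^sub>R \<psi>' y)) \<in> borel_measurable lborel"
      using integrable_scaleR_right[OF ip] by (rule borel_measurable_integrable)
    then show "(\<lambda>y. indicator {0..1} y *\<^sub>R (u p * \<psi>' y)) \<in> borel_measurable lborel"
      by (simp add: mult_ac)
    show "AE y in lborel. (\<lambda>n. ?g n y) \<longlonglongrightarrow> indicator {0..1} y *\<^sub>R (u p * \<psi>' y)"
    proof (intro AE_I2 tendsto_intros)
      fix y
      have "isCont u p" using u p by (simp add: continuous_on_eq_continuous_at)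
      moreover have "(\<lambda>n. p + c n * y) \<longlonglongrightarrow> p + 0 * y" by (intro tendsto_intros c(1))
      ultimately show "(\<lambda>n. u (p + c n * y)) \<longlonglongrightarrow> u p"
        using isCont_tendsto_compose[of p u "\<lambda>n. p + c n * y" sequentially] by simp
    qed
    show "AE y in lborel. norm (?g n y) \<le> B *\<^sub>R (indicator {0..1} y *\<^sub>R \<psi>' y)" for n
    proof (intro AE_I2)
      fix y show "norm (?g n y) \<le> B *\<^sub>R (indicator {0..1} y *\<^sub>R \<psi>' y)"
        using B[OF near[of y n]] \<psi>'(3)[of y] by (auto simp: abs_mult intro!: mult_right_mono split: split_indicator)
    qed
  qed
  moreover have "(LINT y|lborel. indicator {0..1} y *\<^sub>R (u p * \<psi>' y)) = u p"
  proof -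
    have "(LINT y:{0..1}|lborel. u p * \<psi>' y) = u p * (LINT y:{0..1}|lborel. \<psi>' y)"
      by (rule set_integral_mult_right)
    then show ?thesis unfolding one by (simp only: set_lebesgue_integral_def mult_1_right)
  qed
  ultimately show "(\<lambda>n. LINT x:{0<..}|lborel. u x * (\<psi>' ((x - p) / c n) / \<bar>c n\<bar>)) \<longlonglongrightarrow> u p"
    unfolding eq by simp
qed

text \<open>Tested with plateaus \<open>\<eta> n\<close> inside the interval from \<open>s\<close>
  to \<open>t\<close> whose edges have width \<open>c n\<close>. The derivatives of the edges are
  mollifier kernels at the two ends, so one side tends to the increment of \<open>u\<close> and the
  other to the integral of \<open>D\<close>.\<close>

lemma weak_gradient_imp_ac_deriv:
  fixes u D :: "real \<Rightarrow> real"
  assumes u: "continuous_on {0<..} u" and D: "weak_gradient {0<..} u D"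
  shows "ac_deriv u D"
  unfolding ac_deriv_def
proof (intro allI impI conjI)
  fix s t :: real assume st: "0 < s \<and> s \<le> t"
  have L2: "set_borel_measurable lborel {0<..} D" "set_integrable lborel {s..t} (\<lambda>x. (norm (D x))\<^sup>2)"
    using D st unfolding weak_gradient_def L2_loc_def
    by (blast, metis (no_types, lifting) atLeastAtMost_iff compact_Icc greaterThan_iff less_le_trans subsetI)
  have [measurable]: "(\<lambda>x. indicator {0<..} x *\<^sub>R D x) \<in> borel_measurable borel"
    using L2(1) by (simp add: set_borel_measurable_def)
  have eqi: "indicator {s..t} x *\<^sub>R D x = indicator {s..t} x *\<^sub>R (indicator {0<..} x *\<^sub>R D x)" for x
    using st by (auto split: split_indicator)
  show int: "set_integrable lborel {s..t} D"
    unfolding set_integrable_def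
  proof (rule Bochner_Integration.integrable_bound)
    show "integrable lborel (\<lambda>x. indicator {s..t} x *\<^sub>R 1 + indicator {s..t} x *\<^sub>R (norm (D x))\<^sup>2)"
      using L2(2) unfolding set_integrable_def
      by (intro Bochner_Integration.integrable_add) (auto intro!: integrable_real_indicator simp: emeasure_lborel_Icc_eq)
    show "(\<lambda>x. indicator {s..t} x *\<^sub>R D x) \<in> borel_measurable lborel"
      unfolding eqi by measurable
    have "\<bar>y\<bar> \<le> 1 + y\<^sup>2" for y :: real
      using zero_le_power2[of "\<bar>y\<bar> - 1"] by (simp add: power2_eq_square algebra_simps)
    then show "AE x in lborel. norm (indicator {s..t} x *\<^sub>R D x) \<le>
        norm (indicator {s..t} x *\<^sub>R 1 + indicator {s..t} x *\<^sub>R (norm (D x))\<^sup>2)"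
      by (auto split: split_indicator)
  qed
  show "u t - u s = (LINT x:{s..t}|lborel. D x)"
  proof (cases "s = t")
    case True
    have "AE x in lborel. indicator {s..t} x *\<^sub>R D x = 0"
      using AE_lborel_singleton[of s] by eventually_elim (use True in auto)
    then have "(LINT x:{s..t}|lborel. D x) = 0" unfolding set_lebesgue_integral_def by (rule integral_eq_zero_AE)
    then show ?thesis using True by simp
  next
    case False
    obtain \<psi> \<psi>' :: "real \<Rightarrow> real" where \<psi>: "smooth_on UNIV \<psi>"
      "\<And>x. x \<le> 0 \<Longrightarrow> \<psi> x = 0" "\<And>x. x \<ge> 1 \<Longrightarrow> \<psi> x = 1" "\<And>x. 0 \<le> \<psi> x" "\<And>x. \<psi> x \<le> 1"
      "\<And>x. (\<psi> has_real_derivative \<psi>' x) (at x)" "continuous_on UNIV \<psi>'"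
      "\<And>x. x \<notin> {0..1} \<Longrightarrow> \<psi>' x = 0" "\<And>x. 0 \<le> \<psi>' x"
      using smooth_step by metis
    have one: "(LINT x:{0..1}|lborel. \<psi>' x) = 1"
    proof -
      have "(LBINT x. indicator {0..1} x *\<^sub>R \<psi>' x) = \<psi> 1 - \<psi> 0"
        by (rule integral_FTC_atLeastAtMost)
          (auto intro: has_vector_derivative_at_within continuous_on_subset[OF \<psi>(7)]
             \<psi>(6)[unfolded has_real_derivative_iff_has_vector_derivative])
      then show ?thesis using \<psi>(2,3) by (simp add: set_lebesgue_integral_def)
    qed
    \<comment> \<open>Edges of width at most \<open>s / 2\<close> satisfy the requirement of the
      mollifier at both ends, and a third of the length keeps the two edges apart.\<close>
    define e where "e = min (s / 2) ((t - s) / 3)"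
    have "e \<le> (t - s) / 3" unfolding e_def by (rule min.cobounded2)
    then have e: "e > 0" "e \<le> s / 2" "3 * e \<le> t - s" using st False by (auto simp: e_def)
    \<comment> \<open>The shift by 2 makes \<open>c n < e\<close> strict also at
      \<open>n = 0\<close>.\<close>
    define c where "c n = e / real (n + 2)" for n
    have c: "c n > 0" "c n < e" for n using e by (auto simp: c_def divide_less_eq)
    have c0: "c \<longlonglongrightarrow> 0"
      unfolding c_def by (rule LIMSEQ_ignore_initial_segment) (rule lim_const_over_n)
    define \<eta> where "\<eta> n x = \<psi> ((x - s) / c n) * \<psi> ((t - x) / c n)" for n x
    have supp: "\<eta> n x = 0" if "x \<notin> {s..t}" for n x
      using that c(1)[of n] \<psi>(2) by (auto simp: \<eta>_def not_le divide_le_0_iff)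
    have tf: "test_fun {0<..} (\<eta> n)" for n
      unfolding test_fun_def
    proof (intro conjI exI[of _ "{s..t}"])
      have "Ck_on m UNIV (\<lambda>x. \<psi> ((x - s) / c n))" for m
        using Ck_on_compose_affine[of m \<psi> "1 / c n" "1::real" "- s / c n"] \<psi>(1)
        by (simp add: smooth_on_def diff_divide_distrib)
      moreover have "Ck_on m UNIV (\<lambda>x. \<psi> ((t - x) / c n))" for m
        using Ck_on_compose_affine[of m \<psi> "- 1 / c n" "1::real" "t / c n"] \<psi>(1)
        by (simp add: smooth_on_def diff_divide_distrib)
      ultimately show "smooth_on UNIV (\<eta> n)" unfolding smooth_on_def \<eta>_def by (intro allI Ck_on_mult)
    qed (use st supp in auto)
    have der: "(\<eta> n has_real_derivative (\<psi>' ((x - s) / c n) / c n - \<psi>' ((t - x) / c n) / c n)) (at x)" for n x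
    proof -
      have "((\<lambda>x. \<psi> ((x - s) / c n)) has_real_derivative \<psi>' ((x - s) / c n) * (1 / c n)) (at x)"
        by (rule DERIV_chain2[OF \<psi>(6)]) (use c(1)[of n] in \<open>auto intro!: derivative_eq_intros\<close>)
      moreover have "((\<lambda>x. \<psi> ((t - x) / c n)) has_real_derivative \<psi>' ((t - x) / c n) * (- 1 / c n)) (at x)"
        by (rule DERIV_chain2[OF \<psi>(6)]) (use c(1)[of n] in \<open>auto intro!: derivative_eq_intros\<close>)
      ultimately have d: "(\<eta> n has_real_derivative
          \<psi>' ((x - s) / c n) * (1 / c n) * \<psi> ((t - x) / c n) + \<psi>' ((t - x) / c n) * (- 1 / c n) * \<psi> ((x - s) / c n)) (at x)"
        unfolding \<eta>_def by (rule DERIV_mult)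
      \<comment> \<open>Where one edge varies, the other factor is already constant 1.\<close>
      have 1: "\<psi>' ((x - s) / c n) * \<psi> ((t - x) / c n) = \<psi>' ((x - s) / c n)"
      proof (cases "x \<le> s + c n")
        case True
        then have "(t - x) / c n \<ge> 1" using c[of n] e by (simp add: le_divide_eq)
        then show ?thesis using \<psi>(3) by simp
      next
        case False
        then have "(x - s) / c n \<notin> {0..1}" using c[of n] by (simp add: divide_le_eq)
        then show ?thesis using \<psi>(8) by simp
      qed
      have 2: "\<psi>' ((t - x) / c n) * \<psi> ((x - s) / c n) = \<psi>' ((t - x) / c n)"
      proof (cases "t \<le> x + c n")
        case True
        then have "(x - s) / c n \<ge> 1" using c[of n] e by (simp add: le_divide_eq)
        then show ?thesis using \<psi>(3) by simp
      next
        case False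
        then have "(t - x) / c n \<notin> {0..1}" using c[of n] by (simp add: divide_le_eq)
        then show ?thesis using \<psi>(8) by simp
      qed
      have "\<psi>' ((x - s) / c n) * (1 / c n) * \<psi> ((t - x) / c n) + \<psi>' ((t - x) / c n) * (- 1 / c n) * \<psi> ((x - s) / c n)
          = (\<psi>' ((x - s) / c n) * \<psi> ((t - x) / c n)) / c n - (\<psi>' ((t - x) / c n) * \<psi> ((x - s) / c n)) / c n"
        by simp
      then show ?thesis using d unfolding 1 2 by simp
    qed
    have fd: "frechet_derivative (\<eta> n) (at x) 1 = \<psi>' ((x - s) / c n) / c n - \<psi>' ((t - x) / c n) / c n" for n x
      using frechet_derivative_at[OF der[of n x, unfolded has_field_derivative_def]] by (metis mult.right_neutral)
    have s0: "s > 0" and t0: "t > 0" using st by auto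
    have cs: "\<bar>c n\<bar> < s / 2" "\<bar>- c n\<bar> < t / 2" for n using c[of n] e st by auto
    have cn: "c n \<noteq> 0" "- c n \<noteq> 0" for n using c[of n] by auto
    have c0': "(\<lambda>n. - c n) \<longlonglongrightarrow> 0" using tendsto_minus[OF c0] by simp
    note mol_s = mollifier_tendsto[OF \<psi>(7,8,9) one u s0 c0 cn(1) cs(1)]
    note mol_t = mollifier_tendsto[OF \<psi>(7,8,9) one u t0 c0' cn(2) cs(2)]
    have flip: "(x - t) / - c n = (t - x) / c n" for x n by (simp add: minus_divide_left[symmetric] divide_minus_right diff_divide_distrib)
    have "(\<lambda>n. (LINT x:{0<..}|lborel. u x * (\<psi>' ((x - s) / c n) / \<bar>c n\<bar>)) -
        (LINT x:{0<..}|lborel. u x * (\<psi>' ((x - t) / - c n) / \<bar>- c n\<bar>))) \<longlonglongrightarrow> u s - u t"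
      by (intro tendsto_diff mol_s(1) mol_t(1))
    moreover have "(LINT x:{0<..}|lborel. u x * (\<psi>' ((x - s) / c n) / \<bar>c n\<bar>)) -
        (LINT x:{0<..}|lborel. u x * (\<psi>' ((x - t) / - c n) / \<bar>- c n\<bar>)) =
        - (LINT x:{0<..}|lborel. D x * \<eta> n x)" for n
    proof -
      have "(LINT x:{0<..}|lborel. u x * (\<psi>' ((x - s) / c n) / \<bar>c n\<bar>)) -
        (LINT x:{0<..}|lborel. u x * (\<psi>' ((x - t) / - c n) / \<bar>- c n\<bar>)) =
        (LINT x:{0<..}|lborel. u x * (\<psi>' ((x - s) / c n) / \<bar>c n\<bar>) - u x * (\<psi>' ((x - t) / - c n) / \<bar>- c n\<bar>))"
        by (rule set_integral_diff(2)[symmetric, OF mol_s(2) mol_t(2)])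
      also have "\<dots> = (LINT x:{0<..}|lborel. u x * frechet_derivative (\<eta> n) (at x) 1)"
        unfolding fd flip using c(1)[of n] by (simp add: right_diff_distrib)
      also have "\<dots> = - (LINT x:{0<..}|lborel. D x * \<eta> n x)"
        using D tf[of n] by (simp add: weak_gradient_def)
      finally show ?thesis .
    qed
    ultimately have lim1: "(\<lambda>n. - (LINT x:{0<..}|lborel. D x * \<eta> n x)) \<longlonglongrightarrow> u s - u t" by simp
    have "(\<lambda>n. LINT x|lborel. indicator {0<..} x *\<^sub>R (D x * \<eta> n x)) \<longlonglongrightarrow> (LINT x|lborel. indicator {s..t} x *\<^sub>R D x)"
    proof (rule integral_dominated_convergence)
      show "integrable lborel (\<lambda>x. norm (indicator {s..t} x *\<^sub>R D x))"
        using int unfolding set_integrable_def by (rule integrable_norm)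
      show "(\<lambda>x. indicator {s..t} x *\<^sub>R D x) \<in> borel_measurable lborel" unfolding eqi by measurable
      have "continuous_on UNIV (\<eta> n)" for n using der[of n] DERIV_isCont by (blast intro: continuous_at_imp_continuous_on)
      then have [measurable]: "\<eta> n \<in> borel_measurable borel" for n by (rule borel_measurable_continuous_onI)
      have "(\<lambda>x. (indicator {0<..} x *\<^sub>R D x) * \<eta> n x) \<in> borel_measurable lborel" for n by measurable
      then show "(\<lambda>x. indicator {0<..} x *\<^sub>R (D x * \<eta> n x)) \<in> borel_measurable lborel" for n by (simp add: mult.assoc)
      show "AE x in lborel. norm (indicator {0<..} x *\<^sub>R (D x * \<eta> n x)) \<le> norm (indicator {s..t} x *\<^sub>R D x)" for n
      proof (intro AE_I2)
        fix x
        have "\<bar>\<eta> n x\<bar> \<le> 1" using \<psi>(4,5) by (auto simp: \<eta>_def abs_mult intro!: mult_le_one)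
        then show "norm (indicator {0<..} x *\<^sub>R (D x * \<eta> n x)) \<le> norm (indicator {s..t} x *\<^sub>R D x)"
          using supp[of x n] by (auto simp: abs_mult intro!: mult_left_le split: split_indicator)
      qed
      show "AE x in lborel. (\<lambda>n. indicator {0<..} x *\<^sub>R (D x * \<eta> n x)) \<longlonglongrightarrow> indicator {s..t} x *\<^sub>R D x"
        using AE_lborel_singleton[of s] AE_lborel_singleton[of t]
      proof eventually_elim
        case (elim x)
        show ?case
        proof (cases "x \<in> {s..t}")
          case True
          then have x: "s < x" "x < t" using elim by auto
          have "\<forall>\<^sub>F n in sequentially. c n < min (x - s) (t - x)"
            using order_tendstoD(2)[OF c0, of "min (x - s) (t - x)"] x by simp
          then have "\<forall>\<^sub>F n in sequentially. indicator {0<..} x *\<^sub>R (D x * \<eta> n x) = indicator {s..t} x *\<^sub>R D x"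
          proof eventually_elim
            case (elim n)
            then have "(x - s) / c n \<ge> 1" "(t - x) / c n \<ge> 1" using c(1)[of n] by (auto simp: le_divide_eq)
            then have "\<eta> n x = 1" using \<psi>(3) by (simp add: \<eta>_def)
            then show ?case using True st by (auto split: split_indicator)
          qed
          then show ?thesis by (rule tendsto_eventually)
        qed (simp add: supp)
      qed
    qed
    then have "(\<lambda>n. - (LINT x:{0<..}|lborel. D x * \<eta> n x)) \<longlonglongrightarrow> - (LINT x:{s..t}|lborel. D x)"
      unfolding set_lebesgue_integral_def by (rule tendsto_minus)
    from LIMSEQ_unique[OF lim1 this] show ?thesis by simp
  qed
qed

section \<open>Locally integrable functions and integration by parts\<close>

lemma measurable_eqI: "f \<in> measurable M N \<Longrightarrow> (\<And>x. f x = g x) \<Longrightarrow> g \<in> measurable M N"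
proof -
  assume "f \<in> measurable M N" "\<And>x. f x = g x"
  moreover from this(2) have "f = g" by (rule ext)
  ultimately show "g \<in> measurable M N" by simp
qed

lemma L2_locI_bound:
  fixes f :: "'e::euclidean_space \<Rightarrow> 'b::euclidean_space" and h :: "'e \<Rightarrow> 'c::euclidean_space"
  assumes h: "set_borel_measurable lborel U h" and f: "L2_loc U f"
    and le: "\<And>K. compact K \<Longrightarrow> K \<subseteq> U \<Longrightarrow> \<exists>C. \<forall>x\<in>K. norm (h x) \<le> C * norm (f x)"
  shows "L2_loc U h"
  unfolding L2_loc_def
proof (intro conjI allI impI h)
  fix K assume K: "compact K \<and> K \<subseteq> U"
  then obtain C where C: "\<And>x. x \<in> K \<Longrightarrow> norm (h x) \<le> C * norm (f x)" using le[of K] by auto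
  have [measurable]: "K \<in> sets borel" using K by (simp add: borel_compact)
  have [measurable]: "(\<lambda>x. indicator U x *\<^sub>R h x) \<in> borel_measurable borel"
    using h by (simp add: set_borel_measurable_def)
  show "set_integrable lborel K (\<lambda>x. (norm (h x))\<^sup>2)"
    unfolding set_integrable_def
  proof (rule Bochner_Integration.integrable_bound)
    show "integrable lborel (\<lambda>x. C\<^sup>2 *\<^sub>R (indicator K x *\<^sub>R (norm (f x))\<^sup>2))"
    proof (rule integrable_scaleR_right)
      show "integrable lborel (\<lambda>x. indicator K x *\<^sub>R (norm (f x))\<^sup>2)"
        using f K by (simp add: L2_loc_def set_integrable_def)
    qed
    have "(\<lambda>x. indicator K x *\<^sub>R (norm (indicator U x *\<^sub>R h x))\<^sup>2) \<in> borel_measurable lborel"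
      by measurable
    also have "(\<lambda>x. indicator K x *\<^sub>R (norm (indicator U x *\<^sub>R h x))\<^sup>2) = (\<lambda>x. indicator K x *\<^sub>R (norm (h x))\<^sup>2)"
      using K by (auto simp: indicator_def fun_eq_iff)
    finally show "(\<lambda>x. indicator K x *\<^sub>R (norm (h x))\<^sup>2) \<in> borel_measurable lborel" .
    have "(norm (h x))\<^sup>2 \<le> C\<^sup>2 * (norm (f x))\<^sup>2" if "x \<in> K" for x
      using power_mono[OF C[OF that], of 2] by (simp add: power_mult_distrib)
    then show "AE x in lborel. norm (indicator K x *\<^sub>R (norm (h x))\<^sup>2) \<le>
        norm (C\<^sup>2 *\<^sub>R (indicator K x *\<^sub>R (norm (f x))\<^sup>2))"
      by (intro AE_I2) (auto split: split_indicator)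
  qed
qed

lemma set_borel_measurable_continuous_open:
  fixes c :: "'e::euclidean_space \<Rightarrow> 'b::euclidean_space"
  assumes "open U" "continuous_on U c"
  shows "set_borel_measurable lborel U c"
  unfolding set_borel_measurable_def
  using borel_measurable_continuous_on_indicator[OF _ assms(2)] assms(1) by simp

lemma L2_loc_one:
  fixes U :: "'e::euclidean_space set"
  assumes "open U"
  shows "L2_loc U (\<lambda>x. 1 :: real)"
  unfolding L2_loc_def
proof (intro conjI allI impI set_borel_measurable_continuous_open assms)
  fix K :: "'e set" assume K: "compact K \<and> K \<subseteq> U"
  show "set_integrable lborel K (\<lambda>x. (norm (1::real))\<^sup>2)"
    using K emeasure_bounded_finite[of K] compact_imp_bounded[of K] by (simp add: set_integrable_def borel_compact)
qed (rule continuous_on_const)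

lemma L2_loc_scaleR_continuous:
  fixes f :: "'e::euclidean_space \<Rightarrow> real" and c :: "'e \<Rightarrow> 'b::euclidean_space"
  assumes U: "open U" and f: "L2_loc U f" and c: "continuous_on U c"
  shows "L2_loc U (\<lambda>x. f x *\<^sub>R c x)"
proof (rule L2_locI_bound[OF _ f])
  have [measurable]: "(\<lambda>x. indicator U x *\<^sub>R f x) \<in> borel_measurable borel"
    using f by (simp add: L2_loc_def set_borel_measurable_def)
  have [measurable]: "(\<lambda>x. indicator U x *\<^sub>R c x) \<in> borel_measurable borel"
    using set_borel_measurable_continuous_open[OF U c] by (simp add: set_borel_measurable_def)
  have "(\<lambda>x. (indicator U x *\<^sub>R f x) *\<^sub>R (indicator U x *\<^sub>R c x)) \<in> borel_measurable borel" by measurable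
  then show "set_borel_measurable lborel U (\<lambda>x. f x *\<^sub>R c x)"
    unfolding set_borel_measurable_def measurable_lborel2 by (rule measurable_eqI) (auto simp: indicator_def)
  fix K assume K: "compact K" "K \<subseteq> U"
  have "bounded (c ` K)"
    using K c by (intro compact_imp_bounded compact_continuous_image continuous_on_subset[OF c])
  then obtain B where "\<And>x. x \<in> K \<Longrightarrow> norm (c x) \<le> B" by (auto simp: bounded_iff)
  then show "\<exists>C. \<forall>x\<in>K. norm (f x *\<^sub>R c x) \<le> C * norm (f x)"
    by (intro exI[of _ B] ballI) (simp add: mult_left_mono mult.commute[of B])
qed

lemma L2_loc_continuous:
  fixes c :: "'e::euclidean_space \<Rightarrow> 'b::euclidean_space"
  assumes "open U" "continuous_on U c"
  shows "L2_loc U c"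
  using L2_loc_scaleR_continuous[OF assms(1) L2_loc_one[OF assms(1)] assms(2)] by simp

lemma L2_loc_add:
  fixes f g :: "'e::euclidean_space \<Rightarrow> 'b::euclidean_space"
  assumes f: "L2_loc U f" and g: "L2_loc U g"
  shows "L2_loc U (\<lambda>x. f x + g x)"
  unfolding L2_loc_def
proof (intro conjI allI impI)
  have [measurable]: "(\<lambda>x. indicator U x *\<^sub>R f x) \<in> borel_measurable borel"
    "(\<lambda>x. indicator U x *\<^sub>R g x) \<in> borel_measurable borel"
    using f g by (simp_all add: L2_loc_def set_borel_measurable_def)
  have m: "(\<lambda>x. indicator U x *\<^sub>R f x + indicator U x *\<^sub>R g x) \<in> borel_measurable borel" by measurable
  then show "set_borel_measurable lborel U (\<lambda>x. f x + g x)"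
    by (simp add: set_borel_measurable_def scaleR_add_right)
  fix K assume K: "compact K \<and> K \<subseteq> U"
  have [measurable]: "K \<in> sets borel" using K by (simp add: borel_compact)
  show "set_integrable lborel K (\<lambda>x. (norm (f x + g x))\<^sup>2)"
    unfolding set_integrable_def
  proof (rule Bochner_Integration.integrable_bound)
    have "set_integrable lborel K (\<lambda>x. 2 *\<^sub>R (norm (f x))\<^sup>2 + 2 *\<^sub>R (norm (g x))\<^sup>2)"
      using f g K unfolding L2_loc_def by (intro set_integral_add(1) set_integrable_scaleR_right) blast+
    then show "integrable lborel (\<lambda>x. indicator K x *\<^sub>R (2 *\<^sub>R (norm (f x))\<^sup>2 + 2 *\<^sub>R (norm (g x))\<^sup>2))"
      by (simp only: set_integrable_def)
    have "(\<lambda>x. indicator K x *\<^sub>R (norm (indicator U x *\<^sub>R f x + indicator U x *\<^sub>R g x))\<^sup>2) \<in> borel_measurable lborel"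
      by measurable
    also have "(\<lambda>x. indicator K x *\<^sub>R (norm (indicator U x *\<^sub>R f x + indicator U x *\<^sub>R g x))\<^sup>2) =
        (\<lambda>x. indicator K x *\<^sub>R (norm (f x + g x))\<^sup>2)"
      using K by (auto simp: indicator_def fun_eq_iff)
    finally show "(\<lambda>x. indicator K x *\<^sub>R (norm (f x + g x))\<^sup>2) \<in> borel_measurable lborel" .
    have "(norm (a + b))\<^sup>2 \<le> 2 * (norm a)\<^sup>2 + 2 * (norm b)\<^sup>2" for a b :: 'b
    proof -
      have "(norm (a + b))\<^sup>2 \<le> (norm a + norm b)\<^sup>2" by (intro power_mono norm_triangle_ineq) auto
      also have "\<dots> \<le> 2 * (norm a)\<^sup>2 + 2 * (norm b)\<^sup>2"
        using zero_le_power2[of "norm a - norm b"] by (simp add: power2_eq_square algebra_simps)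
      finally show ?thesis .
    qed
    then show "AE x in lborel. norm (indicator K x *\<^sub>R (norm (f x + g x))\<^sup>2) \<le>
        norm (indicator K x *\<^sub>R (2 *\<^sub>R (norm (f x))\<^sup>2 + 2 *\<^sub>R (norm (g x))\<^sup>2))"
      by (intro AE_I2) (auto split: split_indicator)
  qed
qed

lemma L2_loc_sum:
  fixes f :: "'i \<Rightarrow> 'e::euclidean_space \<Rightarrow> 'b::euclidean_space"
  assumes "open U" "\<And>i. i \<in> I \<Longrightarrow> L2_loc U (f i)"
  shows "L2_loc U (\<lambda>x. \<Sum>i\<in>I. f i x)"
  using assms(2)
  by (induction I rule: infinite_finite_induct)
    (auto intro: L2_loc_add L2_loc_continuous[OF assms(1)] continuous_on_const)

lemma L2_loc_inner_continuous:
  fixes f c :: "'e::euclidean_space \<Rightarrow> 'b::euclidean_space"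
  assumes U: "open U" and f: "L2_loc U f" and c: "continuous_on U c"
  shows "L2_loc U (\<lambda>x. f x \<bullet> c x)"
proof (rule L2_locI_bound[OF _ f])
  have [measurable]: "(\<lambda>x. indicator U x *\<^sub>R f x) \<in> borel_measurable borel"
    using f by (simp add: L2_loc_def set_borel_measurable_def)
  have [measurable]: "(\<lambda>x. indicator U x *\<^sub>R c x) \<in> borel_measurable borel"
    using set_borel_measurable_continuous_open[OF U c] by (simp add: set_borel_measurable_def)
  have "(\<lambda>x. (indicator U x *\<^sub>R f x) \<bullet> (indicator U x *\<^sub>R c x)) \<in> borel_measurable borel" by measurable
  then show "set_borel_measurable lborel U (\<lambda>x. f x \<bullet> c x)"
    unfolding set_borel_measurable_def measurable_lborel2 by (rule measurable_eqI) (auto simp: indicator_def)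
  fix K assume K: "compact K" "K \<subseteq> U"
  have "bounded (c ` K)"
    using K c by (intro compact_imp_bounded compact_continuous_image continuous_on_subset[OF c])
  then obtain B where B: "\<And>x. x \<in> K \<Longrightarrow> norm (c x) \<le> B" by (auto simp: bounded_iff)
  show "\<exists>C. \<forall>x\<in>K. norm (f x \<bullet> c x) \<le> C * norm (f x)"
  proof (intro exI[of _ B] ballI)
    fix x assume x: "x \<in> K"
    have "norm (f x \<bullet> c x) \<le> norm (f x) * norm (c x)" using Cauchy_Schwarz_ineq2[of "f x" "c x"] by simp
    also have "\<dots> \<le> norm (f x) * B" using B[OF x] by (intro mult_left_mono) auto
    finally show "norm (f x \<bullet> c x) \<le> B * norm (f x)" by (simp add: mult.commute)
  qed
qed

text \<open>Expansion of \<open>F p\<close> in a basis. It serves the terms below that are linear in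
  the square integrable derivative of the metric with coefficients depending continuously on the
  point.\<close>

lemma L2_loc_linear_field:
  fixes F :: "'e::euclidean_space \<Rightarrow> 'm::euclidean_space" and T :: "'e \<Rightarrow> 'm \<Rightarrow> 'b::euclidean_space"
  assumes U: "open U" and F: "L2_loc U F" and lin: "\<And>p. linear (T p)" and cont: "\<And>A. continuous_on U (\<lambda>p. T p A)"
  shows "L2_loc U (\<lambda>p. T p (F p))"
proof -
  have "L2_loc U (\<lambda>p. \<Sum>B\<in>Basis. (F p \<bullet> B) *\<^sub>R T p B)"
    by (intro L2_loc_sum U L2_loc_scaleR_continuous cont L2_loc_inner_continuous F continuous_on_const)
  moreover have "(\<Sum>B\<in>Basis. (F p \<bullet> B) *\<^sub>R T p B) = T p (F p)" for p
  proof -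
    have "T p (F p) = T p (\<Sum>B\<in>Basis. (F p \<bullet> B) *\<^sub>R B)" by (simp add: euclidean_representation)
    also have "\<dots> = (\<Sum>B\<in>Basis. (F p \<bullet> B) *\<^sub>R T p B)"
      by (simp add: linear_sum[OF lin] linear_scale[OF lin])
    finally show ?thesis by simp
  qed
  ultimately show ?thesis by simp
qed

lemma L1_loc_inner_L2:
  fixes f g :: "'e::euclidean_space \<Rightarrow> 'b::euclidean_space"
  assumes f: "L2_loc U f" and g: "L2_loc U g"
  shows "L1_loc U (\<lambda>x. f x \<bullet> g x)"
  unfolding L1_loc_def
proof (intro conjI allI impI)
  have [measurable]: "(\<lambda>x. indicator U x *\<^sub>R f x) \<in> borel_measurable borel"
    "(\<lambda>x. indicator U x *\<^sub>R g x) \<in> borel_measurable borel"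
    using f g by (simp_all add: L2_loc_def set_borel_measurable_def)
  have "(\<lambda>x. (indicator U x *\<^sub>R f x) \<bullet> (indicator U x *\<^sub>R g x)) \<in> borel_measurable borel" by measurable
  then show "set_borel_measurable lborel U (\<lambda>x. f x \<bullet> g x)"
    unfolding set_borel_measurable_def measurable_lborel2 by (rule measurable_eqI) (auto simp: indicator_def)
  fix K assume K: "compact K \<and> K \<subseteq> U"
  have [measurable]: "K \<in> sets borel" using K by (simp add: borel_compact)
  show "set_integrable lborel K (\<lambda>x. f x \<bullet> g x)"
    unfolding set_integrable_def
  proof (rule Bochner_Integration.integrable_bound)
    have "set_integrable lborel K (\<lambda>x. (norm (f x))\<^sup>2 + (norm (g x))\<^sup>2)"
      using f g K unfolding L2_loc_def by (intro set_integral_add(1)) blast+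
    then show "integrable lborel (\<lambda>x. indicator K x *\<^sub>R ((norm (f x))\<^sup>2 + (norm (g x))\<^sup>2))"
      by (simp only: set_integrable_def)
    have "(\<lambda>x. indicator K x *\<^sub>R ((indicator U x *\<^sub>R f x) \<bullet> (indicator U x *\<^sub>R g x))) \<in> borel_measurable lborel"
      by measurable
    also have "(\<lambda>x. indicator K x *\<^sub>R ((indicator U x *\<^sub>R f x) \<bullet> (indicator U x *\<^sub>R g x))) =
        (\<lambda>x. indicator K x *\<^sub>R (f x \<bullet> g x))"
      using K by (auto simp: indicator_def fun_eq_iff)
    finally show "(\<lambda>x. indicator K x *\<^sub>R (f x \<bullet> g x)) \<in> borel_measurable lborel" .
    have "\<bar>a \<bullet> b\<bar> \<le> (norm a)\<^sup>2 + (norm b)\<^sup>2" for a b :: 'b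
    proof -
      have "\<bar>a \<bullet> b\<bar> \<le> norm a * norm b" by (rule Cauchy_Schwarz_ineq2)
      also have "\<dots> \<le> (norm a)\<^sup>2 + (norm b)\<^sup>2"
        using sum_squares_bound[of "norm a" "norm b"] mult_nonneg_nonneg[OF norm_ge_zero[of a] norm_ge_zero[of b]]
        by linarith
      finally show ?thesis .
    qed
    then show "AE x in lborel. norm (indicator K x *\<^sub>R (f x \<bullet> g x)) \<le>
        norm (indicator K x *\<^sub>R ((norm (f x))\<^sup>2 + (norm (g x))\<^sup>2))"
      by (intro AE_I2) (auto split: split_indicator)
  qed
qed

lemma L1_loc_mult_L2:
  fixes f g :: "'e::euclidean_space \<Rightarrow> real"
  shows "L2_loc U f \<Longrightarrow> L2_loc U g \<Longrightarrow> L1_loc U (\<lambda>x. f x * g x)"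
  using L1_loc_inner_L2[of U f g] by simp

lemma L2_imp_L1_loc:
  fixes f :: "'e::euclidean_space \<Rightarrow> real"
  assumes "open U" "L2_loc U f"
  shows "L1_loc U f"
  using L1_loc_mult_L2[OF assms(2) L2_loc_one[OF assms(1)]] by simp

lemma L1_loc_integrable:
  fixes f c :: "'e::euclidean_space \<Rightarrow> real"
  assumes f: "L1_loc U f" and c: "continuous_on U c" and K: "compact K" "K \<subseteq> U"
    and 0: "\<And>x. x \<in> U \<Longrightarrow> x \<notin> K \<Longrightarrow> c x = 0"
  shows "set_integrable lborel U (\<lambda>x. f x * c x)"
proof -
  have "set_integrable lborel K (\<lambda>x. c x * f x)"
    using f K by (intro set_integrable_continuous_mult continuous_on_subset[OF c]) (auto simp: L1_loc_def)
  moreover have "(\<lambda>x. indicator K x *\<^sub>R (c x * f x)) = (\<lambda>x. indicator U x *\<^sub>R (f x * c x))"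
    using 0 K by (auto simp: indicator_def fun_eq_iff)
  ultimately show ?thesis by (simp only: set_integrable_def)
qed

lemma test_fun_continuous: "test_fun U \<phi> \<Longrightarrow> continuous_on V \<phi>"
proof -
  assume "test_fun U \<phi>"
  then have "Ck_on 0 UNIV \<phi>" unfolding test_fun_def smooth_on_def by blast
  then show "continuous_on V \<phi>" by (auto elim: continuous_on_subset)
qed

lemma L1_loc_test_integrable:
  fixes f \<phi> :: "'e::euclidean_space \<Rightarrow> real"
  assumes "L1_loc U f" "test_fun U \<phi>"
  shows "set_integrable lborel U (\<lambda>x. f x * \<phi> x)"
proof -
  obtain K where "compact K" "K \<subseteq> U" "\<forall>x. x \<notin> K \<longrightarrow> \<phi> x = 0" using assms(2) by (auto simp: test_fun_def)
  then show ?thesis by (intro L1_loc_integrable[OF assms(1) test_fun_continuous[OF assms(2)]]) auto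
qed

lemma compact_pos_bounds:
  fixes S :: "real set"
  assumes "compact S" "S \<subseteq> {0<..}"
  obtains a b where "0 < a" "a \<le> b" "S \<subseteq> {a..b}"
proof (cases "S = {}")
  case False
  obtain a where a: "a \<in> S" "\<And>x. x \<in> S \<Longrightarrow> a \<le> x" using compact_attains_inf[OF assms(1) False] by blast
  obtain b where b: "b \<in> S" "\<And>x. x \<in> S \<Longrightarrow> x \<le> b" using compact_attains_sup[OF assms(1) False] by blast
  show ?thesis by (rule that[of a b]) (use a b assms(2) in auto)
qed (rule that[of 1 1], auto)

text \<open>A compact subset of the cylinder lies in the product of a compact interval and a compact
  set \<open>K2\<close>, where the integral splits by Fubini.\<close>

lemma L2_loc_fst:
  fixes d :: "real \<Rightarrow> 'b::euclidean_space" and C :: "'c::euclidean_space set"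
  assumes d: "L2_loc {0<..} d" and C: "open C"
  shows "L2_loc ({0<..} \<times> C) (\<lambda>p. d (fst p))"
  unfolding L2_loc_def
proof (intro conjI allI impI)
  have [measurable]: "C \<in> sets borel" using C by simp
  have dm[measurable]: "(\<lambda>r. indicator {0<..} r *\<^sub>R d r) \<in> borel_measurable borel"
    using d by (simp add: L2_loc_def set_borel_measurable_def)
  have "(\<lambda>p. (indicator ({0<..} \<times> C) p :: real) *\<^sub>R (\<lambda>r. indicator {0<..} r *\<^sub>R d r) (fst p)) \<in> borel_measurable (borel :: (real \<times> 'c) measure)"
    unfolding borel_prod[symmetric] by measurable
  then show "set_borel_measurable lborel ({0<..} \<times> C) (\<lambda>p. d (fst p))"
    unfolding set_borel_measurable_def measurable_lborel2 by (rule measurable_eqI) (auto simp: indicator_def)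
  fix K :: "(real \<times> 'c) set" assume K: "compact K \<and> K \<subseteq> {0<..} \<times> C"
  have "compact (fst ` K)" "compact (snd ` K)"
    using K by (auto intro!: compact_continuous_image continuous_intros)
  moreover have "fst ` K \<subseteq> {0<..}" using K by force
  ultimately obtain a b where ab: "0 < a" "a \<le> b" "fst ` K \<subseteq> {a..b}" by (metis compact_pos_bounds)
  define K2 where "K2 = snd ` K"
  have K2: "compact K2" unfolding K2_def by fact
  have [measurable]: "K2 \<in> sets borel" "K \<in> sets borel" using K2 K by (auto simp: borel_compact)
  have [measurable]: "K \<in> sets (borel \<Otimes>\<^sub>M borel)" unfolding borel_prod by simp
  have iab: "integrable lborel (\<lambda>r. indicator {a..b} r *\<^sub>R (norm (d r))\<^sup>2)"
  proof -
    have "{a..b} \<subseteq> {0<..}" using ab by auto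
    then show ?thesis using d unfolding L2_loc_def set_integrable_def by blast
  qed
  have i2: "integrable (lborel :: 'c measure) (indicator K2 :: 'c \<Rightarrow> real)"
    using emeasure_bounded_finite[OF compact_imp_bounded[OF K2]] by (intro integrable_real_indicator) auto
  let ?F = "\<lambda>p. (indicator {a..b} (fst p) *\<^sub>R (norm (indicator {0<..} (fst p) *\<^sub>R d (fst p)))\<^sup>2) * (indicator K2 (snd p) :: real)"
  have eq1: "indicator {a..b} r *\<^sub>R (norm (indicator {0<..} r *\<^sub>R d r))\<^sup>2 = indicator {a..b} r *\<^sub>R (norm (d r))\<^sup>2" for r
    using ab by (auto simp: indicator_def)
  have mF: "?F \<in> borel_measurable (lborel \<Otimes>\<^sub>M (lborel :: 'c measure))" by measurable
  have "integrable (lborel \<Otimes>\<^sub>M (lborel :: 'c measure)) ?F"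
  proof (rule lborel_pair.Fubini_integrable[OF mF])
    have "(\<lambda>x. LINT y|lborel. norm (?F (x, y :: 'c))) =
       (\<lambda>x. (LINT y|lborel. indicator K2 y) * (indicator {a..b} x *\<^sub>R (norm (d x))\<^sup>2))"
      unfolding fst_conv snd_conv eq1 norm_mult by (simp add: mult.commute)
    then show "integrable lborel (\<lambda>x. LINT y|lborel. norm (?F (x, y :: 'c)))" using iab by simp
    show "AE x in lborel. integrable lborel (\<lambda>y. ?F (x, y :: 'c))"
      using i2 by (intro AE_I2) simp
  qed
  then have iF: "integrable (lborel :: (real \<times> 'c) measure) ?F" by (simp only: lborel_prod)
  show "set_integrable lborel K (\<lambda>p. (norm (d (fst p)))\<^sup>2)"
    unfolding set_integrable_def
  proof (rule Bochner_Integration.integrable_bound[OF iF])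
    have "(\<lambda>p. indicator K p *\<^sub>R (norm ((\<lambda>r. indicator {0<..} r *\<^sub>R d r) (fst p)))\<^sup>2) \<in> borel_measurable (borel \<Otimes>\<^sub>M borel)"
      by measurable
    then have "(\<lambda>p. indicator K p *\<^sub>R (norm ((\<lambda>r. indicator {0<..} r *\<^sub>R d r) (fst p)))\<^sup>2) \<in> borel_measurable (lborel :: (real \<times> 'c) measure)"
      by (simp add: borel_prod)
    moreover have "(\<lambda>p. indicator K p *\<^sub>R (norm ((\<lambda>r. indicator {0<..} r *\<^sub>R d r) (fst p)))\<^sup>2) = (\<lambda>p. indicator K p *\<^sub>R (norm (d (fst p)))\<^sup>2)"
      using K by (auto simp: indicator_def fun_eq_iff)
    ultimately show "(\<lambda>p. indicator K p *\<^sub>R (norm (d (fst p)))\<^sup>2) \<in> borel_measurable lborel" by (simp only:)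
    show "AE p in lborel. norm (indicator K p *\<^sub>R (norm (d (fst p)))\<^sup>2) \<le> norm (?F p)"
    proof (intro AE_I2)
      fix p :: "real \<times> 'c"
      have "p \<in> K \<Longrightarrow> fst p \<in> {a..b} \<and> snd p \<in> K2 \<and> fst p \<in> {0<..}" using ab K by (auto simp: K2_def)
      then show "norm (indicator K p *\<^sub>R (norm (d (fst p)))\<^sup>2) \<le> norm (?F p)"
        by (cases "p \<in> K") auto
    qed
  qed
qed

section \<open>Integration by parts on the cylinder\<close>

lemma cylinder_integral_zero:
  fixes F :: "real \<times> 'c::euclidean_space \<Rightarrow> real"
  assumes F: "set_integrable lborel ({0<..} \<times> C) F"
    and slice: "\<And>x. x \<in> C \<Longrightarrow> (LINT r:{0<..}|lborel. F (r, x)) = 0"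
  shows "(LINT p:{0<..} \<times> C|lborel. F p) = 0"
proof -
  have i: "integrable (lborel \<Otimes>\<^sub>M lborel) (\<lambda>(r, x). indicator ({0<..} \<times> C) (r, x) *\<^sub>R F (r, x))"
    using F by (simp add: set_integrable_def lborel_prod case_prod_beta')
  have "(LINT p:{0<..} \<times> C|lborel. F p) = integral\<^sup>L (lborel \<Otimes>\<^sub>M lborel) (\<lambda>(r, x). indicator ({0<..} \<times> C) (r, x) *\<^sub>R F (r, x))"
    by (simp add: set_lebesgue_integral_def lborel_prod case_prod_beta')
  also have "\<dots> = (LINT x|lborel. LINT r|lborel. indicator ({0<..} \<times> C) (r, x) *\<^sub>R F (r, x))"
    by (rule lborel_pair.integral_snd[OF i, symmetric])
  also have "\<dots> = (LINT x::'c|lborel. 0)"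
  proof (rule Bochner_Integration.integral_cong[OF refl])
    fix x :: 'c
    have "(LINT r|lborel. indicator ({0<..} \<times> C) (r, x) *\<^sub>R F (r, x)) = (LINT r|lborel. indicator C x *\<^sub>R (indicator {0<..} r *\<^sub>R F (r, x)))"
      by (intro Bochner_Integration.integral_cong refl) (auto simp: indicator_def)
    also have "\<dots> = indicator C x *\<^sub>R (LINT r:{0<..}|lborel. F (r, x))"
      unfolding set_lebesgue_integral_def by (rule integral_scaleR_right)
    also have "\<dots> = 0" using slice[of x] by (auto simp: indicator_def)
    finally show "(LINT r|lborel. indicator ({0<..} \<times> C) (r, x) *\<^sub>R F (r, x)) = 0" .
  qed
  finally show ?thesis by simp
qed

text \<open>Along each line with fixed \<open>x\<close> the product rule for \<open>ac_deriv\<close>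
  applies and the boundary terms vanish by compact support; Fubini assembles the lines.\<close>

lemma cylinder_integrate_by_parts:
  fixes u d :: "real \<Rightarrow> real" and p pr :: "real \<times> 'c::euclidean_space \<Rightarrow> real"
  assumes u: "ac_deriv u d" and d: "L1_loc ({0<..} \<times> C) (\<lambda>q. d (fst q))" and C: "open C"
    and p: "continuous_on ({0<..} \<times> C) p" and pr: "continuous_on ({0<..} \<times> C) pr"
    and der: "\<And>r x. r > 0 \<Longrightarrow> x \<in> C \<Longrightarrow> ((\<lambda>r. p (r, x)) has_real_derivative pr (r, x)) (at r)"
    and K: "compact K" "K \<subseteq> {0<..} \<times> C"
    and 0: "\<And>q. q \<in> {0<..} \<times> C \<Longrightarrow> q \<notin> K \<Longrightarrow> p q = 0"
    and 1: "\<And>q. q \<in> {0<..} \<times> C \<Longrightarrow> q \<notin> K \<Longrightarrow> pr q = 0"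
  shows "set_integrable lborel ({0<..} \<times> C) (\<lambda>q. d (fst q) * p q)"
    and "set_integrable lborel ({0<..} \<times> C) (\<lambda>q. u (fst q) * pr q)"
    and "(LINT q:{0<..} \<times> C|lborel. u (fst q) * pr q) = - (LINT q:{0<..} \<times> C|lborel. d (fst q) * p q)"
proof -
  have U: "open ({0::real<..} \<times> C)" using C by (intro open_Times) auto
  show i1: "set_integrable lborel ({0<..} \<times> C) (\<lambda>q. d (fst q) * p q)"
    by (rule L1_loc_integrable[OF d p K 0])
  have "continuous_on ({0<..} \<times> C) (\<lambda>q. u (fst q))"
    by (rule continuous_on_compose2[OF ac_deriv_continuous[OF u] continuous_on_fst[OF continuous_on_id]]) auto
  then have "L1_loc ({0<..} \<times> C) (\<lambda>q. u (fst q))"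
    using U by (intro L2_imp_L1_loc L2_loc_continuous)
  then show i2: "set_integrable lborel ({0<..} \<times> C) (\<lambda>q. u (fst q) * pr q)"
    by (rule L1_loc_integrable[OF _ pr K 1])
  have "compact (fst ` K)" using K by (auto intro!: compact_continuous_image continuous_intros)
  moreover have "fst ` K \<subseteq> {0<..}" using K by force
  ultimately obtain a b where ab: "0 < a" "a \<le> b" "fst ` K \<subseteq> {a..b}" by (metis compact_pos_bounds)
  have "(LINT q:{0<..} \<times> C|lborel. d (fst q) * p q + u (fst q) * pr q) = 0"
  proof (rule cylinder_integral_zero)
    show "set_integrable lborel ({0<..} \<times> C) (\<lambda>q. d (fst q) * p q + u (fst q) * pr q)"
      by (intro set_integral_add(1) i1 i2)
    fix x assume x: "x \<in> C"
    have "ac_deriv (\<lambda>r. p (r, x)) (\<lambda>r. pr (r, x))"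
    proof (rule ac_deriv_C1)
      show "continuous_on {0<..} (\<lambda>r. pr (r, x))"
        by (rule continuous_on_compose2[OF pr]) (use x in \<open>auto intro!: continuous_intros\<close>)
    qed (use der x in \<open>simp add: has_real_derivative_iff_has_vector_derivative\<close>)
    from ac_deriv_mult[OF u this] have ac: "ac_deriv (\<lambda>r. u r * p (r, x)) (\<lambda>r. d r * p (r, x) + u r * pr (r, x))" .
    have off: "p (r, x) = 0 \<and> pr (r, x) = 0" if "r > 0" "r \<notin> {a..b}" for r
    proof -
      have "(r, x) \<notin> K" using that ab by force
      then show ?thesis using 0 1 that x by auto
    qed
    \<comment> \<open>The ends \<open>a / 2\<close> and \<open>b + 1\<close> lie strictly outside
      the interval that contains the support; \<open>p\<close> need not vanish at \<open>a\<close>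
      and \<open>b\<close> themselves.\<close>
    have "(LINT r:{0<..}|lborel. d r * p (r, x) + u r * pr (r, x)) = 0"
    proof (rule ac_deriv_compact_support[OF ac, of "a / 2" "b + 1"])
      show "u (a / 2) * p (a / 2, x) = 0" "u (b + 1) * p (b + 1, x) = 0"
        using off[of "a / 2"] off[of "b + 1"] ab by auto
      show "d r * p (r, x) + u r * pr (r, x) = 0" if "r > 0" "r \<notin> {a / 2..b + 1}" for r
        using off[of r] that ab by auto
    qed (use ab in auto)
    then show "(LINT r:{0<..}|lborel. d (fst (r, x)) * p (r, x) + u (fst (r, x)) * pr (r, x)) = 0" by simp
  qed
  moreover have "(LINT q:{0<..} \<times> C|lborel. d (fst q) * p q + u (fst q) * pr q) =
      (LINT q:{0<..} \<times> C|lborel. d (fst q) * p q) + (LINT q:{0<..} \<times> C|lborel. u (fst q) * pr q)"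
    by (rule set_integral_add(2)[OF i1 i2])
  ultimately show "(LINT q:{0<..} \<times> C|lborel. u (fst q) * pr q) = - (LINT q:{0<..} \<times> C|lborel. d (fst q) * p q)" by simp
qed

text \<open>By translation invariance the difference quotients have integral 0, and the bound on the
  derivative dominates them on a ball. Differentiability is assumed only along \<open>b\<close>,
  because \<open>h\<close> will also be a function with a merely continuous factor in r,
  differentiated along a slice.\<close>

lemma integral_directional_derivative_zero:
  fixes h h' :: "'e::euclidean_space \<Rightarrow> real"
  assumes hi: "integrable lborel h" and h': "h' \<in> borel_measurable borel" and K: "bounded K"
    and off: "\<And>x. x \<notin> K \<Longrightarrow> h x = 0" and B: "\<And>x. \<bar>h' x\<bar> \<le> B"
    and der: "\<And>x. ((\<lambda>t. h (x + t *\<^sub>R b)) has_real_derivative h' x) (at 0)"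
  shows "(LINT x|lborel. h' x) = 0"
proof -
  have der': "((\<lambda>t. h (x + t *\<^sub>R b)) has_real_derivative h' (x + t *\<^sub>R b)) (at t)" for x t
  proof -
    have "((\<lambda>s. h (x + (t + s) *\<^sub>R b)) has_real_derivative h' (x + t *\<^sub>R b)) (at 0)"
      using der[of "x + t *\<^sub>R b"] by (simp add: scaleR_add_left add.assoc)
    then show ?thesis using DERIV_shift[of "\<lambda>s. h (x + s *\<^sub>R b)" _ 0 t] by (simp add: add.commute)
  qed
  have lip: "\<bar>h (x + t *\<^sub>R b) - h x\<bar> \<le> B * t" if t: "t > 0" for x t
  proof -
    obtain z where "h (x + t *\<^sub>R b) - h (x + 0 *\<^sub>R b) = (t - 0) * h' (x + z *\<^sub>R b)"
      using MVT2[OF t, of "\<lambda>t. h (x + t *\<^sub>R b)" "\<lambda>t. h' (x + t *\<^sub>R b)"] der' by blast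
    then have "\<bar>h (x + t *\<^sub>R b) - h x\<bar> = t * \<bar>h' (x + z *\<^sub>R b)\<bar>" using t by (simp add: abs_mult)
    also have "\<dots> \<le> t * B" using B t by (intro mult_left_mono) auto
    finally show ?thesis by (simp add: mult.commute)
  qed
  obtain R where R: "\<And>x. x \<in> K \<Longrightarrow> norm x \<le> R" using K by (auto simp: bounded_iff)
  define t where "t n = 1 / real (Suc n)" for n
  have t: "t n > 0" "t n \<le> 1" for n by (auto simp: t_def)
  have t0: "t \<longlonglongrightarrow> 0" unfolding t_def by (rule LIMSEQ_Suc[OF lim_1_over_n])
  define q where "q n x = (h (x + t n *\<^sub>R b) - h x) / t n" for n x
  have hm: "h \<in> borel_measurable borel" using borel_measurable_integrable[OF hi] by simp
  have sh: "integrable lborel (\<lambda>x. h (x + c))" "(LINT x|lborel. h (x + c)) = (LINT x|lborel. h x)" for c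
  proof -
    have "integrable (distr lborel borel ((+) c)) h" using hi by (simp add: lborel_distr_plus)
    then show "integrable lborel (\<lambda>x. h (x + c))" by (subst (asm) integrable_distr_eq[OF _ hm]) (auto simp: add.commute)
    have "(LINT x|lborel. h x) = (LINT x|distr lborel borel ((+) c). h x)" by (simp add: lborel_distr_plus)
    also have "\<dots> = (LINT x|lborel. h (c + x))"
      by (rule integral_distr[OF _ hm]) simp
    finally show "(LINT x|lborel. h (x + c)) = (LINT x|lborel. h x)" by (simp add: add.commute)
  qed
  have q0: "(LINT x|lborel. q n x) = 0" for n
    unfolding q_def using sh[of "t n *\<^sub>R b"] hi by (simp add: Bochner_Integration.integral_diff)
  have "(\<lambda>n. LINT x|lborel. q n x) \<longlonglongrightarrow> (LINT x|lborel. h' x)"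
  proof (rule integral_dominated_convergence)
    \<comment> \<open>The steps \<open>t n\<close> are at most 1, so outside this ball both points
      of the difference quotient miss \<open>K\<close>.\<close>
    show "integrable lborel (\<lambda>x::'e. B * indicator (cball 0 (R + norm b)) x)"
      by (intro integrable_mult_right integrable_real_indicator)
        (use emeasure_bounded_finite[OF bounded_cball[of "0::'e" "R + norm b"]] in auto)
    show "h' \<in> borel_measurable lborel" using h' by simp
    show "q n \<in> borel_measurable lborel" for n
      unfolding q_def using sh(1)[of "t n *\<^sub>R b"] hi by (intro borel_measurable_integrable) auto
    show "AE x in lborel. (\<lambda>n. q n x) \<longlonglongrightarrow> h' x"
    proof (intro AE_I2)
      fix x
      have "((\<lambda>s. (h (x + s *\<^sub>R b) - h x) / s) \<longlongrightarrow> h' x) (at 0)"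
        using der[of x] by (simp add: has_field_derivative_iff)
      then show "(\<lambda>n. q n x) \<longlonglongrightarrow> h' x"
        unfolding q_def by (rule filterlim_compose) (use t0 t in \<open>auto simp: filterlim_at intro!: always_eventually less_imp_neq[symmetric]\<close>)
    qed
    show "AE x in lborel. norm (q n x) \<le> B * indicator (cball 0 (R + norm b)) x" for n
    proof (intro AE_I2)
      fix x
      show "norm (q n x) \<le> B * indicator (cball 0 (R + norm b)) x"
      proof (cases "x \<in> cball 0 (R + norm b)")
        case True
        then show ?thesis using lip[OF t(1), of x n] t(1)[of n] by (simp add: q_def abs_divide divide_le_eq)
      next
        case False
        then have big: "norm x > R + norm b" by (simp add: not_le)
        have "norm (t n *\<^sub>R b) \<le> norm b" using t[of n] by (simp add: mult_left_le_one_le)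
        then have "norm (x + t n *\<^sub>R b) > R" using big norm_diff_ineq[of x "t n *\<^sub>R b"] by linarith
        then have "x + t n *\<^sub>R b \<notin> K" "x \<notin> K" using R[of "x + t n *\<^sub>R b"] R[of x] big norm_ge_zero[of b] by force+
        then show ?thesis using off False by (simp add: q_def)
      qed
    qed
  qed
  then show ?thesis by (simp add: q0 LIMSEQ_const_iff)
qed

section \<open>Distributional derivatives along smooth fields\<close>

lemma smooth_on_has_derivative:
  assumes "open U" "smooth_on U Z" "x \<in> U"
  shows "(Z has_derivative frechet_derivative Z (at x)) (at x)"
proof -
  have "Ck_on (Suc 0) U Z" using assms(2) by (simp only: smooth_on_def)
  then have "Z differentiable at x within U" using assms(3) by (simp add: differentiable_on_def)
  then have "Z differentiable at x" using at_within_open[OF assms(3,1)] by simp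
  then show ?thesis by (simp only: frechet_derivative_works)
qed

lemma smooth_on_derivative_continuous:
  assumes "smooth_on U Z"
  shows "continuous_on U (\<lambda>x. frechet_derivative Z (at x) v)"
proof -
  have "Ck_on (Suc 0) U Z" using assms by (simp only: smooth_on_def)
  then show ?thesis by simp
qed

lemma smooth_on_continuous: "smooth_on U Z \<Longrightarrow> continuous_on U Z"
proof -
  assume "smooth_on U Z"
  then have "Ck_on 0 U Z" by (simp only: smooth_on_def)
  then show ?thesis by simp
qed

lemma Ck_on_const_field: "Ck_on n U (\<lambda>_. c)"
proof (induction n arbitrary: c)
  case (Suc n)
  then show ?case by (simp add: frechet_derivative_const)
qed simp

lemma smooth_on_const: "smooth_on U (\<lambda>_. c)"
  by (simp add: smooth_on_def Ck_on_const_field)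

text \<open>The extension of \<open>h\<close> by zero is differentiable on the whole space, because
  \<open>U\<close> and the complement of \<open>K\<close> are open and cover it.\<close>

lemma integral_partial_derivative_zero:
  fixes h :: "'e::euclidean_space \<Rightarrow> real"
  assumes U: "open U" and K: "compact K" "K \<subseteq> U"
    and der: "\<And>x. x \<in> U \<Longrightarrow> (h has_derivative h' x) (at x)"
    and cont: "continuous_on U (\<lambda>x. h' x b)"
    and off: "\<And>x. x \<in> U \<Longrightarrow> x \<notin> K \<Longrightarrow> h x = 0"
  shows "set_integrable lborel U (\<lambda>x. h' x b)" "(LINT x:U|lborel. h' x b) = 0"
proof -
  define h0 where "h0 x = (if x \<in> U then h x else 0)" for x
  define h1 where "h1 x = (if x \<in> U then h' x b else 0)" for x
  have h0': "(h0 has_derivative (if x \<in> U then h' x else (\<lambda>_. 0))) (at x)" for x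
  proof (cases "x \<in> U")
    case True
    have "(h0 has_derivative h' x) (at x)"
      by (rule has_derivative_transform_within_open[OF der[OF True] U True]) (simp add: h0_def)
    then show ?thesis using True by simp
  next
    case False
    then have "x \<in> - K" using K by auto
    have "(h0 has_derivative (\<lambda>_. 0)) (at x)"
      by (rule has_derivative_transform_within_open[OF has_derivative_const[of 0] open_Compl \<open>x \<in> - K\<close>])
        (use K off in \<open>auto simp: h0_def compact_imp_closed\<close>)
    then show ?thesis using False by simp
  qed
  have h1off: "h1 x = 0" if "x \<notin> K" for x
  proof (cases "x \<in> U")
    case True
    have "(h0 has_derivative (\<lambda>_. 0)) (at x)"
      by (rule has_derivative_transform_within_open[OF has_derivative_const[of 0] open_Compl])
        (use K off that in \<open>auto simp: h0_def compact_imp_closed\<close>)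
    from has_derivative_unique[OF this h0'[of x]] have "h' x = (\<lambda>_. 0)" using True by simp
    then show ?thesis by (simp add: h1_def)
  qed (simp add: h1_def)
  have cK: "continuous_on K (\<lambda>x. h' x b)" by (rule continuous_on_subset[OF cont K(2)])
  have h1eq: "h1 x = indicator K x *\<^sub>R h' x b" for x
    using h1off[of x] K(2) by (auto simp: h1_def indicator_def)
  have i1: "integrable lborel h1"
    using borel_integrable_compact[OF K(1) cK] unfolding h1eq[abs_def] indicator_scaleR_eq_if
    by (simp cong: if_cong)
  have h1U: "h1 x = indicator U x *\<^sub>R h' x b" for x by (simp add: h1_def)
  show "set_integrable lborel U (\<lambda>x. h' x b)"
    using i1 unfolding set_integrable_def h1U[abs_def] .
  obtain B where B: "\<And>x. x \<in> K \<Longrightarrow> \<bar>h' x b\<bar> \<le> B"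
    using compact_imp_bounded[OF compact_continuous_image[OF cK K(1)]] by (auto simp: bounded_iff)
  have "(LINT x|lborel. h1 x) = 0"
  proof (rule integral_directional_derivative_zero)
    have "continuous_on UNIV h0"
      by (rule continuous_at_imp_continuous_on) (rule ballI, rule has_derivative_continuous[OF h0'])
    then have "integrable lborel (\<lambda>x. indicator K x *\<^sub>R h0 x)"
      by (intro borel_integrable_compact[OF K(1)]) (rule continuous_on_subset[OF _ subset_UNIV])
    moreover have "(\<lambda>x. indicator K x *\<^sub>R h0 x) = h0" using off by (auto simp: h0_def fun_eq_iff indicator_def)
    ultimately show "integrable lborel h0" by simp
    show "h1 \<in> borel_measurable borel" using borel_measurable_integrable[OF i1] by simp
    show "bounded K" using K by (simp add: compact_imp_bounded)
    show "h0 x = 0" if "x \<notin> K" for x using off that by (simp add: h0_def)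
    show "\<bar>h1 x\<bar> \<le> \<bar>B\<bar>" for x
      using B[of x] by (auto simp: h1eq indicator_def)
    show "((\<lambda>t. h0 (x + t *\<^sub>R b)) has_real_derivative h1 x) (at 0)" for x
    proof -
      have "((\<lambda>t. x + t *\<^sub>R b) has_derivative (\<lambda>t. t *\<^sub>R b)) (at 0)" by (auto intro!: derivative_eq_intros)
      moreover have "(h0 has_derivative (if x \<in> U then h' x else (\<lambda>_. 0))) (at (x + 0 *\<^sub>R b))" using h0'[of x] by simp
      ultimately have "((\<lambda>t. h0 (x + t *\<^sub>R b)) has_derivative (\<lambda>t. (if x \<in> U then h' x else (\<lambda>_. 0)) (t *\<^sub>R b))) (at 0)"
        by (rule has_derivative_compose)
      moreover have "(\<lambda>t. (if x \<in> U then h' x else (\<lambda>_. 0)) (t *\<^sub>R b)) = (\<lambda>t. h1 x * t)"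
        using has_derivative_linear[OF der] by (auto simp: h1_def linear_scale fun_eq_iff)
      ultimately show ?thesis by (simp add: has_field_derivative_def)
    qed
  qed
  then show "(LINT x:U|lborel. h' x b) = 0" unfolding set_lebesgue_integral_def h1U[abs_def] .
qed

text \<open>The divergence theorem for the compactly supported field \<open>f \<phi> Z\<close>. It
  handles those terms of the Koszul formula that pair a field with \<open>d_r\<close> and hence do
  not involve the metrics of the slices.\<close>

lemma dist_deriv_C1:
  fixes f \<phi> :: "'e::euclidean_space \<Rightarrow> real"
  assumes U: "open U" and Z: "smooth_on U Z" and \<phi>: "test_fun U \<phi>"
    and f: "\<And>x. x \<in> U \<Longrightarrow> (f has_derivative f' x) (at x)" and cf: "\<And>v. continuous_on U (\<lambda>x. f' x v)"
  shows "set_integrable lborel U (\<lambda>x. f' x (Z x) * \<phi> x)"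
    "dist_deriv U Z f \<phi> = (LINT x:U|lborel. f' x (Z x) * \<phi> x)"
proof -
  obtain K where K: "compact K" "K \<subseteq> U" and \<phi>0: "\<And>x. x \<notin> K \<Longrightarrow> \<phi> x = 0"
    using \<phi> by (auto simp: test_fun_def)
  have s\<phi>: "smooth_on UNIV \<phi>" using \<phi> by (simp add: test_fun_def)
  define \<phi>' where "\<phi>' x = frechet_derivative \<phi> (at x)" for x
  define Z' where "Z' x = frechet_derivative Z (at x)" for x
  have d\<phi>: "(\<phi> has_derivative \<phi>' x) (at x)" for x
    unfolding \<phi>'_def by (rule smooth_on_has_derivative[OF open_UNIV s\<phi>]) simp
  have c\<phi>: "continuous_on U (\<lambda>x. \<phi>' x v)" for v
    unfolding \<phi>'_def by (rule continuous_on_subset[OF smooth_on_derivative_continuous[OF s\<phi>]]) simp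
  have dZ: "(Z has_derivative Z' x) (at x)" if "x \<in> U" for x
    unfolding Z'_def by (rule smooth_on_has_derivative[OF U Z that])
  have cZ: "continuous_on U (\<lambda>x. Z' x v)" for v
    unfolding Z'_def by (rule smooth_on_derivative_continuous[OF Z])
  have cZ0: "continuous_on U Z" by (rule smooth_on_continuous[OF Z])
  have cf0: "continuous_on U f"
    by (rule continuous_at_imp_continuous_on) (rule ballI, rule has_derivative_continuous[OF f])
  have c\<phi>0: "continuous_on U \<phi>" by (rule test_fun_continuous[OF \<phi>])
  \<comment> \<open>The derivative of the \<open>b\<close>-component of the field in the direction
    \<open>v\<close>. With \<open>v = b\<close>, summed over the basis, it is \<open>f\<close> times
    the divergence of \<open>\<phi> Z\<close> plus \<open>\<phi>\<close> times the derivative of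
    \<open>f\<close> along \<open>Z\<close>, while each summand has integral 0.\<close>
  define hd where "hd b x v = f x * (\<phi> x * (Z' x v \<bullet> b) + \<phi>' x v * (Z x \<bullet> b)) + f' x v * (\<phi> x * (Z x \<bullet> b))" for b x v
  have dh: "((\<lambda>x. f x * (\<phi> x * (Z x \<bullet> b))) has_derivative hd b x) (at x)" if x: "x \<in> U" for b x
    unfolding hd_def
    by (intro has_derivative_mult f x d\<phi> has_derivative_inner_left dZ)
  have ch: "continuous_on U (\<lambda>x. hd b x v)" for b v
    unfolding hd_def by (intro continuous_intros cf0 c\<phi>0 cZ c\<phi> cZ0 cf)
  note z = integral_partial_derivative_zero[OF U K dh ch]
  have iz: "set_integrable lborel U (\<lambda>x. hd b x b)" "(LINT x:U|lborel. hd b x b) = 0" for b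
    using z[of b b] \<phi>0 by auto
  have div: "divergence (\<lambda>z. \<phi> z *\<^sub>R Z z) x = (\<Sum>b\<in>Basis. \<phi> x * (Z' x b \<bullet> b) + \<phi>' x b * (Z x \<bullet> b))" if x: "x \<in> U" for x
  proof -
    have "((\<lambda>z. \<phi> z *\<^sub>R Z z) has_derivative (\<lambda>v. \<phi> x *\<^sub>R Z' x v + \<phi>' x v *\<^sub>R Z x)) (at x)"
      by (rule has_derivative_scaleR[OF d\<phi> dZ[OF x]])
    note fd = frechet_derivative_at[OF this]
    show ?thesis
      unfolding divergence_def by (subst fd[symmetric]) (simp add: inner_add_left)
  qed
  have fZ: "f' x (Z x) = (\<Sum>b\<in>Basis. (Z x \<bullet> b) * f' x b)" if x: "x \<in> U" for x
  proof -
    have lin: "linear (f' x)" by (rule has_derivative_linear[OF f[OF x]])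
    have "f' x (Z x) = f' x (\<Sum>b\<in>Basis. (Z x \<bullet> b) *\<^sub>R b)" by (simp add: euclidean_representation)
    also have "\<dots> = (\<Sum>b\<in>Basis. (Z x \<bullet> b) * f' x b)"
      by (simp add: linear_sum[OF lin] linear_scale[OF lin])
    finally show ?thesis .
  qed
  have cfZ: "continuous_on U (\<lambda>x. f' x (Z x))"
  proof -
    have "continuous_on U (\<lambda>x. \<Sum>b\<in>Basis. (Z x \<bullet> b) * f' x b)" by (intro continuous_intros cZ0 cf)
    then show ?thesis by (rule continuous_on_eq) (rule fZ[symmetric])
  qed
  show i1: "set_integrable lborel U (\<lambda>x. f' x (Z x) * \<phi> x)"
    by (intro L1_loc_test_integrable[OF _ \<phi>] L2_imp_L1_loc L2_loc_continuous U cfZ)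
  have sum: "(\<Sum>b\<in>Basis. hd b x b) = f x * divergence (\<lambda>z. \<phi> z *\<^sub>R Z z) x + f' x (Z x) * \<phi> x" if x: "x \<in> U" for x
    unfolding div[OF x] fZ[OF x] hd_def sum_distrib_left sum_distrib_right sum.distrib[symmetric]
    by (intro sum.cong refl) (simp add: algebra_simps)
  have isum: "set_integrable lborel U (\<lambda>x. \<Sum>b\<in>Basis. hd b x b)"
    using iz(1) unfolding set_integrable_def scaleR_sum_right by (intro Bochner_Integration.integrable_sum)
  have "(LINT x:U|lborel. \<Sum>b\<in>Basis. hd b x b) = (\<Sum>b\<in>Basis. LINT x:U|lborel. hd b x b)"
    using iz(1) unfolding set_integrable_def set_lebesgue_integral_def scaleR_sum_right
    by (intro Bochner_Integration.integral_sum)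
  then have 0: "(LINT x:U|lborel. \<Sum>b\<in>Basis. hd b x b) = 0" using iz(2) by simp
  have "(LINT x:U|lborel. f x * divergence (\<lambda>z. \<phi> z *\<^sub>R Z z) x) =
      (LINT x:U|lborel. (\<Sum>b\<in>Basis. hd b x b) - f' x (Z x) * \<phi> x)"
    unfolding set_lebesgue_integral_def
    by (intro Bochner_Integration.integral_cong refl) (auto simp: sum indicator_def)
  also have "\<dots> = (LINT x:U|lborel. \<Sum>b\<in>Basis. hd b x b) - (LINT x:U|lborel. f' x (Z x) * \<phi> x)"
    by (rule set_integral_diff(2)[OF isum i1])
  finally show "dist_deriv U Z f \<phi> = (LINT x:U|lborel. f' x (Z x) * \<phi> x)"
    by (simp add: dist_deriv_def 0)
qed

lemma divergence_const_field:
  fixes \<phi> :: "'e::euclidean_space \<Rightarrow> real"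
  assumes "test_fun U \<phi>"
  shows "divergence (\<lambda>z. \<phi> z *\<^sub>R b) x = frechet_derivative \<phi> (at x) b"
proof -
  have s: "smooth_on UNIV \<phi>" using assms by (simp add: test_fun_def)
  have d: "(\<phi> has_derivative frechet_derivative \<phi> (at x)) (at x)"
    by (rule smooth_on_has_derivative[OF open_UNIV s]) simp
  have "((\<lambda>z. \<phi> z *\<^sub>R b) has_derivative (\<lambda>v. frechet_derivative \<phi> (at x) v *\<^sub>R b)) (at x)"
    by (rule has_derivative_scaleR_left[OF d])
  from frechet_derivative_at[OF this] have "divergence (\<lambda>z. \<phi> z *\<^sub>R b) x = (\<Sum>e\<in>Basis. frechet_derivative \<phi> (at x) e * (b \<bullet> e))"
    unfolding divergence_def by (metis inner_scaleR_left)
  also have "\<dots> = frechet_derivative \<phi> (at x) (\<Sum>e\<in>Basis. (b \<bullet> e) *\<^sub>R e)"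
    using has_derivative_linear[OF d] by (simp add: linear_sum linear_scale mult.commute)
  finally show ?thesis by (simp add: euclidean_representation)
qed

section \<open>Identification of fields up to null sets\<close>

lemma set_integral_cong:
  assumes "\<And>x. x \<in> A \<Longrightarrow> f x = g x"
  shows "(LINT x:A|M. f x) = (LINT x:A|M. g x)"
  unfolding set_lebesgue_integral_def
  by (intro Bochner_Integration.integral_cong refl) (use assms in \<open>auto simp: indicator_def\<close>)

lemma L2_loc_fields_AE_eq:
  fixes W W' :: "'e::euclidean_space \<Rightarrow> 'b::euclidean_space"
  assumes U: "open U" and W: "L2_loc U W" "L2_loc U W'"
    and eq: "\<And>\<phi> c. c \<in> Basis \<Longrightarrow> test_fun U \<phi> \<Longrightarrow> (LINT x:U|lborel. (W x \<bullet> c) * \<phi> x) = (LINT x:U|lborel. (W' x \<bullet> c) * \<phi> x)"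
  shows "AE x in lborel. x \<in> U \<longrightarrow> W x = W' x"
proof -
  have L: "L2_loc U (\<lambda>x. W x \<bullet> c)" "L2_loc U (\<lambda>x. W' x \<bullet> c)" for c
    using L2_loc_inner_continuous[OF U _ continuous_on_const] W by auto
  have "AE x in lborel. x \<in> U \<longrightarrow> W x \<bullet> c - W' x \<bullet> c = 0" if c: "c \<in> Basis" for c
  proof (rule fundamental_lemma_variations[OF U])
    have "L2_loc U (\<lambda>x. W x \<bullet> c + W' x \<bullet> (- c))"
      by (intro L2_loc_add L)
    then show "L1_loc U (\<lambda>x. W x \<bullet> c - W' x \<bullet> c)" by (intro L2_imp_L1_loc U) simp
    fix \<phi> assume \<phi>: "test_fun U \<phi>"
    have "(LINT x:U|lborel. (W x \<bullet> c) * \<phi> x - (W' x \<bullet> c) * \<phi> x) = 0"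
      using eq[OF c \<phi>] by (subst set_integral_diff(2)) (auto intro!: L1_loc_test_integrable[OF L2_imp_L1_loc[OF U L(1)] \<phi>]
        L1_loc_test_integrable[OF L2_imp_L1_loc[OF U L(2)] \<phi>])
    then show "(LINT x:U|lborel. (W x \<bullet> c - W' x \<bullet> c) * \<phi> x) = 0" by (simp add: left_diff_distrib)
  qed
  then have "AE x in lborel. \<forall>c\<in>Basis. x \<in> U \<longrightarrow> W x \<bullet> c - W' x \<bullet> c = 0"
    by (subst AE_ball_countable) (auto intro: countable_finite)
  then show ?thesis by eventually_elim (auto intro: euclidean_eqI)
qed

lemma weak_gradient_unique:
  assumes "open U" "weak_gradient U u D" "weak_gradient U u D'"
  shows "AE x in lborel. x \<in> U \<longrightarrow> D x = D' x"
proof (rule L2_loc_fields_AE_eq[OF assms(1)])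
  fix \<phi> c assume "test_fun U \<phi>"
  then show "(LINT x:U|lborel. (D x \<bullet> c) * \<phi> x) = (LINT x:U|lborel. (D' x \<bullet> c) * \<phi> x)"
    using assms(2,3) unfolding weak_gradient_def by (metis minus_equation_iff)
qed (use assms in \<open>auto simp: weak_gradient_def\<close>)

text \<open>One known weak gradient shows that the choice in \<open>wgrad\<close> is a genuine one,
  and uniqueness identifies its result up to a null set.\<close>

lemma wgrad_AE_eq:
  assumes "open U" "weak_gradient U u D"
  shows "weak_gradient U u (wgrad U u)" "AE x in lborel. x \<in> U \<longrightarrow> wgrad U u x = D x"
proof -
  show 1: "weak_gradient U u (wgrad U u)" unfolding wgrad_def by (rule someI[of "\<lambda>D. weak_gradient U u D"]) (rule assms(2))
  show "AE x in lborel. x \<in> U \<longrightarrow> wgrad U u x = D x"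
    by (rule weak_gradient_unique[OF assms(1) 1 assms(2)])
qed

section \<open>Continuity of matrix operations\<close>

lemma continuous_on_matrix_mult:
  fixes A :: "'a::topological_space \<Rightarrow> real ^ 'n::finite ^ 'm::finite" and B :: "'a \<Rightarrow> real ^ 'p::finite ^ 'n"
  assumes "continuous_on S A" "continuous_on S B"
  shows "continuous_on S (\<lambda>x. A x ** B x)"
  unfolding matrix_matrix_mult_def
  by (intro continuous_on_vec_lambda continuous_on_sum continuous_on_mult continuous_on_component assms)

lemma continuous_on_matrix_vector_mult:
  fixes A :: "'a::topological_space \<Rightarrow> real ^ 'n::finite ^ 'm::finite" and v :: "'a \<Rightarrow> real ^ 'n"
  assumes "continuous_on S A" "continuous_on S v"
  shows "continuous_on S (\<lambda>x. A x *v v x)"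
  unfolding matrix_vector_mult_def
  by (intro continuous_on_vec_lambda continuous_on_sum continuous_on_mult continuous_on_component assms)

lemma continuous_on_transpose:
  fixes A :: "'a::topological_space \<Rightarrow> real ^ 'n::finite ^ 'm::finite"
  assumes "continuous_on S A"
  shows "continuous_on S (\<lambda>x. transpose (A x))"
  unfolding transpose_def by (intro continuous_on_vec_lambda continuous_on_component assms)

lemma continuous_on_det:
  fixes A :: "'a::topological_space \<Rightarrow> real ^ 'n::finite ^ 'n"
  assumes "continuous_on S A"
  shows "continuous_on S (\<lambda>x. det (A x))"
  unfolding det_def
  by (intro continuous_on_sum continuous_on_mult continuous_on_const continuous_on_prod continuous_on_component assms)

text \<open>By Cramer's rule the entries of the inverse are quotients of determinants;
  \<open>E l k x\<close> is \<open>A x\<close> with its column \<open>k\<close> replaced by the unit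
  vector \<open>axis l 1\<close>.\<close>

lemma continuous_on_matrix_inv:
  fixes A :: "'a::topological_space \<Rightarrow> real ^ 'n::finite ^ 'n"
  assumes A: "continuous_on S A" and inv: "\<And>x. x \<in> S \<Longrightarrow> invertible (A x)"
  shows "continuous_on S (\<lambda>x. matrix_inv (A x))"
proof -
  define E where "E l k x = (\<chi> i j. if j = k then axis l 1 $ i else A x $ i $ j)" for l k x
  have eq: "matrix_inv (A x) = (\<chi> k l. det (E l k x) / det (A x))" if x: "x \<in> S" for x
  proof -
    have "matrix_inv (A x) $ k $ l = det (E l k x) / det (A x)" for k l
    proof -
      have "A x *v (matrix_inv (A x) *v axis l 1) = axis l 1"
        by (rule matrix_inv_mult(4)[OF inv[OF x]])
      then have "matrix_inv (A x) *v axis l 1 = (\<chi> k. det (E l k x) / det (A x))"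
        using inv[OF x] cramer[of "A x"] unfolding E_def by (simp add: invertible_det_nz)
      moreover have "(matrix_inv (A x) *v axis l 1) $ k = matrix_inv (A x) $ k $ l"
        by (simp add: matrix_vector_mult_def axis_def if_distrib cong: if_cong)
      ultimately show ?thesis by simp
    qed
    then show ?thesis by (simp add: vec_eq_iff)
  qed
  have "continuous_on S (E l k)" for l k
    unfolding E_def
  proof (intro continuous_on_vec_lambda)
    show "continuous_on S (\<lambda>x. if j = k then axis l 1 $ i else A x $ i $ j)" for i j
      by (cases "j = k") (auto intro!: continuous_on_const continuous_on_component A)
  qed
  then have "continuous_on S (\<lambda>x. (\<chi> k l. det (E l k x) / det (A x)))"
    by (intro continuous_on_vec_lambda continuous_on_divide continuous_on_det A)
      (use inv in \<open>auto simp: invertible_det_nz\<close>)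
  then show ?thesis by (subst continuous_on_cong[OF refl eq]) auto
qed

section \<open>Distributional curvature of a cylinder\<close>

lemma test_fun_derivative:
  fixes \<phi> :: "'e::euclidean_space \<Rightarrow> real"
  assumes "test_fun U \<phi>"
  shows "(\<phi> has_derivative frechet_derivative \<phi> (at x)) (at x)"
    "continuous_on V (\<lambda>x. frechet_derivative \<phi> (at x) v)"
proof -
  have s: "smooth_on UNIV \<phi>" using assms by (simp add: test_fun_def)
  show "(\<phi> has_derivative frechet_derivative \<phi> (at x)) (at x)"
    by (rule smooth_on_has_derivative[OF open_UNIV s]) simp
  show "continuous_on V (\<lambda>x. frechet_derivative \<phi> (at x) v)"
    by (rule continuous_on_subset[OF smooth_on_derivative_continuous[OF s]]) simp
qed

lemma test_fun_support:
  fixes \<phi> :: "'e::euclidean_space \<Rightarrow> real"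
  assumes "test_fun U \<phi>"
  obtains K where "compact K" "K \<subseteq> U" "\<And>x. x \<notin> K \<Longrightarrow> \<phi> x = 0"
    "\<And>x v. x \<notin> K \<Longrightarrow> frechet_derivative \<phi> (at x) v = 0"
proof -
  obtain K where K: "compact K" "K \<subseteq> U" "\<And>x. x \<notin> K \<Longrightarrow> \<phi> x = 0"
    using assms by (auto simp: test_fun_def)
  have "frechet_derivative \<phi> (at x) v = 0" if x: "x \<notin> K" for x v
  proof -
    have "open (- K)" "x \<in> - K" using K(1) x by (auto intro: compact_imp_closed)
    then have "(\<phi> has_derivative (\<lambda>_. 0)) (at x)"
      by (rule has_derivative_transform_within_open[OF has_derivative_const[of 0]]) (use K(3) in auto)
    from frechet_derivative_at[OF this] show ?thesis by metis
  qed
  with K that show thesis by blast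
qed

text \<open>A weak derivative along \<open>d_r\<close>. Integrability is part of the notion because
  the integral of a nonintegrable function is 0 by convention, and sums could not be split without
  it.\<close>

definition r_derivative ::
  "(real \<times> (real ^ 'k::finite)) set \<Rightarrow> (real \<times> (real ^ 'k) \<Rightarrow> real) \<Rightarrow> (real \<times> (real ^ 'k) \<Rightarrow> real) \<Rightarrow> bool" where
  "r_derivative U f e \<longleftrightarrow> (\<forall>\<phi>. test_fun U \<phi> \<longrightarrow>
     set_integrable lborel U (\<lambda>q. f q * frechet_derivative \<phi> (at q) (1, 0)) \<and>
     set_integrable lborel U (\<lambda>q. e q * \<phi> q) \<and>
     (LINT q:U|lborel. f q * frechet_derivative \<phi> (at q) (1, 0)) = - (LINT q:U|lborel. e q * \<phi> q))"

lemma r_derivative_dist_deriv: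
  assumes "r_derivative U f e" "test_fun U \<phi>"
  shows "dist_deriv U d_r f \<phi> = (LINT q:U|lborel. e q * \<phi> q)"
  using assms divergence_const_field[OF assms(2), of "(1, 0)"]
  by (simp add: r_derivative_def dist_deriv_def d_r_def)

lemma r_derivative_add:
  assumes "r_derivative U f e" "r_derivative U f' e'"
  shows "r_derivative U (\<lambda>q. f q + f' q) (\<lambda>q. e q + e' q)"
  using assms unfolding r_derivative_def distrib_right
  by (simp add: set_integral_add)

lemma r_derivative_sum:
  assumes "finite I" "\<And>i. i \<in> I \<Longrightarrow> r_derivative U (f i) (e i)"
  shows "r_derivative U (\<lambda>q. \<Sum>i\<in>I. f i q) (\<lambda>q. \<Sum>i\<in>I. e i q)"
  using assms
proof (induction I rule: finite_induct)
  case empty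
  then show ?case by (simp add: r_derivative_def set_integrable_def set_lebesgue_integral_def)
next
  case (insert i I)
  then show ?case by (simp add: r_derivative_add)
qed

text \<open>The shape of the terms of \<open>g(Z, Z')\<close>: an entry of the Gram matrix, which is
  only absolutely continuous in r, times a factor with a classical derivative in r.\<close>

lemma r_derivative_product:
  fixes u d :: "real \<Rightarrow> real" and C :: "(real ^ 'k::finite) set"
  assumes u: "ac_deriv u d" and d: "L2_loc {0<..} d" and C: "open C"
    and p: "continuous_on ({0<..} \<times> C) p" and pr: "continuous_on ({0<..} \<times> C) pr"
    and der: "\<And>r x. r > 0 \<Longrightarrow> x \<in> C \<Longrightarrow> ((\<lambda>r. p (r, x)) has_real_derivative pr (r, x)) (at r)"
  shows "r_derivative ({0<..} \<times> C) (\<lambda>q. u (fst q) * p q) (\<lambda>q. d (fst q) * p q + u (fst q) * pr q)"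
  unfolding r_derivative_def
proof (intro allI impI)
  let ?U = "{0::real<..} \<times> C"
  fix \<phi> assume \<phi>: "test_fun ?U \<phi>"
  obtain K where K: "compact K" "K \<subseteq> ?U" "\<And>x. x \<notin> K \<Longrightarrow> \<phi> x = 0"
    "\<And>x v. x \<notin> K \<Longrightarrow> frechet_derivative \<phi> (at x) v = 0"
    using test_fun_support[OF \<phi>] by blast
  have U: "open ({0::real<..} \<times> C)" using C by (intro open_Times) auto
  have d': "L1_loc ?U (\<lambda>q. d (fst q))" by (intro L2_imp_L1_loc U L2_loc_fst d C)
  have cu: "continuous_on ?U (\<lambda>q. u (fst q))"
    by (rule continuous_on_compose2[OF ac_deriv_continuous[OF u] continuous_on_fst[OF continuous_on_id]]) auto
  note c\<phi> = test_fun_continuous[OF \<phi>] and c\<phi>' = test_fun_derivative(2)[OF \<phi>]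
  have der': "((\<lambda>r. p (r, x) * \<phi> (r, x)) has_real_derivative
      (pr (r, x) * \<phi> (r, x) + p (r, x) * frechet_derivative \<phi> (at (r, x)) (1, 0))) (at r)"
    if "r > 0" "x \<in> C" for r x
  proof -
    have "((\<lambda>r. (r, x)) has_derivative (\<lambda>t. (t, 0))) (at r)" by (auto intro!: derivative_eq_intros)
    from has_derivative_compose[OF this test_fun_derivative(1)[OF \<phi>]]
    have "((\<lambda>r. \<phi> (r, x)) has_derivative (\<lambda>t. frechet_derivative \<phi> (at (r, x)) (t, 0))) (at r)" .
    moreover have "(\<lambda>t. frechet_derivative \<phi> (at (r, x)) (t, 0)) = (*) (frechet_derivative \<phi> (at (r, x)) (1, 0))"
    proof
      fix t show "frechet_derivative \<phi> (at (r, x)) (t, 0) = frechet_derivative \<phi> (at (r, x)) (1, 0) * t"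
        using linear_scale[OF has_derivative_linear[OF test_fun_derivative(1)[OF \<phi>, of "(r, x)"]], of t "(1, 0)"] by simp
    qed
    ultimately have "((\<lambda>r. \<phi> (r, x)) has_real_derivative frechet_derivative \<phi> (at (r, x)) (1, 0)) (at r)"
      unfolding has_field_derivative_def by (simp only:)
    from DERIV_mult[OF der[OF that] this] show ?thesis by (simp add: mult.commute add.commute)
  qed
  have c1: "continuous_on ?U (\<lambda>q. p q * \<phi> q)"
    by (intro continuous_on_mult p c\<phi>)
  have c2: "continuous_on ?U (\<lambda>q. pr q * \<phi> q + p q * frechet_derivative \<phi> (at q) (1, 0))"
    by (intro continuous_on_add continuous_on_mult p pr c\<phi> c\<phi>')
  have z1: "p q * \<phi> q = 0" if "q \<in> ?U" "q \<notin> K" for q using K(3)[OF that(2)] by simp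
  have z2: "pr q * \<phi> q + p q * frechet_derivative \<phi> (at q) (1, 0) = 0" if "q \<in> ?U" "q \<notin> K" for q
    using K(3,4)[OF that(2)] by simp
  note parts = cylinder_integrate_by_parts[OF u d' C c1 c2 der' K(1,2) z1 z2]
  have i1: "set_integrable lborel ?U (\<lambda>q. (u (fst q) * pr q) * \<phi> q)"
    by (intro L1_loc_test_integrable[OF _ \<phi>] L2_imp_L1_loc U L2_loc_continuous continuous_intros cu pr)
  have i2: "set_integrable lborel ?U (\<lambda>q. (u (fst q) * p q) * frechet_derivative \<phi> (at q) (1, 0))"
    by (rule L1_loc_integrable[OF _ c\<phi>' K(1,2)])
      (auto intro!: L2_imp_L1_loc U L2_loc_continuous continuous_intros cu p simp: K(4))
  have "(LINT q:?U|lborel. u (fst q) * (pr q * \<phi> q + p q * frechet_derivative \<phi> (at q) (1, 0))) =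
      (LINT q:?U|lborel. (u (fst q) * pr q) * \<phi> q) + (LINT q:?U|lborel. (u (fst q) * p q) * frechet_derivative \<phi> (at q) (1, 0))"
    unfolding set_integral_add(2)[OF i1 i2, symmetric] by (intro set_integral_cong) (simp add: algebra_simps)
  moreover have "(LINT q:?U|lborel. (d (fst q) * p q + u (fst q) * pr q) * \<phi> q) =
      (LINT q:?U|lborel. d (fst q) * (p q * \<phi> q)) + (LINT q:?U|lborel. (u (fst q) * pr q) * \<phi> q)"
  proof -
    have "(LINT q:?U|lborel. (d (fst q) * p q + u (fst q) * pr q) * \<phi> q) =
        (LINT q:?U|lborel. d (fst q) * (p q * \<phi> q) + (u (fst q) * pr q) * \<phi> q)"
      by (intro set_integral_cong) (simp add: algebra_simps)
    also have "\<dots> = (LINT q:?U|lborel. d (fst q) * (p q * \<phi> q)) + (LINT q:?U|lborel. (u (fst q) * pr q) * \<phi> q)"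
      by (rule set_integral_add(2)[OF parts(1) i1])
    finally show ?thesis .
  qed
  moreover have "set_integrable lborel ?U (\<lambda>q. (d (fst q) * p q + u (fst q) * pr q) * \<phi> q)"
    using set_integral_add(1)[OF parts(1) i1] by (simp add: algebra_simps)
  ultimately show "set_integrable lborel ?U (\<lambda>q. (u (fst q) * p q) * frechet_derivative \<phi> (at q) (1, 0)) \<and>
     set_integrable lborel ?U (\<lambda>q. (d (fst q) * p q + u (fst q) * pr q) * \<phi> q) \<and>
     (LINT q:?U|lborel. (u (fst q) * p q) * frechet_derivative \<phi> (at q) (1, 0)) =
       - (LINT q:?U|lborel. (d (fst q) * p q + u (fst q) * pr q) * \<phi> q)"
    using i2 parts(3) by simp
qed

lemma r_derivative_cong:
  assumes r: "r_derivative U f e" and f: "\<And>p. p \<in> U \<Longrightarrow> f' p = f p" and e: "\<And>p. p \<in> U \<Longrightarrow> e' p = e p"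
  shows "r_derivative U f' e'"
  unfolding r_derivative_def
proof (intro allI impI)
  fix \<phi> assume \<phi>: "test_fun U \<phi>"
  have 1: "indicator U q *\<^sub>R (f' q * z) = indicator U q *\<^sub>R (f q * z)"
    "indicator U q *\<^sub>R (e' q * z) = indicator U q *\<^sub>R (e q * z)" for q and z :: real
    using f[of q] e[of q] by (auto simp: indicator_def)
  show "set_integrable lborel U (\<lambda>q. f' q * frechet_derivative \<phi> (at q) (1, 0)) \<and>
     set_integrable lborel U (\<lambda>q. e' q * \<phi> q) \<and>
     (LINT q:U|lborel. f' q * frechet_derivative \<phi> (at q) (1, 0)) = - (LINT q:U|lborel. e' q * \<phi> q)"
    using r[unfolded r_derivative_def, rule_format, OF \<phi>]
    unfolding set_integrable_def set_lebesgue_integral_def 1 .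
qed

lemma ac_deriv_const: "ac_deriv (\<lambda>_. c) (\<lambda>_. 0)"
  by (simp add: ac_deriv_def set_integrable_def set_lebesgue_integral_def)

lemma trace_Basis:
  fixes A :: "real ^ 'k::finite ^ 'k"
  shows "trace A = (\<Sum>b\<in>Basis. (A *v b) \<bullet> b)"
proof -
  have B: "(Basis :: (real ^ 'k) set) = range (\<lambda>i. axis i 1)" by (auto simp: Basis_vec_def)
  have inj: "inj (\<lambda>i :: 'k. axis i (1 :: real))" by (auto simp: inj_on_def axis_eq_axis)
  have "(\<Sum>b\<in>Basis. (A *v b) \<bullet> b) = (\<Sum>i\<in>UNIV. (A *v axis i 1) \<bullet> axis i 1)"
    unfolding B by (subst sum.reindex[OF inj]) simp
  then show ?thesis
    by (simp add: inner_axis trace_def matrix_vector_mult_basis column_def)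
qed

lemma dist_deriv_cong:
  assumes "\<And>x. x \<in> U \<Longrightarrow> f x = f' x"
  shows "dist_deriv U X f \<phi> = dist_deriv U X f' \<phi>"
  unfolding dist_deriv_def by (intro arg_cong[of _ _ uminus] set_integral_cong) (use assms in simp)

text \<open>What remains of the Lie group in one chart: the columns of \<open>P x\<close> are the
  left-invariant frame, so \<open>matrix_inv (P x)\<close> passes to frame components, in which the
  metric of a slice is the Gram matrix \<open>M r\<close> and depends on r alone. \<open>D\<close>
  is the weak derivative of \<open>M\<close>.\<close>

locale cylinder_geometry =
  fixes C :: "(real ^ 'k::finite) set" and P :: "real ^ 'k \<Rightarrow> real ^ 'k ^ 'k" and M D :: "real \<Rightarrow> real ^ 'k ^ 'k"
    and g :: "real \<times> (real ^ 'k) \<Rightarrow> real \<times> (real ^ 'k) \<Rightarrow> real \<times> (real ^ 'k) \<Rightarrow> real"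
  assumes C: "open C" and P: "continuous_on C P" "\<And>x. x \<in> C \<Longrightarrow> invertible (P x)"
    and M: "\<And>r. r > 0 \<Longrightarrow> invertible (M r)" "\<And>r. r > 0 \<Longrightarrow> transpose (M r) = M r"
    and D: "ac_deriv M D" "L2_loc {0<..} D"
    and g: "\<And>r x u v. r > 0 \<Longrightarrow> x \<in> C \<Longrightarrow> g (r, x) u v =
      fst u * fst v + (M r *v (matrix_inv (P x) *v snd u)) \<bullet> (matrix_inv (P x) *v snd v)"
begin

abbreviation "U \<equiv> {0::real<..} \<times> C"

definition Q :: "real \<times> (real ^ 'k) \<Rightarrow> real ^ 'k ^ 'k" where "Q p = matrix_inv (P (snd p))"

text \<open>The shape operator of the slices \<open>r = const\<close> in the coordinate frame.\<close>

definition S :: "real \<times> (real ^ 'k) \<Rightarrow> real ^ 'k ^ 'k" where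
  "S p = (1 / 2) *\<^sub>R (P (snd p) ** (matrix_inv (M (fst p)) ** D (fst p)) ** Q p)"

text \<open>The classical formula for the covariant derivative of \<open>Z\<close> along
  \<open>d_r\<close>, and so the candidate with which the choice in \<open>nabla\<close> is
  compared.\<close>

definition conn :: "(real \<times> (real ^ 'k) \<Rightarrow> real \<times> (real ^ 'k)) \<Rightarrow> real \<times> (real ^ 'k) \<Rightarrow> real \<times> (real ^ 'k)" where
  "conn Z p = frechet_derivative Z (at p) (1, 0) + (0, S p *v snd (Z p))"

lemma U_open: "open U" using C by (intro open_Times) auto

lemma gU: "p \<in> U \<Longrightarrow> g p u v = fst u * fst v + (M (fst p) *v (Q p *v snd u)) \<bullet> (Q p *v snd v)"
  using g[of "fst p" "snd p" u v] by (auto simp: Q_def)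

lemma continuous_snd_C: "continuous_on C f \<Longrightarrow> continuous_on U (\<lambda>p. f (snd p))"
  by (rule continuous_on_compose2[of C f]) (auto intro!: continuous_intros)

lemma continuous_fst_pos: "continuous_on {0<..} f \<Longrightarrow> continuous_on U (\<lambda>p. f (fst p))"
  by (rule continuous_on_compose2[of "{0<..}" f]) (auto intro!: continuous_intros)

lemma continuous_Q: "continuous_on U Q"
  unfolding Q_def by (intro continuous_snd_C continuous_on_matrix_inv P)

lemma continuous_P: "continuous_on U (\<lambda>p. P (snd p))" by (intro continuous_snd_C P)

lemma continuous_M: "continuous_on U (\<lambda>p. M (fst p))"
  by (intro continuous_fst_pos ac_deriv_continuous[OF D(1)])

lemma continuous_Minv: "continuous_on U (\<lambda>p. matrix_inv (M (fst p)))"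
  by (intro continuous_fst_pos continuous_on_matrix_inv ac_deriv_continuous[OF D(1)] M) auto

lemma PQ: "p \<in> U \<Longrightarrow> Q p ** P (snd p) = mat 1" "p \<in> U \<Longrightarrow> P (snd p) ** Q p = mat 1"
  using matrix_inv_mult[OF P(2)] by (auto simp: Q_def)

lemma MM: "p \<in> U \<Longrightarrow> M (fst p) ** matrix_inv (M (fst p)) = mat 1"
  "p \<in> U \<Longrightarrow> matrix_inv (M (fst p)) ** M (fst p) = mat 1"
  using matrix_inv_mult[OF M(1)] by auto

lemma continuous_g:
  assumes "continuous_on U u" "continuous_on U v"
  shows "continuous_on U (\<lambda>p. g p (u p) (v p))"
proof -
  have "continuous_on U (\<lambda>p. fst (u p) * fst (v p) + (M (fst p) *v (Q p *v snd (u p))) \<bullet> (Q p *v snd (v p)))"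
    by (intro continuous_intros continuous_on_matrix_vector_mult continuous_M continuous_Q assms)
  then show ?thesis by (rule continuous_on_eq) (rule gU[symmetric])
qed

lemma D_entry: "ac_deriv (\<lambda>r. M r $ a $ b) (\<lambda>r. D r $ a $ b)" "L2_loc {0<..} (\<lambda>r. D r $ a $ b)"
proof -
  show "ac_deriv (\<lambda>r. M r $ a $ b) (\<lambda>r. D r $ a $ b)"
    by (rule ac_deriv_linear[OF _ D(1)])
      (rule bounded_linear_compose[OF bounded_linear_vec_nth bounded_linear_vec_nth])
  have "L2_loc {0<..} (\<lambda>r. D r \<bullet> axis a (axis b 1))"
    by (intro L2_loc_inner_continuous D) (auto intro: continuous_intros)
  then show "L2_loc {0<..} (\<lambda>r. D r $ a $ b)" by (simp add: inner_axis)
qed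

text \<open>Separates the linear dependence of the shape operator on the matrix \<open>D\<close>,
  which is only square integrable, from its continuous dependence on the point, as
  \<open>L2_loc_linear_field\<close> requires.\<close>

definition Sof :: "real \<times> (real ^ 'k) \<Rightarrow> real ^ 'k ^ 'k \<Rightarrow> real ^ 'k ^ 'k" where
  "Sof p A = (1 / 2) *\<^sub>R (P (snd p) ** (matrix_inv (M (fst p)) ** A) ** Q p)"

lemma S_Sof: "S p = Sof p (D (fst p))" by (simp add: S_def Sof_def)

lemma linear_Sof: "linear (Sof p)"
  by (rule linearI)
    (simp_all add: Sof_def matrix_add_ldistrib matrix_add_rdistrib scaleR_add_right
      scalar_matrix_assoc[symmetric] matrix_scalar_ac)

lemma continuous_Sof: "continuous_on U (\<lambda>p. Sof p A)"
  unfolding Sof_def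
  by (intro continuous_on_scaleR continuous_on_const continuous_on_matrix_mult continuous_P continuous_Minv continuous_Q)

lemma L2_loc_S: "L2_loc U S"
  using L2_loc_linear_field[OF U_open L2_loc_fst[OF D(2) C] linear_Sof continuous_Sof] by (simp add: S_Sof[abs_def])

lemma L2_loc_S_vector:
  assumes z: "continuous_on U z"
  shows "L2_loc U (\<lambda>p. (0 :: real, S p *v z p))" "L2_loc U (\<lambda>p. (0 :: real, transpose (S p) *v z p))"
proof -
  have "linear (\<lambda>A. (0 :: real, Sof p A *v z p))" for p
    by (rule linearI) (simp_all add: linear_add[OF linear_Sof] linear_scale[OF linear_Sof]
        matrix_vector_mult_add_rdistrib scaleR_matrix_vector_assoc[symmetric])
  moreover have "continuous_on U (\<lambda>p. (0 :: real, Sof p A *v z p))" for A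
    by (intro continuous_on_Pair continuous_on_const continuous_on_matrix_vector_mult continuous_Sof z)
  ultimately show "L2_loc U (\<lambda>p. (0 :: real, S p *v z p))"
    unfolding S_Sof by (rule L2_loc_linear_field[OF U_open L2_loc_fst[OF D(2) C]])
  have "transpose (A + B) = transpose A + transpose B" "transpose (c *\<^sub>R A) = c *\<^sub>R transpose A"
    for A B :: "real ^ 'k ^ 'k" and c by (simp_all add: transpose_def vec_eq_iff)
  then have "linear (\<lambda>A. (0 :: real, transpose (Sof p A) *v z p))" for p
    by (intro linearI) (simp_all add: linear_add[OF linear_Sof] linear_scale[OF linear_Sof]
        matrix_vector_mult_add_rdistrib scaleR_matrix_vector_assoc[symmetric])
  moreover have "continuous_on U (\<lambda>p. (0 :: real, transpose (Sof p A) *v z p))" for A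
    by (intro continuous_on_Pair continuous_on_const continuous_on_matrix_vector_mult continuous_on_transpose continuous_Sof z)
  ultimately show "L2_loc U (\<lambda>p. (0 :: real, transpose (S p) *v z p))"
    unfolding S_Sof by (rule L2_loc_linear_field[OF U_open L2_loc_fst[OF D(2) C]])
qed

lemma L2_loc_conn:
  assumes "smooth_on U Z"
  shows "L2_loc U (conn Z)"
  unfolding conn_def
  by (intro L2_loc_add L2_loc_S_vector L2_loc_continuous U_open smooth_on_derivative_continuous assms
      continuous_on_snd smooth_on_continuous)

text \<open>In frame components the metric turns \<open>S\<close> into one half of \<open>D\<close>:
  the second fundamental form of a slice is half the r-derivative of the metric.\<close>

lemma g_conn:
  assumes p: "p \<in> U"
  shows "g p (conn Z p) v = g p (frechet_derivative Z (at p) (1, 0)) v +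
    (1 / 2) * ((D (fst p) *v (Q p *v snd (Z p))) \<bullet> (Q p *v snd v))"
proof -
  have "M (fst p) *v (Q p *v (S p *v z)) = (1 / 2) *\<^sub>R (D (fst p) *v (Q p *v z))" for z
  proof -
    have "M (fst p) ** (Q p ** S p) = (1 / 2) *\<^sub>R ((M (fst p) ** (Q p ** P (snd p)) ** matrix_inv (M (fst p))) ** D (fst p) ** Q p)"
      by (simp add: S_def matrix_mul_assoc matrix_scalar_ac scalar_matrix_assoc[symmetric])
    also have "\<dots> = (1 / 2) *\<^sub>R (D (fst p) ** Q p)"
      using p by (simp add: PQ MM)
    finally show ?thesis by (simp add: matrix_vector_mul_assoc scaleR_matrix_vector_assoc[symmetric])
  qed
  then show ?thesis using p
    by (simp add: gU conn_def matrix_vector_right_distrib inner_add_left algebra_simps)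
qed

lemma slice_derivative:
  fixes T :: "real \<times> (real ^ 'k) \<Rightarrow> real"
  assumes Z: "smooth_on U Z" and T: "bounded_linear T" and r: "r > 0" "x \<in> C"
  shows "((\<lambda>r. T (Z (r, x))) has_real_derivative T (frechet_derivative Z (at (r, x)) (1, 0))) (at r)"
proof -
  have "(r, x) \<in> U" using r by simp
  note dZ = smooth_on_has_derivative[OF U_open Z this]
  have "((\<lambda>r. (r, x)) has_derivative (\<lambda>t. (t, 0))) (at r)" by (auto intro!: derivative_eq_intros)
  from has_derivative_compose[OF this dZ]
  have "((\<lambda>r. Z (r, x)) has_derivative (\<lambda>t. frechet_derivative Z (at (r, x)) (t, 0))) (at r)" .
  from bounded_linear.has_derivative[OF T this]
  have "((\<lambda>r. T (Z (r, x))) has_derivative (\<lambda>t. T (frechet_derivative Z (at (r, x)) (t, 0)))) (at r)" .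
  moreover have "(\<lambda>t. T (frechet_derivative Z (at (r, x)) (t, 0))) = (*) (T (frechet_derivative Z (at (r, x)) (1, 0)))"
  proof
    fix t show "T (frechet_derivative Z (at (r, x)) (t, 0)) = T (frechet_derivative Z (at (r, x)) (1, 0)) * t"
      using linear_scale[OF has_derivative_linear[OF dZ], of t "(1, 0)"]
        linear_scale[OF bounded_linear.linear[OF T], of t] by simp
  qed
  ultimately show ?thesis unfolding has_field_derivative_def by (simp only:)
qed

text \<open>The Leibniz rule for the metric. Passing to frame components does not involve r, so the
  components of smooth fields are classically differentiable in r, and only the entries of
  \<open>M\<close> need their weak derivative.\<close>

lemma r_derivative_g:
  assumes Z: "smooth_on U Z" and Z': "smooth_on U Z'"
  shows "r_derivative U (\<lambda>p. g p (Z p) (Z' p))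
    (\<lambda>p. (D (fst p) *v (Q p *v snd (Z p))) \<bullet> (Q p *v snd (Z' p)) +
      g p (frechet_derivative Z (at p) (1, 0)) (Z' p) + g p (Z p) (frechet_derivative Z' (at p) (1, 0)))"
    (is "r_derivative U ?f ?e")
proof -
  define dZ where "dZ p = frechet_derivative Z (at p) (1, 0)" for p
  define dZ' where "dZ' p = frechet_derivative Z' (at p) (1, 0)" for p
  have c: "continuous_on U Z" "continuous_on U Z'" "continuous_on U dZ" "continuous_on U dZ'"
    unfolding dZ_def dZ'_def by (intro smooth_on_continuous smooth_on_derivative_continuous Z Z')+
  define q where "q V a p = (Q p *v snd (V p)) $ a" for V :: "real \<times> (real ^ 'k) \<Rightarrow> real \<times> (real ^ 'k)" and a p
  have cq: "continuous_on U (q V a)" if "continuous_on U V" for V a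
    unfolding q_def by (intro continuous_on_component continuous_on_matrix_vector_mult continuous_Q continuous_on_snd that)
  have dq: "((\<lambda>r. q V a (r, x)) has_real_derivative q (\<lambda>p. frechet_derivative V (at p) (1, 0)) a (r, x)) (at r)"
    if "smooth_on U V" "r > 0" "x \<in> C" for V a r x
  proof -
    have "bounded_linear (\<lambda>z. (matrix_inv (P x) *v snd z) $ a)"
      by (rule bounded_linear_compose[OF bounded_linear_vec_nth
            bounded_linear_compose[OF matrix_vector_mul_bounded_linear bounded_linear_snd]])
    from slice_derivative[OF that(1) this that(2,3)] show ?thesis by (simp add: q_def Q_def)
  qed
  \<comment> \<open>The part of the metric along r has the constant coefficient 1 with derivative 0,
    written out to fit \<open>r_derivative_product\<close>.\<close>
  have 1: "r_derivative U (\<lambda>p. 1 * (fst (Z p) * fst (Z' p)))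
      (\<lambda>p. 0 * (fst (Z p) * fst (Z' p)) + 1 * (fst (dZ p) * fst (Z' p) + fst (Z p) * fst (dZ' p)))"
  proof (rule r_derivative_product[OF ac_deriv_const[of 1] _ C])
    show "L2_loc {0<..} (\<lambda>_::real. 0 :: real)" by (intro L2_loc_continuous continuous_on_const) simp
    show "((\<lambda>r. fst (Z (r, x)) * fst (Z' (r, x))) has_real_derivative
        fst (dZ (r, x)) * fst (Z' (r, x)) + fst (Z (r, x)) * fst (dZ' (r, x))) (at r)" if "r > 0" "x \<in> C" for r x
      using DERIV_mult[OF slice_derivative[OF Z bounded_linear_fst that] slice_derivative[OF Z' bounded_linear_fst that]]
      by (simp add: dZ_def dZ'_def mult.commute add.commute)
  qed (intro continuous_intros c)+
  have 2: "r_derivative U (\<lambda>p. M (fst p) $ a $ b * (q Z b p * q Z' a p))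
     (\<lambda>p. D (fst p) $ a $ b * (q Z b p * q Z' a p) + M (fst p) $ a $ b * (q dZ b p * q Z' a p + q Z b p * q dZ' a p))" for a b
  proof (rule r_derivative_product[OF D_entry C])
    show "((\<lambda>r. q Z b (r, x) * q Z' a (r, x)) has_real_derivative
        q dZ b (r, x) * q Z' a (r, x) + q Z b (r, x) * q dZ' a (r, x)) (at r)" if "r > 0" "x \<in> C" for r x
      using DERIV_mult[OF dq[OF Z that] dq[OF Z' that]]
      unfolding dZ_def[symmetric] dZ'_def[symmetric] by (simp add: mult.commute add.commute)
  qed (intro continuous_intros cq c)+
  have 3: "r_derivative U (\<lambda>p. 1 * (fst (Z p) * fst (Z' p)) + (\<Sum>a\<in>UNIV. \<Sum>b\<in>UNIV. M (fst p) $ a $ b * (q Z b p * q Z' a p)))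
    (\<lambda>p. (0 * (fst (Z p) * fst (Z' p)) + 1 * (fst (dZ p) * fst (Z' p) + fst (Z p) * fst (dZ' p))) +
      (\<Sum>a\<in>UNIV. \<Sum>b\<in>UNIV. D (fst p) $ a $ b * (q Z b p * q Z' a p) + M (fst p) $ a $ b * (q dZ b p * q Z' a p + q Z b p * q dZ' a p)))"
    by (intro r_derivative_add r_derivative_sum 1 2) auto
  have bil: "(A *v (Q p *v snd (V p))) \<bullet> (Q p *v snd (V' p)) = (\<Sum>a\<in>UNIV. \<Sum>b\<in>UNIV. A $ a $ b * (q V b p * q V' a p))"
    for A :: "real ^ 'k ^ 'k" and V V' p
    by (simp add: q_def inner_vec_def matrix_vector_mult_def[of A] sum_distrib_right mult.assoc)
  have f: "?f p = 1 * (fst (Z p) * fst (Z' p)) + (\<Sum>a\<in>UNIV. \<Sum>b\<in>UNIV. M (fst p) $ a $ b * (q Z b p * q Z' a p))" if "p \<in> U" for p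
    unfolding gU[OF that] bil by simp
  have e: "?e p = (0 * (fst (Z p) * fst (Z' p)) + 1 * (fst (dZ p) * fst (Z' p) + fst (Z p) * fst (dZ' p))) +
      (\<Sum>a\<in>UNIV. \<Sum>b\<in>UNIV. D (fst p) $ a $ b * (q Z b p * q Z' a p) + M (fst p) $ a $ b * (q dZ b p * q Z' a p + q Z b p * q dZ' a p))"
    if "p \<in> U" for p
    unfolding gU[OF that] dZ_def[symmetric] dZ'_def[symmetric] bil by (simp add: sum.distrib distrib_left)
  show ?thesis by (rule r_derivative_cong[OF 3 f e])
qed

text \<open>Of the three derivatives in the Koszul formula only the one along \<open>d_r\<close>
  meets the metrics of the slices. The other two act on the r-components of \<open>Z\<close> and
  \<open>Z'\<close> and cancel against the bracket of these fields.\<close>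

lemma koszul_conn:
  assumes Z: "smooth_on U Z"
  shows "koszul U g d_r Z (conn Z)"
  unfolding koszul_def
proof (intro allI impI, elim conjE)
  fix Z' :: "real \<times> (real ^ 'k) \<Rightarrow> real \<times> (real ^ 'k)" and \<phi> :: "real \<times> (real ^ 'k) \<Rightarrow> real"
  assume Z': "smooth_on U Z'" and \<phi>: "test_fun U \<phi>"
  define dZ where "dZ p = frechet_derivative Z (at p)" for p
  define dZ' where "dZ' p = frechet_derivative Z' (at p)" for p
  have hZ: "(Z has_derivative dZ p) (at p)" "(Z' has_derivative dZ' p) (at p)" if "p \<in> U" for p
    unfolding dZ_def dZ'_def by (intro smooth_on_has_derivative[OF U_open] Z Z' that)+
  have cd: "continuous_on U (\<lambda>p. dZ p v)" "continuous_on U (\<lambda>p. dZ' p v)" for v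
    unfolding dZ_def dZ'_def by (intro smooth_on_derivative_continuous Z Z')+
  have c: "continuous_on U Z" "continuous_on U Z'" by (intro smooth_on_continuous Z Z')+
  define e1 where "e1 p = (D (fst p) *v (Q p *v snd (Z p))) \<bullet> (Q p *v snd (Z' p)) +
      g p (dZ p (1, 0)) (Z' p) + g p (Z p) (dZ' p (1, 0))" for p
  define e4 where "e4 p = g p (dZ p (1, 0)) (Z' p) - g p (dZ' p (1, 0)) (Z p) - (fst (dZ' p (Z p)) - fst (dZ p (Z' p)))" for p
  have r1: "r_derivative U (\<lambda>p. g p (Z p) (Z' p)) e1"
    using r_derivative_g[OF Z Z'] unfolding e1_def dZ_def dZ'_def .
  have t1: "dist_deriv U d_r (\<lambda>p. g p (Z p) (Z' p)) \<phi> = (LINT p:U|lborel. e1 p * \<phi> p)"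
    by (rule r_derivative_dist_deriv[OF r1 \<phi>])
  have i1: "set_integrable lborel U (\<lambda>p. e1 p * \<phi> p)" using r1 \<phi> by (simp add: r_derivative_def)
  have gr: "g p (d_r p) v = fst v" if "p \<in> U" for p v using that by (simp add: gU d_r_def)
  have gr': "g p v (d_r p) = fst v" if "p \<in> U" for p v using that by (simp add: gU d_r_def)
  have hf: "((\<lambda>p. fst (Z p)) has_derivative (\<lambda>v. fst (dZ p v))) (at p)"
    "((\<lambda>p. fst (Z' p)) has_derivative (\<lambda>v. fst (dZ' p v))) (at p)" if "p \<in> U" for p
    using has_derivative_fst[OF hZ(1)[OF that]] has_derivative_fst[OF hZ(2)[OF that]] .
  note C2 = dist_deriv_C1[OF U_open Z \<phi> hf(2) continuous_on_fst[OF cd(2)]]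
  note C3 = dist_deriv_C1[OF U_open Z' \<phi> hf(1) continuous_on_fst[OF cd(1)]]
  have t2: "dist_deriv U Z (\<lambda>p. g p (d_r p) (Z' p)) \<phi> = (LINT p:U|lborel. fst (dZ' p (Z p)) * \<phi> p)"
    using C2(2) by (subst dist_deriv_cong[OF gr])
  have t3: "dist_deriv U Z' (\<lambda>p. g p (d_r p) (Z p)) \<phi> = (LINT p:U|lborel. fst (dZ p (Z' p)) * \<phi> p)"
    using C3(2) by (subst dist_deriv_cong[OF gr])
  note i2 = C2(1) and i3 = C3(1)
  have lb: "lie_bracket d_r V p = frechet_derivative V (at p) (1, 0)" for V p
    by (simp add: lie_bracket_def d_r_def frechet_derivative_const)
  have lbZ: "lie_bracket Z Z' p = dZ' p (Z p) - dZ p (Z' p)" for p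
    by (simp add: lie_bracket_def dZ_def dZ'_def)
  have t4: "(LINT p:U|lborel. (g p (lie_bracket d_r Z p) (Z' p) - g p (lie_bracket d_r Z' p) (Z p) -
      g p (lie_bracket Z Z' p) (d_r p)) * \<phi> p) = (LINT p:U|lborel. e4 p * \<phi> p)"
    by (intro set_integral_cong) (simp add: lb lbZ e4_def gr' dZ_def dZ'_def)
  have i4: "set_integrable lborel U (\<lambda>p. e4 p * \<phi> p)"
  proof -
    have "set_integrable lborel U (\<lambda>p. (g p (dZ p (1, 0)) (Z' p) - g p (dZ' p (1, 0)) (Z p)) * \<phi> p)"
      by (intro L1_loc_test_integrable[OF _ \<phi>] L2_imp_L1_loc U_open L2_loc_continuous continuous_on_diff continuous_g cd c)
    from set_integral_add(1)[OF set_integral_diff(1)[OF this i2] i3] show ?thesis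
      by (simp add: e4_def algebra_simps)
  qed
  have sym: "g p u v = g p v u" if "p \<in> U" for p u v
    using that symmetric_matrix_inner[OF M(2), of "fst p" "Q p *v snd u" "Q p *v snd v"]
    by (auto simp: gU mult.commute inner_commute)
  have "2 * (LINT p:U|lborel. g p (conn Z p) (Z' p) * \<phi> p) = (LINT p:U|lborel. 2 * (g p (conn Z p) (Z' p) * \<phi> p))"
    by simp
  also have "\<dots> = (LINT p:U|lborel. e1 p * \<phi> p + fst (dZ' p (Z p)) * \<phi> p - fst (dZ p (Z' p)) * \<phi> p + e4 p * \<phi> p)"
  proof (intro set_integral_cong)
    fix p assume p: "p \<in> U"
    have "2 * g p (conn Z p) (Z' p) = e1 p + fst (dZ' p (Z p)) - fst (dZ p (Z' p)) + e4 p"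
      unfolding g_conn[OF p] e1_def e4_def dZ_def[symmetric] by (simp add: sym[OF p, of "Z p"])
    then show "2 * (g p (conn Z p) (Z' p) * \<phi> p) = e1 p * \<phi> p + fst (dZ' p (Z p)) * \<phi> p - fst (dZ p (Z' p)) * \<phi> p + e4 p * \<phi> p"
      unfolding mult.assoc[symmetric] by (simp add: distrib_right left_diff_distrib)
  qed
  also have "\<dots> = (LINT p:U|lborel. e1 p * \<phi> p) + (LINT p:U|lborel. fst (dZ' p (Z p)) * \<phi> p)
      - (LINT p:U|lborel. fst (dZ p (Z' p)) * \<phi> p) + (LINT p:U|lborel. e4 p * \<phi> p)"
    by (simp add: i1 i2 i3 i4 set_integral_add set_integral_diff)
  finally show "2 * (LINT p:U|lborel. g p (conn Z p) (Z' p) * \<phi> p) =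
      dist_deriv U d_r (\<lambda>p. g p (Z p) (Z' p)) \<phi> + dist_deriv U Z (\<lambda>p. g p (d_r p) (Z' p)) \<phi>
      - dist_deriv U Z' (\<lambda>p. g p (d_r p) (Z p)) \<phi>
      + (LINT p:U|lborel. (g p (lie_bracket d_r Z p) (Z' p) - g p (lie_bracket d_r Z' p) (Z p) -
      g p (lie_bracket Z Z' p) (d_r p)) * \<phi> p)"
    unfolding t1 t2 t3 t4 .
qed

text \<open>Torsion-freeness for commuting fields: the Koszul expression is symmetric in its first
  two fields when their bracket vanishes.\<close>

lemma koszul_swap_const:
  assumes "koszul U g d_r (\<lambda>_. b) W"
  shows "koszul U g (\<lambda>_. b) d_r W"
proof -
  have sym: "g p u v = g p v u" if "p \<in> U" for p u v
    using that symmetric_matrix_inner[OF M(2), of "fst p" "Q p *v snd u" "Q p *v snd v"]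
    by (auto simp: gU mult.commute inner_commute)
  have lb: "lie_bracket (\<lambda>_. b) d_r p = 0" "lie_bracket d_r (\<lambda>_. b) p = 0" for p
    by (simp_all add: lie_bracket_def d_r_def frechet_derivative_const)
  have g0: "g p 0 v = 0" if "p \<in> U" for p v using that by (simp add: gU)
  have dd: "dist_deriv U Z (\<lambda>p. g p b (d_r p)) \<phi> = dist_deriv U Z (\<lambda>p. g p (d_r p) b) \<phi>" for Z \<phi>
    by (intro dist_deriv_cong sym)
  have int: "(LINT p:U|lborel. (g p (lie_bracket (\<lambda>_. b) d_r p) (Z p) - g p (lie_bracket (\<lambda>_. b) Z p) (d_r p) - g p (lie_bracket d_r Z p) b) * \<phi> p)
    = (LINT p:U|lborel. (g p (lie_bracket d_r (\<lambda>_. b) p) (Z p) - g p (lie_bracket d_r Z p) b - g p (lie_bracket (\<lambda>_. b) Z p) (d_r p)) * \<phi> p)" for Z \<phi>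
    by (intro set_integral_cong) (simp add: lb g0)
  show ?thesis using assms unfolding koszul_def dd int by (simp add: add.commute)
qed

end

section \<open>The connection, curvature and Hessian in the direction of r\<close>

lemma L1_loc_integral_AE_cong:
  fixes f f' \<phi> :: "'e::euclidean_space \<Rightarrow> real"
  assumes U: "open U" and f: "L1_loc U f" "L1_loc U f'" and eq: "AE x in lborel. x \<in> U \<longrightarrow> f x = f' x"
    and \<phi>: "continuous_on U \<phi>"
  shows "(LINT x:U|lborel. f x * \<phi> x) = (LINT x:U|lborel. f' x * \<phi> x)"
  unfolding set_lebesgue_integral_def
proof (rule integral_cong_AE)
  have [measurable]: "(\<lambda>x. indicator U x *\<^sub>R \<phi> x) \<in> borel_measurable borel"
    using set_borel_measurable_continuous_open[OF U \<phi>] by (simp add: set_borel_measurable_def)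
  have m: "(\<lambda>x. indicator U x *\<^sub>R (h x * \<phi> x)) \<in> borel_measurable lborel" if "L1_loc U h" for h
  proof -
    have [measurable]: "(\<lambda>x. indicator U x *\<^sub>R h x) \<in> borel_measurable borel"
      using that by (simp add: L1_loc_def set_borel_measurable_def)
    have "(\<lambda>x. (indicator U x *\<^sub>R h x) * (indicator U x *\<^sub>R \<phi> x)) \<in> borel_measurable lborel" by measurable
    then show ?thesis by (rule measurable_eqI) (auto simp: indicator_def)
  qed
  show "(\<lambda>x. indicator U x *\<^sub>R (f x * \<phi> x)) \<in> borel_measurable lborel" by (rule m[OF f(1)])
  show "(\<lambda>x. indicator U x *\<^sub>R (f' x * \<phi> x)) \<in> borel_measurable lborel" by (rule m[OF f(2)])
  show "AE x in lborel. indicator U x *\<^sub>R (f x * \<phi> x) = indicator U x *\<^sub>R (f' x * \<phi> x)"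
    using eq by eventually_elim (auto simp: indicator_def)
qed

lemma set_integral_eq_zero_AE:
  fixes f :: "'a \<Rightarrow> 'b::{banach, second_countable_topology}"
  assumes "AE x in M. x \<in> A \<longrightarrow> f x = 0"
  shows "(LINT x:A|M. f x) = 0"
  unfolding set_lebesgue_integral_def
  by (rule integral_eq_zero_AE) (use assms in \<open>eventually_elim, auto simp: indicator_def\<close>)

lemma set_integral_sum:
  fixes f :: "'i \<Rightarrow> 'a \<Rightarrow> real"
  assumes "\<And>i. i \<in> I \<Longrightarrow> set_integrable M A (f i)"
  shows "(LINT x:A|M. \<Sum>i\<in>I. f i x) = (\<Sum>i\<in>I. LINT x:A|M. f i x)"
  using assms unfolding set_integrable_def set_lebesgue_integral_def scaleR_sum_right
  by (intro Bochner_Integration.integral_sum)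

lemma sum_Basis_Pair:
  fixes f :: "'a::euclidean_space \<times> 'b::euclidean_space \<Rightarrow> real"
  shows "(\<Sum>i\<in>Basis. f i) = (\<Sum>i\<in>Basis. f (i, 0)) + (\<Sum>i\<in>Basis. f (0, i))"
proof -
  have "inj_on (\<lambda>u. (u :: 'a, 0 :: 'b)) Basis" "inj_on (\<lambda>u. (0 :: 'a, u :: 'b)) Basis"
    by (auto intro!: inj_onI Pair_inject)
  then show ?thesis
    unfolding Basis_prod_def by (subst sum.union_disjoint) (auto simp: sum.reindex)
qed

context cylinder_geometry
begin

text \<open>The metric as a map from vectors to covectors. It turns pairing with the metric into the
  Euclidean inner product, to which the fundamental lemma applies.\<close>

definition lower :: "real \<times> (real ^ 'k) \<Rightarrow> real \<times> (real ^ 'k) \<Rightarrow> real \<times> (real ^ 'k)" where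
  "lower p w = (fst w, transpose (Q p) *v (M (fst p) *v (Q p *v snd w)))"

lemma g_lower: "p \<in> U \<Longrightarrow> g p w c = lower p w \<bullet> c"
  by (simp add: gU lower_def inner_prod_def transpose_matrix_vector dot_lmul_matrix)

lemma lower_inj:
  assumes p: "p \<in> U" and eq: "lower p w = lower p w'"
  shows "w = w'"
proof -
  have "P (snd p) ** (matrix_inv (M (fst p)) ** (transpose (P (snd p)) ** (transpose (Q p) ** (M (fst p) ** Q p)))) = mat 1"
  proof -
    have "transpose (P (snd p)) ** transpose (Q p) = mat 1"
      using PQ(1)[OF p] by (metis matrix_transpose_mul transpose_mat)
    then have "transpose (P (snd p)) ** (transpose (Q p) ** (M (fst p) ** Q p)) = M (fst p) ** Q p"
      by (simp add: matrix_mul_assoc)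
    moreover have "matrix_inv (M (fst p)) ** (M (fst p) ** Q p) = Q p"
      using MM(2)[OF p] by (simp add: matrix_mul_assoc)
    ultimately show ?thesis using PQ(2)[OF p] by simp
  qed
  then have inv: "P (snd p) *v (matrix_inv (M (fst p)) *v (transpose (P (snd p)) *v (transpose (Q p) *v (M (fst p) *v (Q p *v z))))) = z" for z
    by (simp only: matrix_vector_mul_assoc matrix_mul_assoc matrix_vector_mul_lid)
  have "transpose (Q p) *v (M (fst p) *v (Q p *v snd w)) = transpose (Q p) *v (M (fst p) *v (Q p *v snd w'))"
    and f: "fst w = fst w'"
    using eq by (simp_all add: lower_def)
  then have "snd w = snd w'" using inv[of "snd w"] inv[of "snd w'"] by simp
  with f show ?thesis by (rule prod_eqI)
qed

lemma L2_loc_lower: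
  assumes "L2_loc U W"
  shows "L2_loc U (\<lambda>p. lower p (W p))"
proof (rule L2_loc_linear_field[OF U_open assms])
  show "linear (lower p)" for p
    by (rule linearI) (simp_all add: lower_def matrix_vector_right_distrib matrix_vector_mult_scaleR)
  show "continuous_on U (\<lambda>p. lower p w)" for w
    unfolding lower_def
    by (intro continuous_on_Pair continuous_on_const continuous_on_matrix_vector_mult continuous_on_transpose
        continuous_Q continuous_M)
qed

text \<open>The right-hand side of the Koszul formula does not contain \<open>W\<close>. Testing
  with constant fields determines the covectors \<open>lower p (W p)\<close> almost everywhere, and
  \<open>lower p\<close> is injective.\<close>

lemma koszul_unique:
  assumes W: "L2_loc U W" "koszul U g X Y W" and W': "L2_loc U W'" "koszul U g X Y W'"
  shows "AE p in lborel. p \<in> U \<longrightarrow> W p = W' p"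
proof -
  have "AE p in lborel. p \<in> U \<longrightarrow> lower p (W p) = lower p (W' p)"
  proof (rule L2_loc_fields_AE_eq[OF U_open L2_loc_lower[OF W(1)] L2_loc_lower[OF W'(1)]])
    fix \<phi> c assume \<phi>: "test_fun U \<phi>"
    have "2 * (LINT p:U|lborel. g p (W p) c * \<phi> p) = 2 * (LINT p:U|lborel. g p (W' p) c * \<phi> p)"
      using W(2)[unfolded koszul_def, rule_format, of "\<lambda>_. c" \<phi>] W'(2)[unfolded koszul_def, rule_format, of "\<lambda>_. c" \<phi>]
        \<phi> by (simp add: smooth_on_const)
    moreover have "(LINT p:U|lborel. (lower p (V p) \<bullet> c) * \<phi> p) = (LINT p:U|lborel. g p (V p) c * \<phi> p)" for V
      by (intro set_integral_cong) (simp add: g_lower)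
    ultimately show "(LINT p:U|lborel. (lower p (W p) \<bullet> c) * \<phi> p) = (LINT p:U|lborel. (lower p (W' p) \<bullet> c) * \<phi> p)"
      by simp
  qed
  then show ?thesis by eventually_elim (use lower_inj in blast)
qed

text \<open>One solution of the Koszul formula both legitimates the choice in \<open>nabla\<close>
  and identifies its result up to a null set.\<close>

lemma nabla_AE:
  assumes W: "L2_loc U W" "koszul U g X Y W"
  shows "L2_loc U (nabla U g X Y)" "AE p in lborel. p \<in> U \<longrightarrow> nabla U g X Y p = W p"
proof -
  have "L2_loc U (nabla U g X Y) \<and> koszul U g X Y (nabla U g X Y)"
    unfolding nabla_def by (rule someI[of "\<lambda>W. L2_loc U W \<and> koszul U g X Y W" W]) (use W in simp)
  then show "L2_loc U (nabla U g X Y)" "AE p in lborel. p \<in> U \<longrightarrow> nabla U g X Y p = W p"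
    using koszul_unique[OF _ _ W] by auto
qed

lemma nabla_r:
  assumes "smooth_on U Z"
  shows "L2_loc U (nabla U g d_r Z)" "AE p in lborel. p \<in> U \<longrightarrow> nabla U g d_r Z p = conn Z p"
  using nabla_AE[OF L2_loc_conn[OF assms] koszul_conn[OF assms]] .

lemma conn_const: "conn (\<lambda>_. b) p = (0, S p *v snd b)"
  by (simp add: conn_def frechet_derivative_const)

lemma nabla_const_r:
  "L2_loc U (nabla U g (\<lambda>_. b) d_r)"
  "AE p in lborel. p \<in> U \<longrightarrow> nabla U g (\<lambda>_. b) d_r p = (0, S p *v snd b)"
  using nabla_AE[OF L2_loc_conn[OF smooth_on_const] koszul_swap_const[OF koszul_conn[OF smooth_on_const]], of b]
  by (simp_all add: conn_const)

text \<open>The r-lines are geodesics, since \<open>S\<close> acts only on the tangential component,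
  which is 0 for \<open>d_r\<close>.\<close>

lemma nabla_r_r: "AE p in lborel. p \<in> U \<longrightarrow> nabla U g d_r d_r p = 0"
  using nabla_const_r(2)[of "(1, 0)"] by (simp add: d_r_def[symmetric] zero_prod_def)

text \<open>For a constant form \<open>b\<close> the ordinary derivative cancels against the one
  contained in \<open>conn\<close>, which leaves minus the dual action of \<open>S\<close>. Testing
  with constant fields gives uniqueness.\<close>

lemma nabla_form_r:
  "L2_loc U (nabla_form U g d_r (\<lambda>_. b))"
  "AE p in lborel. p \<in> U \<longrightarrow> nabla_form U g d_r (\<lambda>_. b) p = - (0, transpose (S p) *v snd b)"
proof -
  \<comment> \<open>The predicate under the choice operator in \<open>nabla_form\<close>, named so
    that the choice can be reasoned about.\<close>
  define is_nf where "is_nf \<omega> \<longleftrightarrow> L2_loc U \<omega> \<and>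
     (\<forall>Z. smooth_on U Z \<longrightarrow> (AE x in lborel. x \<in> U \<longrightarrow>
        \<omega> x \<bullet> Z x = frechet_derivative (\<lambda>z. b \<bullet> Z z) (at x) (d_r x) - b \<bullet> nabla U g d_r Z x))" for \<omega>
  define \<omega>0 where "\<omega>0 p = - (0 :: real, transpose (S p) *v snd b)" for p
  have L0: "L2_loc U \<omega>0"
  proof -
    have "L2_loc U (\<lambda>p. (0 :: real, transpose (S p) *v (- snd b)))"
      by (intro L2_loc_S_vector continuous_on_const)
    moreover have "(0 :: real, transpose (S p) *v (- snd b)) = \<omega>0 p" for p
      using matrix_vector_mult_scaleR[of "transpose (S p)" "-1" "snd b"] by (simp add: \<omega>0_def)
    ultimately show ?thesis by (simp only:)
  qed
  have "is_nf \<omega>0"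
    unfolding is_nf_def
  proof (intro conjI allI impI L0)
    fix Z :: "real \<times> (real ^ 'k) \<Rightarrow> real \<times> (real ^ 'k)" assume Z: "smooth_on U Z"
    show "AE x in lborel. x \<in> U \<longrightarrow>
        \<omega>0 x \<bullet> Z x = frechet_derivative (\<lambda>z. b \<bullet> Z z) (at x) (d_r x) - b \<bullet> nabla U g d_r Z x"
      using nabla_r(2)[OF Z]
    proof eventually_elim
      case (elim x)
      show ?case
      proof
        assume x: "x \<in> U"
        have "((\<lambda>z. b \<bullet> Z z) has_derivative (\<lambda>v. b \<bullet> frechet_derivative Z (at x) v)) (at x)"
          by (rule has_derivative_inner_right[OF smooth_on_has_derivative[OF U_open Z x]])
        from frechet_derivative_at[OF this] have "frechet_derivative (\<lambda>z. b \<bullet> Z z) (at x) (d_r x) = b \<bullet> frechet_derivative Z (at x) (1, 0)"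
          by (metis d_r_def)
        moreover have "(transpose (S x) *v snd b) \<bullet> snd (Z x) = snd b \<bullet> (S x *v snd (Z x))"
          by (simp only: transpose_matrix_vector dot_lmul_matrix)
        ultimately show "\<omega>0 x \<bullet> Z x = frechet_derivative (\<lambda>z. b \<bullet> Z z) (at x) (d_r x) - b \<bullet> nabla U g d_r Z x"
          using elim x by (simp add: conn_def \<omega>0_def inner_add_right inner_prod_def)
      qed
    qed
  qed
  then have "is_nf (SOME \<omega>. is_nf \<omega>)" by (rule someI[of is_nf])
  moreover have "nabla_form U g d_r (\<lambda>_. b) = (SOME \<omega>. is_nf \<omega>)"
    unfolding nabla_form_def is_nf_def ..
  ultimately have nf: "is_nf (nabla_form U g d_r (\<lambda>_. b))" by simp
  then show "L2_loc U (nabla_form U g d_r (\<lambda>_. b))" by (simp add: is_nf_def)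
  have "AE x in lborel. \<forall>c\<in>Basis. x \<in> U \<longrightarrow> nabla_form U g d_r (\<lambda>_. b) x \<bullet> c = \<omega>0 x \<bullet> c"
  proof (subst AE_ball_countable)
    show "\<forall>c\<in>Basis. AE x in lborel. x \<in> U \<longrightarrow> nabla_form U g d_r (\<lambda>_. b) x \<bullet> c = \<omega>0 x \<bullet> c"
    proof
      fix c :: "real \<times> (real ^ 'k)"
      have "AE x in lborel. x \<in> U \<longrightarrow> nabla_form U g d_r (\<lambda>_. b) x \<bullet> c =
          frechet_derivative (\<lambda>z. b \<bullet> c) (at x) (d_r x) - b \<bullet> nabla U g d_r (\<lambda>_. c) x"
        using nf smooth_on_const[of U c] unfolding is_nf_def by blast
      moreover have "AE x in lborel. x \<in> U \<longrightarrow> \<omega>0 x \<bullet> c =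
          frechet_derivative (\<lambda>z. b \<bullet> c) (at x) (d_r x) - b \<bullet> nabla U g d_r (\<lambda>_. c) x"
        using \<open>is_nf \<omega>0\<close> smooth_on_const[of U c] unfolding is_nf_def by blast
      ultimately show "AE x in lborel. x \<in> U \<longrightarrow> nabla_form U g d_r (\<lambda>_. b) x \<bullet> c = \<omega>0 x \<bullet> c"
        by eventually_elim simp
    qed
  qed (auto intro: countable_finite)
  then show "AE p in lborel. p \<in> U \<longrightarrow> nabla_form U g d_r (\<lambda>_. b) p = - (0, transpose (S p) *v snd b)"
    unfolding \<omega>0_def by eventually_elim (use euclidean_eqI in blast)
qed

text \<open>Three of the five terms vanish, since \<open>d_r\<close> is geodesic and commutes with
  the constant field \<open>b\<close>. The rest is the Riccati expression, minus the r-derivative of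
  \<open>S\<close> minus its square, with the derivative moved to the test function.\<close>

lemma riem_r_r:
  assumes \<phi>: "test_fun U \<phi>"
  shows "riem_dist U g (\<lambda>_. b) d_r d_r (\<lambda>_. b) \<phi> =
    (LINT p:U|lborel. ((S p *v snd b) \<bullet> snd b) * frechet_derivative \<phi> (at p) (1, 0))
    - (LINT p:U|lborel. ((S p *v (S p *v snd b)) \<bullet> snd b) * \<phi> p)"
proof -
  have 1: "dist_deriv U (\<lambda>_. b) (\<lambda>x. nabla U g d_r d_r x \<bullet> b) \<phi> = 0"
    unfolding dist_deriv_def neg_equal_0_iff_equal
    by (rule set_integral_eq_zero_AE) (use nabla_r_r in \<open>eventually_elim, simp\<close>)
  \<comment> \<open>No formula for the derivative of the form along \<open>b\<close> is available
    here; it is multiplied by a field that vanishes almost everywhere.\<close>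
  have 3: "(LINT x:U|lborel. (nabla U g d_r d_r x \<bullet> nabla_form U g (\<lambda>_. b) (\<lambda>_. b) x) * \<phi> x) = 0"
    by (rule set_integral_eq_zero_AE) (use nabla_r_r in \<open>eventually_elim, simp\<close>)
  \<comment> \<open>The covariant derivative along the zero field is the instance
    \<open>b = 0\<close> of \<open>nabla_const_r\<close>.\<close>
  have "lie_bracket (\<lambda>_. b) d_r = (\<lambda>_. 0)"
    by (simp add: fun_eq_iff lie_bracket_def d_r_def frechet_derivative_const)
  then have 5: "(LINT x:U|lborel. (nabla U g (lie_bracket (\<lambda>_. b) d_r) d_r x \<bullet> b) * \<phi> x) = 0"
    by (intro set_integral_eq_zero_AE) (use nabla_const_r(2)[of 0] in \<open>simp, eventually_elim, simp add: zero_prod_def[symmetric]\<close>)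
  have 2: "dist_deriv U d_r (\<lambda>x. nabla U g (\<lambda>_. b) d_r x \<bullet> b) \<phi> =
      - (LINT p:U|lborel. ((S p *v snd b) \<bullet> snd b) * frechet_derivative \<phi> (at p) (1, 0))"
  proof -
    have "(LINT p:U|lborel. (nabla U g (\<lambda>_. b) d_r p \<bullet> b) * frechet_derivative \<phi> (at p) (1, 0)) =
        (LINT p:U|lborel. ((0 :: real, S p *v snd b) \<bullet> b) * frechet_derivative \<phi> (at p) (1, 0))"
    proof (rule L1_loc_integral_AE_cong[OF U_open])
      show "L1_loc U (\<lambda>x. nabla U g (\<lambda>_. b) d_r x \<bullet> b)" "L1_loc U (\<lambda>x. (0 :: real, S x *v snd b) \<bullet> b)"
        by (intro L2_imp_L1_loc L2_loc_inner_continuous U_open nabla_const_r L2_loc_S_vector continuous_on_const)+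
      show "AE x in lborel. x \<in> U \<longrightarrow> nabla U g (\<lambda>_. b) d_r x \<bullet> b = (0, S x *v snd b) \<bullet> b"
        using nabla_const_r(2)[of b] by eventually_elim simp
    qed (rule test_fun_derivative[OF \<phi>])
    then show ?thesis
      unfolding dist_deriv_def d_r_def divergence_const_field[OF \<phi>] by (simp add: inner_prod_def)
  qed
  have 4: "(LINT x:U|lborel. (nabla U g (\<lambda>_. b) d_r x \<bullet> nabla_form U g d_r (\<lambda>_. b) x) * \<phi> x) =
      - (LINT p:U|lborel. ((S p *v (S p *v snd b)) \<bullet> snd b) * \<phi> p)"
  proof -
    have e: "(0 :: real, S x *v snd b) \<bullet> (0, transpose (S x) *v snd b) = (S x *v (S x *v snd b)) \<bullet> snd b" for x
      by (simp only: inner_Pair transpose_matrix_vector inner_commute[of "S x *v snd b"] dot_lmul_matrix)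
        (simp add: inner_commute)
    have "(LINT x:U|lborel. (nabla U g (\<lambda>_. b) d_r x \<bullet> nabla_form U g d_r (\<lambda>_. b) x) * \<phi> x) =
        (LINT x:U|lborel. (- ((0 :: real, S x *v snd b) \<bullet> (0, transpose (S x) *v snd b))) * \<phi> x)"
    proof (rule L1_loc_integral_AE_cong[OF U_open])
      show "L1_loc U (\<lambda>x. nabla U g (\<lambda>_. b) d_r x \<bullet> nabla_form U g d_r (\<lambda>_. b) x)"
        by (intro L1_loc_inner_L2 nabla_const_r nabla_form_r)
      have "L2_loc U (\<lambda>x. (0 :: real, S x *v (- snd b)))" by (intro L2_loc_S_vector continuous_on_const)
      then have "L1_loc U (\<lambda>x. (0 :: real, S x *v (- snd b)) \<bullet> (0 :: real, transpose (S x) *v snd b))"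
        by (intro L1_loc_inner_L2 L2_loc_S_vector continuous_on_const)
      moreover have "(0 :: real, S x *v (- snd b)) = - (0, S x *v snd b)" for x
        using matrix_vector_mult_scaleR[of "S x" "-1" "snd b"] by simp
      ultimately show "L1_loc U (\<lambda>x. - ((0 :: real, S x *v snd b) \<bullet> (0 :: real, transpose (S x) *v snd b)))"
        by (simp only: inner_minus_left)
      show "AE x in lborel. x \<in> U \<longrightarrow> nabla U g (\<lambda>_. b) d_r x \<bullet> nabla_form U g d_r (\<lambda>_. b) x =
          - ((0 :: real, S x *v snd b) \<bullet> (0, transpose (S x) *v snd b))"
        using nabla_const_r(2)[of b] nabla_form_r(2)[of b] 
      proof eventually_elim
        case (elim x)
        show ?case
        proof
          assume "x \<in> U"
          then have a: "nabla U g (\<lambda>_. b) d_r x = (0, S x *v snd b)"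
            "nabla_form U g d_r (\<lambda>_. b) x = - (0, transpose (S x) *v snd b)"
            using elim by blast+
          show "nabla U g (\<lambda>_. b) d_r x \<bullet> nabla_form U g d_r (\<lambda>_. b) x =
              - ((0 :: real, S x *v snd b) \<bullet> (0, transpose (S x) *v snd b))"
            unfolding a by (rule inner_minus_right)
        qed
      qed
    qed (rule test_fun_continuous[OF \<phi>])
    then show ?thesis unfolding e by (simp add: set_lebesgue_integral_def)
  qed
  show ?thesis unfolding riem_dist_def 1 2 3 4 5 by simp
qed

text \<open>The basis vector along r contributes nothing because its second component is 0; over the
  remaining ones the sums are traces. The first trace keeps the derivative on \<open>\<phi>\<close>,
  being only square integrable.\<close>

lemma ric_r_r:
  assumes \<phi>: "test_fun U \<phi>"
  shows "ric_dist U g d_r d_r \<phi> =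
    (LINT p:U|lborel. trace (S p) * frechet_derivative \<phi> (at p) (1, 0)) - (LINT p:U|lborel. trace (S p ** S p) * \<phi> p)"
proof -
  obtain K where K: "compact K" "K \<subseteq> U" "\<And>x v. x \<notin> K \<Longrightarrow> frechet_derivative \<phi> (at x) v = 0"
    using test_fun_support[OF \<phi>] by metis
  have "L2_loc U (\<lambda>p. (0 :: real, S p *v b) \<bullet> (0, b))" for b
    by (intro L2_loc_inner_continuous U_open L2_loc_S_vector continuous_on_const)
  then have L2: "L2_loc U (\<lambda>p. (S p *v b) \<bullet> b)" for b by simp
  have i1: "set_integrable lborel U (\<lambda>p. ((S p *v b) \<bullet> b) * frechet_derivative \<phi> (at p) (1, 0))" for b
    by (rule L1_loc_integrable[OF L2_imp_L1_loc[OF U_open L2] test_fun_derivative(2)[OF \<phi>] K(1,2)]) (rule K(3))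
  have "L1_loc U (\<lambda>p. (0 :: real, S p *v b) \<bullet> (0 :: real, transpose (S p) *v b))" for b
    by (intro L1_loc_inner_L2 L2_loc_S_vector continuous_on_const)
  moreover have "(0 :: real, S p *v b) \<bullet> (0 :: real, transpose (S p) *v b) = (S p *v (S p *v b)) \<bullet> b" for p b
    by (simp only: inner_Pair transpose_matrix_vector inner_commute[of "S p *v b"] dot_lmul_matrix)
        (simp add: inner_commute)
  ultimately have L1: "L1_loc U (\<lambda>p. (S p *v (S p *v b)) \<bullet> b)" for b by (simp only:)
  have i2: "set_integrable lborel U (\<lambda>p. ((S p *v (S p *v b)) \<bullet> b) * \<phi> p)" for b
    by (rule L1_loc_test_integrable[OF L1 \<phi>])
  have "ric_dist U g d_r d_r \<phi> = (\<Sum>b\<in>(Basis :: (real \<times> (real ^ 'k)) set). (LINT p:U|lborel. ((S p *v snd b) \<bullet> snd b) * frechet_derivative \<phi> (at p) (1, 0))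
    - (LINT p:U|lborel. ((S p *v (S p *v snd b)) \<bullet> snd b) * \<phi> p))"
    unfolding ric_dist_def by (intro sum.cong refl riem_r_r \<phi>)
  also have "\<dots> = (\<Sum>b\<in>Basis. (LINT p:U|lborel. ((S p *v b) \<bullet> b) * frechet_derivative \<phi> (at p) (1, 0))
    - (LINT p:U|lborel. ((S p *v (S p *v b)) \<bullet> b) * \<phi> p))"
    by (subst sum_Basis_Pair) (simp add: set_lebesgue_integral_def)
  also have "\<dots> = (LINT p:U|lborel. \<Sum>b\<in>Basis. ((S p *v b) \<bullet> b) * frechet_derivative \<phi> (at p) (1, 0))
    - (LINT p:U|lborel. \<Sum>b\<in>Basis. ((S p *v (S p *v b)) \<bullet> b) * \<phi> p)"
    unfolding sum_subtractf by (simp only: set_integral_sum[OF i1] set_integral_sum[OF i2])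
  finally show ?thesis
    by (simp only: sum_distrib_right[symmetric] matrix_vector_mul_assoc trace_Basis[symmetric])
qed

text \<open>Along r this is integration by parts. Along a slice the function is constant, so the
  integral is that of the tangential derivative of a compactly supported function, although
  \<open>V\<close> itself is not differentiable.\<close>

lemma weak_gradient_fst:
  fixes V V' :: "real \<Rightarrow> real"
  assumes V: "ac_deriv V V'" and V': "L2_loc {0<..} V'"
  shows "weak_gradient U (\<lambda>p. V (fst p)) (\<lambda>p. (V' (fst p), 0))"
  unfolding weak_gradient_def
proof (intro conjI allI impI)
  have L2: "L2_loc U (\<lambda>p. V' (fst p))" by (rule L2_loc_fst[OF V' C])
  from L2_loc_scaleR_continuous[OF U_open this continuous_on_const[of U "(1 :: real, 0 :: real ^ 'k)"]]
  show "L2_loc U (\<lambda>p. (V' (fst p), 0 :: real ^ 'k))" by simp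
  fix \<phi> v assume \<phi>: "test_fun U \<phi>"
  obtain K where K: "compact K" "K \<subseteq> U" "\<And>x. x \<notin> K \<Longrightarrow> \<phi> x = 0"
    "\<And>x v. x \<notin> K \<Longrightarrow> frechet_derivative \<phi> (at x) v = 0"
    using test_fun_support[OF \<phi>] by blast
  define d\<phi> where "d\<phi> p = frechet_derivative \<phi> (at p)" for p
  have dd: "(\<phi> has_derivative d\<phi> p) (at p)" for p unfolding d\<phi>_def by (rule test_fun_derivative[OF \<phi>])
  have cd: "continuous_on W (\<lambda>p. d\<phi> p w)" for w W unfolding d\<phi>_def by (rule test_fun_derivative[OF \<phi>])
  have d0: "d\<phi> p w = 0" if "p \<notin> K" for p w unfolding d\<phi>_def by (rule K(4)[OF that])
  have cV: "continuous_on U (\<lambda>p. V (fst p))" by (intro continuous_fst_pos ac_deriv_continuous[OF V])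
  have "r_derivative U (\<lambda>q. V (fst q) * 1) (\<lambda>q. V' (fst q) * 1 + V (fst q) * 0)"
    by (rule r_derivative_product[OF V V' C]) (auto intro: continuous_on_const)
  then have r: "(LINT p:U|lborel. V (fst p) * d\<phi> p (1, 0)) = - (LINT p:U|lborel. V' (fst p) * \<phi> p)"
    using \<phi> by (simp add: r_derivative_def d\<phi>_def)
  have iV: "set_integrable lborel U (\<lambda>p. V (fst p) * d\<phi> p w)" for w
    by (rule L1_loc_integrable[OF L2_imp_L1_loc[OF U_open L2_loc_continuous[OF U_open cV]] cd K(1,2)]) (rule d0)
  have h: "(LINT p:U|lborel. V (fst p) * d\<phi> p (0, w)) = 0" for w
  proof -
    define h0 where "h0 p = indicator U p *\<^sub>R (V (fst p) * \<phi> p)" for p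
    define h1 where "h1 p = indicator U p *\<^sub>R (V (fst p) * d\<phi> p (0, w))" for p
    have cK: "continuous_on K (\<lambda>p. V (fst p) * d\<phi> p (0, w))"
      by (intro continuous_on_mult cd continuous_on_subset[OF cV K(2)])
    obtain B where B: "\<And>p. p \<in> K \<Longrightarrow> \<bar>V (fst p) * d\<phi> p (0, w)\<bar> \<le> B"
      using compact_imp_bounded[OF compact_continuous_image[OF cK K(1)]] by (auto simp: bounded_iff)
    have "(LINT p|lborel. h1 p) = 0"
    proof (rule integral_directional_derivative_zero)
      have "set_integrable lborel U (\<lambda>p. V (fst p) * \<phi> p)"
        by (intro L1_loc_test_integrable[OF _ \<phi>] L2_imp_L1_loc U_open L2_loc_continuous cV)
      then show "integrable lborel h0" by (simp only: set_integrable_def h0_def[abs_def])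
      have "integrable lborel h1" using iV[of "(0, w)"] by (simp only: set_integrable_def h1_def[abs_def])
      then show "h1 \<in> borel_measurable borel" using borel_measurable_integrable by force
      show "bounded K" using K by (simp add: compact_imp_bounded)
      show "h0 p = 0" if "p \<notin> K" for p using K(3)[OF that] by (simp add: h0_def)
      show "\<bar>h1 p\<bar> \<le> \<bar>B\<bar>" for p
        using B[of p] d0[of p "(0, w)"] by (cases "p \<in> K") (auto simp: h1_def indicator_def)
      show "((\<lambda>t. h0 (p + t *\<^sub>R (0, w))) has_real_derivative h1 p) (at 0)" for p
      proof -
        have "((\<lambda>t. p + t *\<^sub>R (0, w)) has_derivative (\<lambda>t. t *\<^sub>R (0, w))) (at 0)" by (auto intro!: derivative_eq_intros)
        moreover have "(\<phi> has_derivative d\<phi> p) (at (p + 0 *\<^sub>R (0, w)))" using dd[of p] by (simp add: zero_prod_def[symmetric])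
        ultimately have "((\<lambda>t. \<phi> (p + t *\<^sub>R (0, w))) has_derivative (\<lambda>t. d\<phi> p (t *\<^sub>R (0, w)))) (at 0)"
          by (rule has_derivative_compose)
        moreover have "(\<lambda>t. d\<phi> p (t *\<^sub>R (0, w))) = (*) (d\<phi> p (0, w))"
          using linear_scale[OF has_derivative_linear[OF dd[of p]]] by (auto simp del: scaleR_Pair)
        ultimately have "((\<lambda>t. \<phi> (p + t *\<^sub>R (0, w))) has_real_derivative d\<phi> p (0, w)) (at 0)"
          unfolding has_field_derivative_def by (simp only:)
        \<comment> \<open>The coefficient is constant along the slice. Off the half-line it is set
          to 0, in accordance with the indicator in \<open>h0\<close>, since \<open>V\<close> is
          arbitrary there.\<close>
        from DERIV_cmult[OF this, of "if fst p > 0 then V (fst p) else 0"]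
        have "((\<lambda>t. (if fst p > 0 then V (fst p) else 0) * \<phi> (p + t *\<^sub>R (0, w))) has_real_derivative
            (if fst p > 0 then V (fst p) else 0) * d\<phi> p (0, w)) (at 0)" .
        moreover have "(if fst p > 0 then V (fst p) else 0) * \<phi> (p + t *\<^sub>R (0, w)) = h0 (p + t *\<^sub>R (0, w))" for t
        proof (cases "p + t *\<^sub>R (0, w) \<in> K")
          case True
          then have "p + t *\<^sub>R (0, w) \<in> U" using K(2) by blast
          then show ?thesis by (simp add: h0_def mem_Times_iff)
        next
          case False
          then show ?thesis using K(3)[OF False] by (simp add: h0_def)
        qed
        moreover have "(if fst p > 0 then V (fst p) else 0) * d\<phi> p (0, w) = h1 p"
        proof (cases "p \<in> K")
          case True
          then have "p \<in> U" using K(2) by blast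
          then show ?thesis by (simp add: h1_def mem_Times_iff)
        next
          case False
          then show ?thesis using d0[OF False] by (simp add: h1_def)
        qed
        ultimately show ?thesis by (simp only:)
      qed
    qed
    then show ?thesis by (simp only: set_lebesgue_integral_def h1_def)
  qed
  have "d\<phi> p v = fst v * d\<phi> p (1, 0) + d\<phi> p (0, snd v)" for p
  proof -
    have lin: "linear (d\<phi> p)" by (rule has_derivative_linear[OF dd])
    have "v = fst v *\<^sub>R (1, 0) + (0, snd v)" by (simp add: prod_eq_iff)
    then have "d\<phi> p v = d\<phi> p (fst v *\<^sub>R (1, 0) + (0, snd v))" by simp
    also have "\<dots> = fst v * d\<phi> p (1, 0) + d\<phi> p (0, snd v)"
      by (simp only: linear_add[OF lin] linear_scale[OF lin] real_scaleR_def)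
    finally show ?thesis .
  qed
  then have "(LINT p:U|lborel. V (fst p) * d\<phi> p v) =
      (LINT p:U|lborel. fst v * (V (fst p) * d\<phi> p (1, 0)) + V (fst p) * d\<phi> p (0, snd v))"
    by (intro set_integral_cong) (simp add: algebra_simps)
  also have "\<dots> = fst v * (LINT p:U|lborel. V (fst p) * d\<phi> p (1, 0)) + (LINT p:U|lborel. V (fst p) * d\<phi> p (0, snd v))"
    by (subst set_integral_add(2)) (auto intro: iV set_integrable_mult_right)
  also have "\<dots> = - (fst v * (LINT p:U|lborel. V' (fst p) * \<phi> p))" unfolding r h by simp
  also have "\<dots> = - (LINT p:U|lborel. fst v * (V' (fst p) * \<phi> p))" by simp
  also have "\<dots> = - (LINT p:U|lborel. ((V' (fst p), 0) \<bullet> v) * \<phi> p)"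
    by (intro arg_cong[of _ _ uminus] set_integral_cong) (simp add: inner_prod_def)
  finally show "(LINT p:U|lborel. V (fst p) * frechet_derivative \<phi> (at p) v) = - (LINT p:U|lborel. ((V' (fst p), 0) \<bullet> v) * \<phi> p)"
    unfolding d\<phi>_def .
qed

lemma hess_r_r:
  assumes V: "ac_deriv V V'" and V': "L2_loc {0<..} V'" and \<phi>: "test_fun U \<phi>"
  shows "hess_dist U g (\<lambda>p. V (fst p)) d_r d_r \<phi> = - (LINT p:U|lborel. V' (fst p) * frechet_derivative \<phi> (at p) (1, 0))"
proof -
  note w = wgrad_AE_eq[OF U_open weak_gradient_fst[OF V V']]
  have 2: "(LINT x:U|lborel. (wgrad U (\<lambda>p. V (fst p)) x \<bullet> nabla U g d_r d_r x) * \<phi> x) = 0"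
    by (rule set_integral_eq_zero_AE) (use nabla_r_r in \<open>eventually_elim, simp\<close>)
  have "(LINT p:U|lborel. (wgrad U (\<lambda>p. V (fst p)) p \<bullet> (1, 0)) * frechet_derivative \<phi> (at p) (1, 0)) =
      (LINT p:U|lborel. V' (fst p) * frechet_derivative \<phi> (at p) (1, 0))"
  proof (rule L1_loc_integral_AE_cong[OF U_open])
    have "L2_loc U (wgrad U (\<lambda>p. V (fst p)))" using w(1) by (simp add: weak_gradient_def)
    then show "L1_loc U (\<lambda>p. wgrad U (\<lambda>p. V (fst p)) p \<bullet> (1, 0))"
      by (intro L2_imp_L1_loc L2_loc_inner_continuous U_open continuous_on_const)
    show "L1_loc U (\<lambda>p. V' (fst p))" by (intro L2_imp_L1_loc U_open L2_loc_fst V' C)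
    show "AE p in lborel. p \<in> U \<longrightarrow> wgrad U (\<lambda>p. V (fst p)) p \<bullet> (1, 0) = V' (fst p)"
      using w(2) by eventually_elim (simp add: inner_prod_def)
  qed (rule test_fun_derivative[OF \<phi>])
  then show ?thesis
    unfolding hess_dist_def 2 unfolding dist_deriv_def d_r_def divergence_const_field[OF \<phi>] by simp
qed

end

section \<open>Weak derivatives of determinants and eigenvalues\<close>

lemma trace_scaleR: "trace (c *\<^sub>R (A :: real ^ 'n::finite ^ 'n)) = c * trace A"
  by (simp add: trace_def sum_distrib_left)

lemma trace_inner: "trace ((A :: real ^ 'n::finite ^ 'n) ** B) = A \<bullet> transpose B"
  by (simp add: trace_def matrix_matrix_mult_def inner_vec_def transpose_def)

lemma bounded_linear_trace_mult: "bounded_linear (\<lambda>X. trace ((A :: real ^ 'n::finite ^ 'n) ** X ** B))"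
proof -
  have "linear (\<lambda>X. trace (A ** X ** B))"
    by (rule linearI) (simp_all add: matrix_add_ldistrib matrix_add_rdistrib trace_add matrix_scalar_ac
        scalar_matrix_assoc[symmetric] trace_scaleR)
  then show ?thesis by (simp add: linear_conv_bounded_linear)
qed

lemma matrix_mult_norm_le:
  obtains B where "B > 0" "\<And>(X :: real ^ 'n::finite ^ 'n) (Y :: real ^ 'n ^ 'n). norm (X ** Y) \<le> B * norm X * norm Y"
proof -
  have "bilinear (\<lambda>(X :: real ^ 'n ^ 'n) (Y :: real ^ 'n ^ 'n). X ** Y)"
    unfolding bilinear_def
    by (intro conjI allI linearI) (simp_all add: matrix_add_ldistrib matrix_add_rdistrib matrix_scalar_ac scalar_matrix_assoc[symmetric])
  from bilinear_bounded_pos[OF this] that show thesis by blast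
qed

lemma trace_norm_le:
  obtains B where "B > 0" "\<And>X :: real ^ 'n::finite ^ 'n. \<bar>trace X\<bar> \<le> B * norm X"
proof -
  have "linear (trace :: real ^ 'n ^ 'n \<Rightarrow> real)"
    by (rule linearI) (simp_all add: trace_add trace_scaleR)
  from linear_bounded_pos[OF this] that show thesis by auto
qed

lemma trace_mult_norm_le:
  obtains B where "B > 0" "\<And>(X :: real ^ 'n::finite ^ 'n) (Y :: real ^ 'n ^ 'n). \<bar>trace (X ** Y)\<bar> \<le> B * norm X * norm Y"
    "\<And>(X :: real ^ 'n::finite ^ 'n) (Y :: real ^ 'n ^ 'n) (Z :: real ^ 'n ^ 'n) (W :: real ^ 'n ^ 'n). \<bar>trace (X ** Y ** Z ** W)\<bar> \<le> B * norm X * norm Y * norm Z * norm W"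
proof -
  obtain b where b: "b > 0" "\<And>(X :: real ^ 'n::finite ^ 'n) (Y :: real ^ 'n ^ 'n). norm (X ** Y) \<le> b * norm X * norm Y"
    using matrix_mult_norm_le by blast
  obtain t where t: "t > 0" "\<And>X :: real ^ 'n::finite ^ 'n. \<bar>trace X\<bar> \<le> t * norm X"
    using trace_norm_le by blast
  define B where "B = t * b + t * b * b * b"
  have B: "B > 0" "t * b \<le> B" "t * b * b * b \<le> B" using b t by (auto simp: B_def intro!: add_pos_pos)
  have 1: "\<bar>trace (X ** Y)\<bar> \<le> B * norm X * norm Y" for X Y :: "real ^ 'n ^ 'n"
  proof -
    have "\<bar>trace (X ** Y)\<bar> \<le> t * norm (X ** Y)" by (rule t)
    also have "\<dots> \<le> t * (b * norm X * norm Y)" using t(1) by (intro mult_left_mono[OF b(2)]) simp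
    also have "\<dots> = (t * b) * (norm X * norm Y)" by simp
    also have "\<dots> \<le> B * (norm X * norm Y)" by (intro mult_right_mono B) simp
    finally show ?thesis by (simp add: mult.assoc)
  qed
  have 2: "\<bar>trace (X ** Y ** Z ** W)\<bar> \<le> B * norm X * norm Y * norm Z * norm W"
    for X :: "real ^ 'n ^ 'n" and Y Z W :: "real ^ 'n ^ 'n"
  proof -
    have "norm (X ** Y ** Z ** W) \<le> b * norm (X ** Y ** Z) * norm W" by (rule b)
    also have "\<dots> \<le> b * (b * norm (X ** Y) * norm Z) * norm W"
      using b by (intro mult_right_mono mult_left_mono) auto
    also have "\<dots> \<le> b * (b * (b * norm X * norm Y) * norm Z) * norm W"
      using b by (intro mult_right_mono mult_left_mono) auto
    finally have n: "norm (X ** Y ** Z ** W) \<le> b * (b * (b * norm X * norm Y) * norm Z) * norm W" .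
    have "\<bar>trace (X ** Y ** Z ** W)\<bar> \<le> t * norm (X ** Y ** Z ** W)" by (rule t)
    also have "\<dots> \<le> t * (b * (b * (b * norm X * norm Y) * norm Z) * norm W)"
      using t(1) by (intro mult_left_mono n) auto
    also have "\<dots> = (t * b * b * b) * (norm X * norm Y * norm Z * norm W)" by simp
    also have "\<dots> \<le> B * (norm X * norm Y * norm Z * norm W)" by (intro mult_right_mono B) simp
    finally show ?thesis by (simp add: mult.assoc)
  qed
  show thesis by (rule that[OF B(1) 1 2])
qed

context cylinder_geometry
begin

lemma trace_S:
  assumes p: "p \<in> U"
  shows "trace (S p) = (1 / 2) * trace (matrix_inv (M (fst p)) ** D (fst p))"
proof -
  have "trace (P (snd p) ** (matrix_inv (M (fst p)) ** D (fst p)) ** Q p) =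
      trace (Q p ** (P (snd p) ** (matrix_inv (M (fst p)) ** D (fst p))))"
    by (rule trace_mul_sym)
  also have "\<dots> = trace (matrix_inv (M (fst p)) ** D (fst p))"
    using PQ(1)[OF p] by (simp add: matrix_mul_assoc)
  finally show ?thesis by (simp add: S_def trace_scaleR)
qed

lemma trace_S_sq:
  assumes p: "p \<in> U"
  shows "trace (S p ** S p) = (1 / 4) * trace (D (fst p) ** matrix_inv (M (fst p)) ** D (fst p) ** matrix_inv (M (fst p)))"
proof -
  let ?X = "matrix_inv (M (fst p)) ** D (fst p)"
  have "S p ** S p = (1 / 4) *\<^sub>R (P (snd p) ** ?X ** (Q p ** P (snd p)) ** ?X ** Q p)"
    by (simp add: S_def matrix_scalar_ac scalar_matrix_assoc[symmetric] matrix_mul_assoc)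
  also have "\<dots> = (1 / 4) *\<^sub>R (P (snd p) ** (?X ** ?X) ** Q p)"
    using PQ(1)[OF p] by (simp add: matrix_mul_assoc)
  finally have "trace (S p ** S p) = (1 / 4) * trace (Q p ** (P (snd p) ** (?X ** ?X)))"
    by (simp add: trace_scaleR trace_mul_sym[of "P (snd p) ** (?X ** ?X)"])
  also have "Q p ** (P (snd p) ** (?X ** ?X)) = ?X ** ?X"
    using PQ(1)[OF p] by (simp add: matrix_mul_assoc)
  also have "trace (?X ** ?X) = trace (D (fst p) ** ?X ** matrix_inv (M (fst p)))"
    by (subst (2) trace_mul_sym) (simp add: matrix_mul_assoc)
  finally show ?thesis by (simp add: matrix_mul_assoc)
qed

text \<open>\<open>E\<close> will be \<open>\<rho>' / \<rho>\<close>. In the Ricci and in the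
  Hessian term the derivative sits on the test function, so \<open>tr S\<close> cancels under an
  integral although its own r-derivative exists only as a distribution.\<close>

theorem ric_m_r_r:
  assumes V: "ac_deriv V (\<lambda>r. (1 / 2) * trace (matrix_inv (M r) ** D r) - E r)" and E: "L2_loc {0<..} E"
    and \<phi>: "test_fun U \<phi>"
  shows "ric_m_infty U g (\<lambda>p. V (fst p)) d_r d_r \<phi> =
    (LINT p:U|lborel. E (fst p) * frechet_derivative \<phi> (at p) (1, 0)) - (LINT p:U|lborel. trace (S p ** S p) * \<phi> p)"
proof -
  obtain K where K: "compact K" "K \<subseteq> U" "\<And>x v. x \<notin> K \<Longrightarrow> frechet_derivative \<phi> (at x) v = 0"
    using test_fun_support[OF \<phi>] by metis
  have cont: "continuous_on {0<..} (\<lambda>r. matrix_inv (M r))"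
    by (intro continuous_on_matrix_inv ac_deriv_continuous[OF D(1)] M) auto
  have lin: "linear (\<lambda>A. (1 / 2) * trace (B ** A))" for B :: "real ^ 'k ^ 'k"
    by (rule linearI) (simp_all add: matrix_add_ldistrib trace_add matrix_scalar_ac scalar_matrix_assoc[symmetric] trace_scaleR algebra_simps)
  have ct: "continuous_on S (\<lambda>x. trace (B x ** A))" if "continuous_on S B" for S :: "'z::topological_space set" and B and A :: "real ^ 'k ^ 'k"
    unfolding trace_def by (intro continuous_on_sum continuous_on_component continuous_on_matrix_mult that continuous_on_const)
  have T: "L2_loc {0<..} (\<lambda>r. (1 / 2) * trace (matrix_inv (M r) ** D r))"
    by (rule L2_loc_linear_field[OF open_greaterThan D(2) lin]) (intro continuous_on_mult continuous_on_const ct cont)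
  have "L2_loc {0<..} (\<lambda>r. (1 / 2) * trace (matrix_inv (M r) ** D r) + E r *\<^sub>R (-1))"
    by (intro L2_loc_add T L2_loc_scaleR_continuous E continuous_on_const) simp
  then have V': "L2_loc {0<..} (\<lambda>r. (1 / 2) * trace (matrix_inv (M r) ** D r) - E r)" by simp
  have iE: "set_integrable lborel U (\<lambda>p. E (fst p) * frechet_derivative \<phi> (at p) (1, 0))"
    by (rule L1_loc_integrable[OF L2_imp_L1_loc[OF U_open L2_loc_fst[OF E C]] test_fun_derivative(2)[OF \<phi>] K(1,2)]) (rule K(3))
  have iT: "set_integrable lborel U (\<lambda>p. (1 / 2) * trace (matrix_inv (M (fst p)) ** D (fst p)) * frechet_derivative \<phi> (at p) (1, 0))"
    by (rule L1_loc_integrable[OF L2_imp_L1_loc[OF U_open L2_loc_fst[OF T C]] test_fun_derivative(2)[OF \<phi>] K(1,2)]) (rule K(3))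
  have "(LINT p:U|lborel. ((1 / 2) * trace (matrix_inv (M (fst p)) ** D (fst p)) - E (fst p)) * frechet_derivative \<phi> (at p) (1, 0)) =
     (LINT p:U|lborel. (1 / 2) * trace (matrix_inv (M (fst p)) ** D (fst p)) * frechet_derivative \<phi> (at p) (1, 0))
     - (LINT p:U|lborel. E (fst p) * frechet_derivative \<phi> (at p) (1, 0))"
    by (subst set_integral_diff(2)[OF iT iE, symmetric]) (simp add: left_diff_distrib)
  moreover have "(LINT p:U|lborel. trace (S p) * frechet_derivative \<phi> (at p) (1, 0)) =
     (LINT p:U|lborel. (1 / 2) * trace (matrix_inv (M (fst p)) ** D (fst p)) * frechet_derivative \<phi> (at p) (1, 0))"
    by (intro set_integral_cong) (simp add: trace_S)
  ultimately show ?thesis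
    unfolding ric_m_infty_def ric_r_r[OF \<phi>] hess_r_r[OF V V' \<phi>] by simp
qed

end

section \<open>Jacobi's formula and the derivatives of the eigenvalues\<close>

lemma set_integrable_linear_field:
  fixes F :: "'e::euclidean_space \<Rightarrow> 'm::euclidean_space" and T :: "'e \<Rightarrow> 'm \<Rightarrow> real"
  assumes K: "compact K" and F: "set_integrable lborel K F" and lin: "\<And>p. linear (T p)"
    and cont: "\<And>A. continuous_on K (\<lambda>p. T p A)"
  shows "set_integrable lborel K (\<lambda>p. T p (F p))"
proof -
  have "set_integrable lborel K (\<lambda>p. T p B * (F p \<bullet> B))" for B
  proof (rule set_integrable_continuous_mult[OF K cont])
    have "integrable lborel (\<lambda>p. (indicator K p *\<^sub>R F p) \<bullet> B)"
      using F unfolding set_integrable_def by (intro integrable_inner_left)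
    then show "set_integrable lborel K (\<lambda>p. F p \<bullet> B)" by (simp add: set_integrable_def)
  qed
  then have "set_integrable lborel K (\<lambda>p. \<Sum>B\<in>Basis. T p B * (F p \<bullet> B))"
    unfolding set_integrable_def scaleR_sum_right by (intro Bochner_Integration.integrable_sum)
  moreover have "(\<Sum>B\<in>Basis. T p B * (F p \<bullet> B)) = T p (F p)" for p
  proof -
    have "T p (F p) = T p (\<Sum>B\<in>Basis. (F p \<bullet> B) *\<^sub>R B)" by (simp add: euclidean_representation)
    also have "\<dots> = (\<Sum>B\<in>Basis. T p B * (F p \<bullet> B))"
      by (simp add: linear_sum[OF lin] linear_scale[OF lin] mult.commute)
    finally show ?thesis by simp
  qed
  ultimately show ?thesis by simp
qed

text \<open>Jacobi's formula for \<open>ln det\<close>: concavity of \<open>ln det\<close> on positive matrices bounds the increment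
  from both sides by integrals of \<open>trace (M\<^sup>-\<^sup>1 D)\<close> with \<open>M\<close> frozen at an endpoint.\<close>

lemma ac_deriv_ln_det:
  fixes M D :: "real \<Rightarrow> real ^ 'k::finite ^ 'k"
  assumes D: "ac_deriv M D" and pos: "\<And>r. r > 0 \<Longrightarrow> pos_spectrum (M r) (\<lambda>j. l j r)"
  shows "ac_deriv (\<lambda>r. ln (det (M r))) (\<lambda>r. trace (matrix_inv (M r) ** D r))"
proof -
  obtain B where B: "B > 0" "\<And>X Y :: real ^ 'k ^ 'k. \<bar>trace (X ** Y)\<bar> \<le> B * norm X * norm Y"
    using trace_mult_norm_le[where 'n = 'k] by metis
  define R where "R r = matrix_inv (M r)" for r
  have cR: "continuous_on {0<..} R"
    unfolding R_def by (intro continuous_on_matrix_inv ac_deriv_continuous[OF D]) (auto intro: pos_spectrum_invertible pos)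
  have ct: "continuous_on S (\<lambda>x. trace (R x ** A))" if "S \<subseteq> {0<..}" for S A
    unfolding trace_def
    by (intro continuous_on_sum continuous_on_component continuous_on_matrix_mult continuous_on_const
        continuous_on_subset[OF cR that])
  have lin: "linear (\<lambda>A. trace (C ** A))" for C :: "real ^ 'k ^ 'k"
    using bounded_linear.linear[OF bounded_linear_trace_mult[of C "mat 1"]] by simp
  have bl: "bounded_linear (\<lambda>A. trace (C ** A))" for C :: "real ^ 'k ^ 'k"
    using bounded_linear_trace_mult[of C "mat 1"] by simp
  have iD: "set_integrable lborel {s..t} D" if "0 < s" "s \<le> t" for s t by (rule ac_derivD(1)[OF D that])
  have fro: "set_integrable lborel {s..t} (\<lambda>x. trace (C ** D x))"
    "trace (C ** (M t - M s)) = (LINT x:{s..t}|lborel. trace (C ** D x))" if "0 < s" "s \<le> t" for s t and C :: "real ^ 'k ^ 'k"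
    using ac_derivD[OF ac_deriv_linear[OF bl D] that] by (simp_all add: matrix_diff_ldistrib trace_sub)
  have int: "set_integrable lborel {s..t} (\<lambda>x. trace (R x ** D x))" if "0 < s" "s \<le> t" for s t
    by (rule set_integrable_linear_field[OF compact_Icc iD[OF that] lin]) (rule ct, use that in auto)
  have "ac_deriv (\<lambda>r. ln (det (M r))) (\<lambda>r. trace (R r ** D r))"
  proof (rule ac_derivI_density[OF int])
    show in': "set_integrable lborel {s..t} (\<lambda>x. B * norm (D x))" if "0 < s" "s \<le> t" for s t
      by (intro set_integrable_mult_right set_integrable_norm iD that)
    fix a b \<epsilon> :: real assume ab: "0 < a" "a \<le> b" and \<epsilon>: "\<epsilon> > 0"
    obtain \<delta> where \<delta>: "\<delta> > 0" "\<And>x y. x \<in> {a..b} \<Longrightarrow> y \<in> {a..b} \<Longrightarrow> \<bar>x - y\<bar> < \<delta> \<Longrightarrow> norm (R x - R y) < \<epsilon>"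
      using uniform_continuity_Icc[OF cR ab(1) \<epsilon>] by blast
    show "\<exists>\<delta>>0. \<forall>s t. a \<le> s \<and> s \<le> t \<and> t \<le> b \<and> t - s < \<delta> \<longrightarrow>
      \<bar>ln (det (M t)) - ln (det (M s)) - (LINT x:{s..t}|lborel. trace (R x ** D x))\<bar> \<le>
      (LINT x:{s..t}|lborel. \<epsilon> * (B * norm (D x)))"
    proof (intro exI[of _ \<delta>] conjI allI impI \<delta>(1))
      fix s t assume st: "a \<le> s \<and> s \<le> t \<and> t \<le> b \<and> t - s < \<delta>"
      then have s0: "0 < s" "s \<le> t" and t0: "0 < t" using ab by auto
      have dev: "\<bar>(LINT x:{s..t}|lborel. trace (R y ** D x)) - (LINT x:{s..t}|lborel. trace (R x ** D x))\<bar> \<le>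
          (LINT x:{s..t}|lborel. \<epsilon> * (B * norm (D x)))" if y: "y \<in> {s, t}" for y
      proof -
        have eq: "(LINT x:{s..t}|lborel. trace (R y ** D x)) - (LINT x:{s..t}|lborel. trace (R x ** D x)) =
            (LINT x:{s..t}|lborel. trace (R y ** D x) - trace (R x ** D x))"
          by (rule set_integral_diff(2)[symmetric, OF fro(1)[OF s0] int[OF s0]])
        show ?thesis unfolding eq
        proof (rule set_integral_abs_le)
          show "set_integrable lborel {s..t} (\<lambda>x. trace (R y ** D x) - trace (R x ** D x))"
            by (rule set_integral_diff(1)[OF fro(1)[OF s0] int[OF s0]])
          show "set_integrable lborel {s..t} (\<lambda>x. \<epsilon> * (B * norm (D x)))"
            by (intro set_integrable_mult_right in' s0)
          fix x assume x: "x \<in> {s..t}"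
          have "\<bar>y - x\<bar> < \<delta>" using x y st by auto
          then have n: "norm (R y - R x) \<le> \<epsilon>" using \<delta>(2)[of y x] x y st by auto
          have "trace (R y ** D x) - trace (R x ** D x) = trace ((R y - R x) ** D x)"
            by (simp add: matrix_diff_rdistrib trace_sub)
          also have "\<bar>\<dots>\<bar> \<le> B * norm (R y - R x) * norm (D x)" by (rule B)
          also have "\<dots> \<le> B * \<epsilon> * norm (D x)" using n B(1) by (intro mult_right_mono mult_left_mono) auto
          finally show "\<bar>trace (R y ** D x) - trace (R x ** D x)\<bar> \<le> \<epsilon> * (B * norm (D x))" by (simp add: mult_ac)
        qed
      qed
      have up: "ln (det (M t)) - ln (det (M s)) \<le> (LINT x:{s..t}|lborel. trace (R s ** D x))"
        using pos_spectrum_ln_det_le[OF pos[OF s0(1)] pos[OF t0]] unfolding R_def[symmetric] fro(2)[OF s0] .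
      have "ln (det (M s)) - ln (det (M t)) \<le> trace (R t ** (M s - M t))"
        using pos_spectrum_ln_det_le[OF pos[OF t0] pos[OF s0(1)]] unfolding R_def[symmetric] .
      also have "\<dots> = - trace (R t ** (M t - M s))" by (simp add: matrix_diff_ldistrib trace_sub)
      finally have lo: "(LINT x:{s..t}|lborel. trace (R t ** D x)) \<le> ln (det (M t)) - ln (det (M s))"
        unfolding fro(2)[OF s0] by simp
      show "\<bar>ln (det (M t)) - ln (det (M s)) - (LINT x:{s..t}|lborel. trace (R x ** D x))\<bar> \<le>
        (LINT x:{s..t}|lborel. \<epsilon> * (B * norm (D x)))"
        using up lo dev[of s] dev[of t] by (auto simp: abs_le_iff)
    qed
  qed
  then show ?thesis unfolding R_def .
qed

lemma ac_deriv_exists: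
  fixes f :: "real \<Rightarrow> real"
  assumes int: "\<And>s t. 0 < s \<Longrightarrow> s \<le> t \<Longrightarrow> set_integrable lborel {s..t} f"
  obtains W where "ac_deriv W f"
proof -
  define W where "W t = (if 1 \<le> t then (LINT x:{1..t}|lborel. f x) else - (LINT x:{t..1}|lborel. f x))" for t
  have z: "(LINT x:{1..1}|lborel. f x) = 0"
    using set_integral_Icc_combine[of 1 1 1 f] int[of 1 1] by simp
  have "W t - W s = (LINT x:{s..t}|lborel. f x)" if st: "0 < s" "s \<le> t" for s t
  proof (cases "1 \<le> s")
    case True
    then show ?thesis using set_integral_Icc_combine[of 1 s t f] int[of 1 t] st by (simp add: W_def)
  next
    case False
    show ?thesis
    proof (cases "1 \<le> t")
      case True
      then show ?thesis using False set_integral_Icc_combine[of s 1 t f] int[of s t] st by (simp add: W_def)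
    next
      case F: False
      then show ?thesis using False set_integral_Icc_combine[of s t 1 f] int[of s 1] st by (simp add: W_def)
    qed
  qed
  then have "ac_deriv W f" using int by (simp add: ac_deriv_def)
  then show thesis by (rule that)
qed

text \<open>A primitive of \<open>f\<close> is monotone, and \<open>ac_deriv_mono_AE_nonneg\<close>
  passes from it back to \<open>f\<close>.\<close>

lemma AE_nonneg_if_Icc_integrals_nonneg:
  fixes f :: "real \<Rightarrow> real"
  assumes int: "\<And>s t. 0 < s \<Longrightarrow> s \<le> t \<Longrightarrow> set_integrable lborel {s..t} f"
    and nn: "\<And>s t. 0 < s \<Longrightarrow> s \<le> t \<Longrightarrow> 0 \<le> (LINT x:{s..t}|lborel. f x)"
  shows "AE x in lborel. 0 < x \<longrightarrow> 0 \<le> f x"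
proof -
  obtain W where W: "ac_deriv W f" using ac_deriv_exists[OF int] by blast
  show ?thesis
  proof (rule ac_deriv_mono_AE_nonneg[OF W])
    fix s t :: real assume "0 < s" "s \<le> t"
    then show "W s \<le> W t" using ac_derivD(2)[OF W, of s t] nn[of s t] by simp
  qed
qed

text \<open>Jensen's inequality for the quadratic form \<open>trace (X A\<^sup>-\<^sup>1 X B\<^sup>-\<^sup>1)\<close>, combined with the bound on
  the increments of the logarithms of the eigenvalues.\<close>

lemma ln_eigenvalue_increment_le:
  fixes M D :: "real \<Rightarrow> real ^ 'k::finite ^ 'k"
  assumes D: "ac_deriv M D" "L2_loc {0<..} D" "\<And>r. transpose (D r) = D r"
    and pos: "\<And>r. r > 0 \<Longrightarrow> pos_spectrum (M r) (\<lambda>j. l j r)" and st: "0 < s" "s < t"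
  shows "set_integrable lborel {s..t} (\<lambda>x. trace (D x ** matrix_inv (M s) ** D x ** matrix_inv (M t)))"
    and "(\<Sum>j=1..CARD('k). (ln (l j t) - ln (l j s))\<^sup>2) \<le>
      (t - s) * (LINT x:{s..t}|lborel. trace (D x ** matrix_inv (M s) ** D x ** matrix_inv (M t)))"
proof -
  define A B where "A = matrix_inv (M s)" and "B = matrix_inv (M t)"
  define \<beta> where "\<beta> X Y = trace (X ** A ** Y ** B)" for X Y
  define h where "h = t - s"
  define I where "I = M t - M s"
  have h: "h > 0" using st by (simp add: h_def)
  have t0: "0 < t" "s \<le> t" using st by auto
  have L1: "L1_loc {0<..} (\<lambda>x. D x \<bullet> transpose (A ** D x ** B))"
  proof (intro L1_loc_inner_L2 D(2) L2_loc_linear_field[OF _ D(2)] continuous_on_const)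
    have tl: "transpose (X + Y) = transpose X + transpose Y" "transpose (c *\<^sub>R X) = c *\<^sub>R transpose X"
      for X Y :: "real ^ 'k ^ 'k" and c by (simp_all add: transpose_def vec_eq_iff)
    show "linear (\<lambda>X. transpose (A ** X ** B))"
      by (rule linearI) (simp_all add: matrix_add_ldistrib matrix_add_rdistrib matrix_scalar_ac
          scalar_matrix_assoc[symmetric] tl)
  qed simp
  have e: "D x \<bullet> transpose (A ** D x ** B) = \<beta> (D x) (D x)" for x
    by (simp add: \<beta>_def trace_inner[symmetric] matrix_mul_assoc)
  have sub: "{s..t} \<subseteq> {0<..}" using st by auto
  have ib: "set_integrable lborel {s..t} (\<lambda>x. \<beta> (D x) (D x))"
    using L1 sub compact_Icc[of s t] unfolding L1_loc_def e by blast
  then show "set_integrable lborel {s..t} (\<lambda>x. trace (D x ** matrix_inv (M s) ** D x ** matrix_inv (M t)))"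
    by (simp add: \<beta>_def A_def B_def)
  have bl1: "bounded_linear (\<lambda>X. \<beta> X Y)" and bl2: "bounded_linear (\<lambda>Y. \<beta> X Y)" for X Y
  proof -
    show "bounded_linear (\<lambda>X. \<beta> X Y)"
      using bounded_linear_trace_mult[of "mat 1" "A ** Y ** B"] by (simp add: \<beta>_def matrix_mul_assoc)
    show "bounded_linear (\<lambda>Y. \<beta> X Y)"
      using bounded_linear_trace_mult[of "X ** A" "B"] by (simp add: \<beta>_def matrix_mul_assoc)
  qed
  note lin1 = bounded_linear.linear[OF bl1] and lin2 = bounded_linear.linear[OF bl2]
  have i1: "set_integrable lborel {s..t} (\<lambda>x. \<beta> (D x) I)" "\<beta> I I = (LINT x:{s..t}|lborel. \<beta> (D x) I)"
    using ac_derivD[OF ac_deriv_linear[OF bl1 D(1)] st(1) t0(2)] by (simp_all add: I_def linear_diff[OF lin1])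
  have i2: "set_integrable lborel {s..t} (\<lambda>x. \<beta> I (D x))" "\<beta> I I = (LINT x:{s..t}|lborel. \<beta> I (D x))"
    using ac_derivD[OF ac_deriv_linear[OF bl2 D(1)] st(1) t0(2)] by (simp_all add: I_def linear_diff[OF lin2])
  have ic: "set_integrable lborel {s..t} (\<lambda>x. c)" "(LINT x:{s..t}|lborel. c) = h * c" for c :: real
    using t0(2) by (simp_all add: set_integrable_def set_integral_const emeasure_lborel_Icc_eq h_def)
  have symI: "transpose I = I"
    using pos[OF st(1)] pos[OF t0(1)] by (simp add: I_def pos_spectrum_def transpose_def vec_eq_iff)
  \<comment> \<open>\<open>(1 / h) *\<^sub>R I\<close> is the mean of \<open>D\<close> over the
    interval. Both mixed terms integrate to \<open>\<beta> I I\<close>, so nonnegativity of the form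
    at the deviation from the mean becomes Jensen's inequality.\<close>
  have exp: "\<beta> (D x - (1 / h) *\<^sub>R I) (D x - (1 / h) *\<^sub>R I) =
      \<beta> (D x) (D x) - (1 / h) * \<beta> (D x) I - (1 / h) * \<beta> I (D x) + (1 / h)\<^sup>2 * \<beta> I I" for x
    by (simp add: linear_diff[OF lin1] linear_diff[OF lin2] linear_scale[OF lin1] linear_scale[OF lin2] power2_eq_square algebra_simps)
  have nn: "0 \<le> \<beta> (D x - (1 / h) *\<^sub>R I) (D x - (1 / h) *\<^sub>R I)" for x
    unfolding \<beta>_def A_def B_def
  proof (rule pos_spectrum_quadratic_nonneg[OF pos[OF st(1)] pos[OF t0(1)]])
    show "transpose (D x - (1 / h) *\<^sub>R I) = D x - (1 / h) *\<^sub>R I"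
      using symI D(3)[of x] by (simp add: transpose_def vec_eq_iff)
  qed
  have "0 \<le> (LINT x:{s..t}|lborel. \<beta> (D x) (D x) - (1 / h) * \<beta> (D x) I - (1 / h) * \<beta> I (D x) + (1 / h)\<^sup>2 * \<beta> I I)"
    unfolding exp[symmetric] set_lebesgue_integral_def by (intro Bochner_Integration.integral_nonneg) (simp add: nn)
  also have "\<dots> = (LINT x:{s..t}|lborel. \<beta> (D x) (D x)) - (1 / h) * \<beta> I I - (1 / h) * \<beta> I I + (1 / h)\<^sup>2 * (h * \<beta> I I)"
  proof -
    note j1 = set_integrable_mult_right[OF i1(1), of "1 / h"] and j2 = set_integrable_mult_right[OF i2(1), of "1 / h"]
    show ?thesis
      using set_integral_add(2)[OF set_integral_diff(1)[OF set_integral_diff(1)[OF ib j1] j2] ic(1), of "(1 / h)\<^sup>2 * \<beta> I I"]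
        set_integral_diff(2)[OF set_integral_diff(1)[OF ib j1] j2] set_integral_diff(2)[OF ib j1]
      by (simp only: ic(2) set_integral_mult_right i1(2)[symmetric] i2(2)[symmetric])
  qed
  also have "\<dots> = (LINT x:{s..t}|lborel. \<beta> (D x) (D x)) - \<beta> I I / h"
    using h by (simp add: power2_eq_square field_simps)
  finally have "\<beta> I I \<le> h * (LINT x:{s..t}|lborel. \<beta> (D x) (D x))"
    using h by (simp add: field_simps)
  moreover have "(\<Sum>j=1..CARD('k). (ln (l j t) - ln (l j s))\<^sup>2) \<le> \<beta> I I"
    using pos_spectrum_ln_ratio_le[OF pos[OF st(1)] pos[OF t0(1)]] by (simp add: \<beta>_def I_def A_def B_def)
  ultimately show "(\<Sum>j=1..CARD('k). (ln (l j t) - ln (l j s))\<^sup>2) \<le>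
      (t - s) * (LINT x:{s..t}|lborel. trace (D x ** matrix_inv (M s) ** D x ** matrix_inv (M t)))"
    by (simp add: \<beta>_def A_def B_def h_def)
qed

text \<open>For fixed slopes \<open>c\<close> the function \<open>w c\<close> is linear in the
  logarithms of the eigenvalues. Its short increments are bounded by the squared logarithmic
  increments over the step length, hence by an integral of the trace with both inverses frozen, and
  summing gives \<open>w' c x <= q x\<close> almost everywhere. Countably many slopes share one null
  set, and the best slopes turn \<open>w' c x\<close> into the sum of squares.\<close>

lemma eigenvalue_derivative_AE:
  fixes M D :: "real \<Rightarrow> real ^ 'k::finite ^ 'k" and l l' :: "nat \<Rightarrow> real \<Rightarrow> real"
  assumes D: "ac_deriv M D" "L2_loc {0<..} D" "\<And>r. transpose (D r) = D r"
    and pos: "\<And>r. r > 0 \<Longrightarrow> pos_spectrum (M r) (\<lambda>j. l j r)"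
    and l: "\<And>j. j \<in> {1..CARD('k)} \<Longrightarrow> ac_deriv (l j) (l' j)"
  shows "AE x in lborel. 0 < x \<longrightarrow> (\<Sum>j=1..CARD('k). (l' j x / l j x)\<^sup>2) \<le>
    trace (D x ** matrix_inv (M x) ** D x ** matrix_inv (M x))"
proof -
  let ?n = "CARD('k)"
  define R where "R r = matrix_inv (M r)" for r
  define q where "q x = trace (D x ** R x ** D x ** R x)" for x
  define \<mu> where "\<mu> j x = (1 / l j x) * l' j x" for j x
  have cR: "continuous_on {0<..} R"
    unfolding R_def by (intro continuous_on_matrix_inv ac_deriv_continuous[OF D(1)]) (auto intro: pos_spectrum_invertible pos)
  have lpos: "l j r > 0" if "j \<in> {1..?n}" "r > 0" for j r
    using pos_spectrum_pos[OF pos[OF that(2)] that(1)] .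
  have ac\<mu>: "ac_deriv (\<lambda>x. ln (l j x)) (\<mu> j)" if j: "j \<in> {1..?n}" for j
    unfolding \<mu>_def
    by (rule ac_deriv_compose[OF l[OF j] lpos[OF j]]) (auto intro!: derivative_eq_intros continuous_intros)
  \<comment> \<open>The supporting lines of the square: \<open>2 c \<mu> - c^2\<close> is at most
    \<open>\<mu>^2\<close>, with equality at \<open>c = \<mu>\<close>. The derivative of
    \<open>w c\<close> sums these over \<open>j\<close>, where \<open>\<mu>\<close> is the
    logarithmic derivative of \<open>l j\<close>.\<close>
  define w where "w c t = (\<Sum>j=1..?n. 2 * c j * ln (l j t) + (- (c j)\<^sup>2) * t)" for c t
  define w' where "w' c t = (\<Sum>j=1..?n. 2 * c j * \<mu> j t + (- (c j)\<^sup>2) * 1)" for c t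
  have acw: "ac_deriv (w c) (w' c)" for c
    unfolding w_def w'_def
  proof (intro ac_deriv_sum ac_deriv_add ac_deriv_linear[OF bounded_linear_mult_right] ac\<mu>)
    show "ac_deriv (\<lambda>t. t) (\<lambda>t. 1 :: real)"
      by (rule ac_deriv_C1) (auto intro: continuous_on_const)
  qed
  have iq: "set_integrable lborel {s..t} q" if "0 < s" "s \<le> t" for s t
  proof -
    have tl: "transpose (X + Y) = transpose X + transpose Y" "transpose (c *\<^sub>R X) = c *\<^sub>R transpose X"
      for X Y :: "real ^ 'k ^ 'k" and c by (simp_all add: transpose_def vec_eq_iff)
    have "L1_loc {0<..} (\<lambda>x. D x \<bullet> transpose (R x ** D x ** R x))"
    proof (intro L1_loc_inner_L2 D(2) L2_loc_linear_field[OF open_greaterThan D(2)])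
      show "linear (\<lambda>X. transpose (R x ** X ** R x))" for x
        by (rule linearI) (simp_all add: matrix_add_ldistrib matrix_add_rdistrib matrix_scalar_ac
            scalar_matrix_assoc[symmetric] tl)
      show "continuous_on {0<..} (\<lambda>x. transpose (R x ** X ** R x))" for X
        by (intro continuous_on_transpose continuous_on_matrix_mult cR continuous_on_const)
    qed
    moreover have "D x \<bullet> transpose (R x ** D x ** R x) = q x" for x
      by (simp add: q_def trace_inner[symmetric] matrix_mul_assoc)
    moreover have "{s..t} \<subseteq> {0<..}" using that by auto
    ultimately show ?thesis using compact_Icc[of s t] unfolding L1_loc_def by (simp only:)
  qed
  have iD2: "set_integrable lborel {s..t} (\<lambda>x. (norm (D x))\<^sup>2)" if "0 < s" "s \<le> t" for s t
  proof -
    have "{s..t} \<subseteq> {0<..}" using that by auto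
    then show ?thesis using D(2) compact_Icc[of s t] unfolding L2_loc_def by blast
  qed
  obtain K where K: "K > 0" "\<And>(X :: real ^ 'k ^ 'k) (Y :: real ^ 'k ^ 'k) (Z :: real ^ 'k ^ 'k) (W :: real ^ 'k ^ 'k).
      \<bar>trace (X ** Y ** Z ** W)\<bar> \<le> K * norm X * norm Y * norm Z * norm W"
    using trace_mult_norm_le[where 'n = 'k] by metis
  have incr: "w c b - w c a \<le> (LINT x:{a..b}|lborel. q x)" if ab: "0 < a" "a \<le> b" for a b c
  proof (rule increment_le_set_integral[OF ab(2) iq[OF ab], where H = "\<lambda>t. LINT x:{a..t}|lborel. (norm (D x))\<^sup>2"])
    fix \<epsilon> :: real assume \<epsilon>: "\<epsilon> > 0"
    have "bounded (R ` {a..b})"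
      by (intro compact_imp_bounded compact_continuous_image continuous_on_subset[OF cR]) (use ab in auto)
    then obtain m0 where "\<forall>y\<in>R ` {a..b}. norm y \<le> m0" by (auto simp only: bounded_iff)
    then have m0: "norm (R x) \<le> m0" if "x \<in> {a..b}" for x using that by blast
    define m where "m = \<bar>m0\<bar> + 1"
    have m: "m > 0" "\<And>x. x \<in> {a..b} \<Longrightarrow> norm (R x) \<le> m"
      using m0 by (force simp: m_def)+
    \<comment> \<open>Replacing the two inverses frozen at \<open>s\<close> and \<open>t\<close> by
      their value at \<open>x\<close> costs at most \<open>K * m * \<eta>\<close> times the squared
      norm of \<open>D x\<close> each, and \<open>2 * K * m * \<eta> = \<epsilon>\<close>.\<close>
    define \<eta> where "\<eta> = \<epsilon> / (2 * K * m)"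
    have \<eta>: "\<eta> > 0" using \<epsilon> K(1) m(1) by (simp add: \<eta>_def)
    obtain \<delta> where \<delta>: "\<delta> > 0" "\<And>x y. x \<in> {a..b} \<Longrightarrow> y \<in> {a..b} \<Longrightarrow> \<bar>x - y\<bar> < \<delta> \<Longrightarrow> norm (R x - R y) < \<eta>"
      using uniform_continuity_Icc[OF cR ab(1) \<eta>] by blast
    show "\<exists>\<delta>>0. \<forall>s t. a \<le> s \<and> s \<le> t \<and> t \<le> b \<and> t - s < \<delta> \<longrightarrow> w c t - w c s \<le> (LINT x:{s..t}|lborel. q x) +
        \<epsilon> * ((LINT x:{a..t}|lborel. (norm (D x))\<^sup>2) - (LINT x:{a..s}|lborel. (norm (D x))\<^sup>2))"
    proof (intro exI[of _ \<delta>] conjI allI impI \<delta>(1))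
      fix s t assume st: "a \<le> s \<and> s \<le> t \<and> t \<le> b \<and> t - s < \<delta>"
      then have s0: "0 < s" "s \<le> t" using ab by auto
      have H: "(LINT x:{a..t}|lborel. (norm (D x))\<^sup>2) - (LINT x:{a..s}|lborel. (norm (D x))\<^sup>2) = (LINT x:{s..t}|lborel. (norm (D x))\<^sup>2)"
        using set_integral_Icc_combine[of a s t "\<lambda>x. (norm (D x))\<^sup>2"] iD2[of a t] st ab by simp
      show "w c t - w c s \<le> (LINT x:{s..t}|lborel. q x) +
        \<epsilon> * ((LINT x:{a..t}|lborel. (norm (D x))\<^sup>2) - (LINT x:{a..s}|lborel. (norm (D x))\<^sup>2))"
      proof (cases "s = t")
        case True
        have "(LINT x:{t..t}|lborel. q x) = 0"
          using set_integral_Icc_combine[of t t t q] iq[of t t] s0 by simp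
        then show ?thesis using True by simp
      next
        case False
        then have lt: "s < t" using s0 by simp
        define h where "h = t - s"
        have h: "h > 0" using lt by (simp add: h_def)
        note le = ln_eigenvalue_increment_le[OF D pos s0(1) lt]
        have "w c t - w c s = (\<Sum>j=1..?n. 2 * c j * (ln (l j t) - ln (l j s)) - (c j)\<^sup>2 * h)"
          unfolding w_def sum_subtractf[symmetric] by (intro sum.cong refl) (simp add: h_def algebra_simps)
        also have "\<dots> \<le> (\<Sum>j=1..?n. (ln (l j t) - ln (l j s))\<^sup>2 / h)"
        proof (intro sum_mono)
          fix j
          have "0 \<le> (ln (l j t) - ln (l j s) - c j * h)\<^sup>2 / h" using h by simp
          also have "\<dots> = (ln (l j t) - ln (l j s))\<^sup>2 / h - (2 * c j * (ln (l j t) - ln (l j s)) - (c j)\<^sup>2 * h)"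
            using h by (simp add: field_simps power2_eq_square)
          finally show "2 * c j * (ln (l j t) - ln (l j s)) - (c j)\<^sup>2 * h \<le> (ln (l j t) - ln (l j s))\<^sup>2 / h" by simp
        qed
        also have "\<dots> = (\<Sum>j=1..?n. (ln (l j t) - ln (l j s))\<^sup>2) / h" by (rule sum_divide_distrib[symmetric])
        also have "\<dots> \<le> (LINT x:{s..t}|lborel. trace (D x ** R s ** D x ** R t))"
          using le(2) h by (simp add: h_def R_def divide_le_eq mult.commute)
        also have "\<dots> \<le> (LINT x:{s..t}|lborel. q x + \<epsilon> * (norm (D x))\<^sup>2)"
        proof (rule set_integral_mono)
          show "set_integrable lborel {s..t} (\<lambda>x. trace (D x ** R s ** D x ** R t))"
            using le(1) by (simp add: R_def)
          show "set_integrable lborel {s..t} (\<lambda>x. q x + \<epsilon> * (norm (D x))\<^sup>2)"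
            by (intro set_integral_add(1) iq iD2 set_integrable_mult_right s0)
          fix x assume x: "x \<in> {s..t}"
          have xab: "x \<in> {a..b}" "s \<in> {a..b}" "t \<in> {a..b}" using x st by auto
          have "\<bar>s - x\<bar> < \<delta>" "\<bar>t - x\<bar> < \<delta>" using x st by auto
          then have n: "norm (R s - R x) \<le> \<eta>" "norm (R t - R x) \<le> \<eta>"
            using \<delta>(2)[of s x] \<delta>(2)[of t x] xab by auto
          have "trace (D x ** R s ** D x ** R t) - q x =
              trace (D x ** (R s - R x) ** D x ** R t) + trace (D x ** R x ** D x ** (R t - R x))"
            by (simp add: q_def matrix_diff_ldistrib matrix_diff_rdistrib trace_sub)
          also have "\<dots> \<le> K * norm (D x) * \<eta> * norm (D x) * m + K * norm (D x) * m * norm (D x) * \<eta>"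
          proof (rule add_mono)
            have "trace (D x ** (R s - R x) ** D x ** R t) \<le> K * norm (D x) * norm (R s - R x) * norm (D x) * norm (R t)"
              using K(2)[of "D x" "R s - R x" "D x" "R t"] by linarith
            also have "\<dots> \<le> K * norm (D x) * \<eta> * norm (D x) * m"
              using n(1) m(2)[OF xab(3)] K(1) \<eta> by (intro mult_mono) auto
            finally show "trace (D x ** (R s - R x) ** D x ** R t) \<le> K * norm (D x) * \<eta> * norm (D x) * m" .
            have "trace (D x ** R x ** D x ** (R t - R x)) \<le> K * norm (D x) * norm (R x) * norm (D x) * norm (R t - R x)"
              using K(2)[of "D x" "R x" "D x" "R t - R x"] by linarith
            also have "\<dots> \<le> K * norm (D x) * m * norm (D x) * \<eta>"
              using n(2) m(2)[OF xab(1)] K(1) m(1) by (intro mult_mono) auto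
            finally show "trace (D x ** R x ** D x ** (R t - R x)) \<le> K * norm (D x) * m * norm (D x) * \<eta>" .
          qed
          also have "\<dots> = (2 * K * m * \<eta>) * (norm (D x))\<^sup>2" by (simp add: power2_eq_square)
          also have "2 * K * m * \<eta> = \<epsilon>" using K(1) m(1) by (simp add: \<eta>_def)
          finally show "trace (D x ** R s ** D x ** R t) \<le> q x + \<epsilon> * (norm (D x))\<^sup>2" by simp
        qed
        also have "\<dots> = (LINT x:{s..t}|lborel. q x) + \<epsilon> * (LINT x:{s..t}|lborel. (norm (D x))\<^sup>2)"
          using set_integral_add(2)[OF iq[OF s0] set_integrable_mult_right[of \<epsilon>, OF iD2[OF s0]]] by simp
        finally show ?thesis unfolding H .
      qed
    qed
  qed
  have AEc: "AE x in lborel. 0 < x \<longrightarrow> 0 \<le> q x - w' c x" for c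
  proof (rule AE_nonneg_if_Icc_integrals_nonneg)
    fix s t :: real assume st: "0 < s" "s \<le> t"
    note i = iq[OF st] ac_derivD(1)[OF acw st]
    show "set_integrable lborel {s..t} (\<lambda>x. q x - w' c x)" by (rule set_integral_diff(1)[OF i])
    show "0 \<le> (LINT x:{s..t}|lborel. q x - w' c x)"
      using incr[OF st] ac_derivD(2)[OF acw st] set_integral_diff(2)[OF i] by simp
  qed
  \<comment> \<open>Only the first \<open>k\<close> slopes matter. Extensional functions are used so
    that the set of rational choices is countable.\<close>
  define Cs where "Cs = PiE {1..?n} (\<lambda>_. \<rat> :: real set)"
  have "countable Cs" unfolding Cs_def by (intro countable_PiE) (auto simp: countable_rat)
  then have "AE x in lborel. \<forall>c\<in>Cs. 0 < x \<longrightarrow> 0 \<le> q x - w' c x"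
    using AEc by (subst AE_ball_countable) auto
  then show ?thesis
  proof eventually_elim
    case (elim x)
    show ?case
    proof
      assume x: "0 < x"
      have "(\<Sum>j=1..?n. (\<mu> j x)\<^sup>2) \<le> q x"
      proof (rule field_le_epsilon)
        fix e :: real assume e: "e > 0"
        \<comment> \<open>Rational slopes within \<open>\<eta>\<close> of the optimal ones lose at
          most \<open>\<eta>\<^sup>2\<close> in each of the \<open>?n\<close> summands, in total
          \<open>e\<close>.\<close>
        define \<eta> where "\<eta> = sqrt (e / real ?n)"
        have \<eta>: "\<eta> > 0" "\<eta>\<^sup>2 = e / real ?n" using e by (auto simp: \<eta>_def)
        have "\<forall>j. \<exists>r\<in>\<rat>. \<mu> j x < r \<and> r < \<mu> j x + \<eta>" using \<eta>(1) by (intro allI Rats_dense_in_real) simp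
        then obtain r where r: "\<And>j. r j \<in> \<rat>" "\<And>j. \<mu> j x < r j" "\<And>j. r j < \<mu> j x + \<eta>" by metis
        define c where "c = restrict r {1..?n}"
        have "c \<in> Cs" using r(1) by (auto simp: Cs_def c_def)
        then have "w' c x \<le> q x" using elim x by force
        moreover have "w' c x = (\<Sum>j=1..?n. 2 * r j * \<mu> j x - (r j)\<^sup>2)"
          unfolding w'_def by (intro sum.cong) (auto simp: c_def)
        moreover have "(\<Sum>j=1..?n. (\<mu> j x)\<^sup>2) = (\<Sum>j=1..?n. (2 * r j * \<mu> j x - (r j)\<^sup>2) + (r j - \<mu> j x)\<^sup>2)"
          by (intro sum.cong refl) (simp add: power2_eq_square algebra_simps)
        moreover have "(\<Sum>j=1..?n. (r j - \<mu> j x)\<^sup>2) \<le> (\<Sum>j=1..?n. \<eta>\<^sup>2)"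
        proof (intro sum_mono power_mono)
          fix j show "r j - \<mu> j x \<le> \<eta>" "0 \<le> r j - \<mu> j x" using r(2,3)[of j] by auto
        qed
        moreover have "(\<Sum>j=1..?n. \<eta>\<^sup>2) = e" by (simp add: \<eta>(2))
        ultimately show "(\<Sum>j=1..?n. (\<mu> j x)\<^sup>2) \<le> q x + e" by (simp add: sum.distrib)
      qed
      then show "(\<Sum>j=1..?n. (l' j x / l j x)\<^sup>2) \<le> trace (D x ** matrix_inv (M x) ** D x ** matrix_inv (M x))"
        by (simp add: q_def R_def \<mu>_def)
    qed
  qed
qed

text \<open>Converse of \<open>weak_gradient_imp_ac_deriv\<close>. It is needed for the density
  \<open>\<rho>\<close>, whose derivative comes from concavity: only after this is
  \<open>wgrad\<close> of \<open>\<rho>\<close> known to be a weak gradient.\<close>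

lemma ac_deriv_imp_weak_gradient:
  fixes u d :: "real \<Rightarrow> real"
  assumes u: "ac_deriv u d" and d: "L2_loc {0<..} d"
  shows "weak_gradient {0<..} u d"
  unfolding weak_gradient_def
proof (intro conjI allI impI d)
  fix \<phi> :: "real \<Rightarrow> real" and v :: real assume \<phi>: "test_fun {0<..} \<phi>"
  obtain K where K: "compact K" "K \<subseteq> {0<..}" "\<And>x. x \<notin> K \<Longrightarrow> \<phi> x = 0"
    "\<And>x v. x \<notin> K \<Longrightarrow> frechet_derivative \<phi> (at x) v = 0"
    using test_fun_support[OF \<phi>] by blast
  define \<phi>' where "\<phi>' x = frechet_derivative \<phi> (at x) 1" for x
  have c\<phi>': "continuous_on A \<phi>'" for A unfolding \<phi>'_def by (rule test_fun_derivative[OF \<phi>])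
  have sc: "frechet_derivative \<phi> (at x) v = v * \<phi>' x" for x v
    using linear_scale[OF has_derivative_linear[OF test_fun_derivative(1)[OF \<phi>, of x]], of v 1]
    by (simp add: \<phi>'_def)
  have "(\<phi> has_vector_derivative \<phi>' x) (at x)" for x
    using test_fun_derivative(1)[OF \<phi>, of x] unfolding has_vector_derivative_def
    by (rule has_derivative_eq_rhs) (simp add: fun_eq_iff sc)
  then have "ac_deriv \<phi> \<phi>'" by (intro ac_deriv_C1 c\<phi>')
  from ac_deriv_mult[OF u this] have ac: "ac_deriv (\<lambda>x. u x * \<phi> x) (\<lambda>x. d x * \<phi> x + u x * \<phi>' x)" .
  obtain a b where ab: "0 < a" "a \<le> b" "K \<subseteq> {a..b}" using compact_pos_bounds[OF K(1,2)] by blast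
  have off: "\<phi> x = 0 \<and> \<phi>' x = 0" if "x \<notin> {a..b}" for x
  proof -
    have "x \<notin> K" using ab(3) that by blast
    then show ?thesis using K(3,4)[of x] by (simp add: \<phi>'_def)
  qed
  have z: "(LINT x:{0<..}|lborel. d x * \<phi> x + u x * \<phi>' x) = 0"
  proof (rule ac_deriv_compact_support[OF ac, of "a / 2" "b + 1"])
    show "u (a / 2) * \<phi> (a / 2) = 0" "u (b + 1) * \<phi> (b + 1) = 0"
      using off[of "a / 2"] off[of "b + 1"] ab by auto
    show "d x * \<phi> x + u x * \<phi>' x = 0" if "x > 0" "x \<notin> {a / 2..b + 1}" for x
      using off[of x] that ab by auto
  qed (use ab in auto)
  have i1: "set_integrable lborel {0<..} (\<lambda>x. d x * \<phi> x)"
    by (intro L1_loc_test_integrable[OF _ \<phi>] L2_imp_L1_loc d) simp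
  have i2: "set_integrable lborel {0<..} (\<lambda>x. u x * \<phi>' x)"
    by (rule L1_loc_integrable[OF L2_imp_L1_loc[OF open_greaterThan L2_loc_continuous[OF open_greaterThan ac_deriv_continuous[OF u]]] c\<phi>' K(1,2)])
      (use K(4) in \<open>simp add: \<phi>'_def\<close>)
  have "(LINT x:{0<..}|lborel. u x * \<phi>' x) = - (LINT x:{0<..}|lborel. d x * \<phi> x)"
    using z set_integral_add(2)[OF i1 i2] by simp
  moreover have "(LINT x:{0<..}|lborel. u x * frechet_derivative \<phi> (at x) v) = (LINT x:{0<..}|lborel. v * (u x * \<phi>' x))"
    by (intro set_integral_cong) (simp add: sc)
  moreover have "(LINT x:{0<..}|lborel. (d x \<bullet> v) * \<phi> x) = (LINT x:{0<..}|lborel. v * (d x * \<phi> x))"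
    by (intro set_integral_cong) simp
  ultimately show "(LINT x:{0<..}|lborel. u x * frechet_derivative \<phi> (at x) v) = - (LINT x:{0<..}|lborel. (d x \<bullet> v) * \<phi> x)"
    by simp
qed

section \<open>Concave densities\<close>

lemma ac_deriv_cong:
  assumes "ac_deriv u d" "\<And>x. x > 0 \<Longrightarrow> u x = v x" "\<And>x. x > 0 \<Longrightarrow> d x = e x"
  shows "ac_deriv v e"
proof -
  have "indicator {s..t} x *\<^sub>R d x = indicator {s..t} x *\<^sub>R e x" if "0 < s" for s t x
    using assms(3)[of x] that by (auto simp: indicator_def)
  then have "(\<lambda>x. indicator {s..t} x *\<^sub>R d x) = (\<lambda>x. indicator {s..t} x *\<^sub>R e x)" if "0 < s" for s t
    using that by blast
  note eq = this
  have "set_integrable lborel {s..t} e \<and> v t - v s = (LINT x:{s..t}|lborel. e x)" if st: "0 < s" "s \<le> t" for s t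
    using ac_derivD[OF assms(1) st] assms(2)[of s] assms(2)[of t] st
    unfolding set_integrable_def set_lebesgue_integral_def eq[OF st(1)] by simp
  then show ?thesis by (simp add: ac_deriv_def)
qed

text \<open>\<open>d\<close> is the right derivative, written as an infimum of difference quotients
  of the convex function \<open>- f\<close>. It is antitone, hence measurable and locally bounded.
  The increment of \<open>f\<close> and the integral of \<open>d\<close> over an interval both lie
  between \<open>(t - s) * d t\<close> and \<open>(t - s) * d s\<close>, so the error is at most the
  length times an increment of \<open>- d\<close>.\<close>

lemma concave_ac_deriv:
  fixes f :: "real \<Rightarrow> real"
  assumes f: "concave_on {0<..} f"
  obtains d where "ac_deriv f d" "L2_loc {0<..} d"
proof -
  have cf: "convex_on {0<..} (\<lambda>x. - f x)" using f by (simp add: concave_on_def)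
  define d where "d x = - Inf ((\<lambda>t. (- f x - - f t) / (x - t)) ` ({x<..} \<inter> {0<..}))" for x
  have tan: "f y \<le> f x + d x * (y - x)" if "x > 0" "y > 0" for x y
    using convex_le_Inf_differential[OF cf, of x y] that by (simp add: d_def interior_open)
  have mono: "d y \<le> d x" if "0 < x" "x \<le> y" for x y
  proof (cases "x = y")
    case False
    then have "0 \<le> (d x - d y) * (y - x)"
      using tan[of x y] tan[of y x] that by (simp add: algebra_simps)
    then show ?thesis using False that by (simp add: zero_le_mult_iff)
  qed simp
  have m: "set_borel_measurable lborel {0<..} d"
  proof -
    have "mono_on {0<..} (\<lambda>x. - d x)" using mono by (auto simp: mono_on_def)
    then have "(\<lambda>x. - d x) \<in> borel_measurable (restrict_space borel {0<..})" by (rule borel_measurable_mono_on_fnc)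
    then have "(\<lambda>x. indicator {0<..} x *\<^sub>R (- d x)) \<in> borel_measurable borel"
      by (subst (asm) borel_measurable_restrict_space_iff) auto
    then have "(\<lambda>x. - (indicator {0<..} x *\<^sub>R (- d x))) \<in> borel_measurable borel" by measurable
    then show ?thesis by (simp add: set_borel_measurable_def)
  qed
  have L2: "L2_loc {0<..} d"
  proof (rule L2_locI_bound[OF m L2_loc_one[OF open_greaterThan]])
    fix K :: "real set" assume "compact K" "K \<subseteq> {0<..}"
    then obtain a b where ab: "0 < a" "a \<le> b" "K \<subseteq> {a..b}" using compact_pos_bounds by metis
    show "\<exists>C. \<forall>x\<in>K. norm (d x) \<le> C * norm (1::real)"
    proof (intro exI[of _ "\<bar>d a\<bar> + \<bar>d b\<bar>"] ballI)
      fix x assume "x \<in> K"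
      then have "a \<le> x" "x \<le> b" using ab by auto
      then show "norm (d x) \<le> (\<bar>d a\<bar> + \<bar>d b\<bar>) * norm (1::real)" using mono[of a x] mono[of x b] ab by simp
    qed
  qed
  have int: "set_integrable lborel {s..t} d" if "0 < s" "s \<le> t" for s t
  proof -
    have "{s..t} \<subseteq> {0<..}" using that by auto
    then show ?thesis using L2_imp_L1_loc[OF open_greaterThan L2] compact_Icc unfolding L1_loc_def by blast
  qed
  have "ac_deriv f d"
  proof (rule ac_derivI[OF int])
    fix a b :: real assume ab: "0 < a" "a \<le> b"
    show "\<exists>H. \<forall>\<epsilon>>0. \<exists>\<delta>>0. \<forall>s t. a \<le> s \<and> s \<le> t \<and> t \<le> b \<and> t - s < \<delta> \<longrightarrow>
        \<bar>f t - f s - (LINT x:{s..t}|lborel. d x)\<bar> \<le> \<epsilon> * (H t - H s)"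
    proof (rule exI[of _ "\<lambda>x. - d x"], intro allI impI)
      fix \<epsilon> :: real assume \<epsilon>: "\<epsilon> > 0"
      show "\<exists>\<delta>>0. \<forall>s t. a \<le> s \<and> s \<le> t \<and> t \<le> b \<and> t - s < \<delta> \<longrightarrow>
        \<bar>f t - f s - (LINT x:{s..t}|lborel. d x)\<bar> \<le> \<epsilon> * (- d t - - d s)"
      proof (intro exI[of _ \<epsilon>] conjI allI impI \<epsilon>)
        fix s t assume st: "a \<le> s \<and> s \<le> t \<and> t \<le> b \<and> t - s < \<epsilon>"
        then have s0: "0 < s" "s \<le> t" using ab by auto
        have c: "set_integrable lborel {s..t} (\<lambda>x. k)" "(LINT x:{s..t}|lborel. k) = (t - s) * k" for k :: real
          using s0 by (simp_all add: set_integrable_def set_integral_const emeasure_lborel_Icc_eq)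
        have "(LINT x:{s..t}|lborel. d x) \<le> (t - s) * d s"
          using set_integral_mono[OF int[OF s0] c(1)[of "d s"]] mono s0 by (simp add: c(2))
        moreover have "(t - s) * d t \<le> (LINT x:{s..t}|lborel. d x)"
          using set_integral_mono[OF c(1)[of "d t"] int[OF s0]] mono s0 by (simp add: c(2))
        moreover have "f t - f s \<le> (t - s) * d s" "(t - s) * d t \<le> f t - f s"
          using tan[of s t] tan[of t s] s0 by (simp_all add: algebra_simps)
        ultimately have "\<bar>f t - f s - (LINT x:{s..t}|lborel. d x)\<bar> \<le> (t - s) * (d s - d t)"
          by (simp add: right_diff_distrib abs_le_iff)
        also have "\<dots> \<le> \<epsilon> * (d s - d t)" using st mono[OF s0] by (intro mult_right_mono) auto
        finally show "\<bar>f t - f s - (LINT x:{s..t}|lborel. d x)\<bar> \<le> \<epsilon> * (- d t - - d s)" by simp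
      qed
    qed
  qed
  then show thesis using L2 by (rule that)
qed

text \<open>The zero at \<open>r0\<close> is a convex combination of \<open>r\<close> and a point on
  the other side, with positive weight at \<open>r\<close>; concavity and nonnegativity then force
  the value at \<open>r\<close> to be 0.\<close>

lemma concave_nonneg_zero:
  fixes f :: "real \<Rightarrow> real"
  assumes f: "concave_on {0..} f" and nn: "\<And>r. r \<ge> 0 \<Longrightarrow> f r \<ge> 0" and z: "f r0 = 0" "r0 > 0" and r: "r \<ge> 0"
  shows "f r = 0"
proof -
  \<comment> \<open>The reflection of \<open>r\<close> in \<open>r0\<close> if \<open>r\<close> lies
    to the left, and the end 0 of the half-line otherwise.\<close>
  define s where "s = (if r < r0 then 2 * r0 - r else 0)"
  define \<theta> where "\<theta> = (if r < r0 then 1 / 2 else r0 / r)"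
  have s: "s \<ge> 0" using z r by (auto simp: s_def)
  have \<theta>: "0 < \<theta>" "\<theta> \<le> 1" using z by (auto simp: \<theta>_def)
  have comb: "\<theta> * r + (1 - \<theta>) * s = r0" using z by (auto simp: s_def \<theta>_def field_simps)
  have "\<theta> * f r + (1 - \<theta>) * f s \<le> f (\<theta> * r + (1 - \<theta>) * s)"
    using concave_onD[OF f, of \<theta> s r] \<theta> s r by (simp add: algebra_simps)
  then have "\<theta> * f r + (1 - \<theta>) * f s \<le> 0" using comb z by simp
  moreover have "0 \<le> (1 - \<theta>) * f s" using nn[OF s] \<theta> by simp
  ultimately have "\<theta> * f r \<le> 0" by linarith
  then have "f r \<le> 0" using \<theta>(1) by (simp add: mult_le_0_iff)
  then show ?thesis using nn[OF r] by simp
qed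

text \<open>\<open>\<rho>\<close> itself need not be concave: it is recovered from its concave power
  by the chain rule for \<open>y powr (N - 1)\<close>, which requires positive values.\<close>

lemma concave_power_density:
  fixes \<rho> :: "real \<Rightarrow> real"
  assumes \<rho>: "concave_on {0..} (\<lambda>r. \<rho> r powr (1 / (N - 1)))" and pos: "\<And>r. r > 0 \<Longrightarrow> \<rho> r > 0" and N: "N > 1"
  obtains e where "ac_deriv \<rho> e" "L2_loc {0<..} e"
proof -
  define f where "f r = \<rho> r powr (1 / (N - 1))" for r
  have "concave_on {0<..} f"
    using \<rho> unfolding f_def[abs_def] concave_on_def by (rule convex_on_subset) auto
  then obtain d where d: "ac_deriv f d" "L2_loc {0<..} d" by (rule concave_ac_deriv)
  have fpos: "f r > 0" if "r > 0" for r using pos[OF that] by (simp add: f_def)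
  have ac: "ac_deriv (\<lambda>r. f r powr (N - 1)) (\<lambda>r. ((N - 1) * f r powr (N - 1 - 1)) * d r)"
  proof (rule ac_deriv_compose[OF d(1) fpos])
    show "((\<lambda>y. y powr (N - 1)) has_real_derivative (N - 1) * y powr (N - 1 - 1)) (at y)" if "y > 0" for y :: real
      by (rule has_real_derivative_powr[OF that])
    show "continuous_on {0<..} (\<lambda>y::real. (N - 1) * y powr (N - 1 - 1))"
      by (intro continuous_intros) auto
  qed
  have eq: "f r powr (N - 1) = \<rho> r" if "r > 0" for r
    using pos[OF that] N by (simp add: f_def powr_powr)
  have "ac_deriv \<rho> (\<lambda>r. ((N - 1) * f r powr (N - 1 - 1)) * d r)"
    by (rule ac_deriv_cong[OF ac eq]) auto
  moreover have "L2_loc {0<..} (\<lambda>r. d r *\<^sub>R ((N - 1) * f r powr (N - 1 - 1)))"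
  proof (rule L2_loc_scaleR_continuous[OF open_greaterThan d(2)])
    show "continuous_on {0<..} (\<lambda>r. (N - 1) * f r powr (N - 1 - 1))"
      by (intro continuous_on_mult continuous_on_const continuous_on_powr ac_deriv_continuous[OF d(1)])
        (use fpos in force)
  qed
  ultimately show thesis using that by (simp add: mult.commute)
qed

section \<open>The weighted description\<close>

lemma L2_loc_componentwise:
  fixes f :: "'e::euclidean_space \<Rightarrow> 'b::euclidean_space"
  assumes "open U" "\<And>b. b \<in> Basis \<Longrightarrow> L2_loc U (\<lambda>x. f x \<bullet> b)"
  shows "L2_loc U f"
proof -
  have "L2_loc U (\<lambda>x. \<Sum>b\<in>Basis. (f x \<bullet> b) *\<^sub>R b)"
    by (intro L2_loc_sum L2_loc_scaleR_continuous assms continuous_on_const)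
  then show ?thesis by (simp add: euclidean_representation)
qed

lemma AE_lborel_fst:
  assumes "AE r in lborel. Q r"
  shows "AE p in (lborel :: ('a::euclidean_space \<times> 'b::euclidean_space) measure). Q (fst p)"
proof -
  obtain N where N: "N \<in> null_sets lborel" "{r \<in> space lborel. \<not> Q r} \<subseteq> N"
    using assms by (auto simp: eventually_ae_filter)
  have "emeasure (lborel \<Otimes>\<^sub>M lborel) (N \<times> (UNIV :: 'b set)) = emeasure lborel N * emeasure lborel (UNIV :: 'b set)"
    using N by (intro lborel.emeasure_pair_measure_Times) auto
  then have "emeasure lborel (N \<times> (UNIV :: 'b set)) = 0" using N(1) by (simp add: lborel_prod null_setsD1)
  moreover have "N \<times> (UNIV :: 'b set) \<in> sets lborel"
    using N(1) by (auto simp: borel_prod[symmetric])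
  ultimately have "N \<times> (UNIV :: 'b set) \<in> null_sets lborel" by (simp add: null_sets_def)
  then show ?thesis by (rule AE_I') (use N(2) in auto)
qed

text \<open>Left translation by \<open>h\<close> carries the identity, where
  \<open>gram_matrix\<close> is evaluated, to \<open>h\<close>, and it preserves both frame and
  metric. The change from the chart at the identity to \<open>\<kappa>\<close> is already part of
  the two invariance conditions.\<close>

lemma gram_matrix_chart:
  fixes A :: "('h::{t2_space, second_countable_topology}, 'k::finite) chart set"
  assumes G: "lie_group G A" and X: "left_invariant_frame G A X" and g: "left_invariant_metric G A g"
    and \<kappa>: "\<kappa> \<in> A" "h \<in> fst \<kappa>"
  shows "g \<kappa> h (X i \<kappa> h) (X j \<kappa> h) = gram_matrix G A X g $ i $ j"
proof -
  interpret group G using G by (simp add: lie_group_def)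
  have car: "x \<in> carrier G" for x using G by (simp add: lie_group_def)
  define \<kappa>0 where "\<kappa>0 = chart_at A \<one>\<^bsub>G\<^esub>"
  have "(\<Union>\<kappa>\<in>A. fst \<kappa>) = UNIV" using G by (simp add: lie_group_def smooth_atlas_def)
  then have "\<exists>\<kappa>. \<kappa> \<in> A \<and> \<one>\<^bsub>G\<^esub> \<in> fst \<kappa>" by blast
  then have \<kappa>0: "\<kappa>0 \<in> A" "\<one>\<^bsub>G\<^esub> \<in> fst \<kappa>0"
    unfolding \<kappa>0_def chart_at_def by (metis (mono_tags, lifting) someI_ex)+
  have h1: "h \<otimes>\<^bsub>G\<^esub> \<one>\<^bsub>G\<^esub> = h" using car by simp
  define T where "T = tangent_map \<kappa>0 \<kappa> (\<lambda>b. h \<otimes>\<^bsub>G\<^esub> b) \<one>\<^bsub>G\<^esub>"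
  have X1: "X i \<kappa> h = T (X i \<kappa>0 \<one>\<^bsub>G\<^esub>)" for i
    using X \<kappa> \<kappa>0 h1 unfolding left_invariant_frame_def left_invariant_vf_def T_def by metis
  have "g \<kappa> h (T u) (T v) = g \<kappa>0 \<one>\<^bsub>G\<^esub> u v" for u v
    using g \<kappa> \<kappa>0 h1 unfolding left_invariant_metric_def T_def by metis
  then show ?thesis by (simp add: X1 gram_matrix_def \<kappa>0_def[symmetric] Let_def)
qed

text \<open>Supplies the metric formula demanded by \<open>cylinder_geometry\<close>: the components
  of \<open>u\<close> in the frame are \<open>matrix_inv (frame_matrix X \<kappa> h) *v u\<close>,
  and in them the metric is the Gram matrix.\<close>

lemma left_invariant_metric_coframe:
  fixes A :: "('h::{t2_space, second_countable_topology}, 'k::finite) chart set"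
  assumes G: "lie_group G A" and X: "left_invariant_frame G A X" and g: "left_invariant_metric G A g"
    and \<kappa>: "\<kappa> \<in> A" "h \<in> fst \<kappa>"
  shows "transpose (gram_matrix G A X g) = gram_matrix G A X g"
    and "g \<kappa> h u v = (gram_matrix G A X g *v (matrix_inv (frame_matrix X \<kappa> h) *v u)) \<bullet>
      (matrix_inv (frame_matrix X \<kappa> h) *v v)"
proof -
  have bil: "bilinear (g \<kappa> h)" and sym: "\<And>u v. g \<kappa> h u v = g \<kappa> h v u"
    using g \<kappa> by (auto simp: left_invariant_metric_def riemannian_metric_def)
  note gr = gram_matrix_chart[OF G X g \<kappa>]
  show tr: "transpose (gram_matrix G A X g) = gram_matrix G A X g"
    by (simp add: transpose_def vec_eq_iff gr[symmetric] sym)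
  have inv: "invertible (frame_matrix X \<kappa> h)" using X \<kappa> by (simp add: left_invariant_frame_def)
  have F: "frame_matrix X \<kappa> h *v a = (\<Sum>i\<in>UNIV. a $ i *\<^sub>R X i \<kappa> h)" for a
    by (simp add: frame_matrix_def matrix_vector_mult_def vec_eq_iff mult.commute)
  have "g \<kappa> h (frame_matrix X \<kappa> h *v a) (frame_matrix X \<kappa> h *v b) = (gram_matrix G A X g *v a) \<bullet> b" for a b
  proof -
    have "g \<kappa> h (frame_matrix X \<kappa> h *v a) (frame_matrix X \<kappa> h *v b) =
        (\<Sum>(i, j)\<in>UNIV \<times> UNIV. g \<kappa> h (a $ i *\<^sub>R X i \<kappa> h) (b $ j *\<^sub>R X j \<kappa> h))"
      unfolding F by (rule bilinear_sum[OF bil])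
    also have "\<dots> = (\<Sum>i\<in>UNIV. \<Sum>j\<in>UNIV. a $ i * (b $ j * gram_matrix G A X g $ i $ j))"
      by (simp only: sum.cartesian_product[symmetric] bilinear_lmul[OF bil] bilinear_rmul[OF bil] gr real_scaleR_def mult.left_commute)
    also have "\<dots> = a \<bullet> (gram_matrix G A X g *v b)"
      by (simp add: inner_vec_def matrix_vector_mult_def sum_distrib_left mult_ac)
    also have "\<dots> = (gram_matrix G A X g *v a) \<bullet> b" by (rule symmetric_matrix_inner[OF tr, symmetric])
    finally show ?thesis .
  qed
  from this[of "matrix_inv (frame_matrix X \<kappa> h) *v u" "matrix_inv (frame_matrix X \<kappa> h) *v v"]
  show "g \<kappa> h u v = (gram_matrix G A X g *v (matrix_inv (frame_matrix X \<kappa> h) *v u)) \<bullet>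
      (matrix_inv (frame_matrix X \<kappa> h) *v v)"
    by (simp only: matrix_inv_mult(4)[OF inv])
qed

text \<open>A zero of \<open>\<rho>\<close> inside the half-line would, by concavity of its power,
  make \<open>\<rho>\<close> vanish identically, and the whole space would have measure 0, against
  full support.\<close>

lemma weighted_description_density_pos:
  fixes m :: "'y::polish_space measure" and A :: "('h::{t2_space, second_countable_topology}, 'k::finite) chart set"
  assumes m: "metric_measure_space m" and w: "weighted_description G A \<alpha> m N X F \<Omega> \<rho> g" and r: "r > 0"
  shows "\<rho> r > 0"
proof (rule ccontr)
  assume "\<not> \<rho> r > 0"
  have nn: "\<rho> s \<ge> 0" if "s \<ge> 0" for s using w that by (simp add: weighted_description_def)
  have "\<rho> r = 0" using \<open>\<not> \<rho> r > 0\<close> nn[of r] r by simp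
  have conc: "concave_on {0..} (\<lambda>r. \<rho> r powr (1 / (N - 1)))" using w by (simp add: weighted_description_def)
  have "\<rho> s powr (1 / (N - 1)) = 0" if "s \<ge> 0" for s
    by (rule concave_nonneg_zero[OF conc _ _ r that]) (use \<open>\<rho> r = 0\<close> in auto)
  then have z: "\<rho> s = 0" if "s \<ge> 0" for s using that by (metis powr_eq_0_iff)
  have "emeasure m UNIV = (\<integral>\<^sup>+ p. ennreal (\<rho> (fst p)) * indicator {p. 0 \<le> fst p \<and> F p \<in> UNIV} p \<partial>(lborel \<Otimes>\<^sub>M \<Omega>))"
    using w by (simp add: weighted_description_def)
  also have "\<dots> = (\<integral>\<^sup>+ p. 0 \<partial>((lborel :: real measure) \<Otimes>\<^sub>M \<Omega>))"
    by (intro nn_integral_cong) (auto simp: indicator_def z)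
  finally have "emeasure m UNIV = 0" by simp
  moreover have "emeasure m UNIV > 0" using m by (simp add: metric_measure_space_def)
  ultimately show False by simp
qed

lemma W12_loc_ac_deriv:
  fixes u :: "real \<Rightarrow> real"
  assumes "W12_loc {0<..} u" "continuous_on {0<..} u"
  shows "ac_deriv u (wgrad {0<..} u)" "L2_loc {0<..} (wgrad {0<..} u)"
proof -
  obtain D where "weak_gradient {0<..} u D" using assms(1) by (auto simp: W12_loc_def)
  then have w: "weak_gradient {0<..} u (wgrad {0<..} u)" by (rule wgrad_AE_eq(1)[OF open_greaterThan])
  show "ac_deriv u (wgrad {0<..} u)" by (rule weak_gradient_imp_ac_deriv[OF assms(2) w])
  show "L2_loc {0<..} (wgrad {0<..} u)" using w by (simp add: weak_gradient_def)
qed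

text \<open>The weak derivatives are chosen entry by entry. Averaging with the transposed entry
  makes \<open>D\<close> symmetric at every r, as the nonnegativity of the quadratic form
  requires.\<close>

lemma symmetric_matrix_ac_deriv:
  fixes M :: "real \<Rightarrow> real ^ 'k::finite ^ 'k"
  assumes M: "\<And>i j. continuous_on {0<..} (\<lambda>r. M r $ i $ j)" "\<And>i j. W12_loc {0<..} (\<lambda>r. M r $ i $ j)"
    and sym: "\<And>r. r > 0 \<Longrightarrow> transpose (M r) = M r"
  obtains D where "ac_deriv M D" "L2_loc {0<..} D" "\<And>r. transpose (D r) = D r"
proof -
  define D0 where "D0 i j = wgrad {0<..} (\<lambda>r. M r $ i $ j)" for i j
  have D0: "ac_deriv (\<lambda>r. M r $ i $ j) (D0 i j)" "L2_loc {0<..} (D0 i j)" for i j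
    unfolding D0_def using W12_loc_ac_deriv[OF M(2) M(1)] by auto
  define D where "D r = (\<chi> i j. (1 / 2) * (D0 i j r + D0 j i r))" for r
  have ent: "ac_deriv (\<lambda>r. M r $ i $ j) (\<lambda>r. D r $ i $ j)" "L2_loc {0<..} (\<lambda>r. D r $ i $ j)" for i j
  proof -
    have "ac_deriv (\<lambda>r. (1 / 2) * (M r $ i $ j + M r $ j $ i)) (\<lambda>r. (1 / 2) * (D0 i j r + D0 j i r))"
      by (intro ac_deriv_linear[OF bounded_linear_mult_right] ac_deriv_add D0)
    moreover have "(1 / 2) * (M r $ i $ j + M r $ j $ i) = M r $ i $ j" if "r > 0" for r
      using arg_cong[OF sym[OF that], of "\<lambda>A. A $ i $ j"] by (simp add: transpose_def)
    ultimately show "ac_deriv (\<lambda>r. M r $ i $ j) (\<lambda>r. D r $ i $ j)"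
      by (rule ac_deriv_cong) (simp_all add: D_def)
    have "L2_loc {0<..} (\<lambda>r. (D0 i j r + D0 j i r) *\<^sub>R (1 / 2 :: real))"
      by (intro L2_loc_scaleR_continuous L2_loc_add D0 continuous_on_const) simp
    then show "L2_loc {0<..} (\<lambda>r. D r $ i $ j)" by (simp add: D_def)
  qed
  have basis: "\<exists>i j. B = axis i (axis j 1)" if "B \<in> Basis" for B :: "real ^ 'k ^ 'k"
    using that by (auto simp: Basis_vec_def)
  show thesis
  proof (rule that[of D])
    show "ac_deriv M D"
    proof (rule ac_deriv_componentwise)
      fix B :: "real ^ 'k ^ 'k" assume "B \<in> Basis"
      then obtain i j where "B = axis i (axis j 1)" using basis by blast
      then show "ac_deriv (\<lambda>r. M r \<bullet> B) (\<lambda>r. D r \<bullet> B)" using ent(1)[of i j] by (simp add: inner_axis)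
    qed
    show "L2_loc {0<..} D"
    proof (rule L2_loc_componentwise[OF open_greaterThan])
      fix B :: "real ^ 'k ^ 'k" assume "B \<in> Basis"
      then obtain i j where "B = axis i (axis j 1)" using basis by blast
      then show "L2_loc {0<..} (\<lambda>r. D r \<bullet> B)" using ent(2)[of i j] by (simp add: inner_axis)
    qed
    show "transpose (D r) = D r" for r by (simp add: D_def transpose_def vec_eq_iff add.commute)
  qed
qed

text \<open>Both integrands are sums of products of two locally square integrable functions, hence
  integrable against \<open>\<phi>\<close>; this allows the pointwise inequality to be
  integrated.\<close>

lemma (in cylinder_geometry) eigenvalue_integral_le:
  assumes symD: "\<And>r. transpose (D r) = D r"
    and pos: "\<And>r. r > 0 \<Longrightarrow> pos_spectrum (M r) (\<lambda>j. l j r)"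
    and l: "\<And>j. j \<in> {1..CARD('k)} \<Longrightarrow> ac_deriv (l j) (l' j)" "\<And>j. j \<in> {1..CARD('k)} \<Longrightarrow> L2_loc {0<..} (l' j)"
    and \<phi>: "test_fun U \<phi>" "\<And>p. 0 \<le> \<phi> p"
  shows "(1 / 4) * (LINT p:U|lborel. (\<Sum>j=1..CARD('k). (l' j (fst p) / l j (fst p))\<^sup>2) * \<phi> p) \<le>
    (LINT p:U|lborel. trace (S p ** S p) * \<phi> p)"
proof -
  let ?n = "CARD('k)"
  have L2: "L2_loc U (\<lambda>p. l' j (fst p) / l j (fst p))" if j: "j \<in> {1..?n}" for j
  proof -
    have "continuous_on {0<..} (\<lambda>r. 1 / l j r)"
      using pos_spectrum_pos[OF pos j]
      by (intro continuous_on_divide continuous_on_const ac_deriv_continuous[OF l(1)[OF j]]) force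
    then have "L2_loc {0<..} (\<lambda>r. l' j r *\<^sub>R (1 / l j r))"
      by (intro L2_loc_scaleR_continuous open_greaterThan l(2) j)
    then show ?thesis using L2_loc_fst[OF _ C, of "\<lambda>r. l' j r / l j r"] by simp
  qed
  have i1: "set_integrable lborel U (\<lambda>p. (\<Sum>j=1..?n. (l' j (fst p) / l j (fst p))\<^sup>2) * \<phi> p)"
  proof -
    have "set_integrable lborel U (\<lambda>p. (l' j (fst p) / l j (fst p) * (l' j (fst p) / l j (fst p))) * \<phi> p)" if "j \<in> {1..?n}" for j
      by (intro L1_loc_test_integrable[OF _ \<phi>(1)] L1_loc_mult_L2 L2 that)
    then show ?thesis
      unfolding set_integrable_def sum_distrib_right scaleR_sum_right power2_eq_square
      by (intro Bochner_Integration.integrable_sum)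
  qed
  have i2: "set_integrable lborel U (\<lambda>p. trace (S p ** S p) * \<phi> p)"
  proof -
    have "linear (transpose :: real ^ 'k ^ 'k \<Rightarrow> _)" by (rule linearI) (simp_all add: transpose_def vec_eq_iff)
    then have "L2_loc U (\<lambda>p. transpose (S p))"
      by (intro L2_loc_linear_field[OF U_open L2_loc_S] continuous_on_const)
    from L1_loc_inner_L2[OF L2_loc_S this] show ?thesis
      unfolding trace_inner by (rule L1_loc_test_integrable[OF _ \<phi>(1)])
  qed
  have "AE p in lborel. 0 < fst p \<longrightarrow> (\<Sum>j=1..?n. (l' j (fst p) / l j (fst p))\<^sup>2) \<le>
    trace (D (fst p) ** matrix_inv (M (fst p)) ** D (fst p) ** matrix_inv (M (fst p)))" (is "AE p in _. ?Q (fst p)")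
    by (rule AE_lborel_fst[OF eigenvalue_derivative_AE[OF D symD pos l(1)]])
  then have "AE p in lborel. p \<in> U \<longrightarrow>
      (1 / 4) * ((\<Sum>j=1..?n. (l' j (fst p) / l j (fst p))\<^sup>2) * \<phi> p) \<le> trace (S p ** S p) * \<phi> p"
  proof eventually_elim
    case (elim p)
    show ?case
    proof
      assume p: "p \<in> U"
      then have "0 < fst p" by auto
      with elim have "(1 / 4) * (\<Sum>j=1..?n. (l' j (fst p) / l j (fst p))\<^sup>2) \<le> trace (S p ** S p)"
        unfolding trace_S_sq[OF p] by (intro mult_left_mono) auto
      from mult_right_mono[OF this \<phi>(2)[of p]]
      show "(1 / 4) * ((\<Sum>j=1..?n. (l' j (fst p) / l j (fst p))\<^sup>2) * \<phi> p) \<le> trace (S p ** S p) * \<phi> p"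
        by (simp only: mult.assoc)
    qed
  qed
  then have "(LINT p:U|lborel. (1 / 4) * ((\<Sum>j=1..?n. (l' j (fst p) / l j (fst p))\<^sup>2) * \<phi> p)) \<le>
      (LINT p:U|lborel. trace (S p ** S p) * \<phi> p)"
    by (intro set_integral_mono_AE set_integrable_mult_right i1 i2) simp
  then show ?thesis by simp
qed

theorem proposition4p2:
  fixes G :: "'h::{t2_space, second_countable_topology} monoid"
    and A :: "('h, 'k::finite) chart set"
    and m :: "'y::polish_space measure" and y :: 'y and N :: real
    and \<alpha> :: "'h \<Rightarrow> 'y \<Rightarrow> 'y" and L :: "'h set"
    and X :: "'k \<Rightarrow> ('h, 'k) vfield"
    and F :: "real \<times> 'h \<Rightarrow> 'y" and \<Omega> :: "'h measure"
    and \<rho> :: "real \<Rightarrow> real" and g :: "real \<Rightarrow> ('h, 'k) metric_tensor"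
    and l :: "nat \<Rightarrow> real \<Rightarrow> real"
  assumes "lie_group G A" and "connected (UNIV :: 'h set)" and "simply_connected (UNIV :: 'h set)"
    and "nilpotent_group G"
    and "N > real CARD('k) + 1" and "RCD0 m N"
    and "closed_isometry_subgroup G \<alpha>" and "measure_preserving_action \<alpha> m"
    and "quotient_is_half_line \<alpha> y"
    and "closed_line_subgroup G L" and "hausdorff_dim ((\<lambda>h. \<alpha> h y) ` L) > 1"
    and "left_invariant_frame G A X"
    and "weighted_description G A \<alpha> m N X F \<Omega> \<rho> g"
    and "\<forall>r>0. ordered_eigenvalues (gram_matrix G A X (g r)) (\<lambda>j. l j r)"
    and "\<forall>j\<in>{1..CARD('k)}. (\<forall>r>0. l j r > 0) \<and> continuous_on {0<..} (l j) \<and> W12_loc {0<..} (l j)"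
  shows "\<forall>\<kappa>\<in>A. distribution_le (half_cylinder \<kappa>)
     (ric_m_infty (half_cylinder \<kappa>) (cylinder_metric g \<kappa>)
        (\<lambda>p. weight_potential G A X g \<rho> (fst p)) d_r d_r)
     (\<lambda>\<phi>. - (1 / 4) * (LINT p:half_cylinder \<kappa>|lborel.
              (\<Sum>j=1..CARD('k). (wgrad {0<..} (l j) (fst p) / l j (fst p))\<^sup>2) * \<phi> p)
           - dist_deriv (half_cylinder \<kappa>) d_r (\<lambda>p. wgrad {0<..} \<rho> (fst p) / \<rho> (fst p)) \<phi>)"
proof
  fix \<kappa> assume \<kappa>: "\<kappa> \<in> A"
  note lie = \<open>lie_group G A\<close> and X = \<open>left_invariant_frame G A X\<close>
    and w = \<open>weighted_description G A \<alpha> m N X F \<Omega> \<rho> g\<close>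
  define M where "M r = gram_matrix G A X (g r)" for r
  define P where "P x = frame_matrix X \<kappa> (chart_inv \<kappa> x)" for x
  have g: "left_invariant_metric G A (g r)" if "r > 0" for r
    using w that by (simp add: weighted_description_def)
  have opn: "open (chart_img \<kappa>)" using lie \<kappa> by (simp add: lie_group_def smooth_atlas_def)
  have inv_in: "chart_inv \<kappa> x \<in> fst \<kappa>" if "x \<in> chart_img \<kappa>" for x
    using that unfolding chart_inv_def chart_img_def by (rule inv_into_into)
  have "(\<Union>\<kappa>\<in>A. fst \<kappa>) = UNIV" using lie by (simp add: lie_group_def smooth_atlas_def)
  \<comment> \<open>Symmetry of the Gram matrix is read off at a point of some chart, so one is
    needed that is not empty.\<close>
  then have "\<exists>\<kappa>'\<in>A. \<one>\<^bsub>G\<^esub> \<in> fst \<kappa>'" by blast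
  then have symM: "transpose (M r) = M r" if "r > 0" for r
    unfolding M_def using left_invariant_metric_coframe(1)[OF lie X g[OF that]] by blast
  have pos: "pos_spectrum (M r) (\<lambda>j. l j r)" if "r > 0" for r
    using symM[OF that] assms(14,15) that by (auto simp: pos_spectrum_def M_def)
  have Mc: "continuous_on {0<..} (\<lambda>r. M r $ i $ j)" "W12_loc {0<..} (\<lambda>r. M r $ i $ j)" for i j
    using w by (simp_all add: weighted_description_def M_def)
  obtain D where D: "ac_deriv M D" "L2_loc {0<..} D" "\<And>r. transpose (D r) = D r"
    using symmetric_matrix_ac_deriv[OF Mc symM] by blast
  note symD = D(3)
  interpret cylinder_geometry "chart_img \<kappa>" P M D "cylinder_metric g \<kappa>"
  proof
    show "continuous_on (chart_img \<kappa>) P"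
      unfolding P_def frame_matrix_def
    proof (intro continuous_on_vec_lambda continuous_on_component)
      fix j
      have "smooth_on (chart_img \<kappa>) (X j \<kappa> \<circ> chart_inv \<kappa>)"
        using X \<kappa> by (simp add: left_invariant_frame_def smooth_vector_field_def)
      from smooth_on_continuous[OF this] show "continuous_on (chart_img \<kappa>) (\<lambda>x. X j \<kappa> (chart_inv \<kappa> x))"
        by (simp add: o_def)
    qed
    show "invertible (P x)" if "x \<in> chart_img \<kappa>" for x
      using X \<kappa> inv_in[OF that] by (simp add: left_invariant_frame_def P_def)
    show "invertible (M r)" if "r > 0" for r by (rule pos_spectrum_invertible[OF pos[OF that]])
    show "cylinder_metric g \<kappa> (r, x) u v =
        fst u * fst v + (M r *v (matrix_inv (P x) *v snd u)) \<bullet> (matrix_inv (P x) *v snd v)"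
      if "r > 0" "x \<in> chart_img \<kappa>" for r x u v
      using left_invariant_metric_coframe(2)[OF lie X g[OF that(1)] \<kappa> inv_in[OF that(2)]]
      by (simp add: cylinder_metric_def M_def P_def)
  qed (use opn symM D in auto)
  have hc: "half_cylinder \<kappa> = U" by (simp add: half_cylinder_def)
  have \<rho>pos: "\<rho> r > 0" if "r > 0" for r
    using weighted_description_density_pos[OF _ w that] assms(6) by (simp add: RCD0_def)
  have N1: "N > 1" using assms(5) by simp
  have "concave_on {0..} (\<lambda>r. \<rho> r powr (1 / (N - 1)))" using w by (simp add: weighted_description_def)
  then obtain e where e: "ac_deriv \<rho> e" "L2_loc {0<..} e" by (rule concave_power_density[OF _ \<rho>pos N1])
  \<comment> \<open>The statement speaks of the representative chosen by \<open>wgrad\<close>. The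
    derivative \<open>e\<close> obtained from concavity shows that this choice is a weak gradient,
    and from here on \<open>\<rho>'\<close> replaces \<open>e\<close>.\<close>
  define \<rho>' where "\<rho>' = wgrad {0<..} \<rho>"
  have w\<rho>: "weak_gradient {0<..} \<rho> \<rho>'"
    unfolding \<rho>'_def by (rule wgrad_AE_eq(1)[OF open_greaterThan ac_deriv_imp_weak_gradient[OF e]])
  have c\<rho>: "continuous_on {0<..} \<rho>" by (rule ac_deriv_continuous[OF e(1)])
  have ac\<rho>: "ac_deriv \<rho> \<rho>'" by (rule weak_gradient_imp_ac_deriv[OF c\<rho> w\<rho>])
  define E where "E r = \<rho>' r / \<rho> r" for r
  have "continuous_on {0<..} (\<lambda>r. 1 / \<rho> r)"
    by (intro continuous_on_divide continuous_on_const c\<rho>) (use \<rho>pos in force)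
  then have "L2_loc {0<..} (\<lambda>r. \<rho>' r *\<^sub>R (1 / \<rho> r))"
    using w\<rho> by (intro L2_loc_scaleR_continuous open_greaterThan) (simp add: weak_gradient_def)
  then have E: "L2_loc {0<..} E" by (simp add: E_def[abs_def])
  have "ac_deriv (\<lambda>r. ln (\<rho> r)) (\<lambda>r. (1 / \<rho> r) * \<rho>' r)"
    by (rule ac_deriv_compose[OF ac\<rho> \<rho>pos]) (auto intro!: derivative_eq_intros continuous_intros)
  then have "ac_deriv (\<lambda>r. (1 / 2) * ln (det (M r)) + (- 1) * ln (\<rho> r))
      (\<lambda>r. (1 / 2) * trace (matrix_inv (M r) ** D r) + (- 1) * ((1 / \<rho> r) * \<rho>' r))"
    by (intro ac_deriv_add ac_deriv_linear[OF bounded_linear_mult_right] ac_deriv_ln_det[OF D(1) pos])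
  then have V: "ac_deriv (weight_potential G A X g \<rho>) (\<lambda>r. (1 / 2) * trace (matrix_inv (M r) ** D r) - E r)"
  proof (rule ac_deriv_cong)
    fix r :: real assume "r > 0"
    then have d: "det (M r) > 0" by (rule pos_spectrum_det_pos[OF pos])
    then have "ln (sqrt (det (M r)) * sqrt (det (M r))) = ln (sqrt (det (M r))) + ln (sqrt (det (M r)))"
      by (intro ln_mult_pos) auto
    then have "ln (det (M r)) = 2 * ln (sqrt (det (M r)))" using d by simp
    then show "(1 / 2) * ln (det (M r)) + (- 1) * ln (\<rho> r) = weight_potential G A X g \<rho> r"
      by (simp add: weight_potential_def M_def)
  qed (simp add: E_def)
  have l: "ac_deriv (l j) (wgrad {0<..} (l j))" "L2_loc {0<..} (wgrad {0<..} (l j))" if "j \<in> {1..CARD('k)}" for j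
    using W12_loc_ac_deriv[of "l j"] assms(15) that by auto
  show "distribution_le (half_cylinder \<kappa>)
     (ric_m_infty (half_cylinder \<kappa>) (cylinder_metric g \<kappa>)
        (\<lambda>p. weight_potential G A X g \<rho> (fst p)) d_r d_r)
     (\<lambda>\<phi>. - (1 / 4) * (LINT p:half_cylinder \<kappa>|lborel.
              (\<Sum>j=1..CARD('k). (wgrad {0<..} (l j) (fst p) / l j (fst p))\<^sup>2) * \<phi> p)
           - dist_deriv (half_cylinder \<kappa>) d_r (\<lambda>p. wgrad {0<..} \<rho> (fst p) / \<rho> (fst p)) \<phi>)"
    unfolding distribution_le_def hc
  proof (intro allI impI, elim conjE)
    fix \<phi> assume \<phi>: "test_fun U \<phi>" "\<forall>x. 0 \<le> \<phi> x"
    have "dist_deriv U d_r (\<lambda>p. wgrad {0<..} \<rho> (fst p) / \<rho> (fst p)) \<phi> =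
        - (LINT p:U|lborel. E (fst p) * frechet_derivative \<phi> (at p) (1, 0))"
      unfolding dist_deriv_def d_r_def divergence_const_field[OF \<phi>(1)] E_def \<rho>'_def ..
    then show "ric_m_infty U (cylinder_metric g \<kappa>) (\<lambda>p. weight_potential G A X g \<rho> (fst p)) d_r d_r \<phi> \<le>
      - (1 / 4) * (LINT p:U|lborel. (\<Sum>j=1..CARD('k). (wgrad {0<..} (l j) (fst p) / l j (fst p))\<^sup>2) * \<phi> p)
           - dist_deriv U d_r (\<lambda>p. wgrad {0<..} \<rho> (fst p) / \<rho> (fst p)) \<phi>"
      using eigenvalue_integral_le[OF symD pos l \<phi>(1)] \<phi>(2) ric_m_r_r[OF V E \<phi>(1)] by simp
  qed
qed

end
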